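(* Let $(\mathbf{B},\mathbf{c},\mathcal{Q},\mathbf{G})$ be a non-degenerate generalized Brascamp--Lieb datum. Then $$ \inf_{\mathbf{f}\in\mathcal{T}(\mathbf{G})} \mathrm{BL}(\mathbf{B},\mathbf{c},\mathcal{Q};\mathbf{f}) \;=\; \inf_{\mathbf{A}\le \mathbf{G}} \mathrm{BL}(\mathbf{B},\mathbf{c},\mathcal{Q};\mathbf{A}), $$ where the infimum on the left is over all $\mathbf{f}=(f_j)_{j=1}^m$ with $f_j\in\mathcal{T}(G_j)$ for each $j$, and the infimum on the right is over all $\mathbf{A}=(A_j)_{j=1}^m$ with $A_j\in S_+(\mathbb{R}^{n_j})$ and $A_j\le G_j$ for each $j$.
   Context: $S(\mathbb{R}^n)$ denotes the self-adjoint linear transformations of $\mathbb{R}^n$ and $S_+(\mathbb{R}^n)$ the positive definite ones; inequalities between self-adjoint maps are in the semidefinite order. Generalized Brascamp--Lieb datum $(\mathbf{B},\mathbf{c},\mathcal{Q},\mathbf{G})$: $\mathbf{B}=(B_j)_{j=1}^m$ with $B_j:\mathbb{R}^n\to\mathbb{R}^{n_j}$ linear surjections; $\mathbf{c}=(c_j)_{j=1}^m$ real non-zero exponents arranged so that $c_1,\dots,c_{m_+}>0>c_{m_++1},\dots,c_m$ for some $0\le m_+\le m$; $\mathcal{Q}\in S(\mathbb{R}^n)$; $\mathbf{G}=(G_j)_{j=1}^m$ with $G_j\in S_+(\mathbb{R}^{n_j})$. Put $\mathbf{B}_+x:=(B_1x,\dots,B_{m_+}x)\in\bigoplus_{j=1}^{m_+}\mathbb{R}^{n_j}$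 and let $s^+(\mathcal{Q})$ be the number of positive eigenvalues of $\mathcal{Q}$ (with multiplicity). Non-degenerate means: (i) $\mathcal{Q}$ is positive definite on $\ker\mathbf{B}_+$ and $n\ge s^+(\mathcal{Q})+\sum_{j=1}^{m_+}n_j$; and (ii) $\mathcal{Q}+\sum_{j=1}^{m_+}c_jB_j^*G_jB_j>0$. For $A\in S_+(\mathbb{R}^k)$, $g_A(x):=(\det A)^{1/2}e^{-\pi\langle x,Ax\rangle}$. For $G\in S_+(\mathbb{R}^k)$, $\mathcal{T}(G):=\{g_G*\mu:\ \mu \text{ a positive finite Borel measure on }\mathbb{R}^k\text{ with non-zero mass}\}$. For $f_j:\mathbb{R}^{n_j}\to\mathbb{R}_+$ measurable with $\int f_j\in(0,\infty)$, $$\mathrm{BL}(\mathbf{B},\mathbf{c},\mathcal{Q};\mathbf{f}):=\frac{\int_{\mathbb{R}^n}e^{-\pi\langle x,\mathcal{Q}x\rangle}\prod_{j=1}^m f_j(B_jx)^{c_j}\,dx}{\prod_{j=1}^m\left(\int_{\mathbb{R}^{n_j}}f_j\right)^{c_j}}\in[0,\infty]$$ with the convention $0\cdot\infty=0$, and $\mathrm{BL}(\mathbf{B},\mathbf{c},\mathcal{Q};\mathbf{A})$ denotes its value at $f_j=g_{A_j}$. *)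

theory Defs
  imports
    "HOL-Analysis.Analysis"
    "Jordan_Normal_Form.Char_Poly"
begin

unbundle no inner_syntax
unbundle no vec_syntax

section \<open>Self-adjoint maps\<close>

text \<open>
  The dimensions \<open>n\<^sub>j\<close> depend on an index, so \<open>\<real>\<^sup>k\<close> is \<^term>\<open>carrier_vec k :: real vec set\<close>
  and a linear map \<open>\<real>\<^sup>n \<rightarrow> \<real>\<^sup>k\<close> is its \<open>k \<times> n\<close> matrix in the standard bases; the adjoint is the
  transpose. Note that the library order on \<^typ>\<open>real mat\<close> is entrywise and hence is not used.
\<close>

definition self_adjoint :: "nat \<Rightarrow> real mat set" where
  "self_adjoint k = {A \<in> carrier_mat k k. transpose_mat A = A}"

definition qform :: "real mat \<Rightarrow> real vec \<Rightarrow> real" where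
  "qform A x = x \<bullet> (A *\<^sub>v x)"

definition positive_definite_on :: "real vec set \<Rightarrow> real mat \<Rightarrow> bool" where
  "positive_definite_on V A \<longleftrightarrow> (\<forall>x\<in>V. x \<noteq> 0\<^sub>v (dim_vec x) \<longrightarrow> qform A x > 0)"

definition positive_definite :: "nat \<Rightarrow> real mat set" where
  "positive_definite k = {A \<in> self_adjoint k. positive_definite_on (carrier_vec k) A}"

definition loewner_le :: "nat \<Rightarrow> real mat \<Rightarrow> real mat \<Rightarrow> bool" where
  "loewner_le k A A' \<longleftrightarrow> (\<forall>x\<in>carrier_vec k. qform A x \<le> qform A' x)"

definition num_pos_eigenvalues :: "real mat \<Rightarrow> nat" where
  "num_pos_eigenvalues Q = (\<Sum>\<mu> | eigenvalue Q \<mu> \<and> \<mu> > 0. order \<mu> (char_poly Q))"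

section \<open>Lebesgue measure on \<open>\<real>\<^sup>k\<close>\<close>

text \<open>The Borel \<open>\<sigma>\<close>-algebra of \<open>\<real>\<^sup>k\<close> is the \<open>k\<close>-fold product of that of \<open>\<real>\<close>.\<close>

definition borel_vec :: "nat \<Rightarrow> real vec measure" where
  "borel_vec k = vimage_algebra (carrier_vec k) (\<lambda>v. \<lambda>i\<in>{..<k}. v $ i) (\<Pi>\<^sub>M i\<in>{..<k}. borel)"

definition lborel_vec :: "nat \<Rightarrow> real vec measure" where
  "lborel_vec k = distr (\<Pi>\<^sub>M i\<in>{..<k}. lborel) (borel_vec k) (vec k)"

lemma space_borel_vec [simp]: "space (borel_vec k) = carrier_vec k"
  by (simp add: borel_vec_def)

lemma sets_lborel_vec [simp, measurable_cong]: "sets (lborel_vec k) = sets (borel_vec k)"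
  by (simp add: lborel_vec_def)

lemma space_lborel_vec [simp]: "space (lborel_vec k) = carrier_vec k"
  by (simp add: lborel_vec_def)

lemma measurable_vec [measurable]: "vec k \<in> measurable (\<Pi>\<^sub>M i\<in>{..<k}. lborel) (borel_vec k)"
proof -
  have "(\<lambda>x. \<lambda>i\<in>{..<k}. vec k x $ i) \<in> measurable (\<Pi>\<^sub>M i\<in>{..<k}. lborel) (\<Pi>\<^sub>M i\<in>{..<k}. (borel :: real measure))"
    by (rule measurable_restrict) simp
  then show ?thesis
    unfolding borel_vec_def by (intro measurable_vimage_algebra2) auto
qed

lemma measurable_vec_index [measurable]:
  assumes "i < k" shows "(\<lambda>v. v $ i) \<in> borel_measurable (borel_vec k)"
proof -
  have r: "(\<lambda>v. \<lambda>i\<in>{..<k}. v $ i) \<in> measurable (borel_vec k) (\<Pi>\<^sub>M i\<in>{..<k}. borel)"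
    unfolding borel_vec_def by (rule measurable_vimage_algebra1) (auto simp: space_PiM)
  have "(\<lambda>v. (\<lambda>i\<in>{..<k}. v $ i) i) \<in> borel_measurable (borel_vec k)"
    by (rule measurable_compose[OF r]) (use assms in auto)
  then show ?thesis using assms by simp
qed

lemma emeasure_lborel_vec_box:
  assumes "\<And>i. i < k \<Longrightarrow> a i \<le> b i"
  shows "emeasure (lborel_vec k) {v \<in> carrier_vec k. \<forall>i<k. a i \<le> v $ i \<and> v $ i \<le> b i} =
           ennreal (\<Prod>i<k. b i - a i)"
proof -
  interpret product_sigma_finite "\<lambda>i::nat. lborel :: real measure" ..
  have "{v \<in> space (borel_vec k). a i \<le> v $ i \<and> v $ i \<le> b i} \<in> sets (borel_vec k)" if "i < k" for i
    using measurable_sets[OF measurable_vec_index[OF that], of "{a i..b i}"]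
    by (simp add: vimage_def Int_def conj_commute)
  then have m: "{v \<in> carrier_vec k. \<forall>i<k. a i \<le> v $ i \<and> v $ i \<le> b i} \<in> sets (borel_vec k)"
    unfolding space_borel_vec[symmetric] lessThan_iff[symmetric] Ball_def[symmetric]
    by (intro sets.sets_Collect_finite_All) auto
  have eq: "vec k -` {v \<in> carrier_vec k. \<forall>i<k. a i \<le> v $ i \<and> v $ i \<le> b i}
      \<inter> space (\<Pi>\<^sub>M i\<in>{..<k}. lborel) = (\<Pi>\<^sub>E i\<in>{..<k}. {a i..b i})"
    by (auto simp: space_PiM PiE_def Pi_def)
  have "emeasure (lborel_vec k) {v \<in> carrier_vec k. \<forall>i<k. a i \<le> v $ i \<and> v $ i \<le> b i} =
      emeasure (\<Pi>\<^sub>M i\<in>{..<k}. lborel) (\<Pi>\<^sub>E i\<in>{..<k}. {a i..b i})"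
    unfolding lborel_vec_def by (subst emeasure_distr[OF measurable_vec m]) (simp only: eq)
  also have "\<dots> = (\<Prod>i<k. emeasure lborel {a i..b i})"
    by (rule emeasure_PiM) auto
  also have "\<dots> = (\<Prod>i<k. ennreal (b i - a i))"
    using assms by (intro prod.cong) auto
  also have "\<dots> = ennreal (\<Prod>i<k. b i - a i)"
    using assms by (intro prod_ennreal) auto
  finally show ?thesis .
qed

section \<open>Generalized Brascamp--Lieb data\<close>

text \<open>
  Indices are shifted to start at \<open>0\<close>: the family is indexed by \<open>j < m\<close>, and
  \<open>c j\<close> is positive exactly for \<open>j < mp\<close>.
\<close>

definition BL_datum ::
  "nat \<Rightarrow> nat \<Rightarrow> nat \<Rightarrow> (nat \<Rightarrow> nat) \<Rightarrow> (nat \<Rightarrow> real mat) \<Rightarrow> (nat \<Rightarrow> real) \<Rightarrow> real mat \<Rightarrow>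
    (nat \<Rightarrow> real mat) \<Rightarrow> bool" where
  "BL_datum n m mp d B c Q G \<longleftrightarrow>
     mp \<le> m \<and>
     (\<forall>j<m. B j \<in> carrier_mat (d j) n \<and> (\<lambda>x. B j *\<^sub>v x) ` carrier_vec n = carrier_vec (d j)) \<and>
     (\<forall>j<mp. c j > 0) \<and> (\<forall>j. mp \<le> j \<and> j < m \<longrightarrow> c j < 0) \<and>
     Q \<in> self_adjoint n \<and>
     (\<forall>j<m. G j \<in> positive_definite (d j))"

definition ker_B_plus :: "nat \<Rightarrow> nat \<Rightarrow> (nat \<Rightarrow> nat) \<Rightarrow> (nat \<Rightarrow> real mat) \<Rightarrow> real vec set" where
  "ker_B_plus n mp d B = {x \<in> carrier_vec n. \<forall>j<mp. B j *\<^sub>v x = 0\<^sub>v (d j)}"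

text \<open>\<open>\<Q> + \<Sum>\<^bsub>j < mp\<^esub> c\<^sub>j B\<^sub>j\<^sup>* G\<^sub>j B\<^sub>j\<close>, with the matrix sum written entrywise\<close>

definition Q_plus ::
  "nat \<Rightarrow> nat \<Rightarrow> (nat \<Rightarrow> real mat) \<Rightarrow> (nat \<Rightarrow> real) \<Rightarrow> real mat \<Rightarrow> (nat \<Rightarrow> real mat) \<Rightarrow> real mat" where
  "Q_plus n mp B c Q G =
     Q + mat n n (\<lambda>(r, s). \<Sum>j<mp. (c j \<cdot>\<^sub>m (transpose_mat (B j) * G j * B j)) $$ (r, s))"

definition nondegenerate ::
  "nat \<Rightarrow> nat \<Rightarrow> (nat \<Rightarrow> nat) \<Rightarrow> (nat \<Rightarrow> real mat) \<Rightarrow> (nat \<Rightarrow> real) \<Rightarrow> real mat \<Rightarrow>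
    (nat \<Rightarrow> real mat) \<Rightarrow> bool" where
  "nondegenerate n mp d B c Q G \<longleftrightarrow>
     positive_definite_on (ker_B_plus n mp d B) Q \<and>
     n \<ge> num_pos_eigenvalues Q + (\<Sum>j<mp. d j) \<and>
     Q_plus n mp B c Q G \<in> positive_definite n"

section \<open>Gaussians and the Brascamp--Lieb functional\<close>

definition gaussian :: "real mat \<Rightarrow> real vec \<Rightarrow> real" where
  "gaussian A x = sqrt (Determinant.det A) * exp (- pi * qform A x)"

definition type_G :: "nat \<Rightarrow> real mat \<Rightarrow> (real vec \<Rightarrow> real) set" where
  "type_G k G = {\<lambda>x. LINT y|\<mu>. gaussian G (x - y) | \<mu>.
     finite_measure \<mu> \<and> sets \<mu> = sets (borel_vec k) \<and> emeasure \<mu> (space \<mu>) > 0}"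

text \<open>\<open>t\<^sup>c \<in> [0,\<infinity>]\<close> for \<open>t \<ge> 0\<close>, so that \<open>0\<^sup>c = \<infinity>\<close> for \<open>c < 0\<close>
  (whereas \<open>0 powr c = 0\<close> in the library). Multiplication on \<^typ>\<open>ennreal\<close> satisfies \<open>0 * \<infinity> = 0\<close>.\<close>

definition pow_ennreal :: "real \<Rightarrow> real \<Rightarrow> ennreal" where
  "pow_ennreal t c = (if t = 0 \<and> c < 0 then \<infinity> else ennreal (t powr c))"

definition BL ::
  "nat \<Rightarrow> nat \<Rightarrow> (nat \<Rightarrow> nat) \<Rightarrow> (nat \<Rightarrow> real mat) \<Rightarrow> (nat \<Rightarrow> real) \<Rightarrow> real mat \<Rightarrow>
    (nat \<Rightarrow> real vec \<Rightarrow> real) \<Rightarrow> ennreal" where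
  "BL n m d B c Q f =
     (\<integral>\<^sup>+x. ennreal (exp (- pi * qform Q x)) * (\<Prod>j<m. pow_ennreal (f j (B j *\<^sub>v x)) (c j)) \<partial>lborel_vec n)
       / ennreal (\<Prod>j<m. (LINT y|lborel_vec (d j). f j y) powr c j)"

end

theory Submission
  imports Defs "Jordan_Normal_Form.Schur_Decomposition" "HOL-Probability.Distributions"
begin

text \<open>
  The nontrivial inequality is a heat-flow argument. Write \<open>\<Q>\<^sub>\<epsilon> = \<Q> - \<epsilon> \<Sum> B\<^sub>j\<^sup>* B\<^sub>j\<close>, the sum over positive
  exponents. Non-degeneracy says that every prescribed family \<open>B\<^sub>j w\<close>, \<open>c\<^sub>j > 0\<close>, is attained at some
  \<open>w\<close> with \<open>w \<bullet> \<Q> w \<le> 0\<close>; hence the constraints \<open>A\<^sub>j \<le> G\<^sub>j\<close>, \<open>M = \<Q>\<^sub>\<epsilon> + \<Sum> c\<^sub>j B\<^sub>j\<^sup>* A\<^sub>j B\<^sub>j > 0\<close> keep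
  \<open>A\<^sub>j\<close> away from \<open>0\<close> for \<open>c\<^sub>j > 0\<close>, and \<open>\<Sum> c\<^sub>j log det A\<^sub>j - log det M\<close>
  attains its minimum over them. Finite Gaussian mixtures \<open>f\<^sub>j\<close> of type \<open>G\<^sub>j\<close> are moved to multiples of
  \<open>g\<^bsub>A\<^sub>j\<^esub>\<close>, \<open>A\<close> the minimizer, by the flow taking the covariances \<open>\<Gamma>\<^sup>-\<^sup>1\<close> to
  \<open>(1 - t) \<Gamma>\<^sup>-\<^sup>1 + t A\<^sub>j\<^sup>-\<^sup>1\<close> and the centers \<open>a\<close> to \<open>(1 - t)\<^sup>1\<^sup>/\<^sup>2 a\<close>. The time derivative of the integrand is
  at most a divergence, by the first-order condition at the minimizer together with a quadratic-form
  inequality that rests on the signature of \<open>\<Q>\<close>; so the integral decreases along the flow.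
  General \<open>f\<^sub>j\<close> are reached by truncating and discretizing the measures while \<open>\<epsilon> \<rightarrow> 0\<close>. For \<open>c\<^sub>j < 0\<close> a small
  centered Gaussian is added to \<open>f\<^sub>j\<close> to provide an integrable majorant.
  In the other direction, \<open>A \<le> G\<close> makes \<open>g\<^sub>A\<close> a convolution of \<open>g\<^sub>G\<close> with a centered Gaussian measure.
\<close>

unbundle no inner_syntax
unbundle no vec_syntax

section \<open>Spectral theorem for real symmetric matrices\<close>

text \<open>The flow must end at Gaussians that depend on the datum alone and satisfy a first-order
  condition. For Q itself, M > 0 yields no uniform lower bound on A_j; the \<epsilon>-term supplies
  one, and as \<open>Qe\<close> <= Q it only enlarges the integrals. On R^(d_j) each f_j solves a
  Fokker-Planck equation with diffusion matrix A_j^-1 and stationary solution g_A, infinite time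
  being compressed to [0, 1]. The product W is compared with the analogous equation on R^n with
  diffusion matrix M^-1, whose right-hand side is a divergence. Second derivatives enter the
  discrepancy through K_j = -(1/2 pi) Hess log f_j; type G implies K_j <= G_j, so K - A is an
  admissible one-sided variation at the minimizer. First derivatives enter quadratically, and the
  signature of Q controls them. All integrations by parts and limits need Gaussian majorants uniform
  in time. They come from a reference family, G_j for c_j > 0 and s G_j for c_j < 0 with s small;
  hence the common covariance of the positive factors and the extra component of the negative
  ones.\<close>

lemma real_symmetric_eigenvector:
  fixes Q :: "real mat"
  assumes Q: "Q \<in> carrier_mat n n" and sym: "transpose_mat Q = Q" and n: "n > 0"
  shows "\<exists>e v. v \<in> carrier_vec n \<and> v \<noteq> 0\<^sub>v n \<and> Q *\<^sub>v v = e \<cdot>\<^sub>v v"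
proof -
  define C where "C = map_mat complex_of_real Q"
  have C: "C \<in> carrier_mat n n" using Q by (simp add: C_def)
  obtain as where as: "char_poly C = (\<Prod> a \<leftarrow> as. [:- a, 1:])" "length as = n"
    using char_poly_factorized[OF C] by blast
  then obtain l where "l \<in> set as" using n by (cases as) auto
  then have "poly (char_poly C) l = 0"
    unfolding as(1) by (auto simp: poly_prod_list prod_list_zero_iff)
  then have "eigenvalue C l" using eigenvalue_root_char_poly[OF C] by simp
  then obtain v where v: "v \<in> carrier_vec n" "v \<noteq> 0\<^sub>v n" "C *\<^sub>v v = l \<cdot>\<^sub>v v"
    using C unfolding eigenvalue_def eigenvector_def by auto
  define a where "a = map_vec Re v"
  define b where "b = map_vec Im v"
  have ab: "a \<in> carrier_vec n" "b \<in> carrier_vec n" using v(1) by (auto simp: a_def b_def)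
  have comp: "(\<Sum>s<n. Q $$ (r, s) * Re (v $ s)) = Re (l * v $ r)"
       "(\<Sum>s<n. Q $$ (r, s) * Im (v $ s)) = Im (l * v $ r)" if r: "r < n" for r
  proof -
    have "(C *\<^sub>v v) $ r = l * v $ r" using v r by simp
    moreover have "(C *\<^sub>v v) $ r = (\<Sum>s<n. of_real (Q $$ (r, s)) * v $ s)"
      using r Q v(1) by (auto simp: C_def scalar_prod_def lessThan_atLeast0 intro!: sum.cong)
    ultimately have e: "(\<Sum>s<n. of_real (Q $$ (r, s)) * v $ s) = l * v $ r" by simp
    show "(\<Sum>s<n. Q $$ (r, s) * Re (v $ s)) = Re (l * v $ r)"
      using arg_cong[OF e, of Re] by simp
    show "(\<Sum>s<n. Q $$ (r, s) * Im (v $ s)) = Im (l * v $ r)"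
      using arg_cong[OF e, of Im] by simp
  qed
  have s: "Q $$ (r, s) = Q $$ (s, r)" if "r < n" "s < n" for r s
    using that Q sym by (metis carrier_matD index_transpose_mat(1))
  \<comment> \<open>Pairing Q (Re v) with Im v and Q (Im v) with Re v gives the same number because
    Q is symmetric; expanding l v turns the equality into Im l * |v|^2 = 0.\<close>
  have "(\<Sum>r<n. Im (v $ r) * Re (l * v $ r)) = (\<Sum>r<n. Re (v $ r) * Im (l * v $ r))"
  proof -
    have "(\<Sum>r<n. Im (v $ r) * Re (l * v $ r)) = (\<Sum>r<n. \<Sum>s<n. Im (v $ r) * (Q $$ (r, s) * Re (v $ s)))"
      by (intro sum.cong refl) (simp only: comp(1)[symmetric] sum_distrib_left lessThan_iff)
    also have "\<dots> = (\<Sum>s<n. \<Sum>r<n. Re (v $ s) * (Q $$ (s, r) * Im (v $ r)))"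
      by (subst sum.swap) (auto intro!: sum.cong simp: s)
    also have "\<dots> = (\<Sum>r<n. Re (v $ r) * Im (l * v $ r))"
      by (intro sum.cong refl) (simp only: comp(2)[symmetric] sum_distrib_left lessThan_iff)
    finally show ?thesis .
  qed
  then have "Im l * (\<Sum>r<n. (Re (v $ r))\<^sup>2 + (Im (v $ r))\<^sup>2) = 0"
    by (simp add: algebra_simps sum_distrib_left power2_eq_square sum.distrib sum_subtractf)
  moreover have "(\<Sum>r<n. (Re (v $ r))\<^sup>2 + (Im (v $ r))\<^sup>2) \<noteq> 0"
  proof
    assume "(\<Sum>r<n. (Re (v $ r))\<^sup>2 + (Im (v $ r))\<^sup>2) = 0"
    then have "\<forall>r<n. v $ r = 0"
      by (subst (asm) sum_nonneg_eq_0_iff) (auto simp: complex_eq_iff)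
    then show False using v(1,2) by (auto intro!: eq_vecI)
  qed
  ultimately have Im: "Im l = 0" by simp
  have "Q *\<^sub>v a = Re l \<cdot>\<^sub>v a"
    using comp(1) Q v(1) Im
    by (intro eq_vecI) (auto simp: a_def scalar_prod_def lessThan_atLeast0)
  moreover have "Q *\<^sub>v b = Re l \<cdot>\<^sub>v b"
    using comp(2) Q v(1) Im
    by (intro eq_vecI) (auto simp: b_def scalar_prod_def lessThan_atLeast0)
  moreover have "a \<noteq> 0\<^sub>v n \<or> b \<noteq> 0\<^sub>v n"
  proof (rule ccontr)
    assume "\<not> ?thesis"
    then have "a $ r = 0 \<and> b $ r = 0" if "r < n" for r using that by simp
    then have "\<forall>r<n. v $ r = 0" using v(1) by (auto simp: a_def b_def complex_eq_iff)
    then show False using v(1,2) by (auto intro!: eq_vecI)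
  qed
  ultimately show ?thesis using ab by blast
qed

text \<open>Gram-Schmidt leaves the first vector of a basis unchanged, so starting from a basis that
  begins with \<open>v\<close> and normalizing at the end keeps the direction of \<open>v\<close> in
  column 0.\<close>

lemma orthonormal_completion:
  fixes v :: "real vec"
  assumes v: "v \<in> carrier_vec n" "v \<noteq> 0\<^sub>v n"
  shows "\<exists>U t. U \<in> carrier_mat n n \<and> transpose_mat U * U = 1\<^sub>m n \<and> col U 0 = t \<cdot>\<^sub>v v"
proof -
  have n: "n > 0" using v by (cases n) auto
  interpret cof_vec_space n "TYPE(real)" .
  define b where "b = basis_completion v"
  note bc = basis_completion[OF v, folded b_def]
  have bv: "b = v # tl b" using bc n by (cases b) auto
  define ws where "ws = gram_schmidt n b"
  have ws: "set ws \<subseteq> carrier_vec n" "corthogonal ws" "length ws = n"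
    using gram_schmidt_result[OF bc(2) bc(4) bc(5) ws_def] bc(6-) by auto
  have hd: "hd ws = v" using gram_schmidt_hd[OF v(1), of "tl b"] bv unfolding ws_def by simp
  have ws0: "ws ! 0 = v" using hd ws(3) n by (metis hd_conv_nth length_greater_0_conv)
  have wc: "ws ! i \<in> carrier_vec n" if "i < n" for i using that ws by auto
  define q where "q i = ws ! i \<bullet> ws ! i" for i
  have orth: "(ws ! i \<bullet> ws ! j = 0) = (i \<noteq> j)" if "i < n" "j < n" for i j
  proof -
    have "conjugate (ws ! j) = ws ! j" by (rule eq_vecI) auto
    then show ?thesis using ws(2,3) that unfolding corthogonal_def by metis
  qed
  have qp: "q i > 0" if "i < n" for i
  proof -
    have "q i \<ge> 0" by (auto simp: q_def scalar_prod_def intro!: sum_nonneg)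
    moreover have "q i \<noteq> 0" using orth[OF that that] by (simp add: q_def)
    ultimately show ?thesis by simp
  qed
  define U where "U = mat n n (\<lambda>(i, j). ws ! j $ i / sqrt (q j))"
  have U: "U \<in> carrier_mat n n" by (simp add: U_def)
  have cols: "col U j = (1 / sqrt (q j)) \<cdot>\<^sub>v ws ! j" if "j < n" for j
    using that wc[OF that] by (intro eq_vecI) (auto simp: U_def)
  have "transpose_mat U * U = 1\<^sub>m n"
  proof (rule eq_matI)
    fix i j assume ij: "i < dim_row (1\<^sub>m n :: real mat)" "j < dim_col (1\<^sub>m n :: real mat)"
    then have "(transpose_mat U * U) $$ (i, j) = col U i \<bullet> col U j" using U by simp
    also have "\<dots> = (1 / sqrt (q i)) * (1 / sqrt (q j)) * (ws ! i \<bullet> ws ! j)"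
      using ij wc[of i] wc[of j] by (simp add: cols)
    also have "\<dots> = (1\<^sub>m n) $$ (i, j)"
      using ij orth[of i j] qp[of i] by (auto simp: q_def[symmetric])
    finally show "(transpose_mat U * U) $$ (i, j) = (1\<^sub>m n) $$ (i, j)" .
  qed (use U in auto)
  then show ?thesis using U cols[OF n] ws0 by auto
qed

definition diag_of :: "nat \<Rightarrow> (nat \<Rightarrow> real) \<Rightarrow> real mat" where
  "diag_of n f = mat n n (\<lambda>(i, j). if i = j then f i else 0)"

lemma diag_of_carrier [simp]: "diag_of n f \<in> carrier_mat n n"
  by (simp add: diag_of_def)

lemma diag_of_dim [simp]: "dim_row (diag_of n f) = n" "dim_col (diag_of n f) = n"
  by (simp_all add: diag_of_def)

lemma diag_of_index [simp]:
  "i < n \<Longrightarrow> j < n \<Longrightarrow> diag_of n f $$ (i, j) = (if i = j then f i else 0)"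
  by (simp add: diag_of_def)

text \<open>Deflation: an orthogonal \<open>U\<close> whose first column is an eigenvector brings Q
  to block form with a 1 x 1 block and a symmetric block \<open>R\<close> of size k, to which the
  induction hypothesis applies; \<open>X\<close> extends the smaller orthogonal matrix by a
  1.\<close>

lemma real_spectral:
  fixes Q :: "real mat"
  assumes "Q \<in> carrier_mat n n" "transpose_mat Q = Q"
  shows "\<exists>U l. U \<in> carrier_mat n n \<and> transpose_mat U * U = 1\<^sub>m n \<and> transpose_mat U * Q * U = diag_of n l"
  using assms
proof (induction n arbitrary: Q)
  case 0
  then show ?case by (intro exI[of _ "1\<^sub>m 0"]) (auto simp: diag_of_def intro!: eq_matI)
next
  case (Suc k)
  note Q = Suc.prems
  obtain e v where v: "v \<in> carrier_vec (Suc k)" "v \<noteq> 0\<^sub>v (Suc k)" "Q *\<^sub>v v = e \<cdot>\<^sub>v v"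
    using real_symmetric_eigenvector[OF Q] by auto
  obtain U t where U: "U \<in> carrier_mat (Suc k) (Suc k)" "transpose_mat U * U = 1\<^sub>m (Suc k)"
      and U0: "col U 0 = t \<cdot>\<^sub>v v"
    using orthonormal_completion[OF v(1,2)] by blast
  define T where "T = transpose_mat U * Q * U"
  have T: "T \<in> carrier_mat (Suc k) (Suc k)" using U Q by (simp add: T_def)
  have Tsym: "transpose_mat T = T"
    using U(1) Q by (simp add: T_def transpose_mult[of _ "Suc k" "Suc k" _ "Suc k"]
        assoc_mult_mat[of _ "Suc k" "Suc k" _ "Suc k" _ "Suc k"])
  have T0: "T $$ (i, 0) = (if i = 0 then e else 0)" if i: "i < Suc k" for i
  proof -
    have "T $$ (i, 0) = (transpose_mat U * (Q * U)) $$ (i, 0)"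
      using U(1) Q by (simp add: T_def assoc_mult_mat[of _ "Suc k" "Suc k" _ "Suc k" _ "Suc k"])
    also have "\<dots> = col U i \<bullet> (Q *\<^sub>v col U 0)"
      using U(1) Q i by (auto simp: col_mult2[symmetric])
    also have "Q *\<^sub>v col U 0 = e \<cdot>\<^sub>v col U 0"
      using v Q(1) unfolding U0 by (simp add: mult_mat_vec[of _ "Suc k" "Suc k"] smult_smult_assoc mult.commute)
    also have "col U i \<bullet> (e \<cdot>\<^sub>v col U 0) = e * (col U i \<bullet> col U 0)"
      using U(1) i by (metis carrier_matD(1) col_dim scalar_prod_smult_distrib)
    also have "col U i \<bullet> col U 0 = (transpose_mat U * U) $$ (i, 0)" using U(1) i by simp
    also have "e * \<dots> = (if i = 0 then e else 0)" using i by (simp add: U(2))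
    finally show ?thesis .
  qed
  have T0': "T $$ (0, i) = (if i = 0 then e else 0)" if i: "i < Suc k" for i
    using T0[OF i] Tsym T i by (metis carrier_matD index_transpose_mat(1) zero_less_Suc)
  define R where "R = mat k k (\<lambda>(i, j). T $$ (Suc i, Suc j))"
  have R: "R \<in> carrier_mat k k" by (simp add: R_def)
  have "transpose_mat R = R"
  proof (rule eq_matI)
    fix i j assume "i < dim_row R" "j < dim_col R"
    then show "transpose_mat R $$ (i, j) = R $$ (i, j)"
      using T Tsym by (simp add: R_def) (metis Suc_less_eq carrier_matD index_transpose_mat(1))
  qed (auto simp: R_def)
  from Suc.IH[OF R this] obtain V l where V: "V \<in> carrier_mat k k" "transpose_mat V * V = 1\<^sub>m k"
     "transpose_mat V * R * V = diag_of k l" by blast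
  define I where "I = (1\<^sub>m 1 :: real mat)"
  define X where "X = four_block_mat I (0\<^sub>m 1 k) (0\<^sub>m k 1) V"
  have X: "X \<in> carrier_mat (Suc k) (Suc k)" using V by (auto simp: X_def I_def)
  have Xt: "transpose_mat X = four_block_mat I (0\<^sub>m 1 k) (0\<^sub>m k 1) (transpose_mat V)"
    unfolding X_def I_def by (subst transpose_four_block_mat[of _ 1 1 _ k _ k]) (use V in auto)
  define E where "E = (e \<cdot>\<^sub>m 1\<^sub>m 1 :: real mat)"
  have Tb: "T = four_block_mat E (0\<^sub>m 1 k) (0\<^sub>m k 1) R"
    by (rule eq_matI) (use T R T0 T0' in \<open>auto simp: E_def R_def\<close>)
  have XX: "transpose_mat X * X = 1\<^sub>m (Suc k)"
  proof -
    have "transpose_mat X * X = four_block_mat (1\<^sub>m 1) (0\<^sub>m 1 k) (0\<^sub>m k 1) (1\<^sub>m k)"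
      unfolding Xt unfolding X_def I_def
      by (subst mult_four_block_mat[of _ 1 1 _ k _ k _ _ 1 _ k]) (use V in auto)
    also have "\<dots> = 1\<^sub>m (Suc k)" by (rule eq_matI) auto
    finally show ?thesis .
  qed
  have XTX: "transpose_mat X * T * X = diag_of (Suc k) (\<lambda>i. if i = 0 then e else l (i - 1))"
  proof -
    have "transpose_mat X * T * X = four_block_mat E (0\<^sub>m 1 k) (0\<^sub>m k 1) (transpose_mat V * R * V)"
      unfolding Xt Tb unfolding X_def I_def
      apply (subst mult_four_block_mat[of _ 1 1 _ k _ k _ _ 1 _ k])
      using V R apply (auto simp: E_def)[6]
      apply (subst mult_four_block_mat[of _ 1 1 _ k _ k _ _ 1 _ k])
      using V R by (auto simp: E_def)
    also have "\<dots> = diag_of (Suc k) (\<lambda>i. if i = 0 then e else l (i - 1))"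
      unfolding V(3) by (rule eq_matI) (auto simp: E_def)
    finally show ?thesis .
  qed
  have 1: "transpose_mat (U * X) * (U * X) = 1\<^sub>m (Suc k)"
  proof -
    have "transpose_mat (U * X) * (U * X) = transpose_mat X * (transpose_mat U * U) * X"
      using U(1) X by (simp add: transpose_mult[of _ "Suc k" "Suc k" _ "Suc k"]
          assoc_mult_mat[of _ "Suc k" "Suc k" _ "Suc k" _ "Suc k"])
    then show ?thesis using X XX U(2) by simp
  qed
  have 2: "transpose_mat (U * X) * Q * (U * X) = transpose_mat X * T * X"
    using U(1) X Q by (simp add: T_def transpose_mult[of _ "Suc k" "Suc k" _ "Suc k"]
        assoc_mult_mat[of _ "Suc k" "Suc k" _ "Suc k" _ "Suc k"])
  show ?case using 1 2 XTX U(1) X by (intro exI[of _ "U * X"]) auto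
qed

lemma inverse_matrix_exists:
  fixes R :: "real mat"
  assumes "R \<in> carrier_mat n n" "Determinant.det R \<noteq> 0"
  obtains L where "L \<in> carrier_mat n n" "R * L = 1\<^sub>m n" "L * R = 1\<^sub>m n"
  using det_non_zero_imp_unit[OF assms, where b = "undefined"]
  by (auto simp: Units_def ring_mat_def)

section \<open>Quadratic forms and their congruence to diagonal form\<close>

lemma self_adjointD:
  assumes "A \<in> self_adjoint n"
  shows "A \<in> carrier_mat n n" "transpose_mat A = A"
  using assms by (auto simp: self_adjoint_def)

lemma positive_definiteD:
  assumes "A \<in> positive_definite n"
  shows "A \<in> carrier_mat n n" "transpose_mat A = A" "A \<in> self_adjoint n"
    "\<And>x. x \<in> carrier_vec n \<Longrightarrow> x \<noteq> 0\<^sub>v n \<Longrightarrow> qform A x > 0"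
    "\<And>x. x \<in> carrier_vec n \<Longrightarrow> qform A x \<ge> 0"
proof -
  show *: "A \<in> carrier_mat n n" "transpose_mat A = A" "A \<in> self_adjoint n"
    "\<And>x. x \<in> carrier_vec n \<Longrightarrow> x \<noteq> 0\<^sub>v n \<Longrightarrow> qform A x > 0"
    using assms by (auto simp: positive_definite_def self_adjoint_def positive_definite_on_def)
  fix x :: "real vec" assume x: "x \<in> carrier_vec n"
  show "qform A x \<ge> 0"
  proof (cases "x = 0\<^sub>v n")
    case True
    then show ?thesis using *(1) by (simp add: qform_def)
  next
    case False
    then show ?thesis using *(4) x by force
  qed
qed

lemma positive_definiteI:
  assumes "A \<in> self_adjoint n" "\<And>x. x \<in> carrier_vec n \<Longrightarrow> x \<noteq> 0\<^sub>v n \<Longrightarrow> qform A x > 0"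
  shows "A \<in> positive_definite n"
  using assms by (auto simp: positive_definite_def positive_definite_on_def)

lemma qform_sum:
  assumes "A \<in> carrier_mat n n" "x \<in> carrier_vec n"
  shows "qform A x = (\<Sum>r<n. \<Sum>s<n. A $$ (r, s) * x $ r * x $ s)"
proof -
  have "qform A x = (\<Sum>r<n. x $ r * (\<Sum>s<n. A $$ (r, s) * x $ s))"
    using assms unfolding qform_def
    by (auto simp: scalar_prod_def lessThan_atLeast0 intro!: sum.cong)
  then show ?thesis by (simp add: sum_distrib_left mult_ac)
qed

lemma symmetric_bilinear:
  fixes A :: "real mat"
  assumes "A \<in> carrier_mat n n" "transpose_mat A = A" "x \<in> carrier_vec n" "y \<in> carrier_vec n"
  shows "x \<bullet> (A *\<^sub>v y) = y \<bullet> (A *\<^sub>v x)"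
  using transpose_vec_mult_scalar[of A n n y x] assms
  by (metis comm_scalar_prod mult_mat_vec_carrier)

lemma scalar_prod_mult_mat_vec:
  fixes B :: "real mat"
  assumes "B \<in> carrier_mat k n" "x \<in> carrier_vec n" "y \<in> carrier_vec k"
  shows "(B *\<^sub>v x) \<bullet> y = x \<bullet> (transpose_mat B *\<^sub>v y)"
  using transpose_vec_mult_scalar[OF assms] assms
  by (metis comm_scalar_prod mult_mat_vec_carrier transpose_carrier_mat)

lemma qform_add:
  assumes "A \<in> self_adjoint n" "x \<in> carrier_vec n" "y \<in> carrier_vec n"
  shows "qform A (x + y) = qform A x + qform A y + 2 * (x \<bullet> (A *\<^sub>v y))"
proof -
  note A = self_adjointD[OF assms(1)]
  have c: "A *\<^sub>v x \<in> carrier_vec n" "A *\<^sub>v y \<in> carrier_vec n" using A assms by auto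
  have "qform A (x + y) = x \<bullet> (A *\<^sub>v x) + x \<bullet> (A *\<^sub>v y) + (y \<bullet> (A *\<^sub>v x) + y \<bullet> (A *\<^sub>v y))"
    using c A assms unfolding qform_def
    by (simp add: mult_add_distrib_mat_vec[of _ n n] add_scalar_prod_distrib[of _ n] scalar_prod_add_distrib[of _ n])
  then show ?thesis using symmetric_bilinear[OF A assms(2,3)] by (simp add: qform_def)
qed

lemma qform_smult:
  assumes "A \<in> carrier_mat n n" "x \<in> carrier_vec n"
  shows "qform A (t \<cdot>\<^sub>v x) = t\<^sup>2 * qform A x"
  using assms unfolding qform_def by (simp add: mult_mat_vec[of _ n n] power2_eq_square)

lemma qform_congruence:
  assumes "R \<in> carrier_mat k n" "D \<in> carrier_mat k k" "x \<in> carrier_vec n"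
  shows "qform (transpose_mat R * D * R) x = qform D (R *\<^sub>v x)"
proof -
  have "(transpose_mat R * D * R) *\<^sub>v x = transpose_mat R *\<^sub>v (D *\<^sub>v (R *\<^sub>v x))"
    using assms by (simp add: assoc_mult_mat_vec[of _ n k _ k] assoc_mult_mat_vec[of _ n k _ n])
  then show ?thesis
    using assms scalar_prod_mult_mat_vec[of R k n x "D *\<^sub>v (R *\<^sub>v x)"] by (simp add: qform_def)
qed

lemma qform_diag_of:
  assumes "x \<in> carrier_vec n"
  shows "qform (diag_of n l) x = (\<Sum>k<n. l k * (x $ k)\<^sup>2)"
proof -
  have "qform (diag_of n l) x = (\<Sum>r<n. \<Sum>s<n. (if r = s then l r * (x $ r)\<^sup>2 else 0))"
    unfolding qform_sum[OF diag_of_carrier assms] by (intro sum.cong refl) (auto simp: power2_eq_square)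
  then show ?thesis by simp
qed

lemma one_mat_eq_diag_of: "1\<^sub>m n = diag_of n (\<lambda>_. 1)"
  by (rule eq_matI) auto

lemma qform_one_mat:
  assumes "x \<in> carrier_vec n"
  shows "qform (1\<^sub>m n) x = x \<bullet> x"
  using assms by (simp add: qform_def)

lemma scalar_prod_self_sum: "x \<in> carrier_vec n \<Longrightarrow> x \<bullet> x = (\<Sum>k<n. (x $ k :: real)\<^sup>2)"
  by (auto simp: scalar_prod_def lessThan_atLeast0 power2_eq_square)

lemma scalar_prod_self_pos:
  "x \<in> carrier_vec n \<Longrightarrow> x \<noteq> 0\<^sub>v n \<Longrightarrow> x \<bullet> x > (0 :: real)"
proof -
  assume x: "x \<in> carrier_vec n" "x \<noteq> 0\<^sub>v n"
  then obtain k where "k < n" "x $ k \<noteq> 0" by (metis carrier_vecD eq_vecI index_zero_vec(1,2))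
  then show ?thesis unfolding scalar_prod_self_sum[OF x(1)] by (intro sum_pos2[of _ k]) auto
qed

lemma diag_of_mult: "diag_of n f * diag_of n g = diag_of n (\<lambda>i. f i * g i)"
proof (rule eq_matI)
  fix i j assume ij: "i < dim_row (diag_of n (\<lambda>i. f i * g i))" "j < dim_col (diag_of n (\<lambda>i. f i * g i))"
  then have "(diag_of n f * diag_of n g) $$ (i, j) = (\<Sum>k<n. (if i = k then (if k = j then f i * g i else 0) else 0))"
    by (subst index_mult_mat) (auto simp: diag_of_def scalar_prod_def lessThan_atLeast0 simp del: sum.delta sum.delta' intro!: sum.cong)
  then show "(diag_of n f * diag_of n g) $$ (i, j) = diag_of n (\<lambda>i. f i * g i) $$ (i, j)"
    using ij by (simp add: diag_of_def)
qed (auto simp: diag_of_def)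

lemma transpose_diag_of [simp]: "transpose_mat (diag_of n f) = diag_of n f"
  by (rule eq_matI) (auto simp: diag_of_def)

lemma det_diag_of: "Determinant.det (diag_of n f) = (\<Prod>k<n. f k)"
proof -
  have "Determinant.det (diag_of n f) = prod_list (diag_mat (diag_of n f))"
    by (rule det_upper_triangular[OF _ diag_of_carrier]) (auto simp: upper_triangular_def diag_of_def)
  also have "diag_mat (diag_of n f) = map f [0..<n]"
    by (auto simp: diag_mat_def diag_of_def)
  finally show ?thesis by (simp add: prod.list_conv_set_nth lessThan_atLeast0)
qed

text \<open>Whitening followed by a rotation: \<open>R0\<close> = diag(sqrt a) U^T satisfies R0^T R0
  = A, and a spectral basis of the transported form L0^T H L0 fixes the remaining orthogonal
  freedom. In the frame \<open>R\<close> both forms are combinations of the same squares, so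
  determinants, inverses and lines A + s H are computed on scalars.\<close>

lemma simultaneous_diagonalization:
  assumes A: "A \<in> positive_definite n" and H: "H \<in> self_adjoint n"
  shows "\<exists>R L l. R \<in> carrier_mat n n \<and> L \<in> carrier_mat n n \<and> R * L = 1\<^sub>m n \<and> L * R = 1\<^sub>m n \<and>
    A = transpose_mat R * R \<and> H = transpose_mat R * diag_of n l * R"
proof -
  note A = positive_definiteD[OF A]
  note H = self_adjointD[OF H]
  note [simp] = assoc_mult_mat[of _ n n _ n _ n] transpose_mult[of _ n n _ n] mult_carrier_mat[of _ n n _ n]
  obtain U a where U: "U \<in> carrier_mat n n" "transpose_mat U * U = 1\<^sub>m n" "transpose_mat U * A * U = diag_of n a"
    using real_spectral[OF A(1,2)] by blast
  have UU: "U * transpose_mat U = 1\<^sub>m n"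
    using mat_mult_left_right_inverse[of "transpose_mat U" n U] U by auto
  have cancel: "U * (transpose_mat U * X) = X" "transpose_mat U * (U * X) = X" if "X \<in> carrier_mat n n" for X
    using that U(1) UU U(2) assoc_mult_mat[of U n n "transpose_mat U" n X n]
      assoc_mult_mat[of "transpose_mat U" n n U n X n] by auto
  have a: "a k > 0" if k: "k < n" for k
  proof -
    have e: "U *\<^sub>v unit_vec n k \<noteq> 0\<^sub>v n"
    proof
      assume "U *\<^sub>v unit_vec n k = 0\<^sub>v n"
      then have "transpose_mat U *\<^sub>v (U *\<^sub>v unit_vec n k) = 0\<^sub>v n"
        using U(1) by (intro eq_vecI) auto
      then have "unit_vec n k = (0\<^sub>v n :: real vec)"
        using U by (simp add: assoc_mult_mat_vec[of _ n n _ n, symmetric])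
      then show False using k by (metis index_unit_vec(1) index_zero_vec(1) zero_neq_one)
    qed
    have "0 < qform A (U *\<^sub>v unit_vec n k)" using e U(1) A(4)[of "U *\<^sub>v unit_vec n k"] by simp
    also have "\<dots> = qform (diag_of n a) (unit_vec n k)"
      using qform_congruence[of U n n A "unit_vec n k"] U A(1) by simp
    also have "\<dots> = (\<Sum>i<n. if i = k then a i else 0)"
      unfolding qform_diag_of[OF unit_vec_carrier] using k by (intro sum.cong) (auto simp: unit_vec_def)
    also have "\<dots> = a k" using k by simp
    finally show ?thesis .
  qed
  define R0 where "R0 = diag_of n (\<lambda>k. sqrt (a k)) * transpose_mat U"
  define L0 where "L0 = U * diag_of n (\<lambda>k. 1 / sqrt (a k))"
  have R0: "R0 \<in> carrier_mat n n" and L0: "L0 \<in> carrier_mat n n" using U by (auto simp: R0_def L0_def)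
  have dg: "diag_of n (\<lambda>k. sqrt (a k)) * diag_of n (\<lambda>k. sqrt (a k)) = diag_of n a"
    "diag_of n (\<lambda>k. sqrt (a k)) * diag_of n (\<lambda>k. 1 / sqrt (a k)) = 1\<^sub>m n"
    unfolding diag_of_mult one_mat_eq_diag_of by (rule eq_matI; use a in \<open>force simp: diag_of_def\<close>)+
  have A_eq: "A = U * (diag_of n a * transpose_mat U)"
    unfolding U(3)[symmetric] using A(1) U(1) UU by (simp add: cancel)
  have RA: "transpose_mat R0 * R0 = A"
  proof -
    have "transpose_mat R0 * R0 = U * ((diag_of n (\<lambda>k. sqrt (a k)) * diag_of n (\<lambda>k. sqrt (a k))) * transpose_mat U)"
      using U(1) by (simp add: R0_def)
    then show ?thesis using A_eq by (simp only: dg)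
  qed
  have RL: "R0 * L0 = 1\<^sub>m n"
  proof -
    have "R0 * L0 = diag_of n (\<lambda>k. sqrt (a k)) * diag_of n (\<lambda>k. 1 / sqrt (a k))"
      using U(1) by (simp add: R0_def L0_def cancel)
    then show ?thesis by (simp only: dg)
  qed
  then have LR: "L0 * R0 = 1\<^sub>m n" using mat_mult_left_right_inverse[OF R0 L0] by simp
  define H' where "H' = transpose_mat L0 * H * L0"
  have H': "H' \<in> carrier_mat n n" "transpose_mat H' = H'"
    using L0 H by (auto simp: H'_def)
  obtain V l where V: "V \<in> carrier_mat n n" "transpose_mat V * V = 1\<^sub>m n" "transpose_mat V * H' * V = diag_of n l"
    using real_spectral[OF H'] by blast
  have VV: "V * transpose_mat V = 1\<^sub>m n"
    using mat_mult_left_right_inverse[of "transpose_mat V" n V] V by auto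
  have cV: "V * (transpose_mat V * X) = X" "transpose_mat V * (V * X) = X" if "X \<in> carrier_mat n n" for X
    using that V(1) VV V(2) assoc_mult_mat[of V n n "transpose_mat V" n X n]
      assoc_mult_mat[of "transpose_mat V" n n V n X n] by auto
  have cR: "R0 * (L0 * X) = X" "L0 * (R0 * X) = X" if "X \<in> carrier_mat n n" for X
    using that R0 L0 RL LR assoc_mult_mat[of R0 n n L0 n X n]
      assoc_mult_mat[of L0 n n R0 n X n] by auto
  have RtLt: "transpose_mat R0 * (transpose_mat L0 * X) = X" if "X \<in> carrier_mat n n" for X
  proof -
    have "transpose_mat R0 * transpose_mat L0 = 1\<^sub>m n"
      using LR R0 L0 by (metis transpose_mult transpose_one)
    then show ?thesis using that R0 L0 assoc_mult_mat[of "transpose_mat R0" n n "transpose_mat L0" n X n] by auto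
  qed
  define R where "R = transpose_mat V * R0"
  define L where "L = L0 * V"
  have "R * L = 1\<^sub>m n" using R0 L0 V by (simp add: R_def L_def cR)
  moreover have "L * R = 1\<^sub>m n" using R0 L0 V LR by (simp add: R_def L_def cV)
  moreover have "A = transpose_mat R * R" using R0 V RA by (simp add: R_def cV)
  moreover have "H = transpose_mat R * diag_of n l * R"
    unfolding V(3)[symmetric] using R0 L0 V(1,2) H(1) LR by (simp add: R_def H'_def cV RtLt)
  ultimately show ?thesis using R0 L0 V(1) by (intro exI[of _ R] exI[of _ L] exI[of _ l]) (auto simp: R_def L_def)
qed

lemma qform_congruence_diag:
  assumes "R \<in> carrier_mat n n" "x \<in> carrier_vec n"
  shows "qform (transpose_mat R * diag_of n l * R) x = (\<Sum>k<n. l k * ((R *\<^sub>v x) $ k)\<^sup>2)"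
  using assms by (subst qform_congruence) (auto simp: qform_diag_of)

lemma qform_gram:
  assumes "R \<in> carrier_mat n n" "x \<in> carrier_vec n"
  shows "qform (transpose_mat R * R) x = (\<Sum>k<n. ((R *\<^sub>v x) $ k)\<^sup>2)"
  using qform_congruence_diag[OF assms, of "\<lambda>_. 1"] assms by (simp add: one_mat_eq_diag_of[symmetric])

lemma det_congruence_diag:
  assumes "R \<in> carrier_mat n n"
  shows "Determinant.det (transpose_mat R * diag_of n l * R) = (Determinant.det R)\<^sup>2 * (\<Prod>k<n. l k)"
  using assms by (simp add: det_mult[of _ n] det_transpose det_diag_of power2_eq_square)

lemma det_gram:
  assumes "R \<in> carrier_mat n n"
  shows "Determinant.det (transpose_mat R * R) = (Determinant.det R)\<^sup>2"
  using assms by (simp add: det_mult[of _ n] det_transpose power2_eq_square)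

lemma det_nonzero_of_inverse:
  fixes R :: "real mat"
  assumes "R \<in> carrier_mat n n" "L \<in> carrier_mat n n" "R * L = 1\<^sub>m n"
  shows "Determinant.det R \<noteq> 0"
  using arg_cong[OF assms(3), of Determinant.det] assms(1,2) by (auto simp: det_mult)

lemma congruence_diag_self_adjoint:
  assumes "R \<in> carrier_mat n n"
  shows "transpose_mat R * diag_of n l * R \<in> self_adjoint n"
  using assms by (auto simp: self_adjoint_def transpose_mult[of _ n n _ n] mult_carrier_mat[of _ n n _ n] assoc_mult_mat[of _ n n _ n _ n])

lemma positive_definite_det_pos:
  assumes "A \<in> positive_definite n"
  shows "Determinant.det A > 0"
proof -
  obtain R L l where "R \<in> carrier_mat n n" "L \<in> carrier_mat n n" "R * L = 1\<^sub>m n" "A = transpose_mat R * R"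
    using simultaneous_diagonalization[OF assms, of A] assms by (auto simp: positive_definite_def)
  then show ?thesis using det_gram[of R n] det_nonzero_of_inverse[of R n L] by simp
qed

lemma self_adjoint_qform_bounds:
  assumes "A \<in> self_adjoint n"
  shows "\<exists>K\<ge>0. \<forall>x\<in>carrier_vec n. \<bar>qform A x\<bar> \<le> K * (x \<bullet> x)"
proof -
  note A = self_adjointD[OF assms]
  define K where "K = (\<Sum>r<n. \<Sum>s<n. \<bar>A $$ (r, s)\<bar>)"
  have "\<bar>qform A x\<bar> \<le> K * (x \<bullet> x)" if x: "x \<in> carrier_vec n" for x
  proof -
    have "\<bar>x $ r\<bar> * \<bar>x $ s\<bar> \<le> x \<bullet> x" if "r < n" "s < n" for r s
    proof -
      have "(x $ i)\<^sup>2 \<le> x \<bullet> x" if "i < n" for i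
        unfolding scalar_prod_self_sum[OF x] using that by (intro member_le_sum) auto
      from this[OF that(1)] this[OF that(2)] sum_squares_bound[of "\<bar>x $ r\<bar>" "\<bar>x $ s\<bar>"]
      show ?thesis by simp
    qed
    then have "(\<Sum>r<n. \<Sum>s<n. \<bar>A $$ (r, s)\<bar> * (\<bar>x $ r\<bar> * \<bar>x $ s\<bar>)) \<le> (\<Sum>r<n. \<Sum>s<n. \<bar>A $$ (r, s)\<bar> * (x \<bullet> x))"
      by (intro sum_mono mult_left_mono) auto
    moreover have "\<bar>qform A x\<bar> \<le> (\<Sum>r<n. \<Sum>s<n. \<bar>A $$ (r, s)\<bar> * (\<bar>x $ r\<bar> * \<bar>x $ s\<bar>))"
      unfolding qform_sum[OF A(1) x]
      by (intro order_trans[OF sum_abs] sum_mono) (auto simp: abs_mult mult_ac)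
    ultimately show ?thesis by (simp add: K_def sum_distrib_right)
  qed
  moreover have "K \<ge> 0" by (auto simp: K_def intro!: sum_nonneg)
  ultimately show ?thesis by blast
qed

text \<open>The identity is diagonalized together with \<open>A\<close>: x . x becomes sum l_k y_k^2
  while the form of \<open>A\<close> is sum y_k^2, so a bound on the coefficients gives the constant
  without compactness of the sphere.\<close>

lemma positive_definite_coercive:
  assumes A: "A \<in> positive_definite n"
  shows "\<exists>\<delta>>0. \<forall>x\<in>carrier_vec n. qform A x \<ge> \<delta> * (x \<bullet> x)"
proof -
  have 1: "1\<^sub>m n \<in> self_adjoint n" by (simp add: self_adjoint_def)
  obtain R L l where R: "R \<in> carrier_mat n n" "L \<in> carrier_mat n n" "R * L = 1\<^sub>m n" "L * R = 1\<^sub>m n"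
     "A = transpose_mat R * R" "1\<^sub>m n = transpose_mat R * diag_of n l * R"
    using simultaneous_diagonalization[OF A 1] by auto
  \<comment> \<open>The summand 1 makes K positive without any information on
    \<open>l\<close>.\<close>
  define K where "K = 1 + (\<Sum>k<n. \<bar>l k\<bar>)"
  have K: "K > 0" unfolding K_def by (intro add_pos_nonneg sum_nonneg) auto
  have "x \<bullet> x \<le> K * qform A x" if x: "x \<in> carrier_vec n" for x
  proof -
    have "x \<bullet> x = (\<Sum>k<n. l k * ((R *\<^sub>v x) $ k)\<^sup>2)"
      using qform_congruence_diag[OF R(1) x, of l] R(6) qform_one_mat[OF x] by simp
    also have "\<dots> \<le> (\<Sum>k<n. K * ((R *\<^sub>v x) $ k)\<^sup>2)"
    proof (intro sum_mono mult_right_mono)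
      fix k assume "k \<in> {..<n}"
      then have "\<bar>l k\<bar> \<le> (\<Sum>k<n. \<bar>l k\<bar>)" by (intro member_le_sum) auto
      then show "l k \<le> K" by (simp add: K_def)
    qed auto
    also have "\<dots> = K * qform A x" unfolding R(5) using qform_gram[OF R(1) x] by (simp add: sum_distrib_left)
    finally show ?thesis .
  qed
  then have "\<forall>x\<in>carrier_vec n. qform A x \<ge> (1 / K) * (x \<bullet> x)" using K by (simp add: field_simps)
  then show ?thesis using K by (intro exI[of _ "1 / K"]) auto
qed

section \<open>The signature condition\<close>

text \<open>The order of the root \<mu> counts the indices with l_i = \<mu>; adding the fibre sizes
  over the distinct positive values recovers the number of indices.\<close>

lemma diagonal_char_poly_pos_count:
  "num_pos_eigenvalues (diag_of n l) = card {i. i < n \<and> l i > 0}"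
proof -
  have cp: "char_poly (diag_of n l) = (\<Prod>i<n. [:- l i, 1:])"
  proof -
    have "char_poly (diag_of n l) = (\<Prod>a\<leftarrow>diag_mat (diag_of n l). [:- a, 1:])"
      by (rule char_poly_upper_triangular[OF diag_of_carrier]) (auto simp: upper_triangular_def)
    also have "diag_mat (diag_of n l) = map l [0..<n]" by (auto simp: diag_mat_def)
    finally show ?thesis by (simp add: prod.list_conv_set_nth lessThan_atLeast0)
  qed
  have ord: "Polynomial.order \<mu> (\<Prod>i\<in>I. [:- l i, 1:]) = card {i\<in>I. l i = \<mu>}" if "finite I" for \<mu> I
    using that
  proof (induction I)
    case (insert i I)
    have ne: "(\<Prod>i\<in>I. [:- l i, 1:]) \<noteq> 0" using insert.hyps(1) by (auto simp: prod_zero_iff)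
    have o1: "Polynomial.order \<mu> [:- l i, 1:] = (if l i = \<mu> then 1 else 0)"
      using order_power_n_n[of "l i" 1] by (auto simp: order_0I)
    have "{j \<in> insert i I. l j = \<mu>} = (if l i = \<mu> then insert i {j\<in>I. l j = \<mu>} else {j\<in>I. l j = \<mu>})"
      by auto
    then show ?case using insert ne by (simp add: order_mult o1 del: mult_pCons_left)
  qed auto
  have ev: "eigenvalue (diag_of n l) \<mu> \<longleftrightarrow> (\<exists>i<n. l i = \<mu>)" for \<mu>
    unfolding eigenvalue_root_char_poly[OF diag_of_carrier] cp by (auto simp: poly_prod prod_zero_iff)
  have "num_pos_eigenvalues (diag_of n l) = (\<Sum>\<mu>\<in>l ` {i. i < n \<and> l i > 0}. card {i\<in>{i. i < n \<and> l i > 0}. l i = \<mu>})"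
    unfolding num_pos_eigenvalues_def cp ev
    by (intro sum.cong) (auto simp: ord intro!: arg_cong[of _ _ card])
  also have "\<dots> = card {i. i < n \<and> l i > 0}"
    using sum.image_gen[of "{i. i < n \<and> l i > 0}" "\<lambda>_. 1::nat" l] by simp
  finally show ?thesis .
qed

lemma num_pos_eigenvalues_similar:
  assumes "similar_mat A A'"
  shows "num_pos_eigenvalues A = num_pos_eigenvalues A'"
proof -
  obtain n where c: "A \<in> carrier_mat n n" "A' \<in> carrier_mat n n"
    using assms by (auto simp: similar_mat_def similar_mat_wit_def Let_def)
  show ?thesis
    unfolding num_pos_eigenvalues_def eigenvalue_root_char_poly[OF c(1)] eigenvalue_root_char_poly[OF c(2)]
      char_poly_similar[OF assms] ..
qed

text \<open>Trivial equations 0 . x = 0 pad the system to a square one, and injectivity of the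
  homogeneous part makes its determinant nonzero. The padding lets all lengths up to n be treated by
  one determinant; injectivity excludes the short systems by itself.\<close>

lemma linear_system_solvable:
  fixes eqs :: "(real vec \<times> real) list"
  assumes len: "length eqs \<le> n" and car: "\<forall>(v, a)\<in>set eqs. v \<in> carrier_vec n"
    and inj: "\<And>x. x \<in> carrier_vec n \<Longrightarrow> (\<forall>(v, a)\<in>set eqs. v \<bullet> x = 0) \<Longrightarrow> x = 0\<^sub>v n"
  shows "\<exists>x\<in>carrier_vec n. \<forall>(v, a)\<in>set eqs. v \<bullet> x = a"
proof -
  define es where "es = eqs @ replicate (n - length eqs) (0\<^sub>v n, 0)"
  have les: "length es = n" using len by (simp add: es_def)
  have ces: "fst (es ! i) \<in> carrier_vec n" if "i < n" for i
  proof -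
    have "es ! i \<in> set es" using that les by simp
    then have "es ! i \<in> set eqs \<or> es ! i = (0\<^sub>v n, 0)" by (auto simp: es_def)
    then show ?thesis using car by auto
  qed
  define K where "K = mat_of_rows n (map fst es)"
  have K: "K \<in> carrier_mat n n" using les by (auto simp: K_def)
  have Kx: "(K *\<^sub>v x) $ i = fst (es ! i) \<bullet> x" if "i < n" "x \<in> carrier_vec n" for i x
    using that K les ces[OF that(1)] by (simp add: K_def mat_of_rows_row)
  have "Determinant.det K \<noteq> 0"
  proof
    assume "Determinant.det K = 0"
    then obtain x where x: "x \<in> carrier_vec n" "x \<noteq> 0\<^sub>v n" "K *\<^sub>v x = 0\<^sub>v n"
      using det_0_iff_vec_prod_zero[OF K] by blast
    have "\<forall>(v, a)\<in>set eqs. v \<bullet> x = 0"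
    proof (safe)
      fix v a assume "(v, a) \<in> set eqs"
      then have "(v, a) \<in> set es" by (simp add: es_def)
      then obtain i where "i < n" "es ! i = (v, a)" using les by (metis in_set_conv_nth)
      then show "v \<bullet> x = 0" using Kx[of i x] x by simp
    qed
    from inj[OF x(1) this] x(2) show False by simp
  qed
  then obtain L where L: "L \<in> carrier_mat n n" "K * L = 1\<^sub>m n" using inverse_matrix_exists[OF K] by metis
  define e where "e = vec n (\<lambda>i. snd (es ! i))"
  define x where "x = L *\<^sub>v e"
  have x: "x \<in> carrier_vec n" using L by (simp add: x_def e_def)
  have Kxe: "K *\<^sub>v x = e"
    using L K by (simp add: x_def e_def assoc_mult_mat_vec[of _ n n _ n, symmetric])
  have "\<forall>(v, a)\<in>set eqs. v \<bullet> x = a"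
  proof safe
    fix v a assume "(v, a) \<in> set eqs"
    then have "(v, a) \<in> set es" by (simp add: es_def)
    then obtain i where i: "i < n" "es ! i = (v, a)" using les by (metis in_set_conv_nth)
    then show "v \<bullet> x = a" using Kx[of i x] x Kxe by (simp add: e_def)
  qed
  then show ?thesis using x by blast
qed

text \<open>Condition (i) enters the later argument only in this form, which passes from Q to
  \<open>Qe\<close> at once because the perturbation lowers the form. Only the values of
  \<open>y\<close> below \<open>mp\<close> matter.\<close>

definition nonpos_lifting ::
  "nat \<Rightarrow> nat \<Rightarrow> (nat \<Rightarrow> nat) \<Rightarrow> (nat \<Rightarrow> real mat) \<Rightarrow> real mat \<Rightarrow> bool" where
  "nonpos_lifting n mp d B Q \<longleftrightarrow>
    (\<forall>y. (\<forall>j<mp. y j \<in> carrier_vec (d j)) \<longrightarrow>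
      (\<exists>w\<in>carrier_vec n. qform Q w \<le> 0 \<and> (\<forall>j<mp. B j *\<^sub>v w = y j)))"

text \<open>Impose on w the equations B_j w = y_j and the vanishing of its components along the
  eigenvectors with positive eigenvalue, which makes Q(w) <= 0. The dimension count bounds the
  number of equations by n, and a homogeneous solution lies in the kernel of B_+ with Q <= 0, hence
  is 0.\<close>

lemma nonpos_lifting_of_index:
  assumes Q: "Q \<in> self_adjoint n"
    and B: "\<And>j. j < mp \<Longrightarrow> B j \<in> carrier_mat (d j) n"
    and ker: "positive_definite_on (ker_B_plus n mp d B) Q"
    and le: "num_pos_eigenvalues Q + (\<Sum>j<mp. d j) \<le> n"
  shows "nonpos_lifting n mp d B Q"
  unfolding nonpos_lifting_def
proof (intro allI impI)
  fix y :: "nat \<Rightarrow> real vec" assume y: "\<forall>j<mp. y j \<in> carrier_vec (d j)"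
  note Qc = self_adjointD[OF Q]
  obtain U l where U: "U \<in> carrier_mat n n" "transpose_mat U * U = 1\<^sub>m n" "transpose_mat U * Q * U = diag_of n l"
    using real_spectral[OF Qc] by blast
  have UU: "U * transpose_mat U = 1\<^sub>m n"
    using mat_mult_left_right_inverse[of "transpose_mat U" n U] U by auto
  have sim: "similar_mat (diag_of n l) Q"
    unfolding similar_mat_def similar_mat_wit_def Let_def
    using U UU Qc by (intro exI[of _ "transpose_mat U"] exI[of _ U]) auto
  have Qeq: "Q = U * diag_of n l * transpose_mat U"
    using Qc U UU unfolding U(3)[symmetric]
    by (simp add: assoc_mult_mat[of _ n n _ n _ n] mult_carrier_mat[of _ n n _ n])
       (simp add: assoc_mult_mat[of _ n n _ n _ n, symmetric] mult_carrier_mat[of _ n n _ n])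
  have qf: "qform Q x = (\<Sum>k<n. l k * (col U k \<bullet> x)\<^sup>2)" if x: "x \<in> carrier_vec n" for x
  proof -
    have "qform Q x = qform (transpose_mat (transpose_mat U) * diag_of n l * transpose_mat U) x"
      using Qeq by simp
    also have "\<dots> = (\<Sum>k<n. l k * ((transpose_mat U *\<^sub>v x) $ k)\<^sup>2)"
      using U x by (intro qform_congruence_diag) auto
    finally show ?thesis using U by simp
  qed
  define ps where "ps = filter (\<lambda>i. l i > 0) [0..<n]"
  have lps: "length ps = num_pos_eigenvalues Q"
  proof -
    have "length ps = card (set ps)" by (rule distinct_card[symmetric]) (simp add: ps_def)
    also have "set ps = {i. i < n \<and> l i > 0}" by (auto simp: ps_def)
    finally show ?thesis using diagonal_char_poly_pos_count num_pos_eigenvalues_similar[OF sim] by simp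
  qed
  define eqs where "eqs = map (\<lambda>i. (col U i, 0)) ps @
     concat (map (\<lambda>j. map (\<lambda>r. (row (B j) r, y j $ r)) [0..<d j]) [0..<mp])"
  have "length eqs = num_pos_eigenvalues Q + (\<Sum>j<mp. d j)"
    by (simp add: eqs_def lps length_concat comp_def sum_list_sum_nth lessThan_atLeast0)
  then have len: "length eqs \<le> n" using le by simp
  have set_eqs: "set eqs = (\<lambda>i. (col U i, 0)) ` {i. i < n \<and> l i > 0} \<union>
      (\<Union>j<mp. (\<lambda>r. (row (B j) r, y j $ r)) ` {..<d j})"
    by (auto simp: eqs_def ps_def)
  have nonpos: "qform Q x \<le> 0" if x: "x \<in> carrier_vec n" and z: "\<forall>i<n. l i > 0 \<longrightarrow> col U i \<bullet> x = 0" for x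
    unfolding qf[OF x] using z by (intro sum_nonpos) (metis lessThan_iff linorder_not_less mult_nonpos_nonneg mult_zero_right power_zero_numeral zero_le_power2)
  have "\<exists>x\<in>carrier_vec n. \<forall>(v, a)\<in>set eqs. v \<bullet> x = a"
  proof (rule linear_system_solvable[OF len])
    show "\<forall>(v, a)\<in>set eqs. v \<in> carrier_vec n" unfolding set_eqs using U B by (force intro: row_carrier_vec)
    fix x :: "real vec" assume x: "x \<in> carrier_vec n" and z: "\<forall>(v, a)\<in>set eqs. v \<bullet> x = 0"
    have "B j *\<^sub>v x = 0\<^sub>v (d j)" if j: "j < mp" for j
      using z j B[OF j] unfolding set_eqs by (intro eq_vecI) auto
    then have "x \<in> ker_B_plus n mp d B" using x by (simp add: ker_B_plus_def)
    moreover have "qform Q x \<le> 0" using z unfolding set_eqs by (intro nonpos[OF x]) auto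
    ultimately show "x = 0\<^sub>v n" using ker x unfolding positive_definite_on_def by force
  qed
  then obtain x where x: "x \<in> carrier_vec n" "\<forall>(v, a)\<in>set eqs. v \<bullet> x = a" by blast
  have "B j *\<^sub>v x = y j" if j: "j < mp" for j
  proof (rule eq_vecI)
    fix r assume "r < dim_vec (y j)"
    then have r: "r < d j" using y j by auto
    then have "(row (B j) r, y j $ r) \<in> set eqs" using j unfolding set_eqs by auto
    then have "row (B j) r \<bullet> x = y j $ r" using bspec[OF x(2)] by fastforce
    then show "(B j *\<^sub>v x) $ r = y j $ r" using B[OF j] r by simp
  qed (use B[OF j] y j in auto)
  moreover have "qform Q x \<le> 0"
  proof (intro nonpos[OF x(1)] allI impI)
    fix i assume "i < n" "l i > 0"
    then have "(col U i, 0) \<in> set eqs" unfolding set_eqs by auto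
    then show "col U i \<bullet> x = 0" using bspec[OF x(2)] by fastforce
  qed
  ultimately show "\<exists>w\<in>carrier_vec n. qform Q w \<le> 0 \<and> (\<forall>j<mp. B j *\<^sub>v w = y j)" using x(1) by blast
qed

text \<open>The number \<open>k\<close> of summands is left free: k = mp gives the matrix of
  condition (ii), k = m the matrix M of the Gaussian integrals. With Q = 0 the same construction is
  the linear part used for variations.\<close>

lemma scalar_prod_Q_plus:
  assumes "Q \<in> carrier_mat n n" "\<And>j. j < k \<Longrightarrow> B j \<in> carrier_mat (d j) n"
    "\<And>j. j < k \<Longrightarrow> A j \<in> carrier_mat (d j) (d j)" "x \<in> carrier_vec n" "y \<in> carrier_vec n"
  shows "x \<bullet> (Q_plus n k B c Q A *\<^sub>v y) = x \<bullet> (Q *\<^sub>v y) + (\<Sum>j<k. c j * ((B j *\<^sub>v x) \<bullet> (A j *\<^sub>v (B j *\<^sub>v y))))"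
proof -
  have bil: "x \<bullet> (C *\<^sub>v y) = (\<Sum>r<n. \<Sum>s<n. x $ r * (C $$ (r, s) * y $ s))" if "C \<in> carrier_mat n n" for C :: "real mat"
    using that assms(4,5) by (auto simp: scalar_prod_def lessThan_atLeast0 sum_distrib_left intro!: sum.cong)
  define S where "S = mat n n (\<lambda>(r, s). \<Sum>j<k. (c j \<cdot>\<^sub>m (transpose_mat (B j) * A j * B j)) $$ (r, s))"
  have summand: "(B j *\<^sub>v x) \<bullet> (A j *\<^sub>v (B j *\<^sub>v y)) = (\<Sum>r<n. \<Sum>s<n. x $ r * ((transpose_mat (B j) * A j * B j) $$ (r, s) * y $ s))"
    if j: "j < k" for j
  proof -
    note c = assms(2)[OF j] assms(3)[OF j]
    have "(B j *\<^sub>v x) \<bullet> (A j *\<^sub>v (B j *\<^sub>v y)) = x \<bullet> (transpose_mat (B j) *\<^sub>v (A j *\<^sub>v (B j *\<^sub>v y)))"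
      using c assms(4,5) by (intro scalar_prod_mult_mat_vec) auto
    also have "transpose_mat (B j) *\<^sub>v (A j *\<^sub>v (B j *\<^sub>v y)) = (transpose_mat (B j) * A j * B j) *\<^sub>v y"
      using c assms(4,5) by (simp add: assoc_mult_mat_vec[of _ n "d j" _ "d j"] assoc_mult_mat_vec[of _ n "d j" _ n])
    finally show ?thesis using c by (simp add: bil)
  qed
  have "x \<bullet> (Q_plus n k B c Q A *\<^sub>v y) = x \<bullet> (Q *\<^sub>v y) + x \<bullet> (S *\<^sub>v y)"
    unfolding Q_plus_def S_def[symmetric] using assms(1,4,5)
    by (subst add_mult_distrib_mat_vec[of _ n n])
       (auto simp: S_def intro!: scalar_prod_add_distrib[of _ n] mult_mat_vec_carrier[of _ n n])
  also have "x \<bullet> (S *\<^sub>v y) = (\<Sum>r<n. \<Sum>s<n. x $ r * ((\<Sum>j<k. c j * (transpose_mat (B j) * A j * B j) $$ (r, s)) * y $ s))"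
  proof -
    have car: "transpose_mat (B j) * A j * B j \<in> carrier_mat n n" if "j < k" for j
      using assms(2,3)[OF that] by auto
    have "S $$ (r, s) = (\<Sum>j<k. c j * (transpose_mat (B j) * A j * B j) $$ (r, s))" if "r < n" "s < n" for r s
      using that car[THEN carrier_matD(1)] car[THEN carrier_matD(2)]
      unfolding S_def by (auto simp del: index_mult_mat intro!: sum.cong index_smult_mat)
    then show ?thesis by (subst bil) (auto simp: S_def intro!: sum.cong)
  qed
  also have "\<dots> = (\<Sum>r<n. \<Sum>s<n. \<Sum>j<k. c j * (x $ r * ((transpose_mat (B j) * A j * B j) $$ (r, s) * y $ s)))"
    by (simp add: sum_distrib_left sum_distrib_right mult_ac)
  also have "\<dots> = (\<Sum>r<n. \<Sum>j<k. \<Sum>s<n. c j * (x $ r * ((transpose_mat (B j) * A j * B j) $$ (r, s) * y $ s)))"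
    by (intro sum.cong refl sum.swap)
  also have "\<dots> = (\<Sum>j<k. \<Sum>r<n. \<Sum>s<n. c j * (x $ r * ((transpose_mat (B j) * A j * B j) $$ (r, s) * y $ s)))"
    by (rule sum.swap)
  also have "\<dots> = (\<Sum>j<k. c j * ((B j *\<^sub>v x) \<bullet> (A j *\<^sub>v (B j *\<^sub>v y))))"
    by (simp add: summand sum_distrib_left)
  finally show ?thesis .
qed

lemma qform_Q_plus:
  assumes "Q \<in> carrier_mat n n" "\<And>j. j < k \<Longrightarrow> B j \<in> carrier_mat (d j) n"
    "\<And>j. j < k \<Longrightarrow> A j \<in> carrier_mat (d j) (d j)" "x \<in> carrier_vec n"
  shows "qform (Q_plus n k B c Q A) x = qform Q x + (\<Sum>j<k. c j * qform (A j) (B j *\<^sub>v x))"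
  using scalar_prod_Q_plus[OF assms assms(4)] by (simp add: qform_def)

lemma self_adjoint_index: 
  assumes "A \<in> self_adjoint n" "r < n" "s < n" shows "A $$ (r, s) = A $$ (s, r)"
  using self_adjointD[OF assms(1)] assms(2,3) by (metis carrier_matD index_transpose_mat(1))

lemma Q_plus_self_adjoint:
  assumes "Q \<in> self_adjoint n" "\<And>j. j < k \<Longrightarrow> B j \<in> carrier_mat (d j) n"
    "\<And>j. j < k \<Longrightarrow> A j \<in> self_adjoint (d j)"
  shows "Q_plus n k B c Q A \<in> self_adjoint n"
proof -
  note Q = self_adjointD[OF assms(1)]
  have "transpose_mat (B j) * A j * B j \<in> self_adjoint n" if j: "j < k" for j
    using assms(2)[OF j] self_adjointD[OF assms(3)[OF j]]
    by (auto simp: self_adjoint_def transpose_mult[of _ n "d j" _ n] transpose_mult[of _ n "d j" _ "d j"] 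
         transpose_mult[of _ "d j" "d j" _ n] assoc_mult_mat[of _ n "d j" _ "d j" _ n])
  note S = self_adjoint_index[OF this] self_adjointD(1)[OF this]
  have "transpose_mat (Q_plus n k B c Q A) = Q_plus n k B c Q A"
  proof (rule eq_matI)
    fix r s assume rs: "r < dim_row (Q_plus n k B c Q A)" "s < dim_col (Q_plus n k B c Q A)"
    then have rs': "r < n" "s < n" by (auto simp: Q_plus_def)
    have "(\<Sum>j<k. (c j \<cdot>\<^sub>m (transpose_mat (B j) * A j * B j)) $$ (s, r)) =
      (\<Sum>j<k. (c j \<cdot>\<^sub>m (transpose_mat (B j) * A j * B j)) $$ (r, s))"
    proof (intro sum.cong refl)
      fix j assume "j \<in> {..<k}"
      then show "(c j \<cdot>\<^sub>m (transpose_mat (B j) * A j * B j)) $$ (s, r) = (c j \<cdot>\<^sub>m (transpose_mat (B j) * A j * B j)) $$ (r, s)"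
        using S(1)[of j r s] S(2)[of j] rs' assms(2)[of j] by simp
    qed
    then show "transpose_mat (Q_plus n k B c Q A) $$ (r, s) = Q_plus n k B c Q A $$ (r, s)"
      using rs' Q self_adjoint_index[OF assms(1) rs'] by (simp add: Q_plus_def)
  qed (use Q in \<open>auto simp: Q_plus_def\<close>)
  then show ?thesis using Q by (auto simp: self_adjoint_def Q_plus_def)
qed

lemma gram_positive_definite:
  assumes "R \<in> carrier_mat n n" "L \<in> carrier_mat n n" "L * R = 1\<^sub>m n"
    "\<And>k. k < n \<Longrightarrow> l k > 0"
  shows "transpose_mat R * diag_of n l * R \<in> positive_definite n"
proof (rule positive_definiteI[OF congruence_diag_self_adjoint[OF assms(1)]])
  fix x :: "real vec" assume x: "x \<in> carrier_vec n" "x \<noteq> 0\<^sub>v n"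
  have "R *\<^sub>v x \<noteq> 0\<^sub>v n"
  proof
    assume "R *\<^sub>v x = 0\<^sub>v n"
    then have "L *\<^sub>v (R *\<^sub>v x) = 0\<^sub>v n" using assms(2) by (intro eq_vecI) auto
    then show False using x assms by (simp add: assoc_mult_mat_vec[of _ n n _ n, symmetric])
  qed
  then obtain k where "k < n" "(R *\<^sub>v x) $ k \<noteq> 0"
    using assms(1) x by (metis carrier_vecD eq_vecI index_zero_vec(1,2) mult_mat_vec_carrier)
  then have "(\<Sum>k<n. l k * ((R *\<^sub>v x) $ k)\<^sup>2) > 0"
    using assms(4) by (intro sum_pos2[of _ k]) (auto simp: less_imp_le)
  then show "qform (transpose_mat R * diag_of n l * R) x > 0"
    by (simp add: qform_congruence_diag[OF assms(1) x(1)])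
qed

lemma positive_definite_inverse_exists:
  assumes "A \<in> positive_definite n"
  shows "\<exists>Ai. Ai \<in> positive_definite n \<and> A * Ai = 1\<^sub>m n \<and> Ai * A = 1\<^sub>m n"
proof -
  obtain R L l where R: "R \<in> carrier_mat n n" "L \<in> carrier_mat n n" "R * L = 1\<^sub>m n" "L * R = 1\<^sub>m n"
    "A = transpose_mat R * R"
    using simultaneous_diagonalization[OF assms, of A] assms by (auto simp: positive_definite_def)
  have T: "transpose_mat L * transpose_mat R = 1\<^sub>m n" "transpose_mat R * transpose_mat L = 1\<^sub>m n"
    using R by (metis transpose_mult transpose_one)+
  have c: "R * (L * X) = X" "L * (R * X) = X" "transpose_mat L * (transpose_mat R * X) = X"
    if "X \<in> carrier_mat n n" for X
    using that R T assoc_mult_mat[of R n n L n X n] assoc_mult_mat[of L n n R n X n]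
      assoc_mult_mat[of "transpose_mat L" n n "transpose_mat R" n X n] by auto
  have "transpose_mat (transpose_mat L) * diag_of n (\<lambda>_. 1) * transpose_mat L \<in> positive_definite n"
    using R T by (intro gram_positive_definite[of _ _ "transpose_mat R"]) auto
  then have "L * transpose_mat L \<in> positive_definite n"
    using R(2) by (simp add: one_mat_eq_diag_of[symmetric])
  moreover have "A * (L * transpose_mat L) = 1\<^sub>m n" "(L * transpose_mat L) * A = 1\<^sub>m n"
    using R T by (simp_all add: R(5) c assoc_mult_mat[of _ n n _ n _ n] mult_carrier_mat[of _ n n _ n])
  ultimately show ?thesis by blast
qed

definition pd_inverse :: "nat \<Rightarrow> real mat \<Rightarrow> real mat" where
  "pd_inverse n A = (SOME Ai. Ai \<in> positive_definite n \<and> A * Ai = 1\<^sub>m n \<and> Ai * A = 1\<^sub>m n)"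

lemma pd_inverse:
  assumes "A \<in> positive_definite n"
  shows "pd_inverse n A \<in> positive_definite n" "A * pd_inverse n A = 1\<^sub>m n" "pd_inverse n A * A = 1\<^sub>m n"
  using someI_ex[OF positive_definite_inverse_exists[OF assms]] by (auto simp: pd_inverse_def)

lemma pd_inverse_cancel:
  assumes "A \<in> positive_definite n" "x \<in> carrier_vec n"
  shows "A *\<^sub>v (pd_inverse n A *\<^sub>v x) = x" "pd_inverse n A *\<^sub>v (A *\<^sub>v x) = x"
  using pd_inverse[OF assms(1)] positive_definiteD(1)[OF assms(1)] positive_definiteD(1)[OF pd_inverse(1)[OF assms(1)]] assms(2)
  by (simp_all add: assoc_mult_mat_vec[of _ n n _ n, symmetric])

text \<open>The quadratic form on the left is indefinite on the sum of all spaces, with positive index at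
  most \<open>n\<close>; it is positive on the \<open>n\<close>-dimensional subspace \<open>{(w, (A\<^sub>j B\<^sub>j w)\<^sub>j)}\<close>, hence
  nonpositive on the orthogonal complement of that subspace.\<close>

lemma signature_inequality:
  fixes \<eta> :: "nat \<Rightarrow> real vec"
  assumes Q: "Q \<in> self_adjoint n"
    and B: "\<And>j. j < m \<Longrightarrow> B j \<in> carrier_mat (d j) n"
    and A: "\<And>j. j < m \<Longrightarrow> A j \<in> positive_definite (d j)"
    and mp: "mp \<le> m" and c: "\<And>j. mp \<le> j \<Longrightarrow> j < m \<Longrightarrow> c j \<le> 0"
    and lift: "nonpos_lifting n mp d B Q"
    and R: "R \<in> carrier_mat n n" and L: "L \<in> carrier_mat n n" "L * R = 1\<^sub>m n"
    and M: "Q_plus n m B c Q A = transpose_mat R * R"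
    and x: "x \<in> carrier_vec n" and \<eta>: "\<And>j. j < m \<Longrightarrow> \<eta> j \<in> carrier_vec (d j)"
  shows "qform Q x + (\<Sum>j<m. c j * qform (pd_inverse (d j) (A j)) (\<eta> j)) \<le>
    (\<Sum>k<n. (col L k \<bullet> (Q *\<^sub>v x) + (\<Sum>j<m. c j * ((B j *\<^sub>v col L k) \<bullet> \<eta> j)))\<^sup>2)"
proof -
  note Qc = self_adjointD[OF Q]
  note Ac = positive_definiteD[OF A]
  note Bc [simp] = mult_mat_vec_carrier[OF B]
  define Ai where "Ai j = pd_inverse (d j) (A j)" for j
  note Aic = positive_definiteD[OF pd_inverse(1)[OF A], folded Ai_def]
  note can = pd_inverse_cancel[OF A, folded Ai_def]
  \<comment> \<open>z represents the linear functional u -> <u, Q x> + sum c_j <B_j u, \<eta>_j>, so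
    that the right-hand side of the claim is the squared length of L^T z.\<close>
  define z where "z = vec n (\<lambda>r. unit_vec n r \<bullet> (Q *\<^sub>v x) + (\<Sum>j<m. c j * ((B j *\<^sub>v unit_vec n r) \<bullet> \<eta> j)))"
  have z: "z \<in> carrier_vec n" by (simp add: z_def)
  have uz: "u \<bullet> z = u \<bullet> (Q *\<^sub>v x) + (\<Sum>j<m. c j * ((B j *\<^sub>v u) \<bullet> \<eta> j))" if u: "u \<in> carrier_vec n" for u
  proof -
    have 1: "unit_vec n r \<bullet> (Q *\<^sub>v x) = (Q *\<^sub>v x) $ r" if "r < n" for r
      using that Qc(1) x by (intro scalar_prod_left_unit) auto
    have 2: "(B j *\<^sub>v unit_vec n r) \<bullet> \<eta> j = (transpose_mat (B j) *\<^sub>v \<eta> j) $ r" if "r < n" "j < m" for r j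
      using that B[of j] \<eta>[of j] by (subst scalar_prod_mult_mat_vec[of _ "d j" n])
        (auto intro!: scalar_prod_left_unit mult_mat_vec_carrier[of _ n "d j"])
    have 3: "(B j *\<^sub>v u) \<bullet> \<eta> j = (\<Sum>r<n. u $ r * (transpose_mat (B j) *\<^sub>v \<eta> j) $ r)" if "j < m" for j
      using that B[of j] \<eta>[of j] u
      by (subst scalar_prod_mult_mat_vec[of _ "d j" n]) (auto simp: scalar_prod_def lessThan_atLeast0 intro!: sum.cong)
    have "u \<bullet> z = (\<Sum>r<n. u $ r * ((Q *\<^sub>v x) $ r + (\<Sum>j<m. c j * (transpose_mat (B j) *\<^sub>v \<eta> j) $ r)))"
      using u by (auto simp: scalar_prod_def[of u] z_def lessThan_atLeast0[symmetric] 1 2 intro!: sum.cong)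
    also have "\<dots> = (\<Sum>r<n. u $ r * (Q *\<^sub>v x) $ r) + (\<Sum>r<n. \<Sum>j<m. c j * (u $ r * (transpose_mat (B j) *\<^sub>v \<eta> j) $ r))"
      by (simp add: algebra_simps sum.distrib sum_distrib_left)
    also have "(\<Sum>r<n. \<Sum>j<m. c j * (u $ r * (transpose_mat (B j) *\<^sub>v \<eta> j) $ r)) =
        (\<Sum>j<m. c j * ((B j *\<^sub>v u) \<bullet> \<eta> j))"
      by (subst sum.swap) (simp add: 3 sum_distrib_left)
    also have "(\<Sum>r<n. u $ r * (Q *\<^sub>v x) $ r) = u \<bullet> (Q *\<^sub>v x)"
      using u x Qc(1) by (auto simp: scalar_prod_def lessThan_atLeast0 intro!: sum.cong)
    finally show ?thesis .
  qed
  \<comment> \<open>L L^T is the inverse of M. Hence w = M^-1 z, and the right-hand side of the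
    claim equals <w, z>, the value of the form M at w.\<close>
  define w where "w = L *\<^sub>v (transpose_mat L *\<^sub>v z)"
  have w: "w \<in> carrier_vec n" using L z by (auto simp: w_def)
  have RL: "R * L = 1\<^sub>m n" using mat_mult_left_right_inverse[OF L(1) R L(2)] .
  have T: "transpose_mat R * transpose_mat L = 1\<^sub>m n" using R L by (metis transpose_mult transpose_one)
  have Mw: "Q_plus n m B c Q A *\<^sub>v w = z"
  proof -
    have "Q_plus n m B c Q A *\<^sub>v w = transpose_mat R *\<^sub>v ((R * L) *\<^sub>v (transpose_mat L *\<^sub>v z))"
      using R L z by (simp add: M w_def assoc_mult_mat_vec[of _ n n _ n])
    also have "\<dots> = (transpose_mat R * transpose_mat L) *\<^sub>v z"
      using R L z by (simp add: RL assoc_mult_mat_vec[of _ n n _ n])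
    finally show ?thesis using z by (simp add: T)
  qed
  have Mb: "u \<bullet> (Q_plus n m B c Q A *\<^sub>v v) = u \<bullet> (Q *\<^sub>v v) + (\<Sum>j<m. c j * ((B j *\<^sub>v u) \<bullet> (A j *\<^sub>v (B j *\<^sub>v v))))"
    if "u \<in> carrier_vec n" "v \<in> carrier_vec n" for u v
    using that by (intro scalar_prod_Q_plus[where d = d]) (auto simp: Qc B Ac)
  have Mq: "qform Q u + (\<Sum>j<m. c j * qform (A j) (B j *\<^sub>v u)) = qform (Q_plus n m B c Q A) u"
    if "u \<in> carrier_vec n" for u
    using Mb[OF that that] by (simp add: qform_def)
  have rhs: "(\<Sum>k<n. (col L k \<bullet> (Q *\<^sub>v x) + (\<Sum>j<m. c j * ((B j *\<^sub>v col L k) \<bullet> \<eta> j)))\<^sup>2) = w \<bullet> z"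
  proof -
    have "(\<Sum>k<n. (col L k \<bullet> (Q *\<^sub>v x) + (\<Sum>j<m. c j * ((B j *\<^sub>v col L k) \<bullet> \<eta> j)))\<^sup>2) =
        (\<Sum>k<n. ((transpose_mat L *\<^sub>v z) $ k)\<^sup>2)"
      using L uz by (intro sum.cong) auto
    also have "\<dots> = (transpose_mat L *\<^sub>v z) \<bullet> (transpose_mat L *\<^sub>v z)"
      using L z by (subst scalar_prod_self_sum[of _ n]) auto
    also have "\<dots> = w \<bullet> z"
      unfolding w_def using L z by (subst scalar_prod_mult_mat_vec[of L n n]) auto
    finally show ?thesis .
  qed
  \<comment> \<open>(x', \<eta>') is (x, \<eta>) minus its projection (w, (A_j B_j w)_j) on the
    subspace; \<open>orth\<close> is orthogonality for the indefinite form and \<open>shift\<close>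
    the resulting Pythagorean identity.\<close>
  define x' where "x' = x - w"
  define \<eta>' where "\<eta>' j = \<eta> j - A j *\<^sub>v (B j *\<^sub>v w)" for j
  have x': "x' \<in> carrier_vec n" using x w by (simp add: x'_def)
  have ABw: "A j *\<^sub>v (B j *\<^sub>v u) \<in> carrier_vec (d j)" if "j < m" "u \<in> carrier_vec n" for j u
    using mult_mat_vec_carrier[OF Ac(1) mult_mat_vec_carrier[OF B]] that by blast
  have \<eta>': "\<eta>' j \<in> carrier_vec (d j)" if "j < m" for j using that \<eta> ABw[OF that w] by (simp add: \<eta>'_def)
  have orth: "u \<bullet> (Q *\<^sub>v x') + (\<Sum>j<m. c j * ((B j *\<^sub>v u) \<bullet> \<eta>' j)) = 0" if u: "u \<in> carrier_vec n" for u
  proof -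
    have "u \<bullet> (Q *\<^sub>v x') = u \<bullet> (Q *\<^sub>v x) - u \<bullet> (Q *\<^sub>v w)"
      using u x w Qc(1) by (simp add: x'_def mult_minus_distrib_mat_vec[of _ n n] scalar_prod_minus_distrib[of _ n])
    moreover have "(B j *\<^sub>v u) \<bullet> \<eta>' j = (B j *\<^sub>v u) \<bullet> \<eta> j - (B j *\<^sub>v u) \<bullet> (A j *\<^sub>v (B j *\<^sub>v w))" if "j < m" for j
      using u w that \<eta> ABw by (simp add: \<eta>'_def scalar_prod_minus_distrib[of _ "d j"])
    ultimately have "u \<bullet> (Q *\<^sub>v x') + (\<Sum>j<m. c j * ((B j *\<^sub>v u) \<bullet> \<eta>' j)) =
        u \<bullet> z - u \<bullet> (Q_plus n m B c Q A *\<^sub>v w)"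
      unfolding uz[OF u] Mb[OF u w] by (simp add: right_diff_distrib sum_subtractf)
    then show ?thesis by (simp add: Mw)
  qed
  define q where "q = qform Q x' + (\<Sum>j<m. c j * qform (Ai j) (\<eta>' j))"
  have shift: "qform Q (u + x') + (\<Sum>j<m. c j * qform (Ai j) (A j *\<^sub>v (B j *\<^sub>v u) + \<eta>' j)) =
      qform (Q_plus n m B c Q A) u + q" if u: "u \<in> carrier_vec n" for u
  proof -
    have "qform (Ai j) (A j *\<^sub>v (B j *\<^sub>v u) + \<eta>' j) = qform (A j) (B j *\<^sub>v u) + qform (Ai j) (\<eta>' j) + 2 * ((B j *\<^sub>v u) \<bullet> \<eta>' j)"
      if j: "j < m" for j
    proof -
      have "(A j *\<^sub>v (B j *\<^sub>v u)) \<bullet> (Ai j *\<^sub>v \<eta>' j) = (B j *\<^sub>v u) \<bullet> \<eta>' j"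
        using scalar_prod_mult_mat_vec[of "A j" "d j" "d j" "B j *\<^sub>v u" "Ai j *\<^sub>v \<eta>' j"] j u \<eta>' Ac(1,2) Aic(1) can
        by (simp add: mult_mat_vec_carrier[of _ "d j" "d j"])
      moreover have "qform (Ai j) (A j *\<^sub>v (B j *\<^sub>v u)) = qform (A j) (B j *\<^sub>v u)"
        using j u can ABw by (simp add: qform_def) (metis Ac(1) Bc comm_scalar_prod)
      ultimately show ?thesis
        using qform_add[OF Aic(3)[OF j] ABw[OF j u] \<eta>'[OF j]] by simp
    qed
    then have "(\<Sum>j<m. c j * qform (Ai j) (A j *\<^sub>v (B j *\<^sub>v u) + \<eta>' j)) =
      (\<Sum>j<m. c j * qform (A j) (B j *\<^sub>v u)) + (\<Sum>j<m. c j * qform (Ai j) (\<eta>' j)) + 2 * (\<Sum>j<m. c j * ((B j *\<^sub>v u) \<bullet> \<eta>' j))"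
      by (simp add: algebra_simps sum.distrib sum_distrib_left)
    then show ?thesis
      using qform_add[OF Q u x'] orth[OF u] Mq[OF u] by (simp add: q_def algebra_simps)
  qed
  \<comment> \<open>The lifting supplies u with A_j B_j u + \<eta>'_j = 0 for j < mp and Q(u + x')
    <= 0. The left-hand side of \<open>shift\<close> is then nonpositive, the remaining summands
    having c_j <= 0, while M(u) >= 0; so q <= 0.\<close>
  have q0: "q \<le> 0"
  proof -
    have "\<forall>j<mp. B j *\<^sub>v x' + - (Ai j *\<^sub>v \<eta>' j) \<in> carrier_vec (d j)"
    proof (intro allI impI)
      fix j assume "j < mp"
      then have j: "j < m" using mp by simp
      show "B j *\<^sub>v x' + - (Ai j *\<^sub>v \<eta>' j) \<in> carrier_vec (d j)"
        using mult_mat_vec_carrier[OF B[OF j] x'] mult_mat_vec_carrier[OF Aic(1)[OF j] \<eta>'[OF j]] by simp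
    qed
    then obtain v where v: "v \<in> carrier_vec n" "qform Q v \<le> 0"
        "\<forall>j<mp. B j *\<^sub>v v = B j *\<^sub>v x' + - (Ai j *\<^sub>v \<eta>' j)"
      using lift unfolding nonpos_lifting_def by (elim allE[of _ "\<lambda>j. B j *\<^sub>v x' + - (Ai j *\<^sub>v \<eta>' j)"]) blast
    define u where "u = v - x'"
    have u: "u \<in> carrier_vec n" using v x' by (simp add: u_def)
    have "u + x' = v" using v x' by (intro eq_vecI) (auto simp: u_def)
    moreover have "A j *\<^sub>v (B j *\<^sub>v u) + \<eta>' j = 0\<^sub>v (d j)" if j: "j < mp" for j
    proof -
      have jm: "j < m" using j mp by simp
      have a: "B j *\<^sub>v x' \<in> carrier_vec (d j)" and b: "Ai j *\<^sub>v \<eta>' j \<in> carrier_vec (d j)"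
        using mult_mat_vec_carrier[OF B[OF jm] x'] mult_mat_vec_carrier[OF Aic(1)[OF jm] \<eta>'[OF jm]] by simp_all
      have "B j *\<^sub>v u = B j *\<^sub>v v - B j *\<^sub>v x'"
        unfolding u_def by (rule mult_minus_distrib_mat_vec[OF B[OF jm] v(1) x'])
      also have "\<dots> = (-1) \<cdot>\<^sub>v (Ai j *\<^sub>v \<eta>' j)"
      proof -
        have "p + - q - p = (-1) \<cdot>\<^sub>v q" if "p \<in> carrier_vec (d j)" "q \<in> carrier_vec (d j)" for p q :: "real vec"
          using that by (intro eq_vecI) auto
        then show ?thesis unfolding v(3)[rule_format, OF j] using a b .
      qed
      finally have "A j *\<^sub>v (B j *\<^sub>v u) = (-1) \<cdot>\<^sub>v \<eta>' j"
        using mult_mat_vec[OF Ac(1)[OF jm] b] can(1)[OF jm \<eta>'[OF jm]] by simp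
      then show ?thesis using \<eta>'[OF jm] by (intro eq_vecI) auto
    qed
    moreover have "c j * qform (Ai j) (A j *\<^sub>v (B j *\<^sub>v u) + \<eta>' j) \<le> 0" if j: "j < m" for j
    proof (cases "j < mp")
      case True
      then show ?thesis using calculation(2)[OF True] Aic(1)[OF j] by (simp add: qform_def)
    next
      case False
      then show ?thesis using c[of j] j Aic(5)[OF j, of "A j *\<^sub>v (B j *\<^sub>v u) + \<eta>' j"] ABw[OF j u] \<eta>'[OF j]
        by (simp add: mult_nonpos_nonneg)
    qed
    ultimately have "qform (Q_plus n m B c Q A) u + q \<le> 0"
      using shift[OF u] v(2) sum_nonpos[of "{..<m}" "\<lambda>j. c j * qform (Ai j) (A j *\<^sub>v (B j *\<^sub>v u) + \<eta>' j)"] by simp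
    moreover have "qform (Q_plus n m B c Q A) u \<ge> 0"
      unfolding M qform_gram[OF R u] by (intro sum_nonneg) simp
    ultimately show ?thesis by simp
  qed
  have wx: "w + x' = x" using x w by (intro eq_vecI) (auto simp: x'_def)
  have we: "A j *\<^sub>v (B j *\<^sub>v w) + \<eta>' j = \<eta> j" if "j < m" for j
  proof -
    have "p + (q - p) = q" if "p \<in> carrier_vec (d j)" "q \<in> carrier_vec (d j)" for p q :: "real vec"
      using that by (intro eq_vecI) auto
    then show ?thesis unfolding \<eta>'_def using \<eta>[OF that] ABw[OF that w] by blast
  qed
  have "(\<Sum>j<m. c j * qform (Ai j) (A j *\<^sub>v (B j *\<^sub>v w) + \<eta>' j)) = (\<Sum>j<m. c j * qform (Ai j) (\<eta> j))"
    by (intro sum.cong refl) (simp only: we lessThan_iff)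
  then have "qform Q x + (\<Sum>j<m. c j * qform (Ai j) (\<eta> j)) \<le> qform (Q_plus n m B c Q A) w"
    using shift[OF w] q0 unfolding wx by simp
  also have "\<dots> = w \<bullet> z" by (simp add: qform_def Mw)
  finally show ?thesis unfolding rhs Ai_def .
qed

section \<open>Harmonic interpolation of inverse covariances\<close>

definition interp :: "real \<Rightarrow> real \<Rightarrow> real" where
  "interp \<gamma> t = \<gamma> / ((1 - t) + t * \<gamma>)"

lemma interp_denom_pos:
  assumes "\<gamma> > 0" "0 \<le> t" "t \<le> (1::real)"
  shows "(1 - t) + t * \<gamma> > 0"
proof (cases "t = 1")
  case False
  then show ?thesis using assms by (intro add_pos_nonneg) auto
qed (use assms in simp)

lemma interp_pos: "\<gamma> > 0 \<Longrightarrow> 0 \<le> t \<Longrightarrow> t \<le> 1 \<Longrightarrow> interp \<gamma> t > 0"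
  using interp_denom_pos[of \<gamma> t] by (simp add: interp_def)

lemma interp_0 [simp]: "interp \<gamma> 0 = \<gamma>" and interp_1 [simp]: "\<gamma> \<noteq> 0 \<Longrightarrow> interp \<gamma> 1 = 1"
  by (simp_all add: interp_def)

text \<open>\<open>interp\<close> \<gamma> t is the reciprocal of (1-t)/\<gamma> + t, that is,
  variances move linearly from 1/\<gamma> to 1. Its product with y^2 is the minimum of (1-t)
  \<gamma> a^2 + t b^2 over all splittings y = (1-t) a + t b, the gap being a multiple of (\<gamma>
  a - b)^2.\<close>

lemma interp_convex:
  assumes "\<gamma> > 0" "0 \<le> t" "t \<le> 1"
  shows "interp \<gamma> t * ((1 - t) * a + t * b)\<^sup>2 \<le> (1 - t) * (\<gamma> * a\<^sup>2) + t * b\<^sup>2"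
proof -
  note p = interp_denom_pos[OF assms]
  have "((1 - t) * (\<gamma> * a\<^sup>2) + t * b\<^sup>2) * ((1 - t) + t * \<gamma>) - \<gamma> * ((1 - t) * a + t * b)\<^sup>2 = t * (1 - t) * (\<gamma> * a - b)\<^sup>2"
    by (simp add: power2_eq_square algebra_simps)
  moreover have "t * (1 - t) * (\<gamma> * a - b)\<^sup>2 \<ge> 0" using assms by simp
  ultimately have "\<gamma> * ((1 - t) * a + t * b)\<^sup>2 \<le> ((1 - t) * (\<gamma> * a\<^sup>2) + t * b\<^sup>2) * ((1 - t) + t * \<gamma>)" by linarith
  then show ?thesis using p by (simp add: interp_def pos_divide_le_eq)
qed

text \<open>The harmonic mean is at most the arithmetic mean; this is what keeps the moving inverse
  covariances below \<open>G\<close>.\<close>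

lemma interp_le:
  assumes "\<gamma> > 0" "0 \<le> t" "t \<le> 1"
  shows "interp \<gamma> t \<le> (1 - t) * \<gamma> + t"
  using interp_convex[OF assms, of 1 1] by simp

lemma interp_bounds:
  assumes "\<gamma> > 0" "0 \<le> t" "t \<le> 1"
  shows "interp \<gamma> t \<le> \<gamma> + 1"
proof -
  have "(1 - t) * \<gamma> + t \<le> 1 * \<gamma> + 1" using assms by (intro add_mono mult_right_mono) auto
  then show ?thesis using interp_le[OF assms] by simp
qed

text \<open>The splitting of \<open>x\<close> along a direction on which \<open>Q\<close> is nonpositive is the minimal splitting in
  the parallel-sum formula for the forms with positive coefficient.\<close>

lemma interpolated_form_lower_bound:
  fixes R L :: "nat \<Rightarrow> real mat"
  assumes Q: "Q \<in> self_adjoint n"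
    and B: "\<And>j. j < m \<Longrightarrow> B j \<in> carrier_mat (d j) n"
    and R: "\<And>j. j < m \<Longrightarrow> R j \<in> carrier_mat (d j) (d j)"
    and L: "\<And>j. j < m \<Longrightarrow> L j \<in> carrier_mat (d j) (d j)" "\<And>j. j < m \<Longrightarrow> L j * R j = 1\<^sub>m (d j)" "\<And>j. j < m \<Longrightarrow> R j * L j = 1\<^sub>m (d j)"
    and \<gamma>: "\<And>j k. j < m \<Longrightarrow> k < d j \<Longrightarrow> \<gamma> j k > 0"
    and mp: "mp \<le> m" and c: "\<And>j. mp \<le> j \<Longrightarrow> j < m \<Longrightarrow> c j \<le> 0"
    and lift: "nonpos_lifting n mp d B Q"
    and M0: "\<And>x. x \<in> carrier_vec n \<Longrightarrow>
      \<delta> * (x \<bullet> x) \<le> qform Q x + (\<Sum>j<m. c j * (\<Sum>k<d j. \<gamma> j k * ((R j *\<^sub>v (B j *\<^sub>v x)) $ k)\<^sup>2))"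
    and M1: "\<And>x. x \<in> carrier_vec n \<Longrightarrow>
      \<delta> * (x \<bullet> x) \<le> qform Q x + (\<Sum>j<m. c j * (\<Sum>k<d j. ((R j *\<^sub>v (B j *\<^sub>v x)) $ k)\<^sup>2))"
    and t: "0 \<le> t" "t \<le> 1" and \<delta>: "\<delta> \<ge> 0" and x: "x \<in> carrier_vec n"
  shows "\<delta> * (x \<bullet> x) \<le> qform Q x + (\<Sum>j<m. c j * (\<Sum>k<d j. interp (\<gamma> j k) t * ((R j *\<^sub>v (B j *\<^sub>v x)) $ k)\<^sup>2))"
proof -
  define Y where "Y j = R j *\<^sub>v (B j *\<^sub>v x)" for j
  \<comment> \<open>y0 and y1 form the minimal splitting Y = (1-t) y0 + t y1, characterized by
    \<gamma> y0 = y1, both equal to \<open>interp\<close> times Y.\<close>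
  define y0 where "y0 j = vec (d j) (\<lambda>k. interp (\<gamma> j k) t / \<gamma> j k * Y j $ k)" for j
  define y1 where "y1 j = vec (d j) (\<lambda>k. interp (\<gamma> j k) t * Y j $ k)" for j
  have yc: "y0 j \<in> carrier_vec (d j)" "y1 j \<in> carrier_vec (d j)" for j by (auto simp: y0_def y1_def)
  have Yc: "Y j \<in> carrier_vec (d j)" if "j < m" for j
    using mult_mat_vec_carrier[OF R[OF that] mult_mat_vec_carrier[OF B[OF that] x]] by (simp add: Y_def)
  have RL: "R j *\<^sub>v (L j *\<^sub>v v) = v" if "j < m" "v \<in> carrier_vec (d j)" for j v
    using that R L by (simp add: assoc_mult_mat_vec[of _ "d j" "d j" _ "d j", symmetric])
  have "\<forall>j<mp. L j *\<^sub>v (y1 j - y0 j) \<in> carrier_vec (d j)"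
    using mult_mat_vec_carrier[OF L(1)] mp yc by auto
  then obtain w where w: "w \<in> carrier_vec n" "qform Q w \<le> 0" "\<forall>j<mp. B j *\<^sub>v w = L j *\<^sub>v (y1 j - y0 j)"
    using lift unfolding nonpos_lifting_def by (elim allE[of _ "\<lambda>j. L j *\<^sub>v (y1 j - y0 j)"]) blast
  \<comment> \<open>x = (1-t) x0 + t x1 and x1 - x0 = w, so every quadratic form q satisfies (1-t)
    q(x0) + t q(x1) = q(x) + t (1-t) q(w). For Q the last term is nonpositive by the choice of
    w.\<close>
  define x0 where "x0 = x + (- t) \<cdot>\<^sub>v w"
  define x1 where "x1 = x + (1 - t) \<cdot>\<^sub>v w"
  have xc: "x0 \<in> carrier_vec n" "x1 \<in> carrier_vec n" using x w by (auto simp: x0_def x1_def)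
  have qs: "qform A (x + s \<cdot>\<^sub>v w) = qform A x + 2 * s * (x \<bullet> (A *\<^sub>v w)) + s\<^sup>2 * qform A w" if "A \<in> self_adjoint n" for A s
    using qform_add[OF that x, of "s \<cdot>\<^sub>v w"] qform_smult[OF self_adjointD(1)[OF that] w(1)] self_adjointD[OF that] x w(1)
    by (simp add: mult_mat_vec[of _ n n] scalar_prod_smult_right)
  have comb: "(1 - t) * qform A x0 + t * qform A x1 = qform A x + t * (1 - t) * qform A w" if "A \<in> self_adjoint n" for A
    unfolding x0_def x1_def qs[OF that] by (simp add: power2_eq_square algebra_simps)
  have RBs: "(R j *\<^sub>v (B j *\<^sub>v (x + s \<cdot>\<^sub>v w))) $ k = Y j $ k + s * (R j *\<^sub>v (B j *\<^sub>v w)) $ k" if "j < m" "k < d j" for j k s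
  proof -
    have "R j *\<^sub>v (B j *\<^sub>v (x + s \<cdot>\<^sub>v w)) = Y j + s \<cdot>\<^sub>v (R j *\<^sub>v (B j *\<^sub>v w))"
      unfolding Y_def using that x w(1) B R
      by (simp add: mult_add_distrib_mat_vec[of _ "d j" n] mult_add_distrib_mat_vec[of _ "d j" "d j"]
         mult_mat_vec[of _ "d j" n] mult_mat_vec[of _ "d j" "d j"] mult_mat_vec_carrier[of _ "d j" n])
    then show ?thesis using that Yc[OF that(1)] mult_mat_vec_carrier[OF R mult_mat_vec_carrier[OF B w(1)], OF that(1) that(1)]
        carrier_matD[OF R[OF that(1)]] by simp
  qed
  \<comment> \<open>For j < mp the splitting induced by w is the minimal one, and equality holds.
    For the other j the splitting is arbitrary, and the factor c_j <= 0 reverses the convexity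
    inequality into the required direction.\<close>
  have summand: "c j * (\<Sum>k<d j. interp (\<gamma> j k) t * (Y j $ k)\<^sup>2) \<ge>
      (1 - t) * (c j * (\<Sum>k<d j. \<gamma> j k * ((R j *\<^sub>v (B j *\<^sub>v x0)) $ k)\<^sup>2)) + t * (c j * (\<Sum>k<d j. ((R j *\<^sub>v (B j *\<^sub>v x1)) $ k)\<^sup>2))"
    if j: "j < m" for j
  proof (cases "j < mp")
    case True
    have Rw: "(R j *\<^sub>v (B j *\<^sub>v w)) $ k = y1 j $ k - y0 j $ k" if "k < d j" for k
      using w(3) True RL[OF j, of "y1 j - y0 j"] yc[of j] that by simp
    have split: "(1 - t) * y0 j $ k + t * y1 j $ k = Y j $ k" if k: "k < d j" for k
    proof -
      have "(1 - t) * (interp (\<gamma> j k) t / \<gamma> j k) + t * interp (\<gamma> j k) t = 1"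
      proof -
        have "(1 - t) * (1 / D) + t * (g / D) = 1" if "D > 0" "D = (1 - t) + t * g" for g D :: real
        proof -
          have "(1 - t) * (1 / D) + t * (g / D) = ((1 - t) + t * g) / D" by (simp add: add_divide_distrib)
          then show ?thesis using that by simp
        qed
        from this[OF interp_denom_pos[OF \<gamma>[OF j k] t] refl] show ?thesis using \<gamma>[OF j k] by (simp add: interp_def)
      qed
      then have "((1 - t) * (interp (\<gamma> j k) t / \<gamma> j k) + t * interp (\<gamma> j k) t) * Y j $ k = Y j $ k" by simp
      then show ?thesis using k by (simp add: y0_def y1_def algebra_simps)
    qed
    have e0: "(R j *\<^sub>v (B j *\<^sub>v x0)) $ k = y0 j $ k" if k: "k < d j" for k
      unfolding x0_def RBs[OF j k] Rw[OF k] using split[OF k] by (simp add: algebra_simps)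
    have e1: "(R j *\<^sub>v (B j *\<^sub>v x1)) $ k = y1 j $ k" if k: "k < d j" for k
      unfolding x1_def RBs[OF j k] Rw[OF k] using split[OF k] by (simp add: algebra_simps)
    have "interp (\<gamma> j k) t * (Y j $ k)\<^sup>2 = (1 - t) * (\<gamma> j k * ((R j *\<^sub>v (B j *\<^sub>v x0)) $ k)\<^sup>2) + t * ((R j *\<^sub>v (B j *\<^sub>v x1)) $ k)\<^sup>2"
      if k: "k < d j" for k
    proof -
      have p: "\<gamma> j k > 0" "(1 - t) + t * \<gamma> j k > 0" using \<gamma>[OF j k] interp_denom_pos[OF \<gamma>[OF j k] t] by auto
      have "(1 - t) * (\<gamma> j k * (interp (\<gamma> j k) t / \<gamma> j k)\<^sup>2) + t * (interp (\<gamma> j k) t)\<^sup>2 = interp (\<gamma> j k) t"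
      proof -
        have "(1 - t) * (g * (1 / D)\<^sup>2) + t * (g / D)\<^sup>2 = g / D" if "D > 0" "D = (1 - t) + t * g" for g D :: real
        proof -
          have "(1 - t) * (g * (1 / D)\<^sup>2) + t * (g / D)\<^sup>2 = g * ((1 - t) + t * g) / D\<^sup>2"
            by (simp add: power2_eq_square algebra_simps add_divide_distrib diff_divide_distrib)
          then show ?thesis using that by (simp add: power2_eq_square)
        qed
        from this[OF p(2) refl] show ?thesis using p by (simp add: interp_def)
      qed
      have gen: "i * y\<^sup>2 = (1 - t) * (g * (a * y)\<^sup>2) + t * (b * y)\<^sup>2"
        if "(1 - t) * (g * a\<^sup>2) + t * b\<^sup>2 = i" for i g a b y :: real
        unfolding that[symmetric] by (simp add: power_mult_distrib algebra_simps)
      have y01: "y0 j $ k = interp (\<gamma> j k) t / \<gamma> j k * Y j $ k" "y1 j $ k = interp (\<gamma> j k) t * Y j $ k"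
        using k by (simp_all add: y0_def y1_def)
      show ?thesis unfolding e0[OF k] e1[OF k] y01 by (rule gen) fact
    qed
    then have "(\<Sum>k<d j. interp (\<gamma> j k) t * (Y j $ k)\<^sup>2) = (1 - t) * (\<Sum>k<d j. \<gamma> j k * ((R j *\<^sub>v (B j *\<^sub>v x0)) $ k)\<^sup>2) + t * (\<Sum>k<d j. ((R j *\<^sub>v (B j *\<^sub>v x1)) $ k)\<^sup>2)"
      unfolding sum_distrib_left sum.distrib[symmetric] by (intro sum.cong refl) (simp only: lessThan_iff)
    then show ?thesis by (simp only: distrib_left mult.left_commute order_refl)
  next
    case False
    have "interp (\<gamma> j k) t * (Y j $ k)\<^sup>2 \<le> (1 - t) * (\<gamma> j k * ((R j *\<^sub>v (B j *\<^sub>v x0)) $ k)\<^sup>2) + t * ((R j *\<^sub>v (B j *\<^sub>v x1)) $ k)\<^sup>2"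
      if k: "k < d j" for k
    proof -
      have "Y j $ k = (1 - t) * (R j *\<^sub>v (B j *\<^sub>v x0)) $ k + t * (R j *\<^sub>v (B j *\<^sub>v x1)) $ k"
        unfolding x0_def x1_def RBs[OF j k] by (simp add: algebra_simps)
      then show ?thesis by (simp only: interp_convex[OF \<gamma>[OF j k] t])
    qed
    then have "(\<Sum>k<d j. interp (\<gamma> j k) t * (Y j $ k)\<^sup>2) \<le> (1 - t) * (\<Sum>k<d j. \<gamma> j k * ((R j *\<^sub>v (B j *\<^sub>v x0)) $ k)\<^sup>2) + t * (\<Sum>k<d j. ((R j *\<^sub>v (B j *\<^sub>v x1)) $ k)\<^sup>2)"
      unfolding sum_distrib_left sum.distrib[symmetric] by (intro sum_mono) (simp only: lessThan_iff)
    then have "c j * ((1 - t) * (\<Sum>k<d j. \<gamma> j k * ((R j *\<^sub>v (B j *\<^sub>v x0)) $ k)\<^sup>2) + t * (\<Sum>k<d j. ((R j *\<^sub>v (B j *\<^sub>v x1)) $ k)\<^sup>2))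
      \<le> c j * (\<Sum>k<d j. interp (\<gamma> j k) t * (Y j $ k)\<^sup>2)"
      by (rule mult_left_mono_neg) (use False c[of j] j in linarith)
    then show ?thesis by (simp only: distrib_left mult.left_commute)
  qed
  have one: "1\<^sub>m n \<in> self_adjoint n" by (simp add: self_adjoint_def)
  have "\<delta> * (x \<bullet> x) \<le> \<delta> * ((1 - t) * (x0 \<bullet> x0) + t * (x1 \<bullet> x1))"
  proof (intro mult_left_mono \<delta>)
    have "w \<bullet> w \<ge> 0" unfolding scalar_prod_self_sum[OF w(1)] by (intro sum_nonneg) simp
    then have "0 \<le> t * (1 - t) * (w \<bullet> w)" using t by simp
    then show "x \<bullet> x \<le> (1 - t) * (x0 \<bullet> x0) + t * (x1 \<bullet> x1)"
      using comb[OF one] unfolding qform_one_mat[OF x] qform_one_mat[OF w(1)] qform_one_mat[OF xc(1)] qform_one_mat[OF xc(2)]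
      by linarith
  qed
  also have "\<dots> = (1 - t) * (\<delta> * (x0 \<bullet> x0)) + t * (\<delta> * (x1 \<bullet> x1))" by (simp add: algebra_simps)
  also have "\<dots> \<le> (1 - t) * (qform Q x0 + (\<Sum>j<m. c j * (\<Sum>k<d j. \<gamma> j k * ((R j *\<^sub>v (B j *\<^sub>v x0)) $ k)\<^sup>2)))
     + t * (qform Q x1 + (\<Sum>j<m. c j * (\<Sum>k<d j. ((R j *\<^sub>v (B j *\<^sub>v x1)) $ k)\<^sup>2)))"
    using M0[OF xc(1)] M1[OF xc(2)] t by (intro add_mono mult_left_mono) auto
  also have "\<dots> = (qform Q x + t * (1 - t) * qform Q w) + (\<Sum>j<m. (1 - t) * (c j * (\<Sum>k<d j. \<gamma> j k * ((R j *\<^sub>v (B j *\<^sub>v x0)) $ k)\<^sup>2)) + t * (c j * (\<Sum>k<d j. ((R j *\<^sub>v (B j *\<^sub>v x1)) $ k)\<^sup>2)))"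
    unfolding comb[OF Q, symmetric] unfolding sum.distrib sum_distrib_left[symmetric] distrib_left by linarith
  also have "\<dots> \<le> qform Q x + (\<Sum>j<m. c j * (\<Sum>k<d j. interp (\<gamma> j k) t * (Y j $ k)\<^sup>2))"
    using summand w(2) t by (intro add_mono sum_mono) (auto intro!: mult_nonneg_nonpos)
  finally show ?thesis by (simp add: Y_def)
qed

section \<open>Minimizing the log-determinant functional\<close>

definition frobenius :: "nat \<Rightarrow> real mat \<Rightarrow> real mat \<Rightarrow> real" where
  "frobenius n X H = (\<Sum>r<n. \<Sum>s<n. X $$ (r, s) * H $$ (r, s))"

lemma pd_inverse_gram:
  assumes "A \<in> positive_definite n" "A = transpose_mat R * R"
    and R: "R \<in> carrier_mat n n" "L \<in> carrier_mat n n" "R * L = 1\<^sub>m n"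
  shows "pd_inverse n A = L * transpose_mat L"
proof -
  note I = pd_inverse[OF assms(1)] positive_definiteD(1)[OF pd_inverse(1)[OF assms(1)]]
  note A = positive_definiteD(1)[OF assms(1)]
  have LR: "L * R = 1\<^sub>m n" using mat_mult_left_right_inverse[OF R] .
  have T: "transpose_mat R * transpose_mat L = 1\<^sub>m n" using R LR by (metis transpose_mult transpose_one)
  have "A * (L * transpose_mat L) = transpose_mat R * (R * (L * transpose_mat L))"
    using R by (simp add: assms(2) assoc_mult_mat[of _ n n _ n _ n] mult_carrier_mat[of _ n n _ n])
  also have "R * (L * transpose_mat L) = transpose_mat L"
    using R assoc_mult_mat[of R n n L n "transpose_mat L" n] by simp
  finally have "A * (L * transpose_mat L) = 1\<^sub>m n" using T by simp
  then have "pd_inverse n A * (A * (L * transpose_mat L)) = pd_inverse n A" using I by simp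
  moreover have "pd_inverse n A * (A * (L * transpose_mat L)) = (pd_inverse n A * A) * (L * transpose_mat L)"
    using A I R by (intro assoc_mult_mat[symmetric]) (auto simp: mult_carrier_mat[of _ n n _ n])
  ultimately show ?thesis using I R by (simp add: mult_carrier_mat[of _ n n _ n])
qed

text \<open>Since A^-1 = L L^T, the trace of A^-1 H is the sum of the values of H on the columns of
  \<open>L\<close>. This turns traces against M^-1 into sums over finitely many directions of
  differentiation.\<close>

lemma frobenius_pd_inverse:
  assumes "A \<in> positive_definite n" "A = transpose_mat R * R"
    and R: "R \<in> carrier_mat n n" "L \<in> carrier_mat n n" "R * L = 1\<^sub>m n"
    and H: "H \<in> carrier_mat n n"
  shows "frobenius n (pd_inverse n A) H = (\<Sum>k<n. qform H (col L k))"
proof -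
  have "pd_inverse n A $$ (r, s) = (\<Sum>k<n. L $$ (r, k) * L $$ (s, k))" if "r < n" "s < n" for r s
    using that R unfolding pd_inverse_gram[OF assms(1-5)] by (auto simp: scalar_prod_def lessThan_atLeast0)
  then have "frobenius n (pd_inverse n A) H = (\<Sum>r<n. \<Sum>s<n. \<Sum>k<n. H $$ (r, s) * L $$ (r, k) * L $$ (s, k))"
    unfolding frobenius_def by (auto simp: sum_distrib_left sum_distrib_right mult_ac intro!: sum.cong)
  also have "\<dots> = (\<Sum>r<n. \<Sum>k<n. \<Sum>s<n. H $$ (r, s) * L $$ (r, k) * L $$ (s, k))"
    by (intro sum.cong refl sum.swap)
  also have "\<dots> = (\<Sum>k<n. \<Sum>r<n. \<Sum>s<n. H $$ (r, s) * L $$ (r, k) * L $$ (s, k))"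
    by (rule sum.swap)
  also have "\<dots> = (\<Sum>k<n. qform H (col L k))"
    using R H by (intro sum.cong refl) (subst qform_sum[of _ n], auto)
  finally show ?thesis .
qed

lemma line_diagonal:
  assumes R: "R \<in> carrier_mat n n"
  shows "transpose_mat R * R + s \<cdot>\<^sub>m (transpose_mat R * diag_of n l * R) =
    transpose_mat R * diag_of n (\<lambda>k. 1 + s * l k) * R"
proof -
  have "diag_of n (\<lambda>k. 1 + s * l k) = 1\<^sub>m n + s \<cdot>\<^sub>m diag_of n l" by (rule eq_matI) auto
  then show ?thesis using R
    by (simp add: mult_add_distrib_mat[of _ n n _ n] add_mult_distrib_mat[of _ n n _ _ n]
        mult_smult_distrib[of _ n n _ n] mult_smult_assoc_mat[of _ n n _ n]
        mult_carrier_mat[of _ n n _ n])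
qed

lemma eventually_line_pos:
  fixes l :: "nat \<Rightarrow> real"
  shows "eventually (\<lambda>s. \<forall>k<n. 1 + s * l k > 0) (at 0)"
proof -
  have "eventually (\<lambda>s. \<forall>k\<in>{..<n}. 1 + s * l k > 0) (at 0)"
  proof (intro eventually_ball_finite ballI finite_lessThan)
    fix k
    have "((\<lambda>s. 1 + s * l k) \<longlongrightarrow> 1 + 0 * l k) (at 0)" by (intro tendsto_intros)
    then show "eventually (\<lambda>s. 1 + s * l k > 0) (at 0)" by (rule order_tendstoD) simp
  qed
  then show ?thesis by (simp add: Ball_def)
qed

text \<open>In a frame that diagonalizes both forms, det (A + s H) = det(R)^2 prod (1 + s l_k); the
  derivative of its logarithm at 0 is sum l_k, the trace of A^-1 H.\<close>

lemma positive_definite_line: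
  assumes A: "A \<in> positive_definite n" and H: "H \<in> self_adjoint n"
  shows "eventually (\<lambda>s. A + s \<cdot>\<^sub>m H \<in> positive_definite n) (at 0)"
    and "((\<lambda>s. ln (Determinant.det (A + s \<cdot>\<^sub>m H))) has_real_derivative frobenius n (pd_inverse n A) H) (at 0)"
proof -
  obtain R L l where R: "R \<in> carrier_mat n n" "L \<in> carrier_mat n n" "R * L = 1\<^sub>m n" "L * R = 1\<^sub>m n"
      and eq: "A = transpose_mat R * R" "H = transpose_mat R * diag_of n l * R"
    using simultaneous_diagonalization[OF A H] by blast
  have line: "A + s \<cdot>\<^sub>m H = transpose_mat R * diag_of n (\<lambda>k. 1 + s * l k) * R" for s
    unfolding eq using line_diagonal[OF R(1)] .
  show "eventually (\<lambda>s. A + s \<cdot>\<^sub>m H \<in> positive_definite n) (at 0)"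
    using eventually_line_pos[of n l]
    by eventually_elim (auto simp: line intro!: gram_positive_definite[OF R(1,2,4)])
  have lk: "qform H (col L k) = l k" if k: "k < n" for k
  proof -
    have "R *\<^sub>v col L k = unit_vec n k"
      using R k col_mult2[OF R(1,2) k] by simp
    then have "qform H (col L k) = (\<Sum>i<n. l i * (unit_vec n k $ i)\<^sup>2)"
      unfolding eq using R k by (subst qform_congruence_diag) auto
    also have "\<dots> = (\<Sum>i<n. if i = k then l i else 0)" by (intro sum.cong) (auto simp: unit_vec_def)
    finally show ?thesis using k by simp
  qed
  have det: "Determinant.det R \<noteq> 0" using det_nonzero_of_inverse[OF R(1-3)] .
  have der: "((\<lambda>s. ln ((Determinant.det R)\<^sup>2) + (\<Sum>k<n. ln (1 + s * l k))) has_real_derivative (\<Sum>k<n. l k)) (at 0)"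
    by (auto intro!: derivative_eq_intros sum.cong)
  have ev: "eventually (\<lambda>s. ln ((Determinant.det R)\<^sup>2) + (\<Sum>k<n. ln (1 + s * l k)) = ln (Determinant.det (A + s \<cdot>\<^sub>m H))) (nhds 0)"
  proof -
    have "eventually (\<lambda>s. \<forall>k<n. 1 + s * l k > 0) (nhds 0)"
      using eventually_line_pos[of n l] by (auto simp: eventually_nhds_conv_at)
    then show ?thesis
    proof eventually_elim
      case (elim s)
      then show ?case
        unfolding line det_congruence_diag[OF R(1)] using det
        by (subst ln_mult_pos) (auto intro!: prod_pos ln_prod[symmetric])
    qed
  qed
  have "((\<lambda>s. ln (Determinant.det (A + s \<cdot>\<^sub>m H))) has_real_derivative (\<Sum>k<n. l k)) (at 0)"
    by (rule iffD1[OF DERIV_cong_ev[OF refl ev refl] der])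
  moreover have "(\<Sum>k<n. l k) = frobenius n (pd_inverse n A) H"
  proof -
    have "(\<Sum>k<n. qform H (col L k)) = (\<Sum>k<n. l k)" by (intro sum.cong refl) (simp only: lk lessThan_iff)
    then show ?thesis using frobenius_pd_inverse[OF A eq(1) R(1-3) self_adjointD(1)[OF H]] by simp
  qed
  ultimately show "((\<lambda>s. ln (Determinant.det (A + s \<cdot>\<^sub>m H))) has_real_derivative frobenius n (pd_inverse n A) H) (at 0)"
    by simp
qed

text \<open>Positivity of the last matrix is what makes the integral of the corresponding Gaussians
  converge.\<close>

definition feasible where
  "feasible n m d B c Q G A \<longleftrightarrow>
    (\<forall>j<m. A j \<in> positive_definite (d j) \<and> loewner_le (d j) (A j) (G j)) \<and> Q_plus n m B c Q A \<in> positive_definite n"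

text \<open>Twice the logarithm of the Gaussian value of the functional: for feasible
  \<open>A\<close> the integral of exp(-pi Q) prod g_A^c is the square root of prod det(A_j)^(c_j) /
  det M.\<close>

definition log_det_functional where
  "log_det_functional n m B c Q A =
    (\<Sum>j<m. c j * ln (Determinant.det (A j))) - ln (Determinant.det (Q_plus n m B c Q A))"

lemma Q_plus_line:
  assumes "Q \<in> carrier_mat n n" "\<And>j. j < k \<Longrightarrow> B j \<in> carrier_mat (d j) n"
    "\<And>j. j < k \<Longrightarrow> A j \<in> carrier_mat (d j) (d j)" "\<And>j. j < k \<Longrightarrow> H j \<in> carrier_mat (d j) (d j)"
  shows "Q_plus n k B c Q (\<lambda>j. A j + s \<cdot>\<^sub>m H j) = Q_plus n k B c Q A + s \<cdot>\<^sub>m Q_plus n k B c (0\<^sub>m n n) H"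
proof (rule eq_matI)
  fix r q assume "r < dim_row (Q_plus n k B c Q A + s \<cdot>\<^sub>m Q_plus n k B c (0\<^sub>m n n) H)"
    "q < dim_col (Q_plus n k B c Q A + s \<cdot>\<^sub>m Q_plus n k B c (0\<^sub>m n n) H)"
  then have rq: "r < n" "q < n" by (auto simp: Q_plus_def)
  have "(c j \<cdot>\<^sub>m (transpose_mat (B j) * (A j + s \<cdot>\<^sub>m H j) * B j)) $$ (r, q) =
      (c j \<cdot>\<^sub>m (transpose_mat (B j) * A j * B j)) $$ (r, q) + s * (c j \<cdot>\<^sub>m (transpose_mat (B j) * H j * B j)) $$ (r, q)"
    if j: "j < k" for j
  proof -
    note cc = assms(2-4)[OF j]
    have car: "transpose_mat (B j) * A j * B j \<in> carrier_mat n n" "transpose_mat (B j) * H j * B j \<in> carrier_mat n n"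
      using cc by auto
    have "transpose_mat (B j) * (A j + s \<cdot>\<^sub>m H j) * B j = transpose_mat (B j) * A j * B j + s \<cdot>\<^sub>m (transpose_mat (B j) * H j * B j)"
      using cc by (simp add: mult_add_distrib_mat[of _ n "d j" _ "d j"] add_mult_distrib_mat[of _ n "d j" _ _ n]
         mult_smult_distrib[of _ n "d j" _ "d j"] mult_smult_assoc_mat[of _ n "d j" _ n] mult_carrier_mat[of _ n "d j" _ "d j"])
    then show ?thesis using car[THEN carrier_matD(1)] car[THEN carrier_matD(2)] rq
      by (simp del: index_mult_mat(1) add: algebra_simps)
  qed
  then show "Q_plus n k B c Q (\<lambda>j. A j + s \<cdot>\<^sub>m H j) $$ (r, q) = (Q_plus n k B c Q A + s \<cdot>\<^sub>m Q_plus n k B c (0\<^sub>m n n) H) $$ (r, q)"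
    using rq assms(1) by (simp add: Q_plus_def sum.distrib sum_distrib_left)
qed (auto simp: Q_plus_def)

text \<open>A + s H is the convex combination (1-s) A + s (A + H), so it stays below
  \<open>G\<close> for 0 < s < 1, and positivity of A and M is an open condition. A + H itself need
  not be positive, and precisely this freedom is exploited later.\<close>

lemma feasible_line:
  assumes Q: "Q \<in> self_adjoint n" and B: "\<And>j. j < m \<Longrightarrow> B j \<in> carrier_mat (d j) n"
    and A: "feasible n m d B c Q G A"
    and H: "\<And>j. j < m \<Longrightarrow> H j \<in> self_adjoint (d j)"
    and le: "\<And>j x. j < m \<Longrightarrow> x \<in> carrier_vec (d j) \<Longrightarrow> qform (A j) x + qform (H j) x \<le> qform (G j) x"
  shows "eventually (\<lambda>s. feasible n m d B c Q G (\<lambda>j. A j + s \<cdot>\<^sub>m H j)) (at_right 0)"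
proof -
  have Apd: "A j \<in> positive_definite (d j)" and Ale: "loewner_le (d j) (A j) (G j)" if "j < m" for j
    using A that by (auto simp: feasible_def)
  note Ac = positive_definiteD[OF Apd] and Hc = self_adjointD[OF H] and Qc = self_adjointD[OF Q]
  have M: "Q_plus n m B c Q A \<in> positive_definite n" using A by (simp add: feasible_def)
  have D: "Q_plus n m B c (0\<^sub>m n n) H \<in> self_adjoint n"
    using B H by (intro Q_plus_self_adjoint[where d = d]) (auto simp: self_adjoint_def)
  have ev: "eventually P (at_right 0)" if "eventually P (at 0)" for P :: "real \<Rightarrow> bool"
    using that by (simp add: eventually_at_split)
  have "eventually (\<lambda>s. \<forall>j\<in>{..<m}. A j + s \<cdot>\<^sub>m H j \<in> positive_definite (d j)) (at_right 0)"
    using positive_definite_line(1)[OF Apd H] by (intro eventually_ball_finite ballI ev) auto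
  moreover have "eventually (\<lambda>s. Q_plus n m B c Q A + s \<cdot>\<^sub>m Q_plus n m B c (0\<^sub>m n n) H \<in> positive_definite n) (at_right 0)"
    using positive_definite_line(1)[OF M D] by (rule ev)
  moreover have "eventually (\<lambda>s. 0 < s \<and> s < (1::real)) (at_right 0)"
    by (subst eventually_at_right[of 0 1]) (auto intro: exI[of _ 1])
  ultimately show ?thesis
  proof eventually_elim
    case (elim s)
    have "loewner_le (d j) (A j + s \<cdot>\<^sub>m H j) (G j)" if j: "j < m" for j
      unfolding loewner_le_def
    proof
      fix x :: "real vec" assume x: "x \<in> carrier_vec (d j)"
      have "qform (A j + s \<cdot>\<^sub>m H j) x = qform (A j) x + s * qform (H j) x"
        using j x Ac(1)[OF j] Hc(1)[OF j]
        by (simp add: qform_sum[of _ "d j"] sum.distrib sum_distrib_left algebra_simps)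
      also have "\<dots> = (1 - s) * qform (A j) x + s * (qform (A j) x + qform (H j) x)" by (simp add: algebra_simps)
      also have "\<dots> \<le> (1 - s) * qform (G j) x + s * qform (G j) x"
        using le[OF j x] Ale[OF j] x elim(3) by (intro add_mono mult_left_mono) (auto simp: loewner_le_def)
      finally show "qform (A j + s \<cdot>\<^sub>m H j) x \<le> qform (G j) x" by (simp add: algebra_simps)
    qed
    moreover have "Q_plus n m B c Q (\<lambda>j. A j + s \<cdot>\<^sub>m H j) = Q_plus n m B c Q A + s \<cdot>\<^sub>m Q_plus n m B c (0\<^sub>m n n) H"
      using Qc(1) B Ac(1) Hc(1) by (intro Q_plus_line[where d = d]) auto
    ultimately show ?case using elim(1,2) by (simp add: feasible_def)
  qed
qed

text \<open>The one-sided derivative at a minimizer is nonnegative. In the direction H it equals sum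
  c_j tr(A_j^-1 H_j) - tr(M^-1 sum c_j B_j^T H_j B_j), and the second trace is expanded over the
  columns of \<open>L\<close>.\<close>

lemma log_det_minimizer_variation:
  assumes Q: "Q \<in> self_adjoint n" and B: "\<And>j. j < m \<Longrightarrow> B j \<in> carrier_mat (d j) n"
    and A: "feasible n m d B c Q G A"
    and min: "\<And>A'. feasible n m d B c Q G A' \<Longrightarrow> log_det_functional n m B c Q A \<le> log_det_functional n m B c Q A'"
    and H: "\<And>j. j < m \<Longrightarrow> H j \<in> self_adjoint (d j)"
    and le: "\<And>j x. j < m \<Longrightarrow> x \<in> carrier_vec (d j) \<Longrightarrow> qform (A j) x + qform (H j) x \<le> qform (G j) x"
    and R: "R \<in> carrier_mat n n" "L \<in> carrier_mat n n" "R * L = 1\<^sub>m n" "Q_plus n m B c Q A = transpose_mat R * R"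
  shows "(\<Sum>k<n. \<Sum>j<m. c j * qform (H j) (B j *\<^sub>v col L k)) \<le> (\<Sum>j<m. c j * frobenius (d j) (pd_inverse (d j) (A j)) (H j))"
proof -
  have Apd: "A j \<in> positive_definite (d j)" if "j < m" for j using A that by (simp add: feasible_def)
  note Ac = positive_definiteD[OF Apd] and Hc = self_adjointD[OF H] and Qc = self_adjointD[OF Q]
  have M: "Q_plus n m B c Q A \<in> positive_definite n" using A by (simp add: feasible_def)
  have D: "Q_plus n m B c (0\<^sub>m n n) H \<in> self_adjoint n"
    using B H by (intro Q_plus_self_adjoint[where d = d]) (auto simp: self_adjoint_def)
  have line: "Q_plus n m B c Q (\<lambda>j. A j + s \<cdot>\<^sub>m H j) = Q_plus n m B c Q A + s \<cdot>\<^sub>m Q_plus n m B c (0\<^sub>m n n) H" for s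
    using Qc(1) B Ac(1) Hc(1) by (intro Q_plus_line[where d = d]) auto
  define f where "f s = log_det_functional n m B c Q (\<lambda>j. A j + s \<cdot>\<^sub>m H j)" for s
  define D1 where "D1 = (\<Sum>j<m. c j * frobenius (d j) (pd_inverse (d j) (A j)) (H j))"
  define D2 where "D2 = frobenius n (pd_inverse n (Q_plus n m B c Q A)) (Q_plus n m B c (0\<^sub>m n n) H)"
  have "((\<lambda>s. (\<Sum>j<m. c j * ln (Determinant.det (A j + s \<cdot>\<^sub>m H j))) -
      ln (Determinant.det (Q_plus n m B c Q A + s \<cdot>\<^sub>m Q_plus n m B c (0\<^sub>m n n) H))) has_real_derivative D1 - D2) (at 0)"
    unfolding D1_def D2_def using positive_definite_line(2)[OF Apd H] positive_definite_line(2)[OF M D]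
    by (intro DERIV_diff DERIV_sum DERIV_cmult) auto
  then have deriv: "(f has_real_derivative D1 - D2) (at 0)"
    unfolding f_def log_det_functional_def line .
  have f0: "f 0 = log_det_functional n m B c Q A"
  proof -
    have "A j + 0 \<cdot>\<^sub>m H j = A j" if "j < m" for j
      using Ac(1)[OF that] Hc(1)[OF that] by (intro eq_matI) auto
    then have "(\<Sum>j<m. c j * ln (Determinant.det (A j + 0 \<cdot>\<^sub>m H j))) = (\<Sum>j<m. c j * ln (Determinant.det (A j)))"
      by (intro sum.cong) auto
    moreover have "Q_plus n m B c Q A + 0 \<cdot>\<^sub>m Q_plus n m B c (0\<^sub>m n n) H = Q_plus n m B c Q A"
      using M D by (intro eq_matI) (auto simp: Q_plus_def)
    ultimately show ?thesis
      unfolding f_def log_det_functional_def line by simp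
  qed
  have "0 \<le> D1 - D2"
  proof (rule ccontr)
    assume "\<not> 0 \<le> D1 - D2"
    then obtain e where e: "e > 0" "\<And>h. 0 < h \<Longrightarrow> h < e \<Longrightarrow> f (0 + h) < f 0"
      using DERIV_neg_dec_right[OF deriv] by auto
    have "eventually (\<lambda>s. s < e) (at_right 0)" using e(1) by (subst eventually_at_right[of 0 e]) (auto intro: exI[of _ e])
    moreover have "eventually (\<lambda>s. s > (0::real)) (at_right 0)" by (simp add: eventually_at_right_less)
    moreover have "eventually (\<lambda>s. feasible n m d B c Q G (\<lambda>j. A j + s \<cdot>\<^sub>m H j)) (at_right 0)"
      using B H le by (intro feasible_line[OF Q _ A]) auto
    ultimately have "eventually (\<lambda>s. False) (at_right (0::real))"
      by eventually_elim (use e(2) min f0 in \<open>force simp: f_def\<close>)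
    then show False by simp
  qed
  moreover have "D2 = (\<Sum>k<n. \<Sum>j<m. c j * qform (H j) (B j *\<^sub>v col L k))"
  proof -
    have "qform (Q_plus n m B c (0\<^sub>m n n) H) (col L k) = (\<Sum>j<m. c j * qform (H j) (B j *\<^sub>v col L k))" if "k < n" for k
    proof -
      have "col L k \<in> carrier_vec n" using R(2) that by auto
      moreover from this have "qform (0\<^sub>m n n) (col L k) = 0" by (subst qform_sum[of _ n]) auto
      ultimately show ?thesis using Hc B by (subst qform_Q_plus[where d = d]) auto
    qed
    then show ?thesis
      unfolding D2_def frobenius_pd_inverse[OF M R(4,1-3) self_adjointD(1)[OF D]]
      by (intro sum.cong refl) (simp only: lessThan_iff)
  qed
  ultimately show ?thesis by (simp add: D1_def)
qed

text \<open>In the frame of \<open>A\<close> the second form has diagonal entries at least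
  1.\<close>

lemma det_mono_loewner:
  assumes A: "A \<in> positive_definite n" and A': "A' \<in> self_adjoint n" and le: "loewner_le n A A'"
  shows "A' \<in> positive_definite n" "Determinant.det A \<le> Determinant.det A'"
proof -
  show "A' \<in> positive_definite n"
    using positive_definiteD(4)[OF A] le by (intro positive_definiteI[OF A']) (force simp: loewner_le_def)
  obtain R L l where R: "R \<in> carrier_mat n n" "L \<in> carrier_mat n n" "R * L = 1\<^sub>m n"
      and eq: "A = transpose_mat R * R" "A' = transpose_mat R * diag_of n l * R"
    using simultaneous_diagonalization[OF A A'] by blast
  have "l k \<ge> 1" if k: "k < n" for k
  proof -
    have c: "col L k \<in> carrier_vec n" using R(2) k by auto
    have RL: "R *\<^sub>v col L k = unit_vec n k" using R k col_mult2[OF R(1,2) k] by simp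
    have "qform A (col L k) = (\<Sum>i<n. if i = k then 1 else 0)"
      unfolding eq qform_gram[OF R(1) c] RL using k by (intro sum.cong) (auto simp: unit_vec_def)
    moreover have "qform A' (col L k) = (\<Sum>i<n. if i = k then l i else 0)"
      unfolding eq qform_congruence_diag[OF R(1) c] RL using k by (intro sum.cong) (auto simp: unit_vec_def)
    moreover have "qform A (col L k) \<le> qform A' (col L k)" using le c by (simp add: loewner_le_def)
    ultimately show ?thesis using k by simp
  qed
  then have "(\<Prod>k<n. l k) \<ge> 1" by (intro prod_ge_1) auto
  then show "Determinant.det A \<le> Determinant.det A'"
    unfolding eq det_congruence_diag[OF R(1)] det_gram[OF R(1)] by (simp add: mult_le_cancel_left1 mult_left_le)
qed

text \<open>Replaces strict positivity by conditions that can be made closed, a nonnegative form and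
  a determinant bounded away from 0, so that a compact set of positive definite matrices can be
  described.\<close>

lemma nonneg_form_positive_definite:
  assumes A: "A \<in> self_adjoint n" and nn: "\<And>x. x \<in> carrier_vec n \<Longrightarrow> qform A x \<ge> 0"
    and det: "Determinant.det A \<noteq> 0"
  shows "A \<in> positive_definite n"
proof -
  note Ac = self_adjointD[OF A]
  obtain U l where U: "U \<in> carrier_mat n n" "transpose_mat U * U = 1\<^sub>m n" "transpose_mat U * A * U = diag_of n l"
    using real_spectral[OF Ac] by blast
  have UU: "U * transpose_mat U = 1\<^sub>m n"
    using mat_mult_left_right_inverse[of "transpose_mat U" n U] U by auto
  have dU: "Determinant.det (transpose_mat U * A * U) = Determinant.det A * (Determinant.det (transpose_mat U * U))"
    using U(1) Ac(1) by (simp add: det_mult[of _ n] mult_carrier_mat[of _ n n _ n])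
  have "(\<Prod>k<n. l k) \<noteq> 0" using dU det U(2,3) by (simp add: det_diag_of)
  moreover have "l k \<ge> 0" if k: "k < n" for k
  proof -
    have "l k = (\<Sum>i<n. if i = k then l i else 0)" using k by simp
    also have "\<dots> = qform (diag_of n l) (unit_vec n k)"
      unfolding qform_diag_of[OF unit_vec_carrier] using k by (intro sum.cong) (auto simp: unit_vec_def)
    also have "\<dots> = qform A (U *\<^sub>v unit_vec n k)"
      using qform_congruence[OF U(1) Ac(1), of "unit_vec n k"] U(3) by simp
    also have "\<dots> \<ge> 0" using U(1) by (intro nn) auto
    finally show ?thesis .
  qed
  ultimately have "l k > 0" if "k < n" for k
    using that by (metis finite_lessThan lessThan_iff less_eq_real_def prod_zero)
  then have "transpose_mat (transpose_mat U) * diag_of n l * transpose_mat U \<in> positive_definite n"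
    using U UU by (intro gram_positive_definite[of _ _ U]) auto
  moreover have "A = U * diag_of n l * transpose_mat U"
  proof -
    have "U * diag_of n l * transpose_mat U = U * (transpose_mat U * (A * (U * transpose_mat U)))"
      unfolding U(3)[symmetric] using U(1) Ac(1)
      by (simp add: assoc_mult_mat[of _ n n _ n _ n] mult_carrier_mat[of _ n n _ n])
    also have "\<dots> = U * (transpose_mat U * A)" unfolding UU using Ac(1) by simp
    also have "\<dots> = (U * transpose_mat U) * A" using U(1) Ac(1) by (intro assoc_mult_mat[symmetric]) auto
    finally show ?thesis using Ac(1) UU by simp
  qed
  ultimately show ?thesis by simp
qed

lemma qform_smult_mat:
  assumes "A \<in> carrier_mat n n" "x \<in> carrier_vec n"
  shows "qform (s \<cdot>\<^sub>m A) x = s * qform A x"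
  using assms by (simp add: qform_sum[of _ n] sum_distrib_left mult_ac)

lemma det_lower_bound:
  assumes A: "A \<in> positive_definite n" and \<kappa>: "\<kappa> > 0"
    and le: "\<And>y. y \<in> carrier_vec n \<Longrightarrow> \<kappa> * (y \<bullet> y) \<le> qform A y"
  shows "\<kappa> ^ n \<le> Determinant.det A"
proof -
  have "transpose_mat (1\<^sub>m n) * diag_of n (\<lambda>_. \<kappa>) * 1\<^sub>m n \<in> positive_definite n"
    using \<kappa> by (intro gram_positive_definite[of _ _ "1\<^sub>m n"]) auto
  then have pd: "diag_of n (\<lambda>_. \<kappa>) \<in> positive_definite n" by simp
  have "loewner_le n (diag_of n (\<lambda>_. \<kappa>)) A"
    using le by (auto simp: loewner_le_def qform_diag_of scalar_prod_self_sum sum_distrib_left)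
  from det_mono_loewner(2)[OF pd positive_definiteD(3)[OF A] this] show ?thesis by (simp add: det_diag_of)
qed

section \<open>Compactness for families of matrices\<close>

lemma closed_Collect_imp_const:
  fixes Q :: "'a::topological_space \<Rightarrow> bool"
  shows "(P \<Longrightarrow> closed {x. Q x}) \<Longrightarrow> closed {x. P \<longrightarrow> Q x}"
  by (cases P) auto

text \<open>Tychonoff. Matrices of varying sizes are later encoded as one real function on index
  triples, and bounds on all entries become membership in such a box.\<close>

lemma compact_function_box: "compact {a :: 'a \<Rightarrow> real. \<forall>p. \<bar>a p\<bar> \<le> b p}"
proof -
  have "compactin (product_topology (\<lambda>_. euclidean) UNIV) (PiE UNIV (\<lambda>p. {- b p .. b p}))"
    by (subst compactin_PiE) (auto simp: compact_Icc)
  moreover have "PiE UNIV (\<lambda>p. {- b p .. b p}) = {a. \<forall>p. \<bar>a p\<bar> \<le> b p}"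
    by (auto simp: PiE_def Pi_def abs_le_iff) (smt (verit))+
  ultimately show ?thesis by (simp add: euclidean_product_topology)
qed

lemma continuous_on_det:
  fixes F :: "'a::topological_space \<Rightarrow> real mat"
  assumes "\<And>a. F a \<in> carrier_mat n n" "\<And>r s. r < n \<Longrightarrow> s < n \<Longrightarrow> continuous_on S (\<lambda>a. F a $$ (r, s))"
  shows "continuous_on S (\<lambda>a. Determinant.det (F a))"
proof -
  have "Determinant.det (F a) = (\<Sum>p\<in>{p. p permutes {0..<n}}. signof p * (\<Prod>i = 0..<n. F a $$ (i, p i)))" for a
    using det_def'[OF assms(1)] .
  moreover have "continuous_on S (\<lambda>a. \<Sum>p\<in>{p. p permutes {0..<n}}. signof p * (\<Prod>i = 0..<n. F a $$ (i, p i)))"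
    by (intro continuous_intros assms(2)) (auto simp: permutes_in_image)
  ultimately show ?thesis by simp
qed

lemma continuous_on_qform:
  fixes F :: "'a::topological_space \<Rightarrow> real mat"
  assumes "\<And>a. F a \<in> carrier_mat n n" "\<And>r s. r < n \<Longrightarrow> s < n \<Longrightarrow> continuous_on S (\<lambda>a. F a $$ (r, s))"
    and "x \<in> carrier_vec n"
  shows "continuous_on S (\<lambda>a. qform (F a) x)"
  unfolding qform_sum[OF assms(1,3)] by (intro continuous_intros assms(2)) auto

lemma continuous_on_Q_plus:
  fixes F :: "nat \<Rightarrow> 'a::topological_space \<Rightarrow> real mat"
  assumes Q: "Q \<in> carrier_mat n n" and B: "\<And>j. j < m \<Longrightarrow> B j \<in> carrier_mat (d j) n"
    and F: "\<And>j a. j < m \<Longrightarrow> F j a \<in> carrier_mat (d j) (d j)"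
      "\<And>j r s. j < m \<Longrightarrow> r < d j \<Longrightarrow> s < d j \<Longrightarrow> continuous_on S (\<lambda>a. F j a $$ (r, s))"
    and rs: "r < n" "s < n"
  shows "continuous_on S (\<lambda>a. Q_plus n m B c Q (\<lambda>j. F j a) $$ (r, s))"
proof -
  have "(c j \<cdot>\<^sub>m (transpose_mat (B j) * F j a * B j)) $$ (r, s) =
    c j * (\<Sum>p = 0..<d j. B j $$ (p, r) * (\<Sum>q = 0..<d j. F j a $$ (p, q) * B j $$ (q, s)))" if j: "j < m" for j a
    using rs B[OF j] F(1)[OF j, of a] by (auto simp: scalar_prod_def intro!: sum.cong)
  then have "Q_plus n m B c Q (\<lambda>j. F j a) $$ (r, s) = Q $$ (r, s) +
     (\<Sum>j<m. c j * (\<Sum>p = 0..<d j. B j $$ (p, r) * (\<Sum>q = 0..<d j. F j a $$ (p, q) * B j $$ (q, s))))" for a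
    using rs Q by (simp add: Q_plus_def)
  moreover have "continuous_on S (\<lambda>a. Q $$ (r, s) +
     (\<Sum>j<m. c j * (\<Sum>p = 0..<d j. B j $$ (p, r) * (\<Sum>q = 0..<d j. F j a $$ (p, q) * B j $$ (q, s)))))"
    by (intro continuous_intros F(2)) auto
  ultimately show ?thesis by simp
qed

text \<open>Testing with e_r + e_s and e_r - e_s bounds twice the entry by the two diagonal entries
  of A, which lie below those of \<open>G\<close>.\<close>

lemma psd_entry_bound:
  assumes A: "A \<in> self_adjoint n" and nn: "\<And>x. x \<in> carrier_vec n \<Longrightarrow> 0 \<le> qform A x"
    and le: "\<And>x. x \<in> carrier_vec n \<Longrightarrow> qform A x \<le> qform G x" and G: "G \<in> carrier_mat n n"
    and rs: "r < n" "s < n"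
  shows "\<bar>A $$ (r, s)\<bar> \<le> \<bar>G $$ (r, r)\<bar> + \<bar>G $$ (s, s)\<bar>"
proof -
  note Ac = self_adjointD[OF A]
  have e: "qform C (unit_vec n i) = C $$ (i, i)" if "i < n" "C \<in> carrier_mat n n" for C i
  proof -
    have "qform C (unit_vec n i) = (\<Sum>p<n. \<Sum>q<n. if p = i then (if q = i then C $$ (i, i) else 0) else 0)"
      unfolding qform_sum[OF that(2) unit_vec_carrier] using that by (intro sum.cong) (auto simp: unit_vec_def)
    also have "\<dots> = (\<Sum>p<n. if p = i then C $$ (i, i) else 0)" using that by (intro sum.cong) auto
    finally show ?thesis using that by simp
  qed
  have A_d: "A $$ (i, i) \<le> \<bar>G $$ (i, i)\<bar>" if "i < n" for i
    using le[of "unit_vec n i"] e[OF that G] e[OF that Ac(1)] by simp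
  have cross: "unit_vec n r \<bullet> (A *\<^sub>v unit_vec n s) = A $$ (r, s)"
    using rs Ac(1) by (subst scalar_prod_left_unit[of _ n]) auto
  have "0 \<le> A $$ (r, r) + A $$ (s, s) + 2 * A $$ (r, s)"
    using nn[of "unit_vec n r + unit_vec n s"] qform_add[OF A, of "unit_vec n r" "unit_vec n s"] cross e rs Ac(1) by simp
  moreover have "0 \<le> A $$ (r, r) + A $$ (s, s) - 2 * A $$ (r, s)"
    using nn[of "unit_vec n r + (-1) \<cdot>\<^sub>v unit_vec n s"] qform_add[OF A, of "unit_vec n r" "(-1) \<cdot>\<^sub>v unit_vec n s"]
      cross e rs Ac(1) qform_smult[OF Ac(1), of "unit_vec n s" "-1"] mult_mat_vec[OF Ac(1), of "unit_vec n s" "-1"]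
      mult_mat_vec_carrier[OF Ac(1), of "unit_vec n s"]
    by (simp add: scalar_prod_smult_right)
  ultimately have "2 * \<bar>A $$ (r, s)\<bar> \<le> A $$ (r, r) + A $$ (s, s)" by linarith
  then show ?thesis using A_d[OF rs(1)] A_d[OF rs(2)] by linarith
qed

text \<open>Every term of the functional is bounded below on the feasible set: det A_j >=
  \<kappa>^(d_j) for c_j > 0, det A_j <= det G_j for c_j < 0, and M <= \<open>Mp\<close>. On a
  sublevel set each term is therefore bounded above as well, which keeps det A_j for c_j < 0 and det
  M away from 0, and the sublevel set embeds in a compact set of feasible points.\<close>

lemma log_det_minimizer_exists:
  assumes Q: "Q \<in> self_adjoint n" and B: "\<And>j. j < m \<Longrightarrow> B j \<in> carrier_mat (d j) n"
    and G: "\<And>j. j < m \<Longrightarrow> G j \<in> positive_definite (d j)"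
    and mp: "mp \<le> m" and cp: "\<And>j. j < mp \<Longrightarrow> c j > 0" and cn: "\<And>j. mp \<le> j \<Longrightarrow> j < m \<Longrightarrow> c j < 0"
    and \<kappa>: "\<kappa> > 0"
    and coercive: "\<And>A j y. feasible n m d B c Q G A \<Longrightarrow> j < mp \<Longrightarrow> y \<in> carrier_vec (d j) \<Longrightarrow> \<kappa> * (y \<bullet> y) \<le> qform (A j) y"
    and A0: "feasible n m d B c Q G A0"
  shows "\<exists>A. feasible n m d B c Q G A \<and>
    (\<forall>A'. feasible n m d B c Q G A' \<longrightarrow> log_det_functional n m B c Q A \<le> log_det_functional n m B c Q A')"
proof -
  note Qc = self_adjointD[OF Q] and Gc = positive_definiteD[OF G]
  define \<Psi> where "\<Psi> = log_det_functional n m B c Q"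
  define M where "M = Q_plus n m B c Q"
  define Mp where "Mp = Q_plus n mp B c Q G"
  have fD: "A j \<in> positive_definite (d j)" "A j \<in> self_adjoint (d j)" "A j \<in> carrier_mat (d j) (d j)" "loewner_le (d j) (A j) (G j)"
    "Determinant.det (A j) \<le> Determinant.det (G j)" "Determinant.det (A j) > 0"
    if "feasible n m d B c Q G A" "j < m" for A j
  proof -
    show *: "A j \<in> positive_definite (d j)" and **: "loewner_le (d j) (A j) (G j)" using that by (auto simp: feasible_def)
    show "A j \<in> self_adjoint (d j)" "A j \<in> carrier_mat (d j) (d j)" using positive_definiteD[OF *] by auto
    show "Determinant.det (A j) \<le> Determinant.det (G j)" using det_mono_loewner(2)[OF * Gc(3) **] that by simp
    show "Determinant.det (A j) > 0" using positive_definite_det_pos[OF *] .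
  qed
  have fM: "M A \<in> positive_definite n" "Determinant.det (M A) > 0" "Determinant.det (M A) \<le> Determinant.det Mp"
    if A: "feasible n m d B c Q G A" for A
  proof -
    show *: "M A \<in> positive_definite n" using A by (simp add: feasible_def M_def)
    show "Determinant.det (M A) > 0" using positive_definite_det_pos[OF *] .
    have "loewner_le n (M A) Mp"
      unfolding loewner_le_def
    proof
      fix x :: "real vec" assume x: "x \<in> carrier_vec n"
      have Bx: "B j *\<^sub>v x \<in> carrier_vec (d j)" if "j < m" for j using mult_mat_vec_carrier[OF B[OF that] x] .
      have "qform (M A) x = qform Q x + (\<Sum>j<m. c j * qform (A j) (B j *\<^sub>v x))"
        unfolding M_def using Qc(1) B fD(3)[OF A] x by (intro qform_Q_plus[where d = d]) auto
      also have "(\<Sum>j<m. c j * qform (A j) (B j *\<^sub>v x)) = (\<Sum>j<mp. c j * qform (A j) (B j *\<^sub>v x)) + (\<Sum>j=mp..<m. c j * qform (A j) (B j *\<^sub>v x))"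
        using mp by (simp add: lessThan_atLeast0 sum.atLeastLessThan_concat)
      also have "\<dots> \<le> (\<Sum>j<mp. c j * qform (G j) (B j *\<^sub>v x)) + 0"
        using mp cp cn fD(4)[OF A] Bx positive_definiteD(5)[OF fD(1)[OF A]]
        by (intro add_mono sum_mono sum_nonpos)
           (auto simp: loewner_le_def less_imp_le mult_left_mono intro!: mult_nonpos_nonneg)
      also have "qform Q x + ((\<Sum>j<mp. c j * qform (G j) (B j *\<^sub>v x)) + 0) = qform Mp x"
        unfolding Mp_def using Qc(1) B Gc(1) x mp by (subst qform_Q_plus[where d = d]) auto
      finally show "qform (M A) x \<le> qform Mp x" by simp
    qed
    moreover have "Mp \<in> self_adjoint n" unfolding Mp_def using Q B Gc(3) mp by (intro Q_plus_self_adjoint[where d = d]) auto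
    ultimately show "Determinant.det (M A) \<le> Determinant.det Mp" using det_mono_loewner(2)[OF *] by blast
  qed
  have Mp_pos: "Determinant.det Mp > 0" using fM(2,3)[OF A0] by simp
  define lo where "lo j = (if j < mp then c j * ln (\<kappa> ^ d j) else c j * ln (Determinant.det (G j)))" for j
  define loM where "loM = - ln (Determinant.det Mp)"
  have lo: "lo j \<le> c j * ln (Determinant.det (A j))" if A: "feasible n m d B c Q G A" and j: "j < m" for A j
  proof (cases "j < mp")
    case True
    have "\<kappa> ^ d j \<le> Determinant.det (A j)"
      using coercive[OF A True] by (intro det_lower_bound[OF fD(1)[OF A j] \<kappa>])
    then show ?thesis using True cp[OF True] \<kappa> fD(6)[OF A j] by (simp add: lo_def del: ln_realpow)
  next
    case False
    then show ?thesis using cn[of j] j fD(5,6)[OF A j] by (simp add: lo_def mult_left_mono_neg)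
  qed
  have loM: "loM \<le> - ln (Determinant.det (M A))" if A: "feasible n m d B c Q G A" for A
    using fM(2,3)[OF A] by (simp add: loM_def)
  \<comment> \<open>The excess of the value at \<open>A0\<close> over the sum of all lower bounds:
    on the sublevel set no single term can exceed its own lower bound by more than e.\<close>
  define e where "e = \<Psi> A0 - (\<Sum>j<m. lo j) - loM"
  have upj: "c j * ln (Determinant.det (A j)) \<le> lo j + e"
    if A: "feasible n m d B c Q G A" and le: "\<Psi> A \<le> \<Psi> A0" and j: "j < m" for A j
  proof -
    have "(\<Sum>i\<in>{..<m} - {j}. lo i) \<le> (\<Sum>i\<in>{..<m} - {j}. c i * ln (Determinant.det (A i)))"
      using lo[OF A] by (intro sum_mono) auto
    then show ?thesis
      using le loM[OF A] j sum.remove[of "{..<m}" j lo] sum.remove[of "{..<m}" j "\<lambda>i. c i * ln (Determinant.det (A i))"]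
      by (simp add: e_def \<Psi>_def log_det_functional_def M_def)
  qed
  have upM: "- ln (Determinant.det (M A)) \<le> loM + e"
    if A: "feasible n m d B c Q G A" and le: "\<Psi> A \<le> \<Psi> A0" for A
  proof -
    have "(\<Sum>i<m. lo i) \<le> (\<Sum>i<m. c i * ln (Determinant.det (A i)))"
      using lo[OF A] by (intro sum_mono) auto
    then show ?thesis using le by (simp add: e_def \<Psi>_def log_det_functional_def M_def)
  qed
  \<comment> \<open>For c_j < 0, division by c_j turns the upper bound on c_j log det A_j into a
    lower bound on det A_j.\<close>
  define \<eta> where "\<eta> j = (if j < mp then \<kappa> ^ d j else exp ((lo j + e) / c j))" for j
  define \<eta>M where "\<eta>M = exp (- (loM + e))"
  have \<eta>_pos: "\<eta> j > 0" for j using \<kappa> by (simp add: \<eta>_def)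
  define mt where "mt j a = mat (d j) (d j) (\<lambda>(r, s). a (j, r, s))" for j and a :: "nat \<times> nat \<times> nat \<Rightarrow> real"
  have mtc: "mt j a \<in> carrier_mat (d j) (d j)" for j a by (simp add: mt_def)
  \<comment> \<open>Coordinates outside the index range are pinned to 0, since compactness of the
    product requires a bound on every coordinate.\<close>
  define bnd where "bnd p = (case p of (j, r, s) \<Rightarrow> if j < m \<and> r < d j \<and> s < d j then \<bar>G j $$ (r, r)\<bar> + \<bar>G j $$ (s, s)\<bar> else 0)" for p
  \<comment> \<open>Only closed conditions occur here; strict positivity on K is recovered from the
    two determinant bounds.\<close>
  define C where "C = {a. (\<forall>j. j < m \<longrightarrow> (\<forall>r s. r < d j \<and> s < d j \<longrightarrow> a (j, r, s) = a (j, s, r)) \<and>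
      (\<forall>x. x \<in> carrier_vec (d j) \<longrightarrow> 0 \<le> qform (mt j a) x \<and> qform (mt j a) x \<le> qform (G j) x) \<and> \<eta> j \<le> Determinant.det (mt j a)) \<and>
      (\<forall>x. x \<in> carrier_vec n \<longrightarrow> 0 \<le> qform (M (\<lambda>j. mt j a)) x) \<and> \<eta>M \<le> Determinant.det (M (\<lambda>j. mt j a))}"
  define K where "K = {a. \<forall>p. \<bar>a p\<bar> \<le> bnd p} \<inter> C"
  have coord: "continuous_on UNIV (\<lambda>a :: nat \<times> nat \<times> nat \<Rightarrow> real. a p)" for p
    by (rule continuous_on_product_coordinates)
  have cmt: "continuous_on UNIV (\<lambda>a. mt j a $$ (r, s))" if "r < d j" "s < d j" for j r s
    using coord that by (simp add: mt_def)
  have Mc: "M (\<lambda>j. mt j a) \<in> carrier_mat n n" for a using Qc(1) by (simp add: M_def Q_plus_def)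
  have cM: "continuous_on UNIV (\<lambda>a. M (\<lambda>j. mt j a) $$ (r, s))" if "r < n" "s < n" for r s
    unfolding M_def using Qc(1) B mtc cmt that by (intro continuous_on_Q_plus[where d = d]) auto
  have cdet: "continuous_on UNIV (\<lambda>a. Determinant.det (mt j a))" for j
    using cmt by (intro continuous_on_det[OF mtc]) auto
  have cdetM: "continuous_on UNIV (\<lambda>a. Determinant.det (M (\<lambda>j. mt j a)))"
    using cM by (intro continuous_on_det[OF Mc]) auto
  have cq: "continuous_on UNIV (\<lambda>a. qform (mt j a) x)" if "x \<in> carrier_vec (d j)" for j x
    using cmt that by (intro continuous_on_qform[OF mtc]) auto
  have cqM: "continuous_on UNIV (\<lambda>a. qform (M (\<lambda>j. mt j a)) x)" if "x \<in> carrier_vec n" for x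
    using cM that by (intro continuous_on_qform[OF Mc]) auto
  have "closed C"
    unfolding C_def using coord cdet cdetM cq cqM
    by (intro closed_Collect_conj closed_Collect_all closed_Collect_imp_const closed_Collect_le closed_Collect_eq
        continuous_on_const) auto
  then have "compact K" unfolding K_def by (intro compact_Int_closed compact_function_box)
  have K_feasible: "feasible n m d B c Q G (\<lambda>j. mt j a)" and K_det: "\<And>j. j < m \<Longrightarrow> Determinant.det (mt j a) > 0"
    "Determinant.det (M (\<lambda>j. mt j a)) > 0" if a: "a \<in> K" for a
  proof -
    have aC: "a \<in> C" using a by (simp add: K_def)
    have sa: "mt j a \<in> self_adjoint (d j)" if "j < m" for j
      using aC that by (auto simp: self_adjoint_def mt_def C_def intro!: eq_matI)
    show dj: "Determinant.det (mt j a) > 0" if "j < m" for j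
      using aC that \<eta>_pos[of j] unfolding C_def by force
    show dM: "Determinant.det (M (\<lambda>j. mt j a)) > 0"
      using aC unfolding C_def \<eta>M_def by (auto intro: less_le_trans[OF exp_gt_zero])
    have "mt j a \<in> positive_definite (d j)" if "j < m" for j
      using aC that dj[OF that] unfolding C_def by (intro nonneg_form_positive_definite[OF sa]) auto
    moreover have "loewner_le (d j) (mt j a) (G j)" if "j < m" for j
      using aC that unfolding C_def loewner_le_def by auto
    moreover have "M (\<lambda>j. mt j a) \<in> self_adjoint n"
      unfolding M_def using Q B sa by (intro Q_plus_self_adjoint[where d = d]) auto
    then have "M (\<lambda>j. mt j a) \<in> positive_definite n"
      using aC dM unfolding C_def by (intro nonneg_form_positive_definite) auto
    ultimately show "feasible n m d B c Q G (\<lambda>j. mt j a)" by (simp add: feasible_def M_def)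
  qed
  have enc: "\<exists>a\<in>K. \<Psi> (\<lambda>j. mt j a) = \<Psi> A" if A: "feasible n m d B c Q G A" and le: "\<Psi> A \<le> \<Psi> A0" for A
  proof -
    define a where "a p = (case p of (j, r, s) \<Rightarrow> if j < m \<and> r < d j \<and> s < d j then A j $$ (r, s) else 0)" for p
    have mtA: "mt j a = A j" if "j < m" for j
      using fD(3)[OF A that] that by (intro eq_matI) (auto simp: mt_def a_def)
    have MA: "M (\<lambda>j. mt j a) = M A" unfolding M_def Q_plus_def by (simp add: mtA cong: sum.cong_simp)
    have "\<bar>a p\<bar> \<le> bnd p" for p
    proof (cases p)
      case (fields j r s)
      then show ?thesis
        using psd_entry_bound[OF fD(2)[OF A] positive_definiteD(5)[OF fD(1)[OF A]], of j "G j" r s] fD(4)[OF A, of j] Gc(1)[of j]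
        by (auto simp: a_def bnd_def loewner_le_def)
    qed
    moreover have "\<eta> j \<le> Determinant.det (A j)" if j: "j < m" for j
    proof (cases "j < mp")
      case True
      then show ?thesis using coercive[OF A True] det_lower_bound[OF fD(1)[OF A j] \<kappa>] by (simp add: \<eta>_def)
    next
      case False
      then have "(lo j + e) / c j \<le> ln (Determinant.det (A j))"
        using upj[OF A le j] cn[of j] j by (simp add: divide_le_eq mult.commute)
      then show ?thesis using False fD(6)[OF A j] by (simp add: \<eta>_def ln_ge_iff)
    qed
    moreover have "\<eta>M \<le> Determinant.det (M A)"
    proof -
      have "- (loM + e) \<le> ln (Determinant.det (M A))" using upM[OF A le] by simp
      then show ?thesis using fM(2)[OF A] by (simp add: \<eta>M_def ln_ge_iff)
    qed
    moreover have "a (j, r, s) = a (j, s, r)" if "j < m" "r < d j" "s < d j" for j r s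
      using self_adjoint_index[OF fD(2)[OF A that(1)] that(2,3)] that by (simp add: a_def)
    ultimately have "a \<in> K"
      using fD(4)[OF A] positive_definiteD(5)[OF fD(1)[OF A]] positive_definiteD(5)[OF fM(1)[OF A]]
      unfolding K_def C_def by (auto simp: mtA MA loewner_le_def)
    moreover have "\<Psi> (\<lambda>j. mt j a) = \<Psi> A"
      using MA by (simp add: \<Psi>_def log_det_functional_def M_def mtA cong: sum.cong_simp)
    ultimately show ?thesis by blast
  qed
  have cont: "continuous_on K (\<lambda>a. \<Psi> (\<lambda>j. mt j a))"
    unfolding \<Psi>_def log_det_functional_def M_def[symmetric]
    using K_det cdet cdetM by (intro continuous_intros continuous_on_subset[OF cdet] continuous_on_subset[OF cdetM]) force+
  obtain a0 where a0: "a0 \<in> K" "\<Psi> (\<lambda>j. mt j a0) = \<Psi> A0" using enc[OF A0] by auto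
  obtain a where a: "a \<in> K" "\<And>b. b \<in> K \<Longrightarrow> \<Psi> (\<lambda>j. mt j a) \<le> \<Psi> (\<lambda>j. mt j b)"
    using continuous_attains_inf[OF \<open>compact K\<close> _ cont] a0 by blast
  have "\<Psi> (\<lambda>j. mt j a) \<le> \<Psi> A'" if A': "feasible n m d B c Q G A'" for A'
  proof (cases "\<Psi> A' \<le> \<Psi> A0")
    case True
    then show ?thesis using enc[OF A' True] a(2) by metis
  next
    case False
    then show ?thesis using a(2)[OF a0(1)] a0(2) by simp
  qed
  then show ?thesis using K_feasible[OF a(1)] unfolding \<Psi>_def by blast
qed

section \<open>Integration on coordinate spaces\<close>

lemma measurable_into_borel_vec:
  assumes "\<And>x. x \<in> space N \<Longrightarrow> g x \<in> carrier_vec k"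
    and "\<And>i. i < k \<Longrightarrow> (\<lambda>x. g x $ i) \<in> borel_measurable N"
  shows "g \<in> measurable N (borel_vec k)"
  unfolding borel_vec_def
proof (rule measurable_vimage_algebra2)
  show "g \<in> space N \<rightarrow> carrier_vec k" using assms(1) by auto
  show "(\<lambda>x. \<lambda>i\<in>{..<k}. g x $ i) \<in> measurable N (\<Pi>\<^sub>M i\<in>{..<k}. borel)"
    by (rule measurable_restrict) (use assms(2) in auto)
qed

lemma measurable_vec_index' [measurable (raw)]:
  assumes "g \<in> measurable N (borel_vec k)" "i < k"
  shows "(\<lambda>x. g x $ i) \<in> borel_measurable N"
  using measurable_compose[OF assms(1) measurable_vec_index[OF assms(2)]] .

lemma measurable_space_vec: "g \<in> measurable N (borel_vec k) \<Longrightarrow> x \<in> space N \<Longrightarrow> g x \<in> carrier_vec k"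
  using measurable_space[of g N "borel_vec k"] by simp

lemma measurable_qform:
  assumes A: "A \<in> carrier_mat k k" and g: "g \<in> measurable N (borel_vec k)"
  shows "(\<lambda>x. qform A (g x)) \<in> borel_measurable N"
proof -
  have "(\<lambda>x. \<Sum>r<k. \<Sum>s<k. A $$ (r, s) * g x $ r * g x $ s) \<in> borel_measurable N"
    using measurable_vec_index'[OF g]
    by (intro borel_measurable_sum borel_measurable_times borel_measurable_const) auto
  then show ?thesis
    by (rule measurable_cong[THEN iffD1, rotated]) (simp add: qform_sum[OF A measurable_space_vec[OF g]])
qed

lemma measurable_scalar_prod:
  assumes "f \<in> measurable N (borel_vec k)" "g \<in> measurable N (borel_vec k)"
  shows "(\<lambda>x. f x \<bullet> g x) \<in> borel_measurable N"
proof -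
  have "(\<lambda>x. \<Sum>r<k. f x $ r * g x $ r) \<in> borel_measurable N"
    using measurable_vec_index'[OF assms(1)] measurable_vec_index'[OF assms(2)]
    by (intro borel_measurable_sum borel_measurable_times) auto
  then show ?thesis
    by (rule measurable_cong[THEN iffD1, rotated])
       (use carrier_vecD[OF measurable_space_vec[OF assms(2)]] in \<open>auto simp: scalar_prod_def lessThan_atLeast0\<close>)
qed

lemma measurable_mult_mat_vec:
  assumes B: "B \<in> carrier_mat k n" and g: "g \<in> measurable N (borel_vec n)"
  shows "(\<lambda>x. B *\<^sub>v g x) \<in> measurable N (borel_vec k)"
proof (rule measurable_into_borel_vec)
  fix x assume "x \<in> space N"
  then show "B *\<^sub>v g x \<in> carrier_vec k" using mult_mat_vec_carrier[OF B measurable_space_vec[OF g]] by simp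
next
  fix i assume i: "i < k"
  have "(\<lambda>x. row B i \<bullet> g x) \<in> borel_measurable N"
    using B i by (intro measurable_scalar_prod[OF _ g] measurable_const) auto
  then show "(\<lambda>x. (B *\<^sub>v g x) $ i) \<in> borel_measurable N" using B i by simp
qed

lemma measurable_vec_add:
  assumes f: "f \<in> measurable N (borel_vec k)" and g: "g \<in> measurable N (borel_vec k)"
  shows "(\<lambda>x. f x + g x) \<in> measurable N (borel_vec k)"
proof (rule measurable_into_borel_vec)
  fix i assume i: "i < k"
  have "(\<lambda>x. f x $ i + g x $ i) \<in> borel_measurable N"
    using measurable_vec_index'[OF f i] measurable_vec_index'[OF g i] by simp
  then show "(\<lambda>x. (f x + g x) $ i) \<in> borel_measurable N"
    by (rule measurable_cong[THEN iffD1, rotated]) (use carrier_vecD[OF measurable_space_vec[OF g]] i in auto)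
qed (use measurable_space_vec[OF f] measurable_space_vec[OF g] in auto)

lemma measurable_vec_diff:
  assumes f: "f \<in> measurable N (borel_vec k)" and g: "g \<in> measurable N (borel_vec k)"
  shows "(\<lambda>x. f x - g x) \<in> measurable N (borel_vec k)"
proof (rule measurable_into_borel_vec)
  fix i assume i: "i < k"
  have "(\<lambda>x. f x $ i - g x $ i) \<in> borel_measurable N"
    using measurable_vec_index'[OF f i] measurable_vec_index'[OF g i] by simp
  then show "(\<lambda>x. (f x - g x) $ i) \<in> borel_measurable N"
    by (rule measurable_cong[THEN iffD1, rotated]) (use carrier_vecD[OF measurable_space_vec[OF g]] i in auto)
qed (use measurable_space_vec[OF f] measurable_space_vec[OF g] in auto)

lemma nn_integral_lborel_vec:
  assumes "f \<in> borel_measurable (borel_vec k)"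
  shows "(\<integral>\<^sup>+x. f x \<partial>lborel_vec k) = (\<integral>\<^sup>+y. f (vec k y) \<partial>(\<Pi>\<^sub>M i\<in>{..<k}. lborel))"
  unfolding lborel_vec_def using assms by (intro nn_integral_distr) auto

lemma nn_integral_lborel_vec_Suc:
  assumes f: "f \<in> borel_measurable (borel_vec (Suc k))"
  shows "(\<integral>\<^sup>+x. f x \<partial>lborel_vec (Suc k)) =
    (\<integral>\<^sup>+y. (\<integral>\<^sup>+t. f (vec (Suc k) (\<lambda>i. if i < k then y $ i else t)) \<partial>lborel) \<partial>lborel_vec k)"
proof -
  interpret product_sigma_finite "\<lambda>i::nat. lborel :: real measure" ..
  have eq: "{..<Suc k} = insert k {..<k}" by auto
  have [measurable]: "(\<lambda>x. f (vec (Suc k) x)) \<in> borel_measurable (\<Pi>\<^sub>M i\<in>{..<Suc k}. lborel)"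
    using measurable_compose[OF measurable_vec f] .
  have "(\<integral>\<^sup>+x. f x \<partial>lborel_vec (Suc k)) = (\<integral>\<^sup>+y. f (vec (Suc k) y) \<partial>(\<Pi>\<^sub>M i\<in>insert k {..<k}. lborel))"
    using nn_integral_lborel_vec[OF f] by (simp add: eq)
  also have "\<dots> = (\<integral>\<^sup>+y. (\<integral>\<^sup>+t. f (vec (Suc k) (y(k := t))) \<partial>lborel) \<partial>(\<Pi>\<^sub>M i\<in>{..<k}. lborel))"
    by (rule product_nn_integral_insert) (auto simp: eq[symmetric])
  also have "\<dots> = (\<integral>\<^sup>+y. (\<integral>\<^sup>+t. f (vec (Suc k) (\<lambda>i. if i < k then vec k y $ i else t)) \<partial>lborel) \<partial>(\<Pi>\<^sub>M i\<in>{..<k}. lborel))"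
  proof -
    have "vec (Suc k) (y(k := t)) = vec (Suc k) (\<lambda>i. if i < k then vec k y $ i else t)" for y and t :: real
      by (rule eq_vecI) auto
    then show ?thesis by (simp only:)
  qed
  also have "\<dots> = (\<integral>\<^sup>+y. (\<integral>\<^sup>+t. f (vec (Suc k) (\<lambda>i. if i < k then y $ i else t)) \<partial>lborel) \<partial>lborel_vec k)"
  proof (rule nn_integral_lborel_vec[symmetric])
    have "(\<lambda>(y, t). vec (Suc k) (\<lambda>i. if i < k then y $ i else t)) \<in> measurable (borel_vec k \<Otimes>\<^sub>M lborel) (borel_vec (Suc k))"
    proof (rule measurable_into_borel_vec)
      fix i assume "i < Suc k"
      then show "(\<lambda>x. (case x of (y, t) \<Rightarrow> vec (Suc k) (\<lambda>i. if i < k then y $ i else t)) $ i) \<in> borel_measurable (borel_vec k \<Otimes>\<^sub>M lborel)"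
        by (cases "i < k") (auto simp: case_prod_beta' intro!: measurable_vec_index' measurable_fst)
    qed auto
    from measurable_compose[OF this f]
    have "(\<lambda>(y, t). f (vec (Suc k) (\<lambda>i. if i < k then y $ i else t))) \<in> borel_measurable (borel_vec k \<Otimes>\<^sub>M lborel)"
      by (simp add: case_prod_beta')
    then show "(\<lambda>y. \<integral>\<^sup>+t. f (vec (Suc k) (\<lambda>i. if i < k then y $ i else t)) \<partial>lborel) \<in> borel_measurable (borel_vec k)"
      by (rule lborel.borel_measurable_nn_integral)
  qed
  finally show ?thesis .
qed

lemma nn_integral_lborel_vec_0:
  assumes f: "f \<in> borel_measurable (borel_vec 0)"
  shows "(\<integral>\<^sup>+x. f x \<partial>lborel_vec 0) = f (0\<^sub>v 0)"
proof -
  interpret product_sigma_finite "\<lambda>i::nat. lborel :: real measure" ..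
  have "(\<integral>\<^sup>+x. f x \<partial>lborel_vec 0) = (\<integral>\<^sup>+y. f (vec 0 y) \<partial>(\<Pi>\<^sub>M i\<in>{}. lborel))"
    using nn_integral_lborel_vec[OF f] by simp
  also have "\<dots> = f (vec 0 (\<lambda>_. undefined))" by (rule nn_integral_empty) simp
  also have "vec 0 (\<lambda>_. undefined) = (0\<^sub>v 0 :: real vec)" by (rule eq_vecI) auto
  finally show ?thesis .
qed

lemma nn_integral_lborel_vec_translate:
  assumes f: "f \<in> borel_measurable (borel_vec k)" and a: "a \<in> carrier_vec k"
  shows "(\<integral>\<^sup>+x. f (x + a) \<partial>lborel_vec k) = (\<integral>\<^sup>+x. f x \<partial>lborel_vec k)"
proof -
  interpret product_sigma_finite "\<lambda>i::nat. lborel :: real measure" ..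
  define T where "T = (\<lambda>y. \<lambda>i\<in>{..<k}. y i + a $ i)"
  have T [measurable]: "T \<in> measurable (\<Pi>\<^sub>M i\<in>{..<k}. lborel) (\<Pi>\<^sub>M i\<in>{..<k}. lborel)"
    unfolding T_def by (intro measurable_restrict) simp
  have "distr (\<Pi>\<^sub>M i\<in>{..<k}. lborel) (\<Pi>\<^sub>M i\<in>{..<k}. lborel) T = (\<Pi>\<^sub>M i\<in>{..<k}. lborel :: real measure)"
  proof (rule PiM_eqI)
    fix A :: "nat \<Rightarrow> real set" assume A: "\<And>i. i \<in> {..<k} \<Longrightarrow> A i \<in> sets lborel"
    have "T -` (Pi\<^sub>E {..<k} A) \<inter> space (\<Pi>\<^sub>M i\<in>{..<k}. lborel) = Pi\<^sub>E {..<k} (\<lambda>i. (\<lambda>t. t + a $ i) -` A i)"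
      by (auto simp: T_def space_PiM PiE_def Pi_def)
    moreover have "(\<lambda>t. t + a $ i) -` A i \<in> sets lborel" if "i < k" for i
    proof -
      have "(\<lambda>t. t + a $ i) \<in> borel_measurable borel" by simp
      from measurable_sets[OF this, of "A i"] show ?thesis using A[of i] that by simp
    qed
    moreover have "emeasure lborel ((\<lambda>t. t + a $ i) -` A i) = emeasure lborel (A i)" if "i < k" for i
    proof -
      have "emeasure lborel (A i) = emeasure (distr lborel borel (\<lambda>t. a $ i + t)) (A i)" by (simp add: lborel_distr_plus)
      also have "\<dots> = emeasure lborel ((\<lambda>t. a $ i + t) -` A i)" using A[of i] that by (subst emeasure_distr) auto
      finally show ?thesis by (simp add: add.commute)
    qed
    moreover have "emeasure (\<Pi>\<^sub>M i\<in>{..<k}. lborel) (Pi\<^sub>E {..<k} (\<lambda>i. (\<lambda>t. t + a $ i) -` A i)) =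
        (\<Prod>i\<in>{..<k}. emeasure lborel ((\<lambda>t. t + a $ i) -` A i))"
      using calculation(2) by (intro emeasure_PiM) auto
    ultimately show "emeasure (distr (\<Pi>\<^sub>M i\<in>{..<k}. lborel) (\<Pi>\<^sub>M i\<in>{..<k}. lborel) T) (Pi\<^sub>E {..<k} A) = (\<Prod>i\<in>{..<k}. emeasure lborel (A i))"
      using A by (subst emeasure_distr) auto
  qed auto
  note dT = this
  have fx: "(\<lambda>x. f (x + a)) \<in> borel_measurable (borel_vec k)"
    using a by (intro measurable_compose[OF _ f] measurable_vec_add measurable_const) auto
  have fv: "(\<lambda>y. f (vec k y)) \<in> borel_measurable (\<Pi>\<^sub>M i\<in>{..<k}. lborel)"
    using measurable_compose[OF measurable_vec f] .
  have "vec k y + a = vec k (T y)" for y using a by (intro eq_vecI) (auto simp: T_def)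
  then have "(\<integral>\<^sup>+x. f (x + a) \<partial>lborel_vec k) = (\<integral>\<^sup>+y. f (vec k (T y)) \<partial>(\<Pi>\<^sub>M i\<in>{..<k}. lborel))"
    by (simp add: nn_integral_lborel_vec[OF fx])
  also have "\<dots> = (\<integral>\<^sup>+y. f (vec k y) \<partial>distr (\<Pi>\<^sub>M i\<in>{..<k}. lborel) (\<Pi>\<^sub>M i\<in>{..<k}. lborel) T)"
    by (rule nn_integral_distr[symmetric]) (use fv in auto)
  also have "\<dots> = (\<integral>\<^sup>+x. f x \<partial>lborel_vec k)" unfolding dT nn_integral_lborel_vec[OF f] ..
  finally show ?thesis .
qed

lemma distr_lborel_vec_translate:
  assumes a: "a \<in> carrier_vec k"
  shows "distr (lborel_vec k) (borel_vec k) (\<lambda>x. x + a) = lborel_vec k"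
proof (rule measure_eqI)
  fix X assume "X \<in> sets (distr (lborel_vec k) (borel_vec k) (\<lambda>x. x + a))"
  then have X: "X \<in> sets (borel_vec k)" by simp
  have t: "(\<lambda>x. x + a) \<in> measurable (lborel_vec k) (borel_vec k)"
    using a by (intro measurable_vec_add measurable_const) (auto intro: measurable_ident_sets)
  have "emeasure (distr (lborel_vec k) (borel_vec k) (\<lambda>x. x + a)) X = (\<integral>\<^sup>+x. indicator X x \<partial>distr (lborel_vec k) (borel_vec k) (\<lambda>x. x + a))"
    using X by simp
  also have "\<dots> = (\<integral>\<^sup>+x. indicator X (x + a) \<partial>lborel_vec k)"
    using X t by (intro nn_integral_distr) auto
  also have "\<dots> = (\<integral>\<^sup>+x. indicator X x \<partial>lborel_vec k)"
    using X a by (intro nn_integral_lborel_vec_translate) auto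
  finally show "emeasure (distr (lborel_vec k) (borel_vec k) (\<lambda>x. x + a)) X = emeasure (lborel_vec k) X" using X by simp
qed simp

text \<open>Exhaustion by boxes; it makes the exchange of integrals available when the mass of a
  convolution is computed.\<close>

lemma sigma_finite_lborel_vec: "sigma_finite_measure (lborel_vec k)"
proof
  define b where "b N = {v \<in> carrier_vec k. \<forall>i<k. - real N \<le> v $ i \<and> v $ i \<le> real N}" for N :: nat
  have m: "b N \<in> sets (lborel_vec k)" for N
  proof -
    have "{v \<in> space (borel_vec k). - real N \<le> v $ i \<and> v $ i \<le> real N} \<in> sets (borel_vec k)" if "i < k" for i
      using measurable_sets[OF measurable_vec_index[OF that], of "{- real N..real N}"]
      by (simp add: vimage_def Int_def conj_commute)
    then show ?thesis
      unfolding b_def sets_lborel_vec space_borel_vec[symmetric] lessThan_iff[symmetric] Ball_def[symmetric]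
      by (intro sets.sets_Collect_finite_All) auto
  qed
  have cover: "(\<Union>N. b N) = carrier_vec k"
  proof safe
    fix v :: "real vec" assume v: "v \<in> carrier_vec k"
    obtain N :: nat where N: "(\<Sum>i<k. \<bar>v $ i\<bar>) \<le> real N" using real_arch_simple by blast
    have "\<bar>v $ i\<bar> \<le> real N" if "i < k" for i
      using member_le_sum[of i "{..<k}" "\<lambda>i. \<bar>v $ i\<bar>"] that N by auto
    then show "v \<in> (\<Union>N. b N)" using v by (auto simp: b_def abs_le_iff intro!: exI[of _ N]) (smt (verit))
  qed (auto simp: b_def)
  have fin: "emeasure (lborel_vec k) (b N) \<noteq> \<infinity>" for N
    unfolding b_def by (subst emeasure_lborel_vec_box) auto
  show "\<exists>A. countable A \<and> A \<subseteq> sets (lborel_vec k) \<and> \<Union>A = space (lborel_vec k) \<and> (\<forall>a\<in>A. emeasure (lborel_vec k) a \<noteq> \<infinity>)"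
    using m cover fin by (intro exI[of _ "range b"]) auto
qed

section \<open>Gaussian integrals\<close>

lemma nn_integral_gaussian_1d:
  assumes a: "a > 0"
  shows "(\<integral>\<^sup>+t. ennreal (exp (- pi * (a * t\<^sup>2 + 2 * \<beta> * t + \<gamma>))) \<partial>lborel) =
    ennreal (exp (- pi * (\<gamma> - \<beta>\<^sup>2 / a)) / sqrt a)"
proof -
  \<comment> \<open>The standard deviation for which the normal density with mean -\<beta>/a is sqrt
    a * exp (-pi a (t + \<beta>/a)^2).\<close>
  define \<sigma> where "\<sigma> = sqrt (1 / (2 * pi * a))"
  have \<sigma>: "\<sigma> > 0" "\<sigma>\<^sup>2 = 1 / (2 * pi * a)" using a by (auto simp: \<sigma>_def)
  have dens: "sqrt a * exp (- pi * (a * (t + \<beta> / a)\<^sup>2)) = normal_density (- \<beta> / a) \<sigma> t" for t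
  proof -
    have "sqrt (2 * pi * \<sigma>\<^sup>2) = 1 / sqrt a" unfolding \<sigma>(2) using a by (simp add: real_sqrt_divide)
    moreover have "(t - - \<beta> / a)\<^sup>2 / (2 * \<sigma>\<^sup>2) = pi * (a * (t + \<beta> / a)\<^sup>2)" unfolding \<sigma>(2) using a by simp
    ultimately show ?thesis by (simp add: normal_density_def)
  qed
  have one: "(\<integral>\<^sup>+t. ennreal (normal_density (- \<beta> / a) \<sigma> t) \<partial>lborel) = 1"
  proof -
    interpret prob_space "density lborel (normal_density (- \<beta> / a) \<sigma>)"
      using prob_space_normal_density[OF \<sigma>(1)] .
    show ?thesis using emeasure_space_1 by (simp add: emeasure_density)
  qed
  have "a * t\<^sup>2 + 2 * \<beta> * t + \<gamma> = (\<gamma> - \<beta>\<^sup>2 / a) + a * (t + \<beta> / a)\<^sup>2" for t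
    using a by (simp add: power2_eq_square field_simps)
  then have "exp (- pi * (a * t\<^sup>2 + 2 * \<beta> * t + \<gamma>)) =
      exp (- pi * (\<gamma> - \<beta>\<^sup>2 / a)) / sqrt a * normal_density (- \<beta> / a) \<sigma> t" for t
    using a unfolding dens[symmetric] by (simp only: distrib_left exp_add) simp
  then have "(\<integral>\<^sup>+t. ennreal (exp (- pi * (a * t\<^sup>2 + 2 * \<beta> * t + \<gamma>))) \<partial>lborel) =
      (\<integral>\<^sup>+t. ennreal (exp (- pi * (\<gamma> - \<beta>\<^sup>2 / a)) / sqrt a) * ennreal (normal_density (- \<beta> / a) \<sigma> t) \<partial>lborel)"
    using a by (simp add: ennreal_mult[symmetric])
  also have "\<dots> = ennreal (exp (- pi * (\<gamma> - \<beta>\<^sup>2 / a)) / sqrt a)"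
    using one by (subst nn_integral_cmult) auto
  finally show ?thesis .
qed

lemma measurable_qform_self [measurable]:
  "A \<in> carrier_mat k k \<Longrightarrow> qform A \<in> borel_measurable (borel_vec k)"
  using measurable_qform[OF _ measurable_ident_sets[OF refl]] by simp

text \<open>Integrating out the last coordinate completes a square and leaves the Schur complement
  \<open>S\<close>; the determinant factors accordingly as a * det S.\<close>

lemma nn_integral_gaussian_qform:
  "A \<in> positive_definite k \<Longrightarrow>
    (\<integral>\<^sup>+x. ennreal (exp (- pi * qform A x)) \<partial>lborel_vec k) = ennreal (1 / sqrt (Determinant.det A))"
proof (induction k arbitrary: A)
  case 0
  have A: "A \<in> carrier_mat 0 0" using positive_definiteD(1)[OF 0] .
  have "(\<lambda>x. ennreal (exp (- pi * qform A x))) \<in> borel_measurable (borel_vec 0)"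
    using A by measurable
  then have "(\<integral>\<^sup>+x. ennreal (exp (- pi * qform A x)) \<partial>lborel_vec 0) = ennreal (exp (- pi * qform A (0\<^sub>v 0)))"
    by (rule nn_integral_lborel_vec_0)
  then show ?case using A by (simp add: qform_sum[OF A])
next
  case (Suc k)
  note A = positive_definiteD[OF Suc.prems]
  have sym: "A $$ (r, s) = A $$ (s, r)" if "r < Suc k" "s < Suc k" for r s
    using A(2) that A(1) by (metis carrier_matD index_transpose_mat(1))
  define a where "a = A $$ (k, k)"
  define b where "b i = A $$ (i, k)" for i
  have sk: "A $$ (k, i) = b i" if "i < k" for i using sym[of k i] that by (simp add: b_def)
  have bk: "A $$ (i, k) = b i" if "i < k" for i by (simp add: b_def)
  define S where "S = mat k k (\<lambda>(i, j). A $$ (i, j) - b i * b j / a)"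
  define app where "app y t = vec (Suc k) (\<lambda>i. if i < k then y $ i else t)" for y :: "real vec" and t :: real
  have appc: "app y t \<in> carrier_vec (Suc k)" for y t by (simp add: app_def)
  have Sc: "S \<in> carrier_mat k k" by (simp add: S_def)
  have qapp: "qform A (app y t) = a * t\<^sup>2 + 2 * (\<Sum>i<k. b i * y $ i) * t + (\<Sum>r<k. \<Sum>s<k. A $$ (r, s) * y $ r * y $ s)" for y t
  proof -
    have "qform A (app y t) = (\<Sum>r<k. (\<Sum>s<k. A $$ (r, s) * y $ r * y $ s) + b r * y $ r * t) + ((\<Sum>s<k. b s * t * y $ s) + a * t * t)"
      unfolding qform_sum[OF A(1) appc] by (simp add: app_def a_def[symmetric] bk sk del: One_nat_def)
    moreover have "(\<Sum>r<k. b r * y $ r * t) = (\<Sum>i<k. b i * y $ i) * t" by (simp add: sum_distrib_right)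
    moreover have "(\<Sum>s<k. b s * t * y $ s) = (\<Sum>i<k. b i * y $ i) * t"
      unfolding sum_distrib_right by (intro sum.cong refl) simp
    ultimately show ?thesis unfolding sum.distrib power2_eq_square by linarith
  qed
  have a: "a > 0"
  proof -
    have "app (0\<^sub>v k) 1 \<noteq> 0\<^sub>v (Suc k)"
    proof
      assume "app (0\<^sub>v k) 1 = 0\<^sub>v (Suc k)"
      then have "app (0\<^sub>v k) 1 $ k = 0" by simp
      then show False by (simp add: app_def)
    qed
    from A(4)[OF appc this] show ?thesis by (simp add: qapp)
  qed
  have qS: "qform S y = (\<Sum>r<k. \<Sum>s<k. A $$ (r, s) * y $ r * y $ s) - (\<Sum>i<k. b i * y $ i)\<^sup>2 / a" if y: "y \<in> carrier_vec k" for y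
  proof -
    have "qform S y = (\<Sum>r<k. \<Sum>s<k. A $$ (r, s) * y $ r * y $ s - (b r * y $ r) * (b s * y $ s) / a)"
      unfolding qform_sum[OF Sc y] by (intro sum.cong refl) (auto simp: S_def field_simps)
    also have "\<dots> = (\<Sum>r<k. \<Sum>s<k. A $$ (r, s) * y $ r * y $ s) - (\<Sum>r<k. \<Sum>s<k. (b r * y $ r) * (b s * y $ s)) / a"
      by (simp add: sum_subtractf sum_divide_distrib)
    also have "(\<Sum>r<k. \<Sum>s<k. (b r * y $ r) * (b s * y $ s)) = (\<Sum>i<k. b i * y $ i)\<^sup>2"
      by (simp add: power2_eq_square sum_product)
    finally show ?thesis .
  qed
  have S: "S \<in> positive_definite k"
  proof (rule positive_definiteI)
    show "S \<in> self_adjoint k" using sym by (auto simp: self_adjoint_def S_def mult.commute intro!: eq_matI)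
    fix y :: "real vec" assume y: "y \<in> carrier_vec k" "y \<noteq> 0\<^sub>v k"
    \<comment> \<open>The minimizer over the last coordinate, at which the form of \<open>A\<close>
      reduces to that of \<open>S\<close>; positivity is inherited through it.\<close>
    define t where "t = - (\<Sum>i<k. b i * y $ i) / a"
    have "app y t \<noteq> 0\<^sub>v (Suc k)"
    proof
      assume 0: "app y t = 0\<^sub>v (Suc k)"
      have "y $ i = 0" if "i < k" for i
        using arg_cong[OF 0, of "\<lambda>v. v $ i"] that by (simp add: app_def)
      then show False using y by (auto intro!: eq_vecI)
    qed
    from A(4)[OF appc this] have "0 < qform A (app y t)" .
    also have "qform A (app y t) = qform S y"
      unfolding qapp qS[OF y(1)] t_def using a by (simp add: power2_eq_square field_simps)
    finally show "qform S y > 0" .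
  qed
  have detA: "Determinant.det A = a * Determinant.det S"
  proof -
    \<comment> \<open>Block factorization A = U D with U unipotent upper triangular and D lower
      block triangular with diagonal blocks S and a.\<close>
    define U where "U = four_block_mat (1\<^sub>m k) (mat k 1 (\<lambda>(i, _). b i / a)) (0\<^sub>m 1 k) (1\<^sub>m 1)"
    define D where "D = four_block_mat S (0\<^sub>m k 1) (mat 1 k (\<lambda>(_, i). b i)) (a \<cdot>\<^sub>m 1\<^sub>m 1)"
    have "U * D = A"
      unfolding U_def D_def
      apply (subst mult_four_block_mat[of _ k k _ 1 _ 1 _ _ k _ 1])
      using Sc A(1) a apply (auto simp: )
      apply (rule eq_matI)
      using a by (auto simp: S_def a_def[symmetric] bk sk scalar_prod_def less_Suc_eq)
    moreover have "Determinant.det U = 1"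
      unfolding U_def by (subst det_four_block_mat_lower_left_zero[of _ k _ 1]) auto
    moreover have "Determinant.det D = Determinant.det S * a"
      unfolding D_def using Sc by (subst det_four_block_mat_upper_right_zero[of _ k _ 1]) (auto simp: det_single)
    moreover have "U \<in> carrier_mat (Suc k) (Suc k)" "D \<in> carrier_mat (Suc k) (Suc k)"
      using Sc by (auto simp: U_def D_def)
    ultimately show ?thesis by (metis det_mult mult.commute mult_1)
  qed
  have m: "(\<lambda>x. ennreal (exp (- pi * qform A x))) \<in> borel_measurable (borel_vec (Suc k))"
    using A(1) by measurable
  have "(\<integral>\<^sup>+x. ennreal (exp (- pi * qform A x)) \<partial>lborel_vec (Suc k)) =
      (\<integral>\<^sup>+y. (\<integral>\<^sup>+t. ennreal (exp (- pi * qform A (app y t))) \<partial>lborel) \<partial>lborel_vec k)"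
    unfolding nn_integral_lborel_vec_Suc[OF m] by (simp add: app_def)
  also have "\<dots> = (\<integral>\<^sup>+y. ennreal (1 / sqrt a) * ennreal (exp (- pi * qform S y)) \<partial>lborel_vec k)"
  proof (rule nn_integral_cong)
    fix y assume "y \<in> space (lborel_vec k)"
    then have y: "y \<in> carrier_vec k" by simp
    show "(\<integral>\<^sup>+t. ennreal (exp (- pi * qform A (app y t))) \<partial>lborel) = ennreal (1 / sqrt a) * ennreal (exp (- pi * qform S y))"
      unfolding qapp nn_integral_gaussian_1d[OF a] qS[OF y] using a by (simp add: ennreal_mult[symmetric])
  qed
  also have "\<dots> = ennreal (1 / sqrt a) * ennreal (1 / sqrt (Determinant.det S))"
    using measurable_qform_self[OF Sc] Suc.IH[OF S]
    by (subst nn_integral_cmult) (auto cong: measurable_cong_sets)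
  also have "\<dots> = ennreal (1 / sqrt (Determinant.det A))"
    using a positive_definite_det_pos[OF S] by (simp add: ennreal_mult[symmetric] detA real_sqrt_mult)
  finally show ?case .
qed

lemma integral_gaussian_qform:
  assumes A: "A \<in> positive_definite k"
  shows "integrable (lborel_vec k) (\<lambda>x. exp (- pi * qform A x))"
    "(LINT x|lborel_vec k. exp (- pi * qform A x)) = 1 / sqrt (Determinant.det A)"
proof -
  note Ac = positive_definiteD(1)[OF A]
  have m: "(\<lambda>x. exp (- pi * qform A x)) \<in> borel_measurable (lborel_vec k)"
    using measurable_qform_self[OF Ac] by (auto cong: measurable_cong_sets)
  show "integrable (lborel_vec k) (\<lambda>x. exp (- pi * qform A x))"
    using m nn_integral_gaussian_qform[OF A] by (intro integrableI_nonneg) auto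
  show "(LINT x|lborel_vec k. exp (- pi * qform A x)) = 1 / sqrt (Determinant.det A)"
    using m nn_integral_gaussian_qform[OF A] positive_definite_det_pos[OF A]
    by (subst integral_eq_nn_integral) auto
qed

lemma integrable_exp_neg_norm:
  assumes "\<delta> > 0"
  shows "integrable (lborel_vec k) (\<lambda>x. exp (- \<delta> * (x \<bullet> x)))"
proof -
  have "transpose_mat (1\<^sub>m k) * diag_of k (\<lambda>_. \<delta> / pi) * 1\<^sub>m k \<in> positive_definite k"
    using assms by (intro gram_positive_definite[of _ _ "1\<^sub>m k"]) auto
  then have "diag_of k (\<lambda>_. \<delta> / pi) \<in> positive_definite k" by simp
  from integral_gaussian_qform(1)[OF this] show ?thesis
    by (rule Bochner_Integration.integrable_cong[THEN iffD1, rotated 2])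
       (auto simp: qform_diag_of scalar_prod_self_sum sum_distrib_left)
qed

section \<open>Differentiation under the integral and integrals of derivatives\<close>

lemma DERIV_lebesgue_integral:
  fixes f :: "real \<Rightarrow> 'a \<Rightarrow> real"
  assumes t: "a < t" "t < b"
    and int: "\<And>s. a < s \<Longrightarrow> s < b \<Longrightarrow> integrable M (f s)"
    and deriv: "\<And>s x. a < s \<Longrightarrow> s < b \<Longrightarrow> x \<in> space M \<Longrightarrow> ((\<lambda>s. f s x) has_real_derivative f' s x) (at s)"
    and bound: "\<And>s x. a < s \<Longrightarrow> s < b \<Longrightarrow> x \<in> space M \<Longrightarrow> \<bar>f' s x\<bar> \<le> D x"
    and D: "integrable M D" and meas: "f' t \<in> borel_measurable M"
  shows "((\<lambda>s. LINT x|M. f s x) has_real_derivative (LINT x|M. f' t x)) (at t)"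
  unfolding has_field_derivative_iff
proof (rule tendsto_at_iff_sequentially[THEN iffD2], intro allI impI)
  fix X :: "nat \<Rightarrow> real" assume X: "\<forall>i. X i \<in> UNIV - {t}" and lim: "X \<longlonglongrightarrow> t"
  have "eventually (\<lambda>i. a < X i) sequentially" "eventually (\<lambda>i. X i < b) sequentially"
    using order_tendstoD[OF lim] t by auto
  then have ev: "eventually (\<lambda>i. a < X i \<and> X i < b) sequentially" by eventually_elim simp
  then obtain N where N: "\<And>i. i \<ge> N \<Longrightarrow> a < X i \<and> X i < b" unfolding eventually_sequentially by blast
  define Y where "Y i = X (i + N)" for i
  have Y: "a < Y i" "Y i < b" "Y i \<noteq> t" for i using N[of "i + N"] X by (auto simp: Y_def)
  have limY: "Y \<longlonglongrightarrow> t" unfolding Y_def using lim by (rule LIMSEQ_ignore_initial_segment)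
  define u where "u i x = (f (Y i) x - f t x) / (Y i - t)" for i x
  have "(\<lambda>i. LINT x|M. u i x) \<longlonglongrightarrow> (LINT x|M. f' t x)"
  proof (rule integral_dominated_convergence[OF meas _ D])
    show "u i \<in> borel_measurable M" for i
      unfolding u_def using int[OF Y(1,2), of i] int[OF t] by auto
    show "AE x in M. (\<lambda>i. u i x) \<longlonglongrightarrow> f' t x"
    proof (rule AE_I2)
      fix x assume x: "x \<in> space M"
      have "((\<lambda>s. (f s x - f t x) / (s - t)) \<longlongrightarrow> f' t x) (at t)"
        using deriv[OF t x] by (simp add: has_field_derivative_iff)
      from this[unfolded tendsto_at_iff_sequentially, rule_format, of Y] show "(\<lambda>i. u i x) \<longlonglongrightarrow> f' t x"
        using Y(3) limY by (auto simp: u_def comp_def)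
    qed
    show "AE x in M. norm (u i x) \<le> D x" for i
    proof (rule AE_I2)
      fix x assume x: "x \<in> space M"
      have lip: "\<bar>f q x - f p x\<bar> \<le> D x * (q - p)" if pq: "a < p" "p < q" "q < b" for p q
      proof -
        obtain z where z: "z > p" "z < q" "f q x - f p x = (q - p) * f' z x"
          using MVT2[OF pq(2), of "\<lambda>s. f s x" "\<lambda>s. f' s x"] deriv x pq by (meson less_le_trans le_less_trans)
        have "\<bar>f' z x\<bar> \<le> D x" using bound[of z x] z pq x by auto
        then show ?thesis unfolding z(3) using pq by (simp add: abs_mult mult.commute mult_right_mono)
      qed
      show "norm (u i x) \<le> D x"
      proof (cases "Y i < t")
        case True
        then show ?thesis using lip[OF Y(1) True t(2)] by (simp add: u_def abs_minus_commute pos_divide_le_eq)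
      next
        case False
        then have ty: "t < Y i" using Y(3)[of i] by simp
        then show ?thesis using lip[OF t(1) ty Y(2)] by (simp add: u_def pos_divide_le_eq)
      qed
    qed
  qed
  moreover have "(LINT x|M. u i x) = ((LINT x|M. f (Y i) x) - (LINT x|M. f t x)) / (Y i - t)" for i
    unfolding u_def using int[OF Y(1,2), of i] int[OF t] by simp
  ultimately have "(\<lambda>i. ((\<lambda>s. ((LINT x|M. f s x) - (LINT x|M. f t x)) / (s - t)) \<circ> X) (i + N)) \<longlonglongrightarrow> (LINT x|M. f' t x)"
    by (simp add: Y_def comp_def)
  then show "((\<lambda>s. ((LINT x|M. f s x) - (LINT x|M. f t x)) / (s - t)) \<circ> X) \<longlonglongrightarrow> (LINT x|M. f' t x)"
    by (rule LIMSEQ_offset)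
qed

lemma integral_lborel_vec_translate:
  fixes f :: "real vec \<Rightarrow> real"
  assumes f: "f \<in> borel_measurable (lborel_vec k)" and a: "a \<in> carrier_vec k"
  shows "integrable (lborel_vec k) (\<lambda>x. f (x + a)) \<longleftrightarrow> integrable (lborel_vec k) f"
    "(LINT x|lborel_vec k. f (x + a)) = (LINT x|lborel_vec k. f x)"
proof -
  have t: "(\<lambda>x. x + a) \<in> measurable (lborel_vec k) (borel_vec k)"
    using a by (intro measurable_vec_add measurable_const) (auto intro: measurable_ident_sets)
  have f': "f \<in> borel_measurable (borel_vec k)" using f by (simp cong: measurable_cong_sets)
  show "integrable (lborel_vec k) (\<lambda>x. f (x + a)) \<longleftrightarrow> integrable (lborel_vec k) f"
    using integrable_distr_eq[OF t f'] by (simp add: distr_lborel_vec_translate[OF a])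
  show "(LINT x|lborel_vec k. f (x + a)) = (LINT x|lborel_vec k. f x)"
    using integral_distr[OF t f'] by (simp add: distr_lborel_vec_translate[OF a])
qed

text \<open>Translation invariance replaces integration by parts: the integral of \<Phi>(x + h e)
  does not depend on h, and differentiating it at h = 0 under the integral gives the claim.\<close>

lemma integral_directional_derivative_zero:
  fixes \<Phi> \<Phi>' :: "real vec \<Rightarrow> real"
  assumes e: "e \<in> carrier_vec n"
    and int: "integrable (lborel_vec n) \<Phi>" and meas: "\<Phi>' \<in> borel_measurable (lborel_vec n)"
    and deriv: "\<And>x. x \<in> carrier_vec n \<Longrightarrow> ((\<lambda>h. \<Phi> (x + h \<cdot>\<^sub>v e)) has_real_derivative \<Phi>' x) (at 0)"
    and bound: "\<And>x. x \<in> carrier_vec n \<Longrightarrow> \<bar>\<Phi>' x\<bar> \<le> C * exp (- \<delta> * (x \<bullet> x))" and \<delta>: "\<delta> > 0" "C \<ge> 0"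
  shows "(LINT x|lborel_vec n. \<Phi>' x) = 0"
proof -
  \<comment> \<open>For |s| < 1 one has |x|^2 <= 2 |x + s e|^2 + 2 |e|^2, so halving the decay rate
    yields one majorant for all these translates.\<close>
  define D where "D x = C * exp (\<delta> * (e \<bullet> e)) * exp (- (\<delta> / 2) * (x \<bullet> x))" for x :: "real vec"
  have m\<Phi>: "\<Phi> \<in> borel_measurable (lborel_vec n)" using int by simp
  have "((\<lambda>h. LINT x|lborel_vec n. \<Phi> (x + h \<cdot>\<^sub>v e)) has_real_derivative (LINT x|lborel_vec n. \<Phi>' (x + 0 \<cdot>\<^sub>v e))) (at 0)"
  proof (rule DERIV_lebesgue_integral[where a = "-1" and b = 1 and D = D])
    show "integrable (lborel_vec n) (\<lambda>x. \<Phi> (x + s \<cdot>\<^sub>v e))" for s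
      using e int integral_lborel_vec_translate(1)[OF m\<Phi>, of "s \<cdot>\<^sub>v e"] by simp
    show "integrable (lborel_vec n) D"
      unfolding D_def using \<delta> by (intro integrable_mult_right integrable_exp_neg_norm) auto
    show "(\<lambda>x. \<Phi>' (x + 0 \<cdot>\<^sub>v e)) \<in> borel_measurable (lborel_vec n)"
      by (rule measurable_cong[THEN iffD1, OF _ meas]) (use e in \<open>auto intro!: arg_cong[of _ _ \<Phi>'] eq_vecI\<close>)
    fix s :: real and x assume s: "-1 < s" "s < 1" and "x \<in> space (lborel_vec n)"
    then have x: "x \<in> carrier_vec n" by simp
    then have xs: "x + s \<cdot>\<^sub>v e \<in> carrier_vec n" using e by simp
    have "((\<lambda>h. \<Phi> ((x + s \<cdot>\<^sub>v e) + (h - s) \<cdot>\<^sub>v e)) has_real_derivative \<Phi>' (x + s \<cdot>\<^sub>v e)) (at s)"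
      using DERIV_shift[of "\<lambda>h. \<Phi> ((x + s \<cdot>\<^sub>v e) + h \<cdot>\<^sub>v e)" "\<Phi>' (x + s \<cdot>\<^sub>v e)" s "- s"] deriv[OF xs] by simp
    moreover have "(x + s \<cdot>\<^sub>v e) + (h - s) \<cdot>\<^sub>v e = x + h \<cdot>\<^sub>v e" for h
      using x e by (intro eq_vecI) (auto simp: algebra_simps)
    ultimately show "((\<lambda>h. \<Phi> (x + h \<cdot>\<^sub>v e)) has_real_derivative \<Phi>' (x + s \<cdot>\<^sub>v e)) (at s)" by simp
    have "x \<bullet> x \<le> 2 * ((x + s \<cdot>\<^sub>v e) \<bullet> (x + s \<cdot>\<^sub>v e)) + 2 * (e \<bullet> e)"
    proof -
      have sq: "p\<^sup>2 \<le> 2 * (p + s * q)\<^sup>2 + 2 * q\<^sup>2" for p q :: real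
      proof -
        have "p\<^sup>2 \<le> 2 * (p + s * q)\<^sup>2 + 2 * (s * q)\<^sup>2"
          using zero_le_power2[of "(p + s * q) + s * q"] by (simp add: power2_eq_square algebra_simps)
        moreover have "(s * q)\<^sup>2 \<le> q\<^sup>2" using s by (simp add: power_mult_distrib abs_square_le_1 mult_left_le_one_le abs_le_iff)
        ultimately show ?thesis by simp
      qed
      show ?thesis
        unfolding scalar_prod_self_sum[OF x] scalar_prod_self_sum[OF xs] scalar_prod_self_sum[OF e] sum_distrib_left sum.distrib[symmetric]
        using x e sq by (intro sum_mono) simp
    qed
    then have "\<delta> / 2 * (x \<bullet> x) \<le> \<delta> / 2 * (2 * ((x + s \<cdot>\<^sub>v e) \<bullet> (x + s \<cdot>\<^sub>v e)) + 2 * (e \<bullet> e))"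
      using \<delta> by (intro mult_left_mono) auto
    then have le: "- \<delta> * ((x + s \<cdot>\<^sub>v e) \<bullet> (x + s \<cdot>\<^sub>v e)) \<le> \<delta> * (e \<bullet> e) + - (\<delta> / 2) * (x \<bullet> x)" by (simp add: algebra_simps)
    have "\<bar>\<Phi>' (x + s \<cdot>\<^sub>v e)\<bar> \<le> C * exp (- \<delta> * ((x + s \<cdot>\<^sub>v e) \<bullet> (x + s \<cdot>\<^sub>v e)))" by (rule bound[OF xs])
    also have "\<dots> \<le> C * exp (\<delta> * (e \<bullet> e) + - (\<delta> / 2) * (x \<bullet> x))" using le \<delta> by (intro mult_left_mono) auto
    also have "\<dots> = D x" by (simp add: D_def mult_exp_exp)
    finally show "\<bar>\<Phi>' (x + s \<cdot>\<^sub>v e)\<bar> \<le> D x" .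
  qed auto
  moreover have "(LINT x|lborel_vec n. \<Phi> (x + h \<cdot>\<^sub>v e)) = (LINT x|lborel_vec n. \<Phi> x)" for h
    using e by (intro integral_lborel_vec_translate(2)[OF m\<Phi>]) simp
  ultimately have "((\<lambda>h::real. LINT x|lborel_vec n. \<Phi> x) has_real_derivative (LINT x|lborel_vec n. \<Phi>' (x + 0 \<cdot>\<^sub>v e))) (at 0)"
    by simp
  then have "(LINT x|lborel_vec n. \<Phi>' (x + 0 \<cdot>\<^sub>v e)) = 0" using DERIV_unique[OF _ DERIV_const] by blast
  moreover have "(LINT x|lborel_vec n. \<Phi>' (x + 0 \<cdot>\<^sub>v e)) = (LINT x|lborel_vec n. \<Phi>' x)"
    by (rule Bochner_Integration.integral_cong) (use e in \<open>auto intro!: arg_cong[of _ _ \<Phi>'] eq_vecI\<close>)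
  ultimately show ?thesis by simp
qed

section \<open>Monotonicity along the flow of Gaussian mixtures\<close>

definition nrm :: "real vec \<Rightarrow> real" where
  "nrm x = sqrt (x \<bullet> x)"

lemma nrm_nonneg: "x \<in> carrier_vec n \<Longrightarrow> nrm x \<ge> 0"
  by (auto simp: nrm_def scalar_prod_self_sum sum_nonneg)

lemma nrm_power2: "x \<in> carrier_vec n \<Longrightarrow> (nrm x)\<^sup>2 = x \<bullet> x"
  by (auto simp: nrm_def scalar_prod_self_sum sum_nonneg)

lemma abs_scalar_prod_le:
  assumes "v \<in> carrier_vec n" "x \<in> carrier_vec n"
  shows "\<bar>v \<bullet> x\<bar> \<le> nrm v * nrm x"
proof -
  have "(v \<bullet> x)\<^sup>2 \<le> (v \<bullet> v) * (x \<bullet> x)"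
    unfolding scalar_prod_self_sum[OF assms(1)] scalar_prod_self_sum[OF assms(2)]
    using Cauchy_Schwarz_ineq_sum[of "\<lambda>i. v $ i" "\<lambda>i. x $ i" "{..<n}"] assms
    by (simp add: scalar_prod_def lessThan_atLeast0)
  then have "sqrt ((v \<bullet> x)\<^sup>2) \<le> sqrt ((v \<bullet> v) * (x \<bullet> x))" by (rule real_sqrt_le_mono)
  then show ?thesis by (simp add: nrm_def real_sqrt_mult)
qed

text \<open>The growth class of the logarithmic derivatives of the integrand, uniform for t in
  [0, 1]. One constant serves as factor and as rate, the class is closed under sums and products,
  and the Gaussian decay of the integrand beats each of its members.\<close>

definition exp_bounded :: "nat \<Rightarrow> (real \<Rightarrow> real vec \<Rightarrow> real) \<Rightarrow> bool" where
  "exp_bounded n f \<longleftrightarrow> (\<exists>C\<ge>0. \<forall>t x. 0 \<le> t \<longrightarrow> t \<le> 1 \<longrightarrow> x \<in> carrier_vec n \<longrightarrow> \<bar>f t x\<bar> \<le> C * exp (C * nrm x))"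

lemma exp_boundedI:
  assumes "\<And>t x. 0 \<le> t \<Longrightarrow> t \<le> 1 \<Longrightarrow> x \<in> carrier_vec n \<Longrightarrow> \<bar>f t x\<bar> \<le> C * exp (D * nrm x)"
  shows "exp_bounded n f"
  unfolding exp_bounded_def
proof (intro exI[of _ "\<bar>C\<bar> + \<bar>D\<bar>"] conjI allI impI)
  fix t :: real and x :: "real vec" assume tx: "0 \<le> t" "t \<le> (1::real)" "x \<in> carrier_vec n"
  have "\<bar>f t x\<bar> \<le> C * exp (D * nrm x)" using assms tx by blast
  also have "\<dots> \<le> (\<bar>C\<bar> + \<bar>D\<bar>) * exp ((\<bar>C\<bar> + \<bar>D\<bar>) * nrm x)"
    using nrm_nonneg[OF tx(3)] by (intro mult_mono) (auto intro!: mult_right_mono)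
  finally show "\<bar>f t x\<bar> \<le> (\<bar>C\<bar> + \<bar>D\<bar>) * exp ((\<bar>C\<bar> + \<bar>D\<bar>) * nrm x)" .
qed auto

lemma exp_bounded_mono:
  assumes "exp_bounded n g"
    and "\<And>t x. 0 \<le> t \<Longrightarrow> t \<le> 1 \<Longrightarrow> x \<in> carrier_vec n \<Longrightarrow> \<bar>f t x\<bar> \<le> \<bar>g t x\<bar>"
  shows "exp_bounded n f"
proof -
  obtain C where C: "C \<ge> 0" "\<And>t x. 0 \<le> t \<Longrightarrow> t \<le> 1 \<Longrightarrow> x \<in> carrier_vec n \<Longrightarrow> \<bar>g t x\<bar> \<le> C * exp (C * nrm x)"
    using assms(1) by (auto simp: exp_bounded_def)
  show ?thesis using C(2) assms(2) by (intro exp_boundedI[of n f C C]) (meson order_trans)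
qed

lemma exp_bounded_const: "exp_bounded n (\<lambda>t x. a)"
  by (rule exp_boundedI[of _ _ "\<bar>a\<bar>" 0]) simp

lemma exp_bounded_bdd:
  assumes "\<And>t x. 0 \<le> t \<Longrightarrow> t \<le> 1 \<Longrightarrow> x \<in> carrier_vec n \<Longrightarrow> \<bar>f t x\<bar> \<le> C"
  shows "exp_bounded n f"
  by (rule exp_boundedI[of _ _ C 0]) (use assms in simp)

lemma exp_bounded_linear:
  assumes "v \<in> carrier_vec n"
  shows "exp_bounded n (\<lambda>t x. v \<bullet> x)"
proof (rule exp_boundedI[of _ _ "nrm v" 1])
  fix x :: "real vec" assume x: "x \<in> carrier_vec n"
  have "\<bar>v \<bullet> x\<bar> \<le> nrm v * nrm x" by (rule abs_scalar_prod_le[OF assms x])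
  also have "\<dots> \<le> nrm v * exp (1 * nrm x)"
  proof (intro mult_left_mono nrm_nonneg[OF assms])
    show "nrm x \<le> exp (1 * nrm x)" using exp_ge_add_one_self[of "nrm x"] unfolding mult_1 by linarith
  qed
  finally show "\<bar>v \<bullet> x\<bar> \<le> nrm v * exp (1 * nrm x)" .
qed

lemma exp_bounded_add:
  assumes "exp_bounded n f" "exp_bounded n g"
  shows "exp_bounded n (\<lambda>t x. f t x + g t x)"
proof -
  obtain C where C: "C \<ge> 0" "\<And>t x. 0 \<le> t \<Longrightarrow> t \<le> 1 \<Longrightarrow> x \<in> carrier_vec n \<Longrightarrow> \<bar>f t x\<bar> \<le> C * exp (C * nrm x)"
    using assms(1) by (auto simp: exp_bounded_def)
  obtain D where D: "D \<ge> 0" "\<And>t x. 0 \<le> t \<Longrightarrow> t \<le> 1 \<Longrightarrow> x \<in> carrier_vec n \<Longrightarrow> \<bar>g t x\<bar> \<le> D * exp (D * nrm x)"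
    using assms(2) by (auto simp: exp_bounded_def)
  show ?thesis
  proof (rule exp_boundedI[of n _ "C + D" "C + D"])
    fix t :: real and x :: "real vec" assume tx: "0 \<le> t" "t \<le> (1::real)" "x \<in> carrier_vec n"
    have "\<bar>f t x + g t x\<bar> \<le> C * exp (C * nrm x) + D * exp (D * nrm x)"
      using C(2)[OF tx] D(2)[OF tx] by linarith
    also have "\<dots> \<le> C * exp ((C + D) * nrm x) + D * exp ((C + D) * nrm x)"
      using C(1) D(1) nrm_nonneg[OF tx(3)] by (intro add_mono mult_left_mono) (auto intro!: mult_right_mono)
    finally show "\<bar>f t x + g t x\<bar> \<le> (C + D) * exp ((C + D) * nrm x)" by (simp add: algebra_simps)
  qed
qed

lemma exp_bounded_mult:
  assumes "exp_bounded n f" "exp_bounded n g"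
  shows "exp_bounded n (\<lambda>t x. f t x * g t x)"
proof -
  obtain C where C: "C \<ge> 0" "\<And>t x. 0 \<le> t \<Longrightarrow> t \<le> 1 \<Longrightarrow> x \<in> carrier_vec n \<Longrightarrow> \<bar>f t x\<bar> \<le> C * exp (C * nrm x)"
    using assms(1) by (auto simp: exp_bounded_def)
  obtain D where D: "D \<ge> 0" "\<And>t x. 0 \<le> t \<Longrightarrow> t \<le> 1 \<Longrightarrow> x \<in> carrier_vec n \<Longrightarrow> \<bar>g t x\<bar> \<le> D * exp (D * nrm x)"
    using assms(2) by (auto simp: exp_bounded_def)
  show ?thesis
  proof (rule exp_boundedI[of n _ "C * D" "C + D"])
    fix t :: real and x :: "real vec" assume tx: "0 \<le> t" "t \<le> (1::real)" "x \<in> carrier_vec n"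
    have "\<bar>f t x * g t x\<bar> \<le> (C * exp (C * nrm x)) * (D * exp (D * nrm x))"
      unfolding abs_mult using C(2)[OF tx] D(2)[OF tx] C(1) by (intro mult_mono) auto
    then show "\<bar>f t x * g t x\<bar> \<le> C * D * exp ((C + D) * nrm x)" unfolding distrib_right exp_add by (simp only: mult_ac)
  qed
qed

lemma exp_bounded_minus: "exp_bounded n f \<Longrightarrow> exp_bounded n (\<lambda>t x. - f t x)"
  by (rule exp_bounded_mono) auto

lemma exp_bounded_diff:
  "exp_bounded n f \<Longrightarrow> exp_bounded n g \<Longrightarrow> exp_bounded n (\<lambda>t x. f t x - g t x)"
  using exp_bounded_add[OF _ exp_bounded_minus, of n f g] by simp

lemma exp_bounded_power2: "exp_bounded n f \<Longrightarrow> exp_bounded n (\<lambda>t x. (f t x)\<^sup>2)"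
  unfolding power2_eq_square by (rule exp_bounded_mult)

lemma exp_bounded_abs: "exp_bounded n f \<Longrightarrow> exp_bounded n (\<lambda>t x. \<bar>f t x\<bar>)"
  by (rule exp_bounded_mono) auto

lemma exp_bounded_sum:
  "(\<And>i. i \<in> I \<Longrightarrow> exp_bounded n (f i)) \<Longrightarrow> exp_bounded n (\<lambda>t x. \<Sum>i\<in>I. f i t x)"
proof (induction I rule: infinite_finite_induct)
  case (insert i I)
  then show ?case using exp_bounded_add[of n "f i" "\<lambda>t x. \<Sum>i\<in>I. f i t x"] by simp
qed (auto intro: exp_bounded_const)

lemmas exp_bounded_intros = exp_bounded_const exp_bounded_linear exp_bounded_add exp_bounded_mult
  exp_bounded_minus exp_bounded_diff exp_bounded_power2 exp_bounded_abs exp_bounded_sum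

lemma exp_linear_quadratic_bound:
  fixes C \<delta> :: real
  assumes "\<delta> > 0"
  shows "\<exists>K\<ge>0. \<forall>u. exp (C * u - pi * \<delta> * u\<^sup>2) \<le> K * exp (- \<delta> * u\<^sup>2)"
proof (intro exI conjI allI)
  \<comment> \<open>Decay exp(-pi \<delta> u^2) is traded for exp(-\<delta> u^2); the surplus b
    absorbs the linear exponent.\<close>
  define b where "b = (pi - 1) * \<delta>"
  have b: "b > 0" using assms pi_gt3 by (simp add: b_def)
  fix u :: real
  have "C * u - b * u\<^sup>2 \<le> C\<^sup>2 / (4 * b)"
  proof -
    have "0 \<le> (2 * b * u - C)\<^sup>2 / (4 * b)" using b by simp
    also have "\<dots> = b * u\<^sup>2 - C * u + C\<^sup>2 / (4 * b)" using b by (simp add: power2_eq_square field_simps)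
    finally show ?thesis by simp
  qed
  then have "exp (C * u - b * u\<^sup>2 + - \<delta> * u\<^sup>2) \<le> exp (C\<^sup>2 / (4 * b)) * exp (- \<delta> * u\<^sup>2)"
    unfolding exp_add[symmetric] by simp
  moreover have "C * u - b * u\<^sup>2 + - \<delta> * u\<^sup>2 = C * u - pi * \<delta> * u\<^sup>2" by (simp add: b_def algebra_simps)
  ultimately show "exp (C * u - pi * \<delta> * u\<^sup>2) \<le> exp (C\<^sup>2 / (4 * ((pi - 1) * \<delta>))) * exp (- \<delta> * u\<^sup>2)"
    unfolding b_def by metis
qed simp

lemma interp_lower:
  assumes "\<gamma> > 0" "0 \<le> t" "t \<le> 1"
  shows "interp \<gamma> t \<ge> \<gamma> / (1 + \<gamma>)"
proof -
  have "(1 - t) + t * \<gamma> \<le> 1 + 1 * \<gamma>" using assms by (intro add_mono mult_right_mono) auto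
  then show ?thesis using assms interp_denom_pos[OF assms] unfolding interp_def by (intro divide_left_mono) auto
qed

text \<open>A logistic equation. Its factor 1/(1-t) is the origin of the normalization 2 (1-t) of
  the time derivatives below and of the restriction to t < 1.\<close>

lemma interp_DERIV:
  assumes "\<gamma> > 0" "0 < t" "t < 1"
  shows "(interp \<gamma> has_real_derivative interp \<gamma> t * (1 - interp \<gamma> t) / (1 - t)) (at t)"
proof -
  have D: "(1 - t) + t * \<gamma> > 0" using interp_denom_pos[of \<gamma> t] assms by simp
  have "((\<lambda>t. \<gamma> / ((1 - t) + t * \<gamma>)) has_real_derivative - (\<gamma> * (\<gamma> - 1)) / ((1 - t) + t * \<gamma>)\<^sup>2) (at t)"
    using D by (auto intro!: derivative_eq_intros simp: power2_eq_square algebra_simps)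
  moreover have "g / D * (1 - g / D) / (1 - t) = - (g * (g - 1)) / D\<^sup>2" if "D > 0" "D = (1 - t) + t * g" for D g
  proof -
    have "1 - g / D = (1 - t) * (1 - g) / D" using that(1) by (simp add: field_simps) (simp add: that(2) algebra_simps)
    then show ?thesis using assms(3) that(1) by (simp only:) (simp add: field_simps power2_eq_square)
  qed
  ultimately show ?thesis unfolding interp_def using D by simp
qed

text \<open>The flow in scalar coordinates: component i of f_j is a product of one-dimensional
  Gaussians in the linear forms v . x with inverse variances \<gamma> and centers a, and \<omega>
  absorbs constants. By \<open>ref_pos\<close> and \<open>ref_neg\<close> a reference Gaussian with
  data \<gamma>0, v0 controls f_j from above for c_j > 0, up to factors exponential in |x|, and from
  below for c_j <= 0. \<open>form_bound\<close> makes the product of the reference Gaussians decay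
  uniformly in t.\<close>

locale gaussian_mixtures =
  fixes n m :: nat and d :: "nat \<Rightarrow> nat" and c :: "nat \<Rightarrow> real" and Q :: "real mat"
    and I :: "nat \<Rightarrow> 'i set" and \<omega> :: "nat \<Rightarrow> 'i \<Rightarrow> real" and \<gamma> :: "nat \<Rightarrow> 'i \<Rightarrow> nat \<Rightarrow> real"
    and v :: "nat \<Rightarrow> 'i \<Rightarrow> nat \<Rightarrow> real vec" and a :: "nat \<Rightarrow> 'i \<Rightarrow> nat \<Rightarrow> real"
    and \<gamma>0 :: "nat \<Rightarrow> nat \<Rightarrow> real" and v0 :: "nat \<Rightarrow> nat \<Rightarrow> real vec" and \<delta> :: real
  assumes Q: "Q \<in> self_adjoint n"
    and finI: "\<And>j. j < m \<Longrightarrow> finite (I j)"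
    and \<omega>_nonneg: "\<And>j i. j < m \<Longrightarrow> i \<in> I j \<Longrightarrow> \<omega> j i \<ge> 0"
    and \<omega>_pos: "\<And>j. j < m \<Longrightarrow> \<exists>i\<in>I j. \<omega> j i > 0"
    and \<gamma>_pos: "\<And>j i k. j < m \<Longrightarrow> i \<in> I j \<Longrightarrow> k < d j \<Longrightarrow> \<gamma> j i k > 0"
    and v: "\<And>j i k. j < m \<Longrightarrow> i \<in> I j \<Longrightarrow> k < d j \<Longrightarrow> v j i k \<in> carrier_vec n"
    and ref_pos: "\<And>j i k. j < m \<Longrightarrow> c j > 0 \<Longrightarrow> i \<in> I j \<Longrightarrow> k < d j \<Longrightarrow> \<gamma> j i k = \<gamma>0 j k \<and> v j i k = v0 j k"
    and ref_neg: "\<And>j. j < m \<Longrightarrow> c j \<le> 0 \<Longrightarrow> \<exists>i\<in>I j. \<omega> j i > 0 \<and> (\<forall>k<d j. a j i k = 0 \<and> \<gamma> j i k = \<gamma>0 j k \<and> v j i k = v0 j k)"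
    and \<delta>: "\<delta> > 0"
    and form_bound: "\<And>t x. 0 \<le> t \<Longrightarrow> t \<le> 1 \<Longrightarrow> x \<in> carrier_vec n \<Longrightarrow>
      \<delta> * (x \<bullet> x) \<le> qform Q x + (\<Sum>j<m. c j * (\<Sum>k<d j. interp (\<gamma>0 j k) t * (v0 j k \<bullet> x)\<^sup>2))"
begin

definition g where "g j i k t = interp (\<gamma> j i k) t"
definition u where "u j i k t x = v j i k \<bullet> x - sqrt (1 - t) * a j i k"
text \<open>The summand ln g / 2 is the logarithm of the normalizing factor, so the mass of each
  component does not change with t.\<close>

definition E where "E j i t x = (\<Sum>k<d j. ln (g j i k t) / 2 - pi * (g j i k t * (u j i k t x)\<^sup>2))"
definition \<phi> where "\<phi> j i t x = \<omega> j i * exp (E j i t x)"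
definition F where "F j t x = (\<Sum>i\<in>I j. \<phi> j i t x)"
definition W where "W t x = exp (- pi * qform Q x + (\<Sum>j<m. c j * ln (F j t x)))"
text \<open>Average over the components with weights \<phi>_i / F, the shape of every logarithmic
  derivative of F.\<close>

definition mean where "mean j t x X = (\<Sum>i\<in>I j. \<phi> j i t x * X i) / F j t x"
text \<open>-2 pi \<chi> is the logarithmic derivative of component i at x in the direction e;
  \<kappa> below is the derivative of \<chi> in the same direction.\<close>

definition \<chi> where "\<chi> j t x e i = (\<Sum>k<d j. g j i k t * u j i k t x * (v j i k \<bullet> e))"
definition \<kappa> where "\<kappa> j t e i = (\<Sum>k<d j. g j i k t * (v j i k \<bullet> e)\<^sup>2)"
text \<open>The directional derivative of log W; \<rho> is the derivative of \<Lambda> in the same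
  direction, and the squares in it make up the variance of \<chi> over the components.\<close>

definition \<Lambda> where "\<Lambda> t x e = - (2 * pi) * (x \<bullet> (Q *\<^sub>v e) + (\<Sum>j<m. c j * mean j t x (\<chi> j t x e)))"
definition \<rho> where "\<rho> t x e = - (2 * pi) * (qform Q e + (\<Sum>j<m. c j *
  (mean j t x (\<lambda>i. \<kappa> j t e i - 2 * pi * (\<chi> j t x e i)\<^sup>2) + 2 * pi * (mean j t x (\<chi> j t x e))\<^sup>2)))"
text \<open>2 (1-t) times the logarithmic time derivative of component i, expressed through space
  quantities; \<open>time_rate\<close> is the same for W.\<close>

definition \<theta> where "\<theta> j t x i = (\<Sum>k<d j. (1 - g j i k t) + 2 * pi * (g j i k t * u j i k t x)\<^sup>2
  - 2 * pi * (g j i k t * u j i k t x * (v j i k \<bullet> x)))"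
definition time_rate where "time_rate t x = (\<Sum>j<m. c j * mean j t x (\<theta> j t x))"

lemma g_pos: "j < m \<Longrightarrow> i \<in> I j \<Longrightarrow> k < d j \<Longrightarrow> 0 \<le> t \<Longrightarrow> t \<le> 1 \<Longrightarrow> g j i k t > 0"
  unfolding g_def by (intro interp_pos \<gamma>_pos)

lemma \<phi>_nonneg: "j < m \<Longrightarrow> i \<in> I j \<Longrightarrow> \<phi> j i t x \<ge> 0"
  using \<omega>_nonneg by (simp add: \<phi>_def)

lemma F_pos: "j < m \<Longrightarrow> F j t x > 0"
proof -
  assume j: "j < m"
  then obtain i where "i \<in> I j" "\<omega> j i > 0" using \<omega>_pos by blast
  then show ?thesis unfolding F_def using finI[OF j] \<phi>_nonneg[OF j]
    by (intro sum_pos2[of _ i]) (auto simp: \<phi>_def)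
qed

lemma mean_bound:
  assumes j: "j < m"
  shows "\<bar>mean j t x X\<bar> \<le> (\<Sum>i\<in>I j. \<bar>X i\<bar>)"
proof -
  have "\<bar>\<Sum>i\<in>I j. \<phi> j i t x * X i\<bar> \<le> (\<Sum>i\<in>I j. F j t x * \<bar>X i\<bar>)"
  proof (intro order_trans[OF sum_abs] sum_mono)
    fix i assume i: "i \<in> I j"
    have "\<phi> j i t x \<le> F j t x"
      unfolding F_def using finI[OF j] \<phi>_nonneg[OF j] i by (intro member_le_sum) auto
    then show "\<bar>\<phi> j i t x * X i\<bar> \<le> F j t x * \<bar>X i\<bar>"
      using \<phi>_nonneg[OF j i, of t x] by (simp add: abs_mult mult_right_mono)
  qed
  then have "\<bar>\<Sum>i\<in>I j. \<phi> j i t x * X i\<bar> \<le> (\<Sum>i\<in>I j. \<bar>X i\<bar>) * F j t x"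
    unfolding sum_distrib_left[symmetric] by (simp only: mult.commute[of _ "F j t x"])
  moreover have "\<bar>mean j t x X\<bar> = \<bar>\<Sum>i\<in>I j. \<phi> j i t x * X i\<bar> / F j t x"
    using F_pos[OF j, of t x] by (simp add: mean_def)
  ultimately show ?thesis using F_pos[OF j, of t x] by (simp only: pos_divide_le_eq)
qed

lemma exp_bounded_mean:
  assumes j: "j < m" and "\<And>i. i \<in> I j \<Longrightarrow> exp_bounded n (\<lambda>t x. X t x i)"
  shows "exp_bounded n (\<lambda>t x. mean j t x (X t x))"
proof (rule exp_bounded_mono)
  show "exp_bounded n (\<lambda>t x. \<Sum>i\<in>I j. \<bar>X t x i\<bar>)" using assms(2) by (intro exp_bounded_intros)
  fix t x
  show "\<bar>mean j t x (X t x)\<bar> \<le> \<bar>\<Sum>i\<in>I j. \<bar>X t x i\<bar>\<bar>" using mean_bound[OF j, of t x "X t x"] by simp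
qed

lemma exp_bounded_g:
  assumes "j < m" "i \<in> I j" "k < d j" shows "exp_bounded n (\<lambda>t x. g j i k t)"
  using interp_bounds[OF \<gamma>_pos[OF assms]] g_pos[OF assms]
  by (intro exp_bounded_bdd[of _ _ "\<gamma> j i k + 1"]) (auto simp: g_def abs_of_pos)

lemma exp_bounded_u:
  assumes "j < m" "i \<in> I j" "k < d j" shows "exp_bounded n (\<lambda>t x. u j i k t x)"
proof -
  have "exp_bounded n (\<lambda>t x. sqrt (1 - t))" by (rule exp_bounded_bdd[of _ _ 1]) auto
  then show ?thesis unfolding u_def by (intro exp_bounded_intros v[OF assms]) auto
qed

lemma exp_bounded_\<chi>:
  assumes "j < m" "i \<in> I j"
  shows "exp_bounded n (\<lambda>t x. \<chi> j t x e i)" "exp_bounded n (\<lambda>t x. \<kappa> j t e i)" "exp_bounded n (\<lambda>t x. \<theta> j t x i)"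
  unfolding \<chi>_def \<kappa>_def \<theta>_def using assms v[OF assms]
  by (intro exp_bounded_intros exp_bounded_g exp_bounded_u; simp)+

lemma exp_bounded_\<Lambda>:
  assumes e: "e \<in> carrier_vec n"
  shows "exp_bounded n (\<lambda>t x. \<Lambda> t x e)" "exp_bounded n (\<lambda>t x. \<rho> t x e)"
proof -
  have Qe: "Q *\<^sub>v e \<in> carrier_vec n" using mult_mat_vec_carrier[OF self_adjointD(1)[OF Q] e] .
  have lin: "exp_bounded n (\<lambda>t x. x \<bullet> (Q *\<^sub>v e))"
    by (rule exp_bounded_mono[OF exp_bounded_linear[OF Qe]]) (use Qe in \<open>simp add: comm_scalar_prod\<close>)
  show "exp_bounded n (\<lambda>t x. \<Lambda> t x e)"
    unfolding \<Lambda>_def using exp_bounded_\<chi>(1) by (intro exp_bounded_intros lin exp_bounded_mean) auto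
  show "exp_bounded n (\<lambda>t x. \<rho> t x e)"
    unfolding \<rho>_def using exp_bounded_\<chi>(1,2) by (intro exp_bounded_intros exp_bounded_mean) auto
qed

lemma exp_bounded_time_rate: "exp_bounded n time_rate"
  unfolding time_rate_def[abs_def] using exp_bounded_\<chi>(3) by (intro exp_bounded_intros exp_bounded_mean) auto

text \<open>All components share the quadratic part given by \<gamma>0 and v0, so the centers
  contribute only cross terms of linear growth in |x|.\<close>

lemma F_upper:
  assumes j: "j < m" and c: "c j > 0"
  shows "\<exists>C. \<forall>t x. 0 \<le> t \<longrightarrow> t \<le> 1 \<longrightarrow> x \<in> carrier_vec n \<longrightarrow>
     ln (F j t x) \<le> C * (1 + nrm x) - pi * (\<Sum>k<d j. interp (\<gamma>0 j k) t * (v0 j k \<bullet> x)\<^sup>2)"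
proof -
  define X where "X = (\<Sum>i\<in>I j. \<Sum>k<d j. \<bar>ln (\<gamma> j i k + 1)\<bar> / 2 + 2 * pi * ((\<gamma> j i k + 1) * nrm (v j i k) * \<bar>a j i k\<bar>))"
  have Ebd: "E j i t x \<le> X * (1 + nrm x) - pi * (\<Sum>k<d j. interp (\<gamma>0 j k) t * (v0 j k \<bullet> x)\<^sup>2)"
    if i: "i \<in> I j" and tx: "0 \<le> t" "t \<le> 1" "x \<in> carrier_vec n" for i t x
  proof -
    have nx: "nrm x \<ge> 0" using nrm_nonneg[OF tx(3)] .
    have "E j i t x \<le> (\<Sum>k<d j. (\<bar>ln (\<gamma> j i k + 1)\<bar> / 2 + 2 * pi * ((\<gamma> j i k + 1) * nrm (v j i k) * \<bar>a j i k\<bar>)) * (1 + nrm x)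
        - pi * (interp (\<gamma>0 j k) t * (v0 j k \<bullet> x)\<^sup>2))"
      unfolding E_def
    proof (intro sum_mono)
      fix k assume "k \<in> {..<d j}"
      then have k: "k < d j" by simp
      note gp = g_pos[OF j i k tx(1,2)]
      note vk = v[OF j i k]
      have gb: "g j i k t \<le> \<gamma> j i k + 1" unfolding g_def using interp_bounds[OF \<gamma>_pos[OF j i k] tx(1,2)] .
      have r: "\<gamma>0 j k = \<gamma> j i k" "v0 j k = v j i k" using ref_pos[OF j c i k] by auto
      have "ln (g j i k t) \<le> \<bar>ln (\<gamma> j i k + 1)\<bar>" using gp gb by (intro order_trans[OF ln_mono abs_ge_self]) auto
      moreover have "\<bar>ln (\<gamma> j i k + 1)\<bar> / 2 * 1 \<le> \<bar>ln (\<gamma> j i k + 1)\<bar> / 2 * (1 + nrm x)"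
        using nx by (intro mult_left_mono) auto
      moreover have "- (g j i k t * (u j i k t x)\<^sup>2) \<le> - (g j i k t * (v j i k \<bullet> x)\<^sup>2) + 2 * ((\<gamma> j i k + 1) * nrm (v j i k) * \<bar>a j i k\<bar>) * (1 + nrm x)"
      proof -
        have "(v j i k \<bullet> x)\<^sup>2 - (u j i k t x)\<^sup>2 \<le> 2 * ((v j i k \<bullet> x) * (sqrt (1 - t) * a j i k))"
        proof -
          have "p\<^sup>2 - (p - q)\<^sup>2 \<le> 2 * (p * q)" for p q :: real
            using zero_le_square[of q] by (simp add: power2_eq_square algebra_simps)
          then show ?thesis unfolding u_def .
        qed
        also have "\<dots> \<le> 2 * (\<bar>v j i k \<bullet> x\<bar> * (1 * \<bar>a j i k\<bar>))"
        proof -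
          have "(v j i k \<bullet> x) * (sqrt (1 - t) * a j i k) \<le> \<bar>v j i k \<bullet> x\<bar> * (\<bar>sqrt (1 - t)\<bar> * \<bar>a j i k\<bar>)"
            by (metis abs_ge_self abs_mult)
          also have "\<dots> \<le> \<bar>v j i k \<bullet> x\<bar> * (1 * \<bar>a j i k\<bar>)"
            using tx by (intro mult_left_mono mult_right_mono) auto
          finally show ?thesis by simp
        qed
        also have "\<dots> \<le> 2 * ((nrm (v j i k) * (1 + nrm x)) * (1 * \<bar>a j i k\<bar>))"
          using abs_scalar_prod_le[OF vk tx(3)] nrm_nonneg[OF vk]
          by (intro mult_left_mono mult_right_mono) (auto simp: distrib_left)
        finally have "(v j i k \<bullet> x)\<^sup>2 - (u j i k t x)\<^sup>2 \<le> 2 * (nrm (v j i k) * \<bar>a j i k\<bar> * (1 + nrm x))" by (simp add: mult_ac)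
        then have "g j i k t * ((v j i k \<bullet> x)\<^sup>2 - (u j i k t x)\<^sup>2) \<le> g j i k t * (2 * (nrm (v j i k) * \<bar>a j i k\<bar> * (1 + nrm x)))"
          using gp by (intro mult_left_mono) auto
        also have "\<dots> \<le> (\<gamma> j i k + 1) * (2 * (nrm (v j i k) * \<bar>a j i k\<bar> * (1 + nrm x)))"
          using gb nx nrm_nonneg[OF vk] by (intro mult_right_mono) auto
        finally show ?thesis by (simp add: algebra_simps)
      qed
      then have "pi * (- (g j i k t * (u j i k t x)\<^sup>2)) \<le> pi * (- (g j i k t * (v j i k \<bullet> x)\<^sup>2) + 2 * ((\<gamma> j i k + 1) * nrm (v j i k) * \<bar>a j i k\<bar>) * (1 + nrm x))"
        by (intro mult_left_mono) auto
      ultimately show "ln (g j i k t) / 2 - pi * (g j i k t * (u j i k t x)\<^sup>2)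
         \<le> (\<bar>ln (\<gamma> j i k + 1)\<bar> / 2 + 2 * pi * ((\<gamma> j i k + 1) * nrm (v j i k) * \<bar>a j i k\<bar>)) * (1 + nrm x)
        - pi * (interp (\<gamma>0 j k) t * (v0 j k \<bullet> x)\<^sup>2)"
        unfolding r g_def[symmetric] distrib_right[of "\<bar>ln (\<gamma> j i k + 1)\<bar> / 2"] by (simp only: distrib_left)
    qed
    also have "\<dots> = (\<Sum>k<d j. \<bar>ln (\<gamma> j i k + 1)\<bar> / 2 + 2 * pi * ((\<gamma> j i k + 1) * nrm (v j i k) * \<bar>a j i k\<bar>)) * (1 + nrm x)
        - pi * (\<Sum>k<d j. interp (\<gamma>0 j k) t * (v0 j k \<bullet> x)\<^sup>2)"
      by (simp only: sum_subtractf sum_distrib_right sum_distrib_left)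
    also have "(\<Sum>k<d j. \<bar>ln (\<gamma> j i k + 1)\<bar> / 2 + 2 * pi * ((\<gamma> j i k + 1) * nrm (v j i k) * \<bar>a j i k\<bar>)) \<le> X"
      unfolding X_def using finI[OF j] i \<gamma>_pos[OF j] nrm_nonneg[OF v[OF j]]
      by (intro member_le_sum[of i "I j" "\<lambda>i. \<Sum>k<d j. \<bar>ln (\<gamma> j i k + 1)\<bar> / 2 + 2 * pi * ((\<gamma> j i k + 1) * nrm (v j i k) * \<bar>a j i k\<bar>)"])
         (auto intro!: sum_nonneg add_nonneg_nonneg mult_nonneg_nonneg simp: less_imp_le)
    finally show ?thesis using nx by (simp add: mult_right_mono)
  qed
  define \<Omega> where "\<Omega> = (\<Sum>i\<in>I j. \<omega> j i)"
  have \<Omega>: "\<Omega> > 0"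
    unfolding \<Omega>_def using \<omega>_pos[OF j] \<omega>_nonneg[OF j] finI[OF j] by (auto intro: sum_pos2)
  show ?thesis
  proof (intro exI allI impI)
    fix t :: real and x :: "real vec" assume tx: "0 \<le> t" "t \<le> (1::real)" "x \<in> carrier_vec n"
    define q where "q = (\<Sum>k<d j. interp (\<gamma>0 j k) t * (v0 j k \<bullet> x)\<^sup>2)"
    have "F j t x \<le> (\<Sum>i\<in>I j. \<omega> j i * exp (X * (1 + nrm x) - pi * q))"
      unfolding F_def \<phi>_def q_def using Ebd[OF _ tx] \<omega>_nonneg[OF j] by (intro sum_mono mult_left_mono) auto
    also have "\<dots> = \<Omega> * exp (X * (1 + nrm x) - pi * q)" by (simp add: \<Omega>_def sum_distrib_right)
    finally have "ln (F j t x) \<le> ln (\<Omega> * exp (X * (1 + nrm x) - pi * q))" using F_pos[OF j] by (intro ln_mono) auto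
    also have "\<dots> = ln \<Omega> + (X * (1 + nrm x) - pi * q)" using \<Omega> by (simp add: ln_mult_pos)
    finally have "ln (F j t x) \<le> ln \<Omega> + (X * (1 + nrm x) - pi * q)" .
    moreover have "\<bar>ln \<Omega>\<bar> * 1 \<le> \<bar>ln \<Omega>\<bar> * (1 + nrm x)"
      using nrm_nonneg[OF tx(3)] by (intro mult_left_mono) auto
    ultimately show "ln (F j t x) \<le> (\<bar>ln \<Omega>\<bar> + X) * (1 + nrm x) - pi * (\<Sum>k<d j. interp (\<gamma>0 j k) t * (v0 j k \<bullet> x)\<^sup>2)"
      unfolding distrib_right[of "\<bar>ln \<Omega>\<bar>"] q_def[symmetric] by linarith
  qed
qed

text \<open>The reference component alone bounds the sum from below, and its center 0 leaves no
  linear term.\<close>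

lemma F_lower:
  assumes j: "j < m" and c: "c j \<le> 0"
  shows "\<exists>C. \<forall>t x. 0 \<le> t \<longrightarrow> t \<le> 1 \<longrightarrow> x \<in> carrier_vec n \<longrightarrow>
     ln (F j t x) \<ge> C - pi * (\<Sum>k<d j. interp (\<gamma>0 j k) t * (v0 j k \<bullet> x)\<^sup>2)"
proof -
  obtain i where i: "i \<in> I j" "\<omega> j i > 0" and r: "\<And>k. k < d j \<Longrightarrow> a j i k = 0 \<and> \<gamma> j i k = \<gamma>0 j k \<and> v j i k = v0 j k"
    using ref_neg[OF j c] by blast
  define X where "X = ln (\<omega> j i) + (\<Sum>k<d j. ln (\<gamma> j i k / (1 + \<gamma> j i k)) / 2)"
  show ?thesis
  proof (intro exI allI impI)
    fix t :: real and x :: "real vec" assume tx: "0 \<le> t" "t \<le> (1::real)" "x \<in> carrier_vec n"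
    have "(\<Sum>k<d j. ln (\<gamma> j i k / (1 + \<gamma> j i k)) / 2 - pi * (interp (\<gamma>0 j k) t * (v0 j k \<bullet> x)\<^sup>2)) \<le> E j i t x"
      unfolding E_def
    proof (intro sum_mono)
      fix k assume "k \<in> {..<d j}"
      then have k: "k < d j" by simp
      have "ln (\<gamma> j i k / (1 + \<gamma> j i k)) \<le> ln (g j i k t)"
        using interp_lower[OF \<gamma>_pos[OF j i(1) k] tx(1,2)] \<gamma>_pos[OF j i(1) k] g_pos[OF j i(1) k tx(1,2)]
        unfolding g_def by (intro ln_mono) auto
      then show "ln (\<gamma> j i k / (1 + \<gamma> j i k)) / 2 - pi * (interp (\<gamma>0 j k) t * (v0 j k \<bullet> x)\<^sup>2)
          \<le> ln (g j i k t) / 2 - pi * (g j i k t * (u j i k t x)\<^sup>2)"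
        using r[OF k] by (simp add: g_def u_def)
    qed
    then have "X - pi * (\<Sum>k<d j. interp (\<gamma>0 j k) t * (v0 j k \<bullet> x)\<^sup>2) \<le> ln (\<omega> j i) + E j i t x"
      by (simp add: X_def sum_subtractf sum_distrib_left)
    also have "\<dots> = ln (\<phi> j i t x)" using i(2) by (simp add: \<phi>_def ln_mult_pos)
    also have "\<dots> \<le> ln (F j t x)"
    proof (intro ln_mono)
      show "\<phi> j i t x \<le> F j t x"
        unfolding F_def using finI[OF j] \<phi>_nonneg[OF j] i by (intro member_le_sum) auto
    qed (use i F_pos[OF j] in \<open>auto simp: \<phi>_def\<close>)
    finally show "X - pi * (\<Sum>k<d j. interp (\<gamma>0 j k) t * (v0 j k \<bullet> x)\<^sup>2) \<le> ln (F j t x)" .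
  qed
qed

text \<open>Multiplication by c_j makes an upper bound on log F_j out of the upper bound for c_j > 0
  and of the lower bound for c_j <= 0 alike, both read as bounds on c_j log F_j; the quadratic parts
  then add up to the form in \<open>form_bound\<close>.\<close>

lemma W_bound: "\<exists>C. \<forall>t x. 0 \<le> t \<longrightarrow> t \<le> 1 \<longrightarrow> x \<in> carrier_vec n \<longrightarrow> W t x \<le> exp (C * (1 + nrm x) - pi * \<delta> * (nrm x)\<^sup>2)"
proof -
  have "\<exists>C. \<forall>t x. 0 \<le> t \<longrightarrow> t \<le> 1 \<longrightarrow> x \<in> carrier_vec n \<longrightarrow>
     c j * ln (F j t x) \<le> C * (1 + nrm x) - pi * (c j * (\<Sum>k<d j. interp (\<gamma>0 j k) t * (v0 j k \<bullet> x)\<^sup>2))" if j: "j < m" for j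
  proof (cases "c j > 0")
    case True
    obtain C where C: "\<And>t x. 0 \<le> t \<Longrightarrow> t \<le> 1 \<Longrightarrow> x \<in> carrier_vec n \<Longrightarrow>
     ln (F j t x) \<le> C * (1 + nrm x) - pi * (\<Sum>k<d j. interp (\<gamma>0 j k) t * (v0 j k \<bullet> x)\<^sup>2)" using F_upper[OF j True] by blast
    have "c j * ln (F j t x) \<le> (c j * C) * (1 + nrm x) - pi * (c j * (\<Sum>k<d j. interp (\<gamma>0 j k) t * (v0 j k \<bullet> x)\<^sup>2))"
      if "0 \<le> t" "t \<le> 1" "x \<in> carrier_vec n" for t x
      using mult_left_mono[OF C[OF that], of "c j"] True by (simp add: right_diff_distrib mult_ac)
    then show ?thesis by blast
  next
    case False
    then have "c j \<le> 0" by simp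
    from F_lower[OF j this] obtain C where C: "\<And>t x. 0 \<le> t \<Longrightarrow> t \<le> 1 \<Longrightarrow> x \<in> carrier_vec n \<Longrightarrow>
     C - pi * (\<Sum>k<d j. interp (\<gamma>0 j k) t * (v0 j k \<bullet> x)\<^sup>2) \<le> ln (F j t x)" by blast
    have "c j * ln (F j t x) \<le> \<bar>c j * C\<bar> * (1 + nrm x) - pi * (c j * (\<Sum>k<d j. interp (\<gamma>0 j k) t * (v0 j k \<bullet> x)\<^sup>2))"
      if tx: "0 \<le> t" "t \<le> 1" "x \<in> carrier_vec n" for t x
    proof -
      have "c j * ln (F j t x) \<le> c j * C - pi * (c j * (\<Sum>k<d j. interp (\<gamma>0 j k) t * (v0 j k \<bullet> x)\<^sup>2))"
        using mult_left_mono_neg[OF C[OF tx], of "c j"] False by (simp add: right_diff_distrib mult_ac)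
      moreover have "\<bar>c j * C\<bar> * 1 \<le> \<bar>c j * C\<bar> * (1 + nrm x)" using nrm_nonneg[OF tx(3)] by (intro mult_left_mono) auto
      ultimately show ?thesis by linarith
    qed
    then show ?thesis by blast
  qed
  note ex = this
  define C where "C j = (SOME C. \<forall>t x. 0 \<le> t \<longrightarrow> t \<le> 1 \<longrightarrow> x \<in> carrier_vec n \<longrightarrow>
     c j * ln (F j t x) \<le> C * (1 + nrm x) - pi * (c j * (\<Sum>k<d j. interp (\<gamma>0 j k) t * (v0 j k \<bullet> x)\<^sup>2)))" for j
  have C: "c j * ln (F j t x) \<le> C j * (1 + nrm x) - pi * (c j * (\<Sum>k<d j. interp (\<gamma>0 j k) t * (v0 j k \<bullet> x)\<^sup>2))"
    if "j < m" "0 \<le> t" "t \<le> 1" "x \<in> carrier_vec n" for j t x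
    using someI_ex[OF ex[OF that(1)], folded C_def] that(2-4) by blast
  show ?thesis
  proof (intro exI allI impI)
    fix t :: real and x :: "real vec" assume tx: "0 \<le> t" "t \<le> (1::real)" "x \<in> carrier_vec n"
    define q where "q j = c j * (\<Sum>k<d j. interp (\<gamma>0 j k) t * (v0 j k \<bullet> x)\<^sup>2)" for j
    have "(\<Sum>j<m. c j * ln (F j t x)) \<le> (\<Sum>j<m. C j * (1 + nrm x) - pi * q j)"
      unfolding q_def using C tx by (intro sum_mono) auto
    also have "\<dots> = (\<Sum>j<m. C j) * (1 + nrm x) - pi * (\<Sum>j<m. q j)"
      by (simp only: sum_subtractf sum_distrib_right sum_distrib_left)
    finally have "- pi * qform Q x + (\<Sum>j<m. c j * ln (F j t x)) \<le> (\<Sum>j<m. C j) * (1 + nrm x) - pi * (qform Q x + (\<Sum>j<m. q j))"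
      by (simp add: distrib_left)
    also have "\<dots> \<le> (\<Sum>j<m. C j) * (1 + nrm x) - pi * (\<delta> * (x \<bullet> x))"
      using form_bound[OF tx] unfolding q_def by (intro diff_left_mono mult_left_mono) auto
    finally show "W t x \<le> exp ((\<Sum>j<m. C j) * (1 + nrm x) - pi * \<delta> * (nrm x)\<^sup>2)"
      unfolding W_def nrm_power2[OF tx(3)] by simp
  qed
qed

lemma W_mult_bound:
  assumes "exp_bounded n f"
  shows "\<exists>K\<ge>0. \<forall>t x. 0 \<le> t \<longrightarrow> t \<le> 1 \<longrightarrow> x \<in> carrier_vec n \<longrightarrow> \<bar>W t x * f t x\<bar> \<le> K * exp (- \<delta> * (x \<bullet> x))"
proof -
  obtain C where C: "C \<ge> 0" "\<And>t x. 0 \<le> t \<Longrightarrow> t \<le> 1 \<Longrightarrow> x \<in> carrier_vec n \<Longrightarrow> \<bar>f t x\<bar> \<le> C * exp (C * nrm x)"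
    using assms by (auto simp: exp_bounded_def)
  obtain D where D: "\<And>t x. 0 \<le> t \<Longrightarrow> t \<le> 1 \<Longrightarrow> x \<in> carrier_vec n \<Longrightarrow> W t x \<le> exp (D * (1 + nrm x) - pi * \<delta> * (nrm x)\<^sup>2)"
    using W_bound by blast
  obtain K where K: "K \<ge> 0" "\<And>u. exp ((C + D) * u - pi * \<delta> * u\<^sup>2) \<le> K * exp (- \<delta> * u\<^sup>2)"
    using exp_linear_quadratic_bound[OF \<delta>] by blast
  show ?thesis
  proof (intro exI[of _ "C * exp D * K"] conjI allI impI)
    fix t :: real and x :: "real vec" assume tx: "0 \<le> t" "t \<le> (1::real)" "x \<in> carrier_vec n"
    have "\<bar>W t x * f t x\<bar> \<le> exp (D * (1 + nrm x) - pi * \<delta> * (nrm x)\<^sup>2) * (C * exp (C * nrm x))"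
      unfolding abs_mult using D[OF tx] C(2)[OF tx] by (intro mult_mono) (auto simp: W_def)
    also have "\<dots> = C * (exp (D * (1 + nrm x) - pi * \<delta> * (nrm x)\<^sup>2) * exp (C * nrm x))" by simp
    also have "\<dots> = C * (exp D * exp ((C + D) * nrm x - pi * \<delta> * (nrm x)\<^sup>2))"
      unfolding mult_exp_exp by (simp add: algebra_simps)
    also have "\<dots> = C * exp D * exp ((C + D) * nrm x - pi * \<delta> * (nrm x)\<^sup>2)" by simp
    also have "\<dots> \<le> C * exp D * (K * exp (- \<delta> * (nrm x)\<^sup>2))"
      using K(2) C(1) by (intro mult_left_mono) auto
    finally show "\<bar>W t x * f t x\<bar> \<le> C * exp D * K * exp (- \<delta> * (x \<bullet> x))"
      by (simp add: nrm_power2[OF tx(3)] mult_ac)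
  qed (use C K in auto)
qed

end

section \<open>Space and time derivatives of the integrand\<close>

context gaussian_mixtures
begin

lemma measurable_linear: "w \<in> carrier_vec n \<Longrightarrow> (\<lambda>x. w \<bullet> x) \<in> borel_measurable (borel_vec n)"
  by (rule measurable_scalar_prod[where k = n]) (auto intro: measurable_ident_sets)

lemma measurable_u: "j < m \<Longrightarrow> i \<in> I j \<Longrightarrow> k < d j \<Longrightarrow> u j i k t \<in> borel_measurable (borel_vec n)"
  unfolding u_def[abs_def] using measurable_linear[OF v] by simp

lemma measurable_\<phi>: "j < m \<Longrightarrow> i \<in> I j \<Longrightarrow> \<phi> j i t \<in> borel_measurable (borel_vec n)"
  unfolding \<phi>_def[abs_def] E_def using measurable_u by simp

lemma measurable_F: "j < m \<Longrightarrow> F j t \<in> borel_measurable (borel_vec n)"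
  unfolding F_def[abs_def] using measurable_\<phi> by simp

lemma measurable_W: "W t \<in> borel_measurable (borel_vec n)"
  unfolding W_def[abs_def] using measurable_F measurable_qform_self[OF self_adjointD(1)[OF Q]] by simp

lemma measurable_mean:
  assumes "j < m" "\<And>i. i \<in> I j \<Longrightarrow> (\<lambda>x. X x i) \<in> borel_measurable (borel_vec n)"
  shows "(\<lambda>x. mean j t x (X x)) \<in> borel_measurable (borel_vec n)"
  unfolding mean_def using assms measurable_\<phi> measurable_F by simp

lemma measurable_\<chi>:
  assumes "j < m" "i \<in> I j"
  shows "(\<lambda>x. \<chi> j t x e i) \<in> borel_measurable (borel_vec n)" "(\<lambda>x. \<theta> j t x i) \<in> borel_measurable (borel_vec n)"
  unfolding \<chi>_def \<theta>_def using measurable_u[OF assms] measurable_linear[OF v[OF assms]] by simp_all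

lemma measurable_\<Lambda>:
  assumes e: "e \<in> carrier_vec n"
  shows "(\<lambda>x. \<Lambda> t x e) \<in> borel_measurable (borel_vec n)" "(\<lambda>x. \<rho> t x e) \<in> borel_measurable (borel_vec n)"
proof -
  have Qe: "Q *\<^sub>v e \<in> carrier_vec n" using mult_mat_vec_carrier[OF self_adjointD(1)[OF Q] e] .
  have "(\<lambda>x. x \<bullet> (Q *\<^sub>v e)) \<in> borel_measurable (borel_vec n)"
    by (rule measurable_scalar_prod[where k = n]) (use Qe in \<open>auto intro: measurable_ident_sets\<close>)
  moreover have "(\<lambda>x. mean j t x (\<chi> j t x e)) \<in> borel_measurable (borel_vec n)" if "j < m" for j
    using measurable_\<chi>(1) that by (intro measurable_mean) auto
  moreover have "(\<lambda>x. mean j t x (\<lambda>i. \<kappa> j t e i - 2 * pi * (\<chi> j t x e i)\<^sup>2)) \<in> borel_measurable (borel_vec n)" if "j < m" for j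
    using measurable_\<chi>(1) that by (intro measurable_mean) simp_all
  ultimately show "(\<lambda>x. \<Lambda> t x e) \<in> borel_measurable (borel_vec n)" "(\<lambda>x. \<rho> t x e) \<in> borel_measurable (borel_vec n)"
    unfolding \<Lambda>_def \<rho>_def by simp_all
qed

lemma measurable_time_rate: "time_rate t \<in> borel_measurable (borel_vec n)"
  unfolding time_rate_def[abs_def] using measurable_mean measurable_\<chi>(2) by simp

lemma zero_line: "x \<in> carrier_vec n \<Longrightarrow> e \<in> carrier_vec n \<Longrightarrow> x + 0 \<cdot>\<^sub>v e = (x :: real vec)"
  by (intro eq_vecI) auto

lemma linear_line:
  "w \<in> carrier_vec n \<Longrightarrow> x \<in> carrier_vec n \<Longrightarrow> e \<in> carrier_vec n \<Longrightarrow> w \<bullet> (x + h \<cdot>\<^sub>v e) = w \<bullet> x + h * (w \<bullet> e :: real)"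
  by (subst scalar_prod_add_distrib[of _ n]) auto

context
  fixes x e :: "real vec"
  assumes x: "x \<in> carrier_vec n" and e: "e \<in> carrier_vec n"
begin

lemma add_zero_smult_vec [simp]: "x + 0 \<cdot>\<^sub>v e = x"
  by (rule zero_line[OF x e])

lemma DERIV_u:
  assumes "j < m" "i \<in> I j" "k < d j"
  shows "((\<lambda>h. u j i k t (x + h \<cdot>\<^sub>v e)) has_real_derivative v j i k \<bullet> e) (at 0)"
  unfolding u_def linear_line[OF v[OF assms] x e] by (auto intro!: derivative_eq_intros)

lemma DERIV_\<phi>:
  assumes "j < m" "i \<in> I j"
  shows "((\<lambda>h. \<phi> j i t (x + h \<cdot>\<^sub>v e)) has_real_derivative \<phi> j i t x * (- (2 * pi) * \<chi> j t x e i)) (at 0)"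
proof -
  have "((\<lambda>h. E j i t (x + h \<cdot>\<^sub>v e)) has_real_derivative (\<Sum>k<d j. 0 - pi * (g j i k t * (2 * u j i k t x * (v j i k \<bullet> e))))) (at 0)"
    unfolding E_def
  proof (intro DERIV_sum DERIV_diff DERIV_const DERIV_cmult)
    fix k assume "k \<in> {..<d j}"
    then show "((\<lambda>h. (u j i k t (x + h \<cdot>\<^sub>v e))\<^sup>2) has_real_derivative 2 * u j i k t x * (v j i k \<bullet> e)) (at 0)"
      using DERIV_power[OF DERIV_u[OF assms], of k t 2] by (simp add: mult_ac)
  qed
  also have "(\<Sum>k<d j. 0 - pi * (g j i k t * (2 * u j i k t x * (v j i k \<bullet> e)))) = - (2 * pi) * \<chi> j t x e i"
    unfolding \<chi>_def sum_distrib_left by (intro sum.cong refl) simp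
  finally have "((\<lambda>h. E j i t (x + h \<cdot>\<^sub>v e)) has_real_derivative - (2 * pi) * \<chi> j t x e i) (at 0)" .
  from DERIV_cmult[OF DERIV_fun_exp[OF this], of "\<omega> j i"] show ?thesis
    unfolding \<phi>_def by (simp add: mult_ac)
qed

lemma DERIV_F:
  assumes j: "j < m"
  shows "((\<lambda>h. F j t (x + h \<cdot>\<^sub>v e)) has_real_derivative - (2 * pi) * (\<Sum>i\<in>I j. \<phi> j i t x * \<chi> j t x e i)) (at 0)"
proof -
  have "((\<lambda>h. F j t (x + h \<cdot>\<^sub>v e)) has_real_derivative (\<Sum>i\<in>I j. \<phi> j i t x * (- (2 * pi) * \<chi> j t x e i))) (at 0)"
    unfolding F_def by (intro DERIV_sum DERIV_\<phi> j)
  then show ?thesis by (simp add: sum_distrib_left sum_negf mult_ac)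
qed

lemma DERIV_lnF:
  assumes j: "j < m"
  shows "((\<lambda>h. ln (F j t (x + h \<cdot>\<^sub>v e))) has_real_derivative - (2 * pi) * mean j t x (\<chi> j t x e)) (at 0)"
proof -
  have "(ln has_real_derivative inverse (F j t x)) (at (F j t (x + 0 \<cdot>\<^sub>v e)))"
    using DERIV_ln[OF F_pos[OF j]] by simp
  from DERIV_chain2[OF this DERIV_F[OF j]] show ?thesis
    by (simp add: mean_def field_simps)
qed

lemma qform_line: "qform Q (x + h \<cdot>\<^sub>v e) = qform Q x + 2 * h * (x \<bullet> (Q *\<^sub>v e)) + h\<^sup>2 * qform Q e"
  using qform_add[OF Q x, of "h \<cdot>\<^sub>v e"] qform_smult[OF self_adjointD(1)[OF Q] e] e x
    mult_mat_vec[OF self_adjointD(1)[OF Q] e] mult_mat_vec_carrier[OF self_adjointD(1)[OF Q] e]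
  by (simp add: scalar_prod_smult_right)

lemma DERIV_W: "((\<lambda>h. W t (x + h \<cdot>\<^sub>v e)) has_real_derivative W t x * \<Lambda> t x e) (at 0)"
proof -
  have "((\<lambda>h. - pi * qform Q (x + h \<cdot>\<^sub>v e)) has_real_derivative - pi * (2 * (x \<bullet> (Q *\<^sub>v e)))) (at 0)"
    unfolding qform_line by (auto intro!: derivative_eq_intros)
  moreover have "((\<lambda>h. \<Sum>j<m. c j * ln (F j t (x + h \<cdot>\<^sub>v e))) has_real_derivative (\<Sum>j<m. c j * (- (2 * pi) * mean j t x (\<chi> j t x e)))) (at 0)"
    by (intro DERIV_sum DERIV_cmult DERIV_lnF) simp
  ultimately have "((\<lambda>h. - pi * qform Q (x + h \<cdot>\<^sub>v e) + (\<Sum>j<m. c j * ln (F j t (x + h \<cdot>\<^sub>v e)))) has_real_derivative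
     - pi * (2 * (x \<bullet> (Q *\<^sub>v e))) + (\<Sum>j<m. c j * (- (2 * pi) * mean j t x (\<chi> j t x e)))) (at 0)"
    by (rule DERIV_add)
  also have "- pi * (2 * (x \<bullet> (Q *\<^sub>v e))) + (\<Sum>j<m. c j * (- (2 * pi) * mean j t x (\<chi> j t x e))) = \<Lambda> t x e"
  proof -
    have "(\<Sum>j<m. c j * (- (2 * pi) * mean j t x (\<chi> j t x e))) = - (2 * pi) * (\<Sum>j<m. c j * mean j t x (\<chi> j t x e))"
      unfolding sum_distrib_left by (intro sum.cong refl) simp
    then show ?thesis unfolding \<Lambda>_def by (simp add: algebra_simps)
  qed
  finally show ?thesis unfolding W_def using DERIV_fun_exp by fastforce
qed

lemma DERIV_\<chi>:
  assumes "j < m" "i \<in> I j"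
  shows "((\<lambda>h. \<chi> j t (x + h \<cdot>\<^sub>v e) e i) has_real_derivative \<kappa> j t e i) (at 0)"
proof -
  have "((\<lambda>h. \<chi> j t (x + h \<cdot>\<^sub>v e) e i) has_real_derivative (\<Sum>k<d j. g j i k t * (v j i k \<bullet> e) * (v j i k \<bullet> e))) (at 0)"
    unfolding \<chi>_def using assms by (intro DERIV_sum DERIV_cmult_right DERIV_cmult DERIV_u) auto
  then show ?thesis by (simp add: \<kappa>_def power2_eq_square mult_ac)
qed

lemma DERIV_mean_\<chi>:
  assumes j: "j < m"
  shows "((\<lambda>h. mean j t (x + h \<cdot>\<^sub>v e) (\<chi> j t (x + h \<cdot>\<^sub>v e) e)) has_real_derivative
     mean j t x (\<lambda>i. \<kappa> j t e i - 2 * pi * (\<chi> j t x e i)\<^sup>2) + 2 * pi * (mean j t x (\<chi> j t x e))\<^sup>2) (at 0)"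
proof -
  define N where "N = (\<Sum>i\<in>I j. \<phi> j i t x * \<chi> j t x e i)"
  define N' where "N' = (\<Sum>i\<in>I j. \<phi> j i t x * (\<kappa> j t e i - 2 * pi * (\<chi> j t x e i)\<^sup>2))"
  note Fp = F_pos[OF j, of t x]
  have "((\<lambda>h. \<Sum>i\<in>I j. \<phi> j i t (x + h \<cdot>\<^sub>v e) * \<chi> j t (x + h \<cdot>\<^sub>v e) e i) has_real_derivative
     (\<Sum>i\<in>I j. \<phi> j i t x * (- (2 * pi) * \<chi> j t x e i) * \<chi> j t x e i + \<kappa> j t e i * \<phi> j i t x)) (at 0)"
  proof (intro DERIV_sum)
    fix i assume i: "i \<in> I j"
    show "((\<lambda>h. \<phi> j i t (x + h \<cdot>\<^sub>v e) * \<chi> j t (x + h \<cdot>\<^sub>v e) e i) has_real_derivative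
     \<phi> j i t x * (- (2 * pi) * \<chi> j t x e i) * \<chi> j t x e i + \<kappa> j t e i * \<phi> j i t x) (at 0)"
      using DERIV_mult[OF DERIV_\<phi>[OF j i] DERIV_\<chi>[OF j i], of t t] by simp
  qed
  also have "(\<Sum>i\<in>I j. \<phi> j i t x * (- (2 * pi) * \<chi> j t x e i) * \<chi> j t x e i + \<kappa> j t e i * \<phi> j i t x) = N'"
    unfolding N'_def by (intro sum.cong refl) (simp add: power2_eq_square algebra_simps)
  finally have dN: "((\<lambda>h. \<Sum>i\<in>I j. \<phi> j i t (x + h \<cdot>\<^sub>v e) * \<chi> j t (x + h \<cdot>\<^sub>v e) e i) has_real_derivative N') (at 0)" .
  have "F j t (x + 0 \<cdot>\<^sub>v e) \<noteq> 0" using Fp by simp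
  from DERIV_divide[OF dN DERIV_F[OF j] this]
  have "((\<lambda>h. mean j t (x + h \<cdot>\<^sub>v e) (\<chi> j t (x + h \<cdot>\<^sub>v e) e)) has_real_derivative
     (N' * F j t x - N * (- (2 * pi) * N)) / (F j t x * F j t x)) (at 0)"
    by (simp add: mean_def N_def)
  moreover have "(N' * F j t x - N * (- (2 * pi) * N)) / (F j t x * F j t x) = N' / F j t x + 2 * pi * (N / F j t x)\<^sup>2"
    using Fp by (simp add: power2_eq_square add_divide_distrib)
  ultimately show ?thesis by (simp add: mean_def N_def N'_def)
qed

lemma DERIV_\<Lambda>: "((\<lambda>h. \<Lambda> t (x + h \<cdot>\<^sub>v e) e) has_real_derivative \<rho> t x e) (at 0)"
proof -
  have Qe: "Q *\<^sub>v e \<in> carrier_vec n" using mult_mat_vec_carrier[OF self_adjointD(1)[OF Q] e] .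
  have "(x + h \<cdot>\<^sub>v e) \<bullet> (Q *\<^sub>v e) = x \<bullet> (Q *\<^sub>v e) + h * qform Q e" for h
    using x e Qe by (subst add_scalar_prod_distrib[of _ n]) (auto simp: qform_def)
  then have "((\<lambda>h. (x + h \<cdot>\<^sub>v e) \<bullet> (Q *\<^sub>v e)) has_real_derivative qform Q e) (at 0)"
    by (auto intro!: derivative_eq_intros)
  then show ?thesis
    unfolding \<Lambda>_def \<rho>_def by (intro DERIV_cmult DERIV_add DERIV_sum DERIV_mean_\<chi>) auto
qed

end

lemma W_pos: "W t x > 0" by (simp add: W_def)

lemma integrable_W_mult:
  assumes t: "0 \<le> t" "t \<le> 1" and f: "exp_bounded n f" and m: "f t \<in> borel_measurable (borel_vec n)"
  shows "integrable (lborel_vec n) (\<lambda>x. W t x * f t x)"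
proof -
  obtain K where K: "K \<ge> 0" "\<And>t x. 0 \<le> t \<Longrightarrow> t \<le> 1 \<Longrightarrow> x \<in> carrier_vec n \<Longrightarrow> \<bar>W t x * f t x\<bar> \<le> K * exp (- \<delta> * (x \<bullet> x))"
    using W_mult_bound[OF f] by blast
  show ?thesis
  proof (rule Bochner_Integration.integrable_bound)
    show "integrable (lborel_vec n) (\<lambda>x. K * exp (- \<delta> * (x \<bullet> x)))" using integrable_exp_neg_norm[OF \<delta>] by simp
    show "(\<lambda>x. W t x * f t x) \<in> borel_measurable (lborel_vec n)"
      using borel_measurable_times[OF measurable_W m] by (simp cong: measurable_cong_sets)
    show "AE x in lborel_vec n. norm (W t x * f t x) \<le> norm (K * exp (- \<delta> * (x \<bullet> x)))"
      using K t by (intro AE_I2) auto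
  qed
qed

text \<open>\<Lambda>^2 + \<rho> is the second directional derivative of W divided by W, so the
  integrand is the derivative of W \<Lambda> along e.\<close>

lemma integral_W_second:
  assumes t: "0 \<le> t" "t \<le> 1" and e: "e \<in> carrier_vec n"
  shows "(LINT x|lborel_vec n. W t x * ((\<Lambda> t x e)\<^sup>2 + \<rho> t x e)) = 0"
proof -
  have eb: "exp_bounded n (\<lambda>t x. (\<Lambda> t x e)\<^sup>2 + \<rho> t x e)"
    by (intro exp_bounded_intros exp_bounded_\<Lambda> e)
  obtain K where K: "K \<ge> 0" "\<And>t x. 0 \<le> t \<Longrightarrow> t \<le> 1 \<Longrightarrow> x \<in> carrier_vec n \<Longrightarrow>
      \<bar>W t x * ((\<Lambda> t x e)\<^sup>2 + \<rho> t x e)\<bar> \<le> K * exp (- \<delta> * (x \<bullet> x))"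
    using W_mult_bound[OF eb] by blast
  show ?thesis
  proof (rule integral_directional_derivative_zero[OF e, where \<Phi> = "\<lambda>x. W t x * \<Lambda> t x e" and C = K and \<delta> = \<delta>])
    show "integrable (lborel_vec n) (\<lambda>x. W t x * \<Lambda> t x e)"
      by (rule integrable_W_mult[OF t exp_bounded_\<Lambda>(1)[OF e] measurable_\<Lambda>(1)[OF e]])
    show "(\<lambda>x. W t x * ((\<Lambda> t x e)\<^sup>2 + \<rho> t x e)) \<in> borel_measurable (lborel_vec n)"
      using measurable_W measurable_\<Lambda>[OF e] by (simp cong: measurable_cong_sets)
    fix x :: "real vec" assume x: "x \<in> carrier_vec n"
    show "((\<lambda>h. W t (x + h \<cdot>\<^sub>v e) * \<Lambda> t (x + h \<cdot>\<^sub>v e) e) has_real_derivative W t x * ((\<Lambda> t x e)\<^sup>2 + \<rho> t x e)) (at 0)"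
      using DERIV_mult[OF DERIV_W[OF x e] DERIV_\<Lambda>[OF x e], of t t] zero_line[OF x e]
      by (simp add: power2_eq_square algebra_simps)
    show "\<bar>W t x * ((\<Lambda> t x e)\<^sup>2 + \<rho> t x e)\<bar> \<le> K * exp (- \<delta> * (x \<bullet> x))" using K(2)[OF t x] .
  qed (use K \<delta> in auto)
qed

text \<open>The r-th term of div (x W): the integrand is the derivative of W x_r in the r-th
  coordinate direction.\<close>

lemma integral_W_coordinate:
  assumes t: "0 \<le> t" "t \<le> 1" and r: "r < n"
  shows "(LINT x|lborel_vec n. W t x * (1 + x $ r * \<Lambda> t x (unit_vec n r))) = 0"
proof -
  define e where "e = (unit_vec n r :: real vec)"
  have e: "e \<in> carrier_vec n" by (simp add: e_def)
  have xr: "x $ r = e \<bullet> x" if "x \<in> carrier_vec n" for x using that r by (simp add: e_def)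
  have eb1: "exp_bounded n (\<lambda>t x. x $ r)"
    by (rule exp_bounded_mono[OF exp_bounded_linear[OF e]]) (simp add: xr)
  have eb: "exp_bounded n (\<lambda>t x. 1 + x $ r * \<Lambda> t x e)"
    by (intro exp_bounded_intros exp_bounded_\<Lambda> e eb1)
  have mr: "(\<lambda>x. x $ r) \<in> borel_measurable (borel_vec n)" using r by (rule measurable_vec_index)
  obtain K where K: "K \<ge> 0" "\<And>t x. 0 \<le> t \<Longrightarrow> t \<le> 1 \<Longrightarrow> x \<in> carrier_vec n \<Longrightarrow>
      \<bar>W t x * (1 + x $ r * \<Lambda> t x e)\<bar> \<le> K * exp (- \<delta> * (x \<bullet> x))"
    using W_mult_bound[OF eb] by blast
  have "(LINT x|lborel_vec n. W t x * (1 + x $ r * \<Lambda> t x e)) = 0"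
  proof (rule integral_directional_derivative_zero[OF e, where \<Phi> = "\<lambda>x. W t x * x $ r" and C = K and \<delta> = \<delta>])
    show "integrable (lborel_vec n) (\<lambda>x. W t x * x $ r)"
      by (rule integrable_W_mult[OF t eb1 mr])
    show "(\<lambda>x. W t x * (1 + x $ r * \<Lambda> t x e)) \<in> borel_measurable (lborel_vec n)"
      using measurable_W measurable_\<Lambda>[OF e] mr by (simp cong: measurable_cong_sets)
    fix x :: "real vec" assume x: "x \<in> carrier_vec n"
    have "((\<lambda>h. (x + h \<cdot>\<^sub>v e) $ r) has_real_derivative 1) (at 0)"
    proof -
      have "(x + h \<cdot>\<^sub>v e) $ r = x $ r + h" for h using x r by (simp add: e_def)
      then show ?thesis by (auto intro!: derivative_eq_intros)
    qed
    from DERIV_mult[OF DERIV_W[OF x e] this, of t]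
    show "((\<lambda>h. W t (x + h \<cdot>\<^sub>v e) * (x + h \<cdot>\<^sub>v e) $ r) has_real_derivative W t x * (1 + x $ r * \<Lambda> t x e)) (at 0)"
      using zero_line[OF x e] by (simp add: algebra_simps)
    show "\<bar>W t x * (1 + x $ r * \<Lambda> t x e)\<bar> \<le> K * exp (- \<delta> * (x \<bullet> x))" using K(2)[OF t x] .
  qed (use K \<delta> in auto)
  then show ?thesis by (simp add: e_def)
qed

lemma unit_vec_expansion: "w \<in> carrier_vec n \<Longrightarrow> x \<in> carrier_vec n \<Longrightarrow> (\<Sum>r<n. x $ r * (w \<bullet> unit_vec n r)) = w \<bullet> (x :: real vec)"
  by (auto simp: scalar_prod_def[of w x] lessThan_atLeast0 mult.commute intro!: sum.cong)

lemma \<Lambda>_expansion: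
  assumes x: "x \<in> carrier_vec n"
  shows "(\<Sum>r<n. x $ r * \<Lambda> t x (unit_vec n r)) = \<Lambda> t x x"
proof -
  have Qx: "Q *\<^sub>v x \<in> carrier_vec n" using mult_mat_vec_carrier[OF self_adjointD(1)[OF Q] x] .
  have *: "(\<Sum>r<n. x $ r * \<chi> j t x (unit_vec n r) i) = \<chi> j t x x i" if "j < m" "i \<in> I j" for j i
  proof -
    have "(\<Sum>r<n. x $ r * \<chi> j t x (unit_vec n r) i) = (\<Sum>k<d j. \<Sum>r<n. g j i k t * u j i k t x * (x $ r * (v j i k \<bullet> unit_vec n r)))"
      unfolding \<chi>_def sum_distrib_left by (subst sum.swap) (simp add: mult_ac)
    also have "\<dots> = \<chi> j t x x i"
      unfolding \<chi>_def sum_distrib_left[symmetric] using unit_vec_expansion[OF v[OF that] x] by (intro sum.cong refl) simp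
    finally show ?thesis .
  qed
  have mean: "(\<Sum>r<n. x $ r * mean j t x (\<chi> j t x (unit_vec n r))) = mean j t x (\<chi> j t x x)" if "j < m" for j
  proof -
    have "(\<Sum>r<n. x $ r * mean j t x (\<chi> j t x (unit_vec n r))) = (\<Sum>r<n. \<Sum>i\<in>I j. \<phi> j i t x * (x $ r * \<chi> j t x (unit_vec n r) i)) / F j t x"
      unfolding mean_def sum_divide_distrib sum_distrib_left by (simp add: mult_ac)
    also have "(\<Sum>r<n. \<Sum>i\<in>I j. \<phi> j i t x * (x $ r * \<chi> j t x (unit_vec n r) i)) = (\<Sum>i\<in>I j. \<phi> j i t x * (\<Sum>r<n. x $ r * \<chi> j t x (unit_vec n r) i))"
      by (subst sum.swap) (simp add: sum_distrib_left)
    also have "\<dots> = (\<Sum>i\<in>I j. \<phi> j i t x * \<chi> j t x x i)" using * that by (intro sum.cong refl) simp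
    finally show ?thesis by (simp add: mean_def)
  qed
  have q: "(\<Sum>r<n. x $ r * (x \<bullet> (Q *\<^sub>v unit_vec n r))) = x \<bullet> (Q *\<^sub>v x)"
  proof -
    have "x \<bullet> (Q *\<^sub>v unit_vec n r) = (Q *\<^sub>v x) \<bullet> unit_vec n r" for r
      using symmetric_bilinear[OF self_adjointD[OF Q] x unit_vec_carrier] Qx by (metis comm_scalar_prod unit_vec_carrier)
    then show ?thesis using unit_vec_expansion[OF Qx x] Qx x by (simp add: comm_scalar_prod[of x n])
  qed
  have "(\<Sum>r<n. x $ r * \<Lambda> t x (unit_vec n r)) =
    - (2 * pi) * ((\<Sum>r<n. x $ r * (x \<bullet> (Q *\<^sub>v unit_vec n r))) + (\<Sum>r<n. \<Sum>j<m. c j * (x $ r * mean j t x (\<chi> j t x (unit_vec n r)))))"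
    unfolding \<Lambda>_def sum.distrib[symmetric] sum_distrib_left by (intro sum.cong refl) (simp add: sum_distrib_left algebra_simps)
  also have "(\<Sum>r<n. \<Sum>j<m. c j * (x $ r * mean j t x (\<chi> j t x (unit_vec n r)))) = (\<Sum>j<m. c j * mean j t x (\<chi> j t x x))"
    by (subst sum.swap) (simp add: sum_distrib_left[symmetric] mean)
  finally show ?thesis unfolding q \<Lambda>_def .
qed

text \<open>The logistic equation governs g, and u changes at rate a / (2 sqrt (1-t)). Substituting
  sqrt (1-t) a = v . x - u removes the center from the result, which is why the centers shrink like
  sqrt (1-t).\<close>

lemma DERIV_time_\<phi>:
  assumes j: "j < m" "i \<in> I j" and t: "0 < t" "t < 1"
  shows "((\<lambda>t. \<phi> j i t x) has_real_derivative \<phi> j i t x * (\<theta> j t x i / (2 * (1 - t)))) (at t)"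
proof -
  have "((\<lambda>t. ln (g j i k t) / 2 - pi * (g j i k t * (u j i k t x)\<^sup>2)) has_real_derivative
     ((1 - g j i k t) + 2 * pi * (g j i k t * u j i k t x)\<^sup>2 - 2 * pi * (g j i k t * u j i k t x * (v j i k \<bullet> x))) / (2 * (1 - t))) (at t)"
    if k: "k < d j" for k
  proof -
    define G where "G = g j i k t"
    define U where "U = u j i k t x"
    define s where "s = sqrt (1 - t)"
    have s: "s > 0" "s\<^sup>2 = 1 - t" using t by (auto simp: s_def)
    have Gp: "G > 0" unfolding G_def using g_pos[OF j k] t by simp
    have dg: "(g j i k has_real_derivative G * (1 - G) / (1 - t)) (at t)"
      unfolding g_def[abs_def] G_def using interp_DERIV[OF \<gamma>_pos[OF j k] t] by (simp add: eta_contract_eq g_def)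
    have du: "((\<lambda>t. u j i k t x) has_real_derivative a j i k / (2 * s)) (at t)"
      unfolding u_def s_def using t by (auto intro!: derivative_eq_intros simp: field_simps)
    have dln: "((\<lambda>t. ln (g j i k t)) has_real_derivative inverse G * (G * (1 - G) / (1 - t))) (at t)"
      using DERIV_chain2[OF DERIV_ln[OF Gp[unfolded G_def]] dg] by (simp add: G_def)
    have du2: "((\<lambda>t. (u j i k t x)\<^sup>2) has_real_derivative 2 * U * (a j i k / (2 * s))) (at t)"
      using DERIV_power[OF du, of 2] by (simp add: U_def mult.commute)
    have "((\<lambda>t. ln (g j i k t) / 2 - pi * (g j i k t * (u j i k t x)\<^sup>2)) has_real_derivative
      inverse G * (G * (1 - G) / (1 - t)) / 2 - pi * (G * (1 - G) / (1 - t) * U\<^sup>2 + 2 * U * (a j i k / (2 * s)) * G)) (at t)"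
      using DERIV_diff[OF DERIV_cdivide[OF dln, of 2] DERIV_cmult[OF DERIV_mult[OF dg du2], of pi]] by (simp add: G_def U_def)
    also have "inverse G * (G * (1 - G) / (1 - t)) / 2 - pi * (G * (1 - G) / (1 - t) * U\<^sup>2 + 2 * U * (a j i k / (2 * s)) * G) =
      (G * (1 - G) / (1 - t)) / G / 2 - pi * (G * (1 - G) / (1 - t) * U\<^sup>2 + G * (2 * U * (a j i k / (2 * s))))"
    proof -
      have "inverse G * X = X / G" for X by (simp add: divide_inverse mult.commute)
      then show ?thesis by (simp only: mult.commute[of "2 * U * (a j i k / (2 * s))" G])
    qed
    also have "(G * (1 - G) / (1 - t)) / G / 2 - pi * (G * (1 - G) / (1 - t) * U\<^sup>2 + G * (2 * U * (a j i k / (2 * s)))) =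
       ((1 - G) + 2 * pi * (G * U)\<^sup>2 - 2 * pi * (G * U * (v j i k \<bullet> x))) / (2 * (1 - t))"
    proof -
      have as: "a j i k / (2 * s) = (s * a j i k) / (2 * (1 - t))" using s by (simp add: s(2)[symmetric] power2_eq_square)
      have vx: "v j i k \<bullet> x = U + s * a j i k" by (simp add: U_def u_def s_def)
      have "(1 - G) * r - pi * (G * (1 - G) * (2 * r) * U\<^sup>2 + G * (2 * U * (S * r))) =
          ((1 - G) + 2 * pi * (G * U)\<^sup>2 - 2 * pi * (G * U * (U + S))) * r" for S r
        by (simp add: power2_eq_square algebra_simps)
      moreover define r where "r = 1 / (2 * (1 - t))"
      have "X / (1 - t) = X * (2 * r)" "X / (2 * (1 - t)) = X * r" for X using t by (simp_all add: r_def field_simps)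
      moreover have "G * (1 - G) * (2 * r) / G / 2 = (1 - G) * r" using Gp by simp
      ultimately show ?thesis unfolding as vx by (simp only:)
    qed
    finally show ?thesis by (simp add: G_def U_def)
  qed
  then have "((\<lambda>t. E j i t x) has_real_derivative (\<Sum>k<d j. ((1 - g j i k t) + 2 * pi * (g j i k t * u j i k t x)\<^sup>2 - 2 * pi * (g j i k t * u j i k t x * (v j i k \<bullet> x))) / (2 * (1 - t)))) (at t)"
    unfolding E_def by (intro DERIV_sum) simp
  then have "((\<lambda>t. E j i t x) has_real_derivative \<theta> j t x i / (2 * (1 - t))) (at t)"
    by (simp add: \<theta>_def sum_divide_distrib)
  from DERIV_cmult[OF DERIV_fun_exp[OF this], of "\<omega> j i"] show ?thesis
    unfolding \<phi>_def by (simp add: mult_ac)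
qed

lemma DERIV_time_W:
  assumes t: "0 < t" "t < 1"
  shows "((\<lambda>t. W t x) has_real_derivative W t x * time_rate t x / (2 * (1 - t))) (at t)"
proof -
  have "((\<lambda>t. c j * ln (F j t x)) has_real_derivative c j * mean j t x (\<theta> j t x) / (2 * (1 - t))) (at t)" if j: "j < m" for j
  proof -
    have "((\<lambda>t. F j t x) has_real_derivative (\<Sum>i\<in>I j. \<phi> j i t x * (\<theta> j t x i / (2 * (1 - t))))) (at t)"
      unfolding F_def by (intro DERIV_sum DERIV_time_\<phi> j t)
    from DERIV_cmult[OF DERIV_chain2[OF DERIV_ln[OF F_pos[OF j]] this], of "c j"]
    show ?thesis using F_pos[OF j, of t x] by (simp add: mean_def sum_divide_distrib sum_distrib_left mult_ac divide_inverse)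
  qed
  then have "((\<lambda>t. - pi * qform Q x + (\<Sum>j<m. c j * ln (F j t x))) has_real_derivative 0 + (\<Sum>j<m. c j * mean j t x (\<theta> j t x) / (2 * (1 - t)))) (at t)"
    by (intro DERIV_add DERIV_const DERIV_sum) simp
  then have "((\<lambda>t. - pi * qform Q x + (\<Sum>j<m. c j * ln (F j t x))) has_real_derivative time_rate t x / (2 * (1 - t))) (at t)"
    by (simp add: time_rate_def sum_divide_distrib)
  from DERIV_fun_exp[OF this] show ?thesis unfolding W_def by simp
qed

lemma continuous_on_time_W: "continuous_on {0..1} (\<lambda>t. W t x)"
proof -
  have g: "continuous_on {0..1} (g j i k)" if "j < m" "i \<in> I j" "k < d j" for j i k
    unfolding g_def[abs_def] interp_def using interp_denom_pos[OF \<gamma>_pos[OF that]]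
    by (intro continuous_intros) (auto simp: less_imp_neq[symmetric] intro: less_imp_neq[symmetric])
  have "g j i k t \<noteq> 0" if "j < m" "i \<in> I j" "k < d j" "t \<in> {0..1}" for j i k t
    using g_pos[OF that(1-3), of t] that(4) by simp
  then have "continuous_on {0..1} (\<lambda>t. F j t x)" if "j < m" for j
    unfolding F_def \<phi>_def E_def u_def using that g by (intro continuous_intros) auto
  then show ?thesis unfolding W_def using F_pos by (intro continuous_intros) (auto simp: less_imp_neq[symmetric])
qed

lemma integrable_W: "0 \<le> t \<Longrightarrow> t \<le> 1 \<Longrightarrow> integrable (lborel_vec n) (W t)"
  using integrable_W_mult[OF _ _ exp_bounded_const[of n 1], of t] by simp

text \<open>The time derivative is available only on the open interval, its factor 1/(1-t) being
  singular at the end; continuity brings in the endpoints.\<close>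

lemma continuous_on_integral_W: "continuous_on {0..1} (\<lambda>t. LINT x|lborel_vec n. W t x)"
proof -
  obtain K where K: "K \<ge> 0" "\<And>t x. 0 \<le> t \<Longrightarrow> t \<le> 1 \<Longrightarrow> x \<in> carrier_vec n \<Longrightarrow> \<bar>W t x * 1\<bar> \<le> K * exp (- \<delta> * (x \<bullet> x))"
    using W_mult_bound[OF exp_bounded_const[of n 1]] by blast
  show ?thesis
    unfolding continuous_on_sequentially
  proof (intro allI ballI impI)
    fix X :: "nat \<Rightarrow> real" and s assume s: "s \<in> {0..1}" and X: "(\<forall>i. X i \<in> {0..1}) \<and> X \<longlonglongrightarrow> s"
    show "((\<lambda>t. LINT x|lborel_vec n. W t x) \<circ> X) \<longlonglongrightarrow> (LINT x|lborel_vec n. W s x)"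
      unfolding comp_def
    proof (rule integral_dominated_convergence[where w = "\<lambda>x. K * exp (- \<delta> * (x \<bullet> x))"])
      show "AE x in lborel_vec n. (\<lambda>i. W (X i) x) \<longlonglongrightarrow> W s x"
        using continuous_on_time_W s X by (intro AE_I2) (auto simp: continuous_on_sequentially comp_def)
      show "AE x in lborel_vec n. norm (W (X i) x) \<le> K * exp (- \<delta> * (x \<bullet> x))" for i
        using K(2)[of "X i"] X by (intro AE_I2) simp
    qed (use measurable_W integrable_exp_neg_norm[OF \<delta>] in \<open>auto cong: measurable_cong_sets\<close>)
  qed
qed

text \<open>W times the right-hand side of \<open>ineq\<close> is div (x W) plus 1/(2 pi) times the
  second derivatives of W along the l_k, and its integral vanishes. As W > 0, the integral of W *
  \<open>time_rate\<close> is nonpositive, and the mean value theorem concludes.\<close>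

theorem integral_W_decreasing:
  assumes l: "\<And>k. k < n \<Longrightarrow> l k \<in> carrier_vec n"
    and ineq: "\<And>t x. 0 < t \<Longrightarrow> t < 1 \<Longrightarrow> x \<in> carrier_vec n \<Longrightarrow>
      time_rate t x \<le> n + \<Lambda> t x x + (1 / (2 * pi)) * (\<Sum>k<n. (\<Lambda> t x (l k))\<^sup>2 + \<rho> t x (l k))"
  shows "(LINT x|lborel_vec n. W 1 x) \<le> (LINT x|lborel_vec n. W 0 x)"
proof -
  define N where "N t = (LINT x|lborel_vec n. W t x)" for t
  have deriv: "(N has_real_derivative (LINT x|lborel_vec n. W t x * time_rate t x / (2 * (1 - t)))) (at t)" if t: "0 < t" "t < 1" for t
  proof -
    \<comment> \<open>The midpoint between t and 1; on (0, b) the factor 1/(1-s) is bounded, as a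
      common majorant requires.\<close>
    define b where "b = (1 + t) / 2"
    have b: "t < b" "b < 1" using t by (auto simp: b_def)
    obtain K where K: "K \<ge> 0" "\<And>t x. 0 \<le> t \<Longrightarrow> t \<le> 1 \<Longrightarrow> x \<in> carrier_vec n \<Longrightarrow> \<bar>W t x * time_rate t x\<bar> \<le> K * exp (- \<delta> * (x \<bullet> x))"
      using W_mult_bound[OF exp_bounded_time_rate] by blast
    show ?thesis
      unfolding N_def[abs_def]
    proof (rule DERIV_lebesgue_integral[where a = 0 and b = b and D = "\<lambda>x. K / (2 * (1 - b)) * exp (- \<delta> * (x \<bullet> x))"])
      show "integrable (lborel_vec n) (W s)" if "0 < s" "s < b" for s using integrable_W[of s] that b by simp
      show "((\<lambda>s. W s x) has_real_derivative W s x * time_rate s x / (2 * (1 - s))) (at s)" if "0 < s" "s < b" for s x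
        using DERIV_time_W[of s x] that b by simp
      show "\<bar>W s x * time_rate s x / (2 * (1 - s))\<bar> \<le> K / (2 * (1 - b)) * exp (- \<delta> * (x \<bullet> x))"
        if "0 < s" "s < b" "x \<in> space (lborel_vec n)" for s x
      proof -
        have "\<bar>W s x * time_rate s x / (2 * (1 - s))\<bar> = \<bar>W s x * time_rate s x\<bar> / (2 * (1 - s))"
          using that b by (simp add: abs_divide)
        also have "\<dots> \<le> (K * exp (- \<delta> * (x \<bullet> x))) / (2 * (1 - b))"
          using K that b by (intro frac_le) auto
        finally show ?thesis by simp
      qed
      show "(\<lambda>x. W t x * time_rate t x / (2 * (1 - t))) \<in> borel_measurable (lborel_vec n)"
        using measurable_W measurable_time_rate by (simp cong: measurable_cong_sets)
    qed (use t b integrable_exp_neg_norm[OF \<delta>] in auto)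
  qed
  have nonpos: "(LINT x|lborel_vec n. W t x * time_rate t x / (2 * (1 - t))) \<le> 0" if t: "0 < t" "t < 1" for t
  proof -
    have t': "0 \<le> t" "t \<le> 1" using t by auto
    define R where "R x = (\<Sum>r<n. W t x * (1 + x $ r * \<Lambda> t x (unit_vec n r))) +
        (1 / (2 * pi)) * (\<Sum>k<n. W t x * ((\<Lambda> t x (l k))\<^sup>2 + \<rho> t x (l k)))" for x
    have eb1: "exp_bounded n (\<lambda>t x. x $ r)" if "r < n" for r
      by (rule exp_bounded_mono[OF exp_bounded_linear[of "unit_vec n r"]]) (use that in auto)
    have i1: "integrable (lborel_vec n) (\<lambda>x. W t x * (1 + x $ r * \<Lambda> t x (unit_vec n r)))" if "r < n" for r
      by (rule integrable_W_mult[OF t'])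
         (use that in \<open>auto intro!: exp_bounded_intros exp_bounded_\<Lambda> eb1 borel_measurable_add borel_measurable_times measurable_\<Lambda> measurable_vec_index\<close>)
    have i2: "integrable (lborel_vec n) (\<lambda>x. W t x * ((\<Lambda> t x (l k))\<^sup>2 + \<rho> t x (l k)))" if "k < n" for k
      by (rule integrable_W_mult[OF t'])
         (use l[OF that] in \<open>auto intro!: exp_bounded_intros exp_bounded_\<Lambda> borel_measurable_add borel_measurable_power measurable_\<Lambda>\<close>)
    have s1: "(LINT x|lborel_vec n. (\<Sum>r<n. W t x * (1 + x $ r * \<Lambda> t x (unit_vec n r)))) = 0"
      using i1 integral_W_coordinate[OF t'] by (subst Bochner_Integration.integral_sum) auto
    have s2: "(LINT x|lborel_vec n. (\<Sum>k<n. W t x * ((\<Lambda> t x (l k))\<^sup>2 + \<rho> t x (l k)))) = 0"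
      using i2 integral_W_second[OF t' l] by (subst Bochner_Integration.integral_sum) auto
    have "(LINT x|lborel_vec n. R x) = 0"
      unfolding R_def by (subst Bochner_Integration.integral_add)
        (use i1 i2 s1 s2 in \<open>auto intro!: integrable_mult_right Bochner_Integration.integrable_sum simp del: Bochner_Integration.integral_sum\<close>)
    moreover have "integrable (lborel_vec n) R"
      unfolding R_def using i1 i2
      by (intro Bochner_Integration.integrable_add integrable_mult_right Bochner_Integration.integrable_sum) auto
    moreover have "W t x * time_rate t x \<le> R x" if x: "x \<in> carrier_vec n" for x
    proof -
      have "R x = W t x * (n + \<Lambda> t x x + (1 / (2 * pi)) * (\<Sum>k<n. (\<Lambda> t x (l k))\<^sup>2 + \<rho> t x (l k)))"
        unfolding R_def sum_distrib_left[symmetric] sum.distrib \<Lambda>_expansion[OF x] by (simp add: algebra_simps)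
      then show ?thesis using ineq[OF t x] W_pos[of t x] by simp
    qed
    moreover have "integrable (lborel_vec n) (\<lambda>x. W t x * time_rate t x)"
      by (rule integrable_W_mult[OF t' exp_bounded_time_rate measurable_time_rate])
    ultimately have "(LINT x|lborel_vec n. W t x * time_rate t x) \<le> 0"
      by (metis (no_types, lifting) integral_mono space_lborel_vec)
    then show ?thesis using t by (simp add: divide_nonpos_pos)
  qed
  obtain r z where z: "0 < z" "z < 1" "(N has_real_derivative r) (at z)" "N 1 - N 0 = (1 - 0) * r"
  proof -
    have "continuous_on {0..1} N" using continuous_on_integral_W by (simp add: N_def[abs_def])
    moreover have "N differentiable (at t)" if "0 < t" "t < 1" for t
      using deriv[OF that] unfolding real_differentiable_def by blast
    ultimately show ?thesis using MVT[of 0 1 N] that by (auto simp: N_def[symmetric])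
  qed
  have "r \<le> 0" using DERIV_unique[OF z(3) deriv[OF z(1,2)]] nonpos[OF z(1,2)] by simp
  then show ?thesis using z(4) by (simp add: N_def)
qed

end

section \<open>Pointwise comparison of the time derivative with a divergence\<close>

definition outer :: "nat \<Rightarrow> real vec \<Rightarrow> real mat" where
  "outer n e = mat n n (\<lambda>(r, s). e $ r * e $ s)"

lemma outer_index [simp]: "r < n \<Longrightarrow> s < n \<Longrightarrow> outer n e $$ (r, s) = e $ r * e $ s"
  by (simp add: outer_def)

lemma frobenius_outer: "A \<in> carrier_mat n n \<Longrightarrow> e \<in> carrier_vec n \<Longrightarrow> frobenius n A (outer n e) = qform A e"
  by (simp add: frobenius_def qform_sum mult_ac)

lemma frobenius_outer_left: "A \<in> carrier_mat n n \<Longrightarrow> e \<in> carrier_vec n \<Longrightarrow> frobenius n (outer n e) A = qform A e"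
  by (simp add: frobenius_def qform_sum mult_ac)

lemma qform_outer:
  assumes "e \<in> carrier_vec n" "b \<in> carrier_vec n"
  shows "qform (outer n e) b = (e \<bullet> b)\<^sup>2"
proof -
  have "qform (outer n e) b = (\<Sum>r<n. \<Sum>s<n. (e $ r * b $ r) * (e $ s * b $ s))"
    using assms by (subst qform_sum[of _ n]) (auto simp: outer_def mult_ac)
  then show ?thesis using assms by (simp add: scalar_prod_def lessThan_atLeast0 power2_eq_square sum_product)
qed

lemma frobenius_diff:
  assumes "H \<in> carrier_mat n n" "K \<in> carrier_mat n n"
  shows "frobenius n X (H - K) = frobenius n X H - frobenius n X K"
  using assms by (simp add: frobenius_def right_diff_distrib sum_subtractf)

lemma gram_frame:
  assumes "R \<in> carrier_mat k k" "L \<in> carrier_mat k k" "R * L = 1\<^sub>m k" "i < k"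
  shows "col L i \<in> carrier_vec k" "qform (transpose_mat R * diag_of k g * R) (col L i) = g i"
proof -
  show c: "col L i \<in> carrier_vec k" using assms by auto
  have RL: "R *\<^sub>v col L i = unit_vec k i" using assms col_mult2[of R k k L k i] by simp
  have "qform (transpose_mat R * diag_of k g * R) (col L i) = (\<Sum>q<k. if q = i then g q else 0)"
    unfolding qform_congruence_diag[OF assms(1) c] RL using assms(4) by (intro sum.cong) (auto simp: unit_vec_def)
  then show "qform (transpose_mat R * diag_of k g * R) (col L i) = g i" using assms(4) by simp
qed

text \<open>The scalar data now come from matrices: A_j = R^T R in a frame that may depend on the
  component, \<open>v\<close> consists of the rows of R B_j, and the l_k are vectors of M-length 1,
  in the application the columns of the inverse of a matrix R with M = R^T R. The assumptions
  \<open>signature\<close> and \<open>variation\<close> are the quadratic-form inequality and the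
  first-order condition at the minimizer.\<close>

locale framed_mixtures = gaussian_mixtures n m d c Q I \<omega> \<gamma> v a \<gamma>0 v0 \<delta>
  for n m :: nat and d :: "nat \<Rightarrow> nat" and c :: "nat \<Rightarrow> real" and Q :: "real mat"
    and I :: "nat \<Rightarrow> 'i set" and \<omega> \<gamma> v a \<gamma>0 v0 \<delta> +
  fixes B A G :: "nat \<Rightarrow> real mat" and R L :: "nat \<Rightarrow> 'i \<Rightarrow> real mat" and l :: "nat \<Rightarrow> real vec"
  assumes B: "\<And>j. j < m \<Longrightarrow> B j \<in> carrier_mat (d j) n"
    and A: "\<And>j. j < m \<Longrightarrow> A j \<in> positive_definite (d j)"
    and R: "\<And>j i. j < m \<Longrightarrow> i \<in> I j \<Longrightarrow> R j i \<in> carrier_mat (d j) (d j)"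
    and L: "\<And>j i. j < m \<Longrightarrow> i \<in> I j \<Longrightarrow> L j i \<in> carrier_mat (d j) (d j)"
    and RL: "\<And>j i. j < m \<Longrightarrow> i \<in> I j \<Longrightarrow> R j i * L j i = 1\<^sub>m (d j)"
    and AR: "\<And>j i. j < m \<Longrightarrow> i \<in> I j \<Longrightarrow> A j = transpose_mat (R j i) * R j i"
    and vB: "\<And>j i k x. j < m \<Longrightarrow> i \<in> I j \<Longrightarrow> k < d j \<Longrightarrow> x \<in> carrier_vec n \<Longrightarrow> v j i k \<bullet> x = (R j i *\<^sub>v (B j *\<^sub>v x)) $ k"
    and comp_le: "\<And>j i y. j < m \<Longrightarrow> i \<in> I j \<Longrightarrow> y \<in> carrier_vec (d j) \<Longrightarrow> (\<Sum>k<d j. \<gamma> j i k * ((R j i *\<^sub>v y) $ k)\<^sup>2) \<le> qform (G j) y"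
    and A_le: "\<And>j y. j < m \<Longrightarrow> y \<in> carrier_vec (d j) \<Longrightarrow> qform (A j) y \<le> qform (G j) y"
    and l: "\<And>k. k < n \<Longrightarrow> l k \<in> carrier_vec n"
    and l_unit: "\<And>k. k < n \<Longrightarrow> qform Q (l k) + (\<Sum>j<m. c j * qform (A j) (B j *\<^sub>v l k)) = 1"
    and signature: "\<And>x \<eta>. x \<in> carrier_vec n \<Longrightarrow> (\<And>j. j < m \<Longrightarrow> \<eta> j \<in> carrier_vec (d j)) \<Longrightarrow>
      qform Q x + (\<Sum>j<m. c j * qform (pd_inverse (d j) (A j)) (\<eta> j)) \<le>
      (\<Sum>k<n. (l k \<bullet> (Q *\<^sub>v x) + (\<Sum>j<m. c j * ((B j *\<^sub>v l k) \<bullet> \<eta> j)))\<^sup>2)"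
    and variation: "\<And>H. (\<And>j. j < m \<Longrightarrow> H j \<in> self_adjoint (d j)) \<Longrightarrow>
      (\<And>j x. j < m \<Longrightarrow> x \<in> carrier_vec (d j) \<Longrightarrow> qform (A j) x + qform (H j) x \<le> qform (G j) x) \<Longrightarrow>
      (\<Sum>k<n. \<Sum>j<m. c j * qform (H j) (B j *\<^sub>v l k)) \<le> (\<Sum>j<m. c j * frobenius (d j) (pd_inverse (d j) (A j)) (H j))"
begin

context
  fixes t :: real and x :: "real vec"
  assumes t: "0 < t" "t < 1" and x: "x \<in> carrier_vec n"
begin

text \<open>-2 pi \<open>hv\<close> is the gradient on R^(d_j) of the logarithm of component i at
  B_j x, and -2 pi \<open>\<eta>\<close> is that of log F_j. Likewise -2 pi \<open>K\<close> is the
  Hessian of log F_j: the average of the inverse covariances \<open>Gt\<close> minus 2 pi times the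
  covariance of \<open>hv\<close> over the components.\<close>

definition hv where "hv j i = transpose_mat (R j i) *\<^sub>v vec (d j) (\<lambda>k. g j i k t * u j i k t x)"
definition Gt where "Gt j i = transpose_mat (R j i) * diag_of (d j) (\<lambda>k. g j i k t) * R j i"
definition p where "p j i = \<phi> j i t x / F j t x"
definition \<eta> where "\<eta> j = vec (d j) (\<lambda>r. \<Sum>i\<in>I j. p j i * hv j i $ r)"
definition K where "K j = mat (d j) (d j) (\<lambda>(r, s). \<Sum>i\<in>I j. p j i * (Gt j i $$ (r, s) - 2 * pi * outer (d j) (hv j i - \<eta> j) $$ (r, s)))"
definition Ai where "Ai j = pd_inverse (d j) (A j)"

lemma hv: "j < m \<Longrightarrow> i \<in> I j \<Longrightarrow> hv j i \<in> carrier_vec (d j)"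
  unfolding hv_def by (rule mult_mat_vec_carrier[of _ _ "d j"]) (use R in auto)

lemma \<eta>: "\<eta> j \<in> carrier_vec (d j)" by (simp add: \<eta>_def)

lemma Gt: "j < m \<Longrightarrow> i \<in> I j \<Longrightarrow> Gt j i \<in> self_adjoint (d j)"
  unfolding Gt_def by (rule congruence_diag_self_adjoint[OF R])

lemma p_nonneg: "j < m \<Longrightarrow> i \<in> I j \<Longrightarrow> p j i \<ge> 0"
  unfolding p_def using \<phi>_nonneg F_pos by (simp add: less_imp_le)

lemma p_sum: "j < m \<Longrightarrow> (\<Sum>i\<in>I j. p j i) = 1"
  unfolding p_def sum_divide_distrib[symmetric] F_def[symmetric] using F_pos[of j t x] by simp

lemma mean_p: "mean j t x X = (\<Sum>i\<in>I j. p j i * X i)"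
  by (simp add: mean_def p_def sum_divide_distrib)

lemma hv_scalar_prod:
  assumes "j < m" "i \<in> I j" "b \<in> carrier_vec (d j)"
  shows "hv j i \<bullet> b = (\<Sum>k<d j. g j i k t * u j i k t x * (R j i *\<^sub>v b) $ k)"
proof -
  have "hv j i \<bullet> b = vec (d j) (\<lambda>k. g j i k t * u j i k t x) \<bullet> (R j i *\<^sub>v b)"
    unfolding hv_def by (rule transpose_vec_mult_scalar[OF R[OF assms(1,2)] assms(3)]) simp
  then show ?thesis using carrier_matD(1)[OF R[OF assms(1,2)]]
    by (simp add: scalar_prod_def lessThan_atLeast0 del: index_mult_mat_vec)
qed

lemma \<chi>_hv: "j < m \<Longrightarrow> i \<in> I j \<Longrightarrow> e \<in> carrier_vec n \<Longrightarrow> \<chi> j t x e i = hv j i \<bullet> (B j *\<^sub>v e)"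
  unfolding \<chi>_def by (subst hv_scalar_prod) (auto simp: vB mult_mat_vec_carrier[OF B] simp del: index_mult_mat_vec)

lemma qform_Gt: "j < m \<Longrightarrow> i \<in> I j \<Longrightarrow> b \<in> carrier_vec (d j) \<Longrightarrow> qform (Gt j i) b = (\<Sum>k<d j. g j i k t * ((R j i *\<^sub>v b) $ k)\<^sup>2)"
  unfolding Gt_def by (rule qform_congruence_diag[OF R])

lemma \<kappa>_Gt: "j < m \<Longrightarrow> i \<in> I j \<Longrightarrow> e \<in> carrier_vec n \<Longrightarrow> \<kappa> j t e i = qform (Gt j i) (B j *\<^sub>v e)"
  unfolding \<kappa>_def by (subst qform_Gt) (auto simp: vB mult_mat_vec_carrier[OF B] simp del: index_mult_mat_vec)

lemma \<eta>_scalar_prod: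
  assumes "j < m" "b \<in> carrier_vec (d j)"
  shows "\<eta> j \<bullet> b = (\<Sum>i\<in>I j. p j i * (hv j i \<bullet> b))"
proof -
  have "\<eta> j \<bullet> b = (\<Sum>r<d j. \<Sum>i\<in>I j. p j i * (hv j i $ r * b $ r))"
    using assms by (simp add: \<eta>_def scalar_prod_def lessThan_atLeast0 sum_distrib_left sum_distrib_right mult_ac)
  also have "\<dots> = (\<Sum>i\<in>I j. p j i * (hv j i \<bullet> b))"
    using assms by (subst sum.swap) (simp add: scalar_prod_def lessThan_atLeast0 sum_distrib_left)
  finally show ?thesis .
qed

lemma mean_\<chi>_\<eta>: "j < m \<Longrightarrow> e \<in> carrier_vec n \<Longrightarrow> mean j t x (\<chi> j t x e) = \<eta> j \<bullet> (B j *\<^sub>v e)"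
  by (simp add: mean_p \<eta>_scalar_prod[OF _ mult_mat_vec_carrier[OF B]] \<chi>_hv)

lemma frobenius_K:
  assumes j: "j < m"
  shows "frobenius (d j) X (K j) = (\<Sum>i\<in>I j. p j i * (frobenius (d j) X (Gt j i) - 2 * pi * frobenius (d j) X (outer (d j) (hv j i - \<eta> j))))"
proof -
  have "frobenius (d j) X (K j) = (\<Sum>r<d j. \<Sum>s<d j. \<Sum>i\<in>I j. p j i * (X $$ (r, s) * Gt j i $$ (r, s) - 2 * pi * (X $$ (r, s) * outer (d j) (hv j i - \<eta> j) $$ (r, s))))"
    unfolding frobenius_def K_def by (simp add: sum_distrib_left algebra_simps)
  also have "\<dots> = (\<Sum>r<d j. \<Sum>i\<in>I j. \<Sum>s<d j. p j i * (X $$ (r, s) * Gt j i $$ (r, s) - 2 * pi * (X $$ (r, s) * outer (d j) (hv j i - \<eta> j) $$ (r, s))))"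
    by (intro sum.cong refl sum.swap)
  also have "\<dots> = (\<Sum>i\<in>I j. \<Sum>r<d j. \<Sum>s<d j. p j i * (X $$ (r, s) * Gt j i $$ (r, s) - 2 * pi * (X $$ (r, s) * outer (d j) (hv j i - \<eta> j) $$ (r, s))))"
    by (rule sum.swap)
  also have "\<dots> = (\<Sum>i\<in>I j. p j i * (frobenius (d j) X (Gt j i) - 2 * pi * frobenius (d j) X (outer (d j) (hv j i - \<eta> j))))"
    unfolding frobenius_def by (simp only: sum_distrib_left[symmetric] sum_subtractf)
  finally show ?thesis .
qed

lemma K_carrier: "K j \<in> carrier_mat (d j) (d j)" by (simp add: K_def)

lemma K: "j < m \<Longrightarrow> K j \<in> self_adjoint (d j)"
  unfolding self_adjoint_def
proof (safe intro!: K_carrier eq_matI)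
  fix r s assume j: "j < m" and rs: "r < dim_row (K j)" "s < dim_col (K j)"
  then have rs': "r < d j" "s < d j" by (auto simp: K_def)
  have "(\<Sum>i\<in>I j. p j i * (Gt j i $$ (s, r) - 2 * pi * outer (d j) (hv j i - \<eta> j) $$ (s, r))) =
      (\<Sum>i\<in>I j. p j i * (Gt j i $$ (r, s) - 2 * pi * outer (d j) (hv j i - \<eta> j) $$ (r, s)))"
    using rs' self_adjoint_index[OF Gt[OF j] rs'] by (intro sum.cong refl) (simp add: mult.commute)
  then show "transpose_mat (K j) $$ (r, s) = K j $$ (r, s)" using rs' by (simp add: K_def)
qed (auto simp: K_def)

lemma qform_K:
  assumes j: "j < m" and b: "b \<in> carrier_vec (d j)"
  shows "qform (K j) b = (\<Sum>i\<in>I j. p j i * (qform (Gt j i) b - 2 * pi * (hv j i \<bullet> b - \<eta> j \<bullet> b)\<^sup>2))"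
proof -
  have "qform (K j) b = frobenius (d j) (outer (d j) b) (K j)"
    using frobenius_outer_left[OF K_carrier b] by simp
  also have "\<dots> = (\<Sum>i\<in>I j. p j i * (qform (Gt j i) b - 2 * pi * (hv j i \<bullet> b - \<eta> j \<bullet> b)\<^sup>2))"
    unfolding frobenius_K[OF j]
  proof (intro sum.cong refl)
    fix i assume i: "i \<in> I j"
    have e: "hv j i - \<eta> j \<in> carrier_vec (d j)" using hv[OF j i] \<eta> by simp
    have "frobenius (d j) (outer (d j) b) (outer (d j) (hv j i - \<eta> j)) = qform (outer (d j) (hv j i - \<eta> j)) b"
      using b by (intro frobenius_outer_left) (auto simp: outer_def)
    also have "\<dots> = (hv j i \<bullet> b - \<eta> j \<bullet> b)\<^sup>2"
      unfolding qform_outer[OF e b] using hv[OF j i] \<eta> b by (subst minus_scalar_prod_distrib[of _ "d j"]) auto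
    finally show "p j i * (frobenius (d j) (outer (d j) b) (Gt j i) - 2 * pi * frobenius (d j) (outer (d j) b) (outer (d j) (hv j i - \<eta> j)))
      = p j i * (qform (Gt j i) b - 2 * pi * (hv j i \<bullet> b - \<eta> j \<bullet> b)\<^sup>2)"
      using frobenius_outer_left[OF self_adjointD(1)[OF Gt[OF j i]] b] by simp
  qed
  finally show ?thesis .
qed

text \<open>The covariance term only lowers K, so each component is bounded separately: its inverse
  covariance at time t is at most (1-t) \<Gamma> + t A, a convex combination of matrices below
  \<open>G\<close>. K itself may fail to be positive.\<close>

lemma K_le:
  assumes j: "j < m" and b: "b \<in> carrier_vec (d j)"
  shows "qform (K j) b \<le> qform (G j) b"
proof -
  have "qform (K j) b \<le> (\<Sum>i\<in>I j. p j i * qform (G j) b)"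
    unfolding qform_K[OF j b]
  proof (intro sum_mono mult_left_mono p_nonneg j)
    fix i assume i: "i \<in> I j"
    have "qform (Gt j i) b \<le> (\<Sum>k<d j. ((1 - t) * \<gamma> j i k + t) * ((R j i *\<^sub>v b) $ k)\<^sup>2)"
      unfolding qform_Gt[OF j i b] g_def using interp_le[OF \<gamma>_pos[OF j i]] t
      by (intro sum_mono mult_right_mono) auto
    also have "\<dots> = (1 - t) * (\<Sum>k<d j. \<gamma> j i k * ((R j i *\<^sub>v b) $ k)\<^sup>2) + t * (\<Sum>k<d j. ((R j i *\<^sub>v b) $ k)\<^sup>2)"
      by (simp only: distrib_right sum.distrib sum_distrib_left mult.assoc)
    also have "\<dots> \<le> (1 - t) * qform (G j) b + t * qform (G j) b"
      using comp_le[OF j i b] A_le[OF j b] qform_gram[OF R[OF j i] b] AR[OF j i] t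
      by (intro add_mono mult_left_mono) auto
    also have "\<dots> = qform (G j) b" by (simp add: algebra_simps)
    finally have "qform (Gt j i) b \<le> qform (G j) b" .
    moreover have "2 * pi * (hv j i \<bullet> b - \<eta> j \<bullet> b)\<^sup>2 \<ge> 0" by simp
    ultimately show "qform (Gt j i) b - 2 * pi * (hv j i \<bullet> b - \<eta> j \<bullet> b)\<^sup>2 \<le> qform (G j) b" by linarith
  qed
  then show ?thesis using p_sum[OF j] by (simp add: sum_distrib_right[symmetric])
qed

lemma variance:
  assumes j: "j < m" and "\<And>i. i \<in> I j \<Longrightarrow> Y i = X i"
  shows "(\<Sum>i\<in>I j. p j i * (X i - (\<Sum>i\<in>I j. p j i * Y i))\<^sup>2) = (\<Sum>i\<in>I j. p j i * (X i)\<^sup>2) - (\<Sum>i\<in>I j. p j i * Y i)\<^sup>2"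
proof -
  define S where "S = (\<Sum>i\<in>I j. p j i * X i)"
  have S: "(\<Sum>i\<in>I j. p j i * Y i) = S" unfolding S_def using assms(2) by (intro sum.cong) auto
  have "(\<Sum>i\<in>I j. p j i * (X i - S)\<^sup>2) = (\<Sum>i\<in>I j. p j i * (X i)\<^sup>2 - 2 * S * (p j i * X i) + S\<^sup>2 * p j i)"
    by (intro sum.cong refl) (simp add: power2_eq_square algebra_simps)
  also have "\<dots> = (\<Sum>i\<in>I j. p j i * (X i)\<^sup>2) - 2 * S * S + S\<^sup>2 * 1"
    unfolding sum.distrib sum_subtractf sum_distrib_left[symmetric] S_def[symmetric] p_sum[OF j] ..
  finally show ?thesis unfolding S by (simp add: power2_eq_square)
qed

lemma \<rho>_K:
  assumes e: "e \<in> carrier_vec n"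
  shows "\<rho> t x e = - (2 * pi) * (qform Q e + (\<Sum>j<m. c j * qform (K j) (B j *\<^sub>v e)))"
proof -
  have "mean j t x (\<lambda>i. \<kappa> j t e i - 2 * pi * (\<chi> j t x e i)\<^sup>2) + 2 * pi * (mean j t x (\<chi> j t x e))\<^sup>2 = qform (K j) (B j *\<^sub>v e)"
    if j: "j < m" for j
  proof -
    note Be = mult_mat_vec_carrier[OF B[OF j] e]
    have "qform (K j) (B j *\<^sub>v e) = (\<Sum>i\<in>I j. p j i * qform (Gt j i) (B j *\<^sub>v e)) - 2 * pi * (\<Sum>i\<in>I j. p j i * (hv j i \<bullet> (B j *\<^sub>v e) - \<eta> j \<bullet> (B j *\<^sub>v e))\<^sup>2)"
      unfolding qform_K[OF j Be] by (simp add: right_diff_distrib sum_subtractf sum_distrib_left mult_ac)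
    also have "(\<Sum>i\<in>I j. p j i * (hv j i \<bullet> (B j *\<^sub>v e) - \<eta> j \<bullet> (B j *\<^sub>v e))\<^sup>2) =
       (\<Sum>i\<in>I j. p j i * (hv j i \<bullet> (B j *\<^sub>v e))\<^sup>2) - (\<eta> j \<bullet> (B j *\<^sub>v e))\<^sup>2"
      unfolding \<eta>_scalar_prod[OF j Be] by (rule variance[OF j refl])
    finally show ?thesis
      unfolding mean_\<chi>_\<eta>[OF j e] unfolding mean_p
      using \<chi>_hv[OF j _ e] \<kappa>_Gt[OF j _ e]
      by (simp add: right_diff_distrib sum_subtractf sum_distrib_left mult_ac)
  qed
  then show ?thesis unfolding \<rho>_def by simp
qed

lemma Ai: "j < m \<Longrightarrow> Ai j \<in> self_adjoint (d j)" "j < m \<Longrightarrow> Ai j \<in> carrier_mat (d j) (d j)"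
  unfolding Ai_def using positive_definiteD[OF pd_inverse(1)[OF A]] by auto

text \<open>A^-1 = L L^T cancels the factor R^T of \<open>hv\<close>, in whichever frame the
  component is given.\<close>

lemma qform_Ai_hv:
  assumes "j < m" "i \<in> I j"
  shows "qform (Ai j) (hv j i) = (\<Sum>k<d j. (g j i k t * u j i k t x)\<^sup>2)"
proof -
  note RL' = R[OF assms] L[OF assms] RL[OF assms]
  define q where "q = vec (d j) (\<lambda>k. g j i k t * u j i k t x)"
  have T: "transpose_mat (L j i) * transpose_mat (R j i) = 1\<^sub>m (d j)"
    using RL' by (metis transpose_mult transpose_one)
  have Lh: "transpose_mat (L j i) *\<^sub>v hv j i = q"
    unfolding hv_def q_def[symmetric] using RL' T
    by (subst assoc_mult_mat_vec[of _ "d j" "d j" _ "d j", symmetric]) (auto simp: q_def)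
  have "Ai j = transpose_mat (transpose_mat (L j i)) * transpose_mat (L j i)"
    unfolding Ai_def pd_inverse_gram[OF A[OF assms(1)] AR[OF assms] RL'] by simp
  then have "qform (Ai j) (hv j i) = (\<Sum>k<d j. (q $ k)\<^sup>2)"
    using qform_gram[of "transpose_mat (L j i)" "d j" "hv j i"] RL'(2) hv[OF assms] by (simp add: Lh)
  then show ?thesis by (simp add: q_def)
qed

lemma frobenius_Ai_K:
  assumes j: "j < m"
  shows "frobenius (d j) (Ai j) (K j) = (\<Sum>i\<in>I j. p j i * (\<Sum>k<d j. g j i k t))
     - 2 * pi * ((\<Sum>i\<in>I j. p j i * (\<Sum>k<d j. (g j i k t * u j i k t x)\<^sup>2)) - qform (Ai j) (\<eta> j))"
proof -
  have fG: "frobenius (d j) (Ai j) (Gt j i) = (\<Sum>k<d j. g j i k t)" if i: "i \<in> I j" for i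
    unfolding Ai_def frobenius_pd_inverse[OF A[OF j] AR[OF j i] R[OF j i] L[OF j i] RL[OF j i] self_adjointD(1)[OF Gt[OF j i]]]
    unfolding Gt_def using gram_frame(2)[OF R[OF j i] L[OF j i] RL[OF j i]] by simp
  define w where "w = Ai j *\<^sub>v \<eta> j"
  have w: "w \<in> carrier_vec (d j)" unfolding w_def by (rule mult_mat_vec_carrier[OF Ai(2)[OF j] \<eta>])
  have fo: "frobenius (d j) (Ai j) (outer (d j) (hv j i - \<eta> j)) = (\<Sum>k<d j. (g j i k t * u j i k t x)\<^sup>2) + qform (Ai j) (\<eta> j) - 2 * (hv j i \<bullet> w)"
    if i: "i \<in> I j" for i
  proof -
    have h: "hv j i \<in> carrier_vec (d j)" by (rule hv[OF j i])
    have "hv j i - \<eta> j = hv j i + (-1) \<cdot>\<^sub>v \<eta> j"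
    proof -
      have "a - b = a + (-1) \<cdot>\<^sub>v b" if "a \<in> carrier_vec (d j)" "b \<in> carrier_vec (d j)" for a b :: "real vec"
        using that by (intro eq_vecI) auto
      then show ?thesis using h \<eta> by blast
    qed
    moreover have "frobenius (d j) (Ai j) (outer (d j) (hv j i - \<eta> j)) = qform (Ai j) (hv j i - \<eta> j)"
      using Ai(2)[OF j] h \<eta> by (intro frobenius_outer) auto
    moreover have "Ai j *\<^sub>v ((-1) \<cdot>\<^sub>v \<eta> j) = (-1) \<cdot>\<^sub>v w" unfolding w_def by (rule mult_mat_vec[OF Ai(2)[OF j] \<eta>])
    ultimately show ?thesis
      using qform_add[OF Ai(1)[OF j] h, of "(-1) \<cdot>\<^sub>v \<eta> j"] qform_smult[OF Ai(2)[OF j] \<eta>, of "-1"] \<eta> h w qform_Ai_hv[OF j i]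
      by (simp add: scalar_prod_smult_right)
  qed
  have "frobenius (d j) (Ai j) (K j) = (\<Sum>i\<in>I j. p j i * (\<Sum>k<d j. g j i k t)
     - 2 * pi * (p j i * (\<Sum>k<d j. (g j i k t * u j i k t x)\<^sup>2)) - 2 * pi * qform (Ai j) (\<eta> j) * p j i + 4 * pi * (p j i * (hv j i \<bullet> w)))"
    unfolding frobenius_K[OF j] by (intro sum.cong refl) (simp add: fG fo algebra_simps)
  also have "\<dots> = (\<Sum>i\<in>I j. p j i * (\<Sum>k<d j. g j i k t)) - 2 * pi * (\<Sum>i\<in>I j. p j i * (\<Sum>k<d j. (g j i k t * u j i k t x)\<^sup>2))
      - 2 * pi * qform (Ai j) (\<eta> j) * 1 + 4 * pi * (\<eta> j \<bullet> w)"
    unfolding sum.distrib sum_subtractf sum_distrib_left[symmetric] p_sum[OF j] \<eta>_scalar_prod[OF j w] ..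
  also have "\<eta> j \<bullet> w = qform (Ai j) (\<eta> j)" by (simp add: w_def qform_def)
  finally show ?thesis by (simp add: algebra_simps)
qed

text \<open>The Fokker-Planck equation in logarithmic form: 2 (1-t) dF/dt = d F + y . grad F + (1/2
  pi) tr (A^-1 Hess F) on R^(d_j), with stationary solution g_A.\<close>

lemma mean_\<theta>:
  assumes j: "j < m"
  shows "mean j t x (\<theta> j t x) = real (d j) - frobenius (d j) (Ai j) (K j) + 2 * pi * qform (Ai j) (\<eta> j) - 2 * pi * (\<eta> j \<bullet> (B j *\<^sub>v x))"
proof -
  have "\<theta> j t x i = real (d j) - (\<Sum>k<d j. g j i k t) + 2 * pi * (\<Sum>k<d j. (g j i k t * u j i k t x)\<^sup>2) - 2 * pi * \<chi> j t x x i" for i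
    unfolding \<theta>_def \<chi>_def by (simp add: sum.distrib sum_subtractf sum_distrib_left)
  then have "mean j t x (\<theta> j t x) = (\<Sum>i\<in>I j. real (d j) * p j i - p j i * (\<Sum>k<d j. g j i k t)
     + 2 * pi * (p j i * (\<Sum>k<d j. (g j i k t * u j i k t x)\<^sup>2)) - 2 * pi * (p j i * \<chi> j t x x i))"
    unfolding mean_p by (intro sum.cong refl) (simp only: distrib_left right_diff_distrib mult.left_commute mult.commute)
  also have "\<dots> = real (d j) * 1 - (\<Sum>i\<in>I j. p j i * (\<Sum>k<d j. g j i k t)) + 2 * pi * (\<Sum>i\<in>I j. p j i * (\<Sum>k<d j. (g j i k t * u j i k t x)\<^sup>2))
     - 2 * pi * mean j t x (\<chi> j t x x)"
    unfolding sum.distrib sum_subtractf sum_distrib_left[symmetric] p_sum[OF j] mean_p ..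
  finally show ?thesis unfolding mean_\<chi>_\<eta>[OF j x] frobenius_Ai_K[OF j] by (simp add: right_diff_distrib)
qed

lemma frobenius_Ai_A:
  assumes j: "j < m"
  shows "frobenius (d j) (Ai j) (A j) = d j"
proof -
  obtain i where i: "i \<in> I j" using \<omega>_pos[OF j] by blast
  have "A j = transpose_mat (R j i) * diag_of (d j) (\<lambda>_. 1) * R j i"
    using AR[OF j i] R[OF j i] by (simp add: one_mat_eq_diag_of[symmetric])
  then have "qform (A j) (col (L j i) k) = 1" if "k < d j" for k
    using gram_frame(2)[OF R[OF j i] L[OF j i] RL[OF j i] that, of "\<lambda>_. 1"] by simp
  then show ?thesis
    unfolding Ai_def frobenius_pd_inverse[OF A[OF j] AR[OF j i] R[OF j i] L[OF j i] RL[OF j i] positive_definiteD(1)[OF A[OF j]]]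
    by simp
qed

text \<open>The claim separates. Its Hessian part is the first-order condition in the direction H =
  K - A, admissible because K <= G, and the unit lengths of the l_k produce the constant n. The
  drift terms cancel up to Q(x), which completes the gradient part to the quadratic-form inequality
  at (x, \<eta>).\<close>

lemma pointwise_inequality:
  "time_rate t x \<le> n + \<Lambda> t x x + (1 / (2 * pi)) * (\<Sum>k<n. (\<Lambda> t x (l k))\<^sup>2 + \<rho> t x (l k))"
proof -
  define f where "f j = frobenius (d j) (Ai j) (K j)" for j
  have var: "(\<Sum>k<n. \<Sum>j<m. c j * qform (K j) (B j *\<^sub>v l k)) \<le> (\<Sum>j<m. c j * (f j - d j)) + n - (\<Sum>k<n. qform Q (l k))"
  proof -
    have Hs: "K j - A j \<in> self_adjoint (d j)" if j: "j < m" for j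
    proof -
      note k = self_adjointD[OF K[OF j]] positive_definiteD(1,2)[OF A[OF j]]
      have "transpose_mat (K j - A j) = transpose_mat (K j) - transpose_mat (A j)" using k(1,3) by (intro eq_matI) auto
      then show ?thesis using k minus_carrier_mat[OF k(3), of "K j"] by (simp add: self_adjoint_def)
    qed
    have qH: "qform (K j - A j) b = qform (K j) b - qform (A j) b" if j: "j < m" and b: "b \<in> carrier_vec (d j)" for j b
      using K_carrier[of j] positive_definiteD(1)[OF A[OF j]] b minus_carrier_mat[OF positive_definiteD(1)[OF A[OF j]], of "K j"]
      by (simp add: qform_sum[of _ "d j"] left_diff_distrib sum_subtractf)
    have "(\<Sum>k<n. \<Sum>j<m. c j * qform (K j - A j) (B j *\<^sub>v l k)) \<le> (\<Sum>j<m. c j * frobenius (d j) (pd_inverse (d j) (A j)) (K j - A j))"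
      using Hs qH K_le by (intro variation) auto
    also have "(\<Sum>j<m. c j * frobenius (d j) (pd_inverse (d j) (A j)) (K j - A j)) = (\<Sum>j<m. c j * (f j - d j))"
      using frobenius_diff[OF K_carrier positive_definiteD(1)[OF A]] frobenius_Ai_A by (intro sum.cong refl) (simp add: f_def Ai_def)
    also have "(\<Sum>k<n. \<Sum>j<m. c j * qform (K j - A j) (B j *\<^sub>v l k)) =
      (\<Sum>k<n. (\<Sum>j<m. c j * qform (K j) (B j *\<^sub>v l k)) - (\<Sum>j<m. c j * qform (A j) (B j *\<^sub>v l k)))"
      using qH mult_mat_vec_carrier[OF B l] by (intro sum.cong refl) (simp add: right_diff_distrib sum_subtractf)
    also have "\<dots> = (\<Sum>k<n. (\<Sum>j<m. c j * qform (K j) (B j *\<^sub>v l k)) - (1 - qform Q (l k)))"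
    proof (intro sum.cong refl)
      fix k assume "k \<in> {..<n}"
      then have "(\<Sum>j<m. c j * qform (A j) (B j *\<^sub>v l k)) = 1 - qform Q (l k)" using l_unit[of k] by simp
      then show "(\<Sum>j<m. c j * qform (K j) (B j *\<^sub>v l k)) - (\<Sum>j<m. c j * qform (A j) (B j *\<^sub>v l k)) =
        (\<Sum>j<m. c j * qform (K j) (B j *\<^sub>v l k)) - (1 - qform Q (l k))" by simp
    qed
    finally show ?thesis by (simp add: sum_subtractf)
  qed
  have Lk: "\<Lambda> t x (l k) = - (2 * pi) * (l k \<bullet> (Q *\<^sub>v x) + (\<Sum>j<m. c j * ((B j *\<^sub>v l k) \<bullet> \<eta> j)))" if k: "k < n" for k
  proof -
    have "(\<Sum>j<m. c j * mean j t x (\<chi> j t x (l k))) = (\<Sum>j<m. c j * ((B j *\<^sub>v l k) \<bullet> \<eta> j))"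
      using mean_\<chi>_\<eta>[OF _ l[OF k]] comm_scalar_prod[OF \<eta> mult_mat_vec_carrier[OF B l[OF k]]] by (intro sum.cong refl) simp
    then show ?thesis using symmetric_bilinear[OF self_adjointD[OF Q] x l[OF k]] by (simp add: \<Lambda>_def)
  qed
  have sq: "(\<Sum>k<n. (\<Lambda> t x (l k))\<^sup>2) = (2 * pi)\<^sup>2 * (\<Sum>k<n. (l k \<bullet> (Q *\<^sub>v x) + (\<Sum>j<m. c j * ((B j *\<^sub>v l k) \<bullet> \<eta> j)))\<^sup>2)"
    unfolding sum_distrib_left by (intro sum.cong refl) (simp add: Lk power_mult_distrib)
  have sig: "qform Q x + (\<Sum>j<m. c j * qform (Ai j) (\<eta> j)) \<le> (\<Sum>k<n. (l k \<bullet> (Q *\<^sub>v x) + (\<Sum>j<m. c j * ((B j *\<^sub>v l k) \<bullet> \<eta> j)))\<^sup>2)"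
    unfolding Ai_def using signature[OF x, of \<eta>] \<eta> by simp
  have Lx: "\<Lambda> t x x = - (2 * pi) * (qform Q x + (\<Sum>j<m. c j * (\<eta> j \<bullet> (B j *\<^sub>v x))))"
    unfolding \<Lambda>_def using mean_\<chi>_\<eta>[OF _ x] by (simp add: qform_def)
  have rho: "(\<Sum>k<n. \<rho> t x (l k)) = - (2 * pi) * ((\<Sum>k<n. qform Q (l k)) + (\<Sum>k<n. \<Sum>j<m. c j * qform (K j) (B j *\<^sub>v l k)))"
    unfolding sum.distrib[symmetric] sum_distrib_left using l by (intro sum.cong refl) (simp add: \<rho>_K sum_distrib_left)
  have tr: "time_rate t x = (\<Sum>j<m. - (c j * (f j - d j))) + 2 * pi * (\<Sum>j<m. c j * qform (Ai j) (\<eta> j)) - 2 * pi * (\<Sum>j<m. c j * (\<eta> j \<bullet> (B j *\<^sub>v x)))"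
    unfolding time_rate_def sum_distrib_left sum.distrib[symmetric] sum_subtractf[symmetric]
    by (intro sum.cong refl) (simp add: mean_\<theta> f_def algebra_simps)
  define V where "V = (\<Sum>k<n. \<Sum>j<m. c j * qform (K j) (B j *\<^sub>v l k))"
  define QL where "QL = (\<Sum>k<n. qform Q (l k))"
  define S where "S = (\<Sum>k<n. (l k \<bullet> (Q *\<^sub>v x) + (\<Sum>j<m. c j * ((B j *\<^sub>v l k) \<bullet> \<eta> j)))\<^sup>2)"
  have "(1 / (2 * pi)) * (\<Sum>k<n. (\<Lambda> t x (l k))\<^sup>2 + \<rho> t x (l k)) = 2 * pi * S - (QL + V)"
    unfolding sum.distrib sq rho S_def[symmetric] V_def[symmetric] QL_def[symmetric] by (simp add: power2_eq_square field_simps)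
  moreover have "2 * pi * (qform Q x + (\<Sum>j<m. c j * qform (Ai j) (\<eta> j))) \<le> 2 * pi * S"
    using sig unfolding S_def by (intro mult_left_mono) auto
  ultimately show ?thesis
    using var unfolding V_def[symmetric] QL_def[symmetric] tr Lx by (simp add: distrib_left sum_negf)
qed

end

theorem integral_W_le: "(LINT x|lborel_vec n. W 1 x) \<le> (LINT x|lborel_vec n. W 0 x)"
  using integral_W_decreasing[OF l pointwise_inequality] by simp

end

definition frame :: "nat \<Rightarrow> real mat \<Rightarrow> real mat \<Rightarrow> real mat \<times> real mat \<times> (nat \<Rightarrow> real)" where
  "frame n A H = (SOME X. case X of (R, L, l) \<Rightarrow> R \<in> carrier_mat n n \<and> L \<in> carrier_mat n n \<and> R * L = 1\<^sub>m n \<and> L * R = 1\<^sub>m n \<and>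
    A = transpose_mat R * R \<and> H = transpose_mat R * diag_of n l * R)"

text \<open>The frame is a fixed function of the two matrices, so components with the same inverse
  covariance receive the same coordinates, as \<open>ref_pos\<close> and \<open>ref_neg\<close>
  demand.\<close>

lemma frame:
  assumes "A \<in> positive_definite n" "H \<in> positive_definite n" "frame n A H = (R, L, l)"
  shows "R \<in> carrier_mat n n" "L \<in> carrier_mat n n" "R * L = 1\<^sub>m n" "L * R = 1\<^sub>m n"
    "A = transpose_mat R * R" "H = transpose_mat R * diag_of n l * R" "\<And>k. k < n \<Longrightarrow> l k > 0"
proof -
  have "\<exists>X. case X of (R, L, l) \<Rightarrow> R \<in> carrier_mat n n \<and> L \<in> carrier_mat n n \<and> R * L = 1\<^sub>m n \<and> L * R = 1\<^sub>m n \<and>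
    A = transpose_mat R * R \<and> H = transpose_mat R * diag_of n l * R"
    using simultaneous_diagonalization[OF assms(1) positive_definiteD(3)[OF assms(2)]] by auto
  from someI_ex[OF this, folded frame_def]
  show *: "R \<in> carrier_mat n n" "L \<in> carrier_mat n n" "R * L = 1\<^sub>m n" "L * R = 1\<^sub>m n"
    "A = transpose_mat R * R" "H = transpose_mat R * diag_of n l * R"
    by (auto simp: assms(3))
  fix k assume k: "k < n"
  have "R *\<^sub>v col L k = unit_vec n k" using * k col_mult2[of R n n L n k] by simp
  moreover have "unit_vec n k \<noteq> (0\<^sub>v n :: real vec)" using k by (metis index_unit_vec(1) index_zero_vec(1) zero_neq_one)
  moreover have "R *\<^sub>v 0\<^sub>v n = 0\<^sub>v n" using *(1) by (intro eq_vecI) auto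
  ultimately have "col L k \<noteq> 0\<^sub>v n" by metis
  then show "l k > 0"
    using positive_definiteD(4)[OF assms(2), of "col L k"] gram_frame(1)[OF *(1-3) k] gram_frame(2)[OF *(1-3) k, of l] *(6) by simp
qed

lemma powr_prod_exp:
  fixes f :: "nat \<Rightarrow> real"
  assumes "\<And>j. j < m \<Longrightarrow> f j > 0"
  shows "exp (q + (\<Sum>j<m. c j * ln (f j))) = exp q * (\<Prod>j<m. f j powr c j)"
proof -
  have "(\<Prod>j<m. f j powr c j) = (\<Prod>j<m. exp (c j * ln (f j)))"
  proof (intro prod.cong refl)
    fix j assume "j \<in> {..<m}"
    then have "f j > 0" using assms by simp
    then show "f j powr c j = exp (c j * ln (f j))" by (simp add: powr_def)
  qed
  then show ?thesis by (simp add: exp_add exp_sum)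
qed

lemma gaussian_pos: "A \<in> positive_definite k \<Longrightarrow> gaussian A y > 0"
  using positive_definite_det_pos[of A k] by (simp add: gaussian_def)

lemma gaussian_congruence:
  assumes R: "R \<in> carrier_mat n n" and l: "\<And>k. k < n \<Longrightarrow> l k > 0" and y: "y \<in> carrier_vec n"
  shows "gaussian (transpose_mat R * diag_of n l * R) y =
    \<bar>Determinant.det R\<bar> * exp (\<Sum>k<n. ln (l k) / 2 - pi * (l k * ((R *\<^sub>v y) $ k)\<^sup>2))"
proof -
  have "sqrt (\<Prod>k<n. l k) = (\<Prod>k<n. exp (ln (l k) / 2))"
  proof -
    have "sqrt (\<Prod>k<n. l k) = (\<Prod>k<n. sqrt (l k))" by (induction n) (auto simp: real_sqrt_mult)
    also have "\<dots> = (\<Prod>k<n. exp (ln (l k) / 2))"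
    proof (intro prod.cong refl)
      fix k assume "k \<in> {..<n}"
      then have "l k > 0" using l by simp
      then show "sqrt (l k) = exp (ln (l k) / 2)" by (simp add: ln_sqrt[symmetric])
    qed
    finally show ?thesis .
  qed
  then have "sqrt (Determinant.det (transpose_mat R * diag_of n l * R)) = \<bar>Determinant.det R\<bar> * exp (\<Sum>k<n. ln (l k) / 2)"
    unfolding det_congruence_diag[OF R] by (simp add: real_sqrt_mult exp_sum)
  moreover have "- pi * qform (transpose_mat R * diag_of n l * R) y = (\<Sum>k<n. - (pi * (l k * ((R *\<^sub>v y) $ k)\<^sup>2)))"
    unfolding qform_congruence_diag[OF R y] by (simp add: sum_distrib_left sum_negf)
  ultimately show ?thesis
    unfolding gaussian_def by (simp add: mult.assoc exp_add[symmetric] sum_subtractf sum_negf)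
qed

text \<open>\<open>H\<close> is the reference family: the inverse covariance of all components for j
  < mp and of one centered component for the other j. Positivity of its matrix gives the decay at
  time 0, positivity of M at the minimizer gives it at time 1, and the lifting gives it in
  between.\<close>

theorem gaussian_mixture_inequality:
  fixes I :: "nat \<Rightarrow> 'i set" and w :: "nat \<Rightarrow> 'i \<Rightarrow> real" and a :: "nat \<Rightarrow> 'i \<Rightarrow> real vec" and \<Gamma> :: "nat \<Rightarrow> 'i \<Rightarrow> real mat"
  assumes Q: "Q \<in> self_adjoint n" and B: "\<And>j. j < m \<Longrightarrow> B j \<in> carrier_mat (d j) n"
    and mp: "mp \<le> m" and cp: "\<And>j. j < mp \<Longrightarrow> c j > 0" and cn: "\<And>j. mp \<le> j \<Longrightarrow> j < m \<Longrightarrow> c j < 0"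
    and lift: "nonpos_lifting n mp d B Q"
    and A: "feasible n m d B c Q G A"
    and min: "\<And>A'. feasible n m d B c Q G A' \<Longrightarrow> log_det_functional n m B c Q A \<le> log_det_functional n m B c Q A'"
    and H: "\<And>j. j < m \<Longrightarrow> H j \<in> positive_definite (d j)" and MH: "Q_plus n m B c Q H \<in> positive_definite n"
    and I: "\<And>j. j < m \<Longrightarrow> finite (I j)"
    and w: "\<And>j i. j < m \<Longrightarrow> i \<in> I j \<Longrightarrow> w j i \<ge> 0" "\<And>j. j < m \<Longrightarrow> \<exists>i\<in>I j. w j i > 0"
    and a: "\<And>j i. j < m \<Longrightarrow> i \<in> I j \<Longrightarrow> a j i \<in> carrier_vec (d j)"
    and \<Gamma>: "\<And>j i. j < m \<Longrightarrow> i \<in> I j \<Longrightarrow> \<Gamma> j i \<in> positive_definite (d j)"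
      "\<And>j i. j < m \<Longrightarrow> i \<in> I j \<Longrightarrow> loewner_le (d j) (\<Gamma> j i) (G j)"
    and pos: "\<And>j i. j < mp \<Longrightarrow> i \<in> I j \<Longrightarrow> \<Gamma> j i = H j"
    and neg: "\<And>j. mp \<le> j \<Longrightarrow> j < m \<Longrightarrow> \<exists>i\<in>I j. w j i > 0 \<and> a j i = 0\<^sub>v (d j) \<and> \<Gamma> j i = H j"
  shows "(\<integral>\<^sup>+x. ennreal (exp (- pi * qform Q x) * (\<Prod>j<m. ((\<Sum>i\<in>I j. w j i) * gaussian (A j) (B j *\<^sub>v x)) powr c j)) \<partial>lborel_vec n)
    \<le> (\<integral>\<^sup>+x. ennreal (exp (- pi * qform Q x) * (\<Prod>j<m. (\<Sum>i\<in>I j. w j i * gaussian (\<Gamma> j i) (B j *\<^sub>v x - a j i)) powr c j)) \<partial>lborel_vec n)"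
proof -
  note Qc = self_adjointD[OF Q]
  have Apd: "A j \<in> positive_definite (d j)" and Ale: "loewner_le (d j) (A j) (G j)" if "j < m" for j
    using A that by (auto simp: feasible_def)
  have M: "Q_plus n m B c Q A \<in> positive_definite n" using A by (simp add: feasible_def)
  obtain RM LM lM where RM: "RM \<in> carrier_mat n n" "LM \<in> carrier_mat n n" "RM * LM = 1\<^sub>m n" "LM * RM = 1\<^sub>m n"
    "Q_plus n m B c Q A = transpose_mat RM * RM"
    using simultaneous_diagonalization[OF M positive_definiteD(3)[OF M]] by metis
  define R where "R j X = fst (frame (d j) (A j) X)" for j X
  define L where "L j X = fst (snd (frame (d j) (A j) X))" for j X
  define l where "l j X = snd (snd (frame (d j) (A j) X))" for j X
  have fr: "R j X \<in> carrier_mat (d j) (d j)" "L j X \<in> carrier_mat (d j) (d j)" "R j X * L j X = 1\<^sub>m (d j)" "L j X * R j X = 1\<^sub>m (d j)"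
    "A j = transpose_mat (R j X) * R j X" "X = transpose_mat (R j X) * diag_of (d j) (l j X) * R j X" "\<And>k. k < d j \<Longrightarrow> l j X k > 0"
    if "j < m" "X \<in> positive_definite (d j)" for j X
    using frame[OF Apd[OF that(1)] that(2), of "R j X" "L j X" "l j X"] by (auto simp: R_def L_def l_def)
  define vv where "vv j X k = row (R j X * B j) k" for j X k
  have RB: "R j X * B j \<in> carrier_mat (d j) n" if "j < m" "X \<in> positive_definite (d j)" for j X
    using fr(1)[OF that] B[OF that(1)] by auto
  have vvc: "vv j X k \<in> carrier_vec n" if "j < m" "X \<in> positive_definite (d j)" "k < d j" for j X k
    using RB[OF that(1,2)] that(3) unfolding vv_def by auto
  have vvx: "vv j X k \<bullet> x = (R j X *\<^sub>v (B j *\<^sub>v x)) $ k" if "j < m" "X \<in> positive_definite (d j)" "k < d j" "x \<in> carrier_vec n" for j X k x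
  proof -
    have "vv j X k \<bullet> x = ((R j X * B j) *\<^sub>v x) $ k" 
      unfolding vv_def by (rule index_mult_mat_vec[symmetric]) (use fr(1)[OF that(1,2)] that(3) in simp)
    also have "(R j X * B j) *\<^sub>v x = R j X *\<^sub>v (B j *\<^sub>v x)"
      using fr(1)[OF that(1,2)] B[OF that(1)] that(4) by (intro assoc_mult_mat_vec)
    finally show ?thesis .
  qed
  have qX: "qform X y = (\<Sum>k<d j. l j X k * ((R j X *\<^sub>v y) $ k)\<^sup>2)" "qform (A j) y = (\<Sum>k<d j. ((R j X *\<^sub>v y) $ k)\<^sup>2)"
    if "j < m" "X \<in> positive_definite (d j)" "y \<in> carrier_vec (d j)" for j X y
    using qform_congruence_diag[OF fr(1)[OF that(1,2)] that(3), of "l j X"] qform_gram[OF fr(1)[OF that(1,2)] that(3)]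
      fr(5,6)[OF that(1,2)] by auto
  obtain \<delta>0 where \<delta>0: "\<delta>0 > 0" "\<And>x. x \<in> carrier_vec n \<Longrightarrow> qform (Q_plus n m B c Q H) x \<ge> \<delta>0 * (x \<bullet> x)"
    using positive_definite_coercive[OF MH] by blast
  obtain \<delta>1 where \<delta>1: "\<delta>1 > 0" "\<And>x. x \<in> carrier_vec n \<Longrightarrow> qform (Q_plus n m B c Q A) x \<ge> \<delta>1 * (x \<bullet> x)"
    using positive_definite_coercive[OF M] by blast
  define \<delta> where "\<delta> = min \<delta>0 \<delta>1"
  have \<delta>: "\<delta> > 0" using \<delta>0 \<delta>1 by (simp add: \<delta>_def)
  have Bx: "B j *\<^sub>v x \<in> carrier_vec (d j)" if "j < m" "x \<in> carrier_vec n" for j x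
    using mult_mat_vec_carrier[OF B[OF that(1)] that(2)] .
  have xx: "x \<bullet> x \<ge> 0" if "x \<in> carrier_vec n" for x :: "real vec"
    using that by (simp add: scalar_prod_self_sum sum_nonneg)
  have form: "\<delta> * (x \<bullet> x) \<le> qform Q x + (\<Sum>j<m. c j * (\<Sum>k<d j. interp (l j (H j) k) t * (vv j (H j) k \<bullet> x)\<^sup>2))"
    if t: "0 \<le> t" "t \<le> 1" and x: "x \<in> carrier_vec n" for t x
  proof -
    have "\<delta> * (x \<bullet> x) \<le> qform Q x + (\<Sum>j<m. c j * (\<Sum>k<d j. interp (l j (H j) k) t * ((R j (H j) *\<^sub>v (B j *\<^sub>v x)) $ k)\<^sup>2))"
    proof (rule interpolated_form_lower_bound[OF Q, where L = "\<lambda>j. L j (H j)" and mp = mp and m = m])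
      fix x :: "real vec" assume x: "x \<in> carrier_vec n"
      have "\<delta> * (x \<bullet> x) \<le> \<delta>0 * (x \<bullet> x)" using xx[OF x] by (intro mult_right_mono) (auto simp: \<delta>_def)
      also have "\<dots> \<le> qform (Q_plus n m B c Q H) x" using \<delta>0(2)[OF x] .
      also have "\<dots> = qform Q x + (\<Sum>j<m. c j * qform (H j) (B j *\<^sub>v x))"
        using Qc B positive_definiteD(1)[OF H] x by (intro qform_Q_plus[where d = d]) auto
      also have "\<dots> = qform Q x + (\<Sum>j<m. c j * (\<Sum>k<d j. l j (H j) k * ((R j (H j) *\<^sub>v (B j *\<^sub>v x)) $ k)\<^sup>2))"
        using qX(1)[OF _ H Bx[OF _ x]] by simp
      finally show "\<delta> * (x \<bullet> x) \<le> qform Q x + (\<Sum>j<m. c j * (\<Sum>k<d j. l j (H j) k * ((R j (H j) *\<^sub>v (B j *\<^sub>v x)) $ k)\<^sup>2))" .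
      have "\<delta> * (x \<bullet> x) \<le> \<delta>1 * (x \<bullet> x)" using xx[OF x] by (intro mult_right_mono) (auto simp: \<delta>_def)
      also have "\<dots> \<le> qform (Q_plus n m B c Q A) x" using \<delta>1(2)[OF x] .
      also have "\<dots> = qform Q x + (\<Sum>j<m. c j * qform (A j) (B j *\<^sub>v x))"
        using Qc B positive_definiteD(1)[OF Apd] x by (intro qform_Q_plus[where d = d]) auto
      also have "\<dots> = qform Q x + (\<Sum>j<m. c j * (\<Sum>k<d j. ((R j (H j) *\<^sub>v (B j *\<^sub>v x)) $ k)\<^sup>2))"
        using qX(2)[OF _ H Bx[OF _ x]] by simp
      finally show "\<delta> * (x \<bullet> x) \<le> qform Q x + (\<Sum>j<m. c j * (\<Sum>k<d j. ((R j (H j) *\<^sub>v (B j *\<^sub>v x)) $ k)\<^sup>2))" .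
    qed (use B fr H mp cn lift t \<delta> x in \<open>auto simp: less_imp_le\<close>)
    also have "\<dots> = qform Q x + (\<Sum>j<m. c j * (\<Sum>k<d j. interp (l j (H j) k) t * (vv j (H j) k \<bullet> x)\<^sup>2))"
      using vvx[OF _ H _ x] by simp
    finally show ?thesis .
  qed
  have cpos: "j < mp" if "j < m" "c j > 0" for j using cn[of j] that by force
  have cneg: "mp \<le> j" if "j < m" "c j \<le> 0" "\<not> j < mp" for j using that by simp
  \<comment> \<open>Each component is diagonalized against A_j in its own frame; the factor |det R|
    of this change of coordinates goes into the weight.\<close>
  define ww where "ww j i = w j i * \<bar>Determinant.det (R j (\<Gamma> j i))\<bar>" for j i
  have wwp: "ww j i > 0" if "j < m" "i \<in> I j" "w j i > 0" for j i
    using det_nonzero_of_inverse[OF fr(1-3)[OF that(1) \<Gamma>(1)[OF that(1,2)]]] that(3) by (simp add: ww_def)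
  interpret framed_mixtures n m d c Q I ww "\<lambda>j i. l j (\<Gamma> j i)" "\<lambda>j i. vv j (\<Gamma> j i)" "\<lambda>j i k. (R j (\<Gamma> j i) *\<^sub>v a j i) $ k"
    "\<lambda>j. l j (H j)" "\<lambda>j. vv j (H j)" \<delta> B A G "\<lambda>j i. R j (\<Gamma> j i)" "\<lambda>j i. L j (\<Gamma> j i)" "\<lambda>k. col LM k"
  proof (unfold_locales)
    show "Q \<in> self_adjoint n" by (rule Q)
    show "finite (I j)" if "j < m" for j using I that .
    show "ww j i \<ge> 0" if "j < m" "i \<in> I j" for j i using w(1)[OF that] by (simp add: ww_def)
    show "\<exists>i\<in>I j. 0 < ww j i" if "j < m" for j using w(2)[OF that] wwp that by blast
    show "0 < l j (\<Gamma> j i) k" if "j < m" "i \<in> I j" "k < d j" for j i k using fr(7)[OF that(1) \<Gamma>(1)[OF that(1,2)] that(3)] .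
    show "vv j (\<Gamma> j i) k \<in> carrier_vec n" if "j < m" "i \<in> I j" "k < d j" for j i k using vvc[OF that(1) \<Gamma>(1)[OF that(1,2)] that(3)] .
    show "l j (\<Gamma> j i) k = l j (H j) k \<and> vv j (\<Gamma> j i) k = vv j (H j) k" if "j < m" "0 < c j" "i \<in> I j" "k < d j" for j i k
      using pos[OF cpos[OF that(1,2)] that(3)] by simp
    show "\<exists>i\<in>I j. 0 < ww j i \<and> (\<forall>k<d j. (R j (\<Gamma> j i) *\<^sub>v a j i) $ k = 0 \<and> l j (\<Gamma> j i) k = l j (H j) k \<and> vv j (\<Gamma> j i) k = vv j (H j) k)"
      if "j < m" "c j \<le> 0" for j
    proof -
      have "mp \<le> j" using cp[of j] that by force
      from neg[OF this that(1)] obtain i where i: "i \<in> I j" "w j i > 0" "a j i = 0\<^sub>v (d j)" "\<Gamma> j i = H j" by blast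
      have "R j (H j) *\<^sub>v 0\<^sub>v (d j) = 0\<^sub>v (d j)" using fr(1)[OF that(1) H[OF that(1)]] by (intro eq_vecI) auto
      then show ?thesis using i wwp[OF that(1) i(1,2)] by (intro bexI[of _ i]) auto
    qed
    show "0 < \<delta>" by (rule \<delta>)
    show "\<delta> * (x \<bullet> x) \<le> qform Q x + (\<Sum>j<m. c j * (\<Sum>k<d j. interp (l j (H j) k) t * (vv j (H j) k \<bullet> x)\<^sup>2))"
      if "0 \<le> t" "t \<le> 1" "x \<in> carrier_vec n" for t x using form[OF that] .
    show "B j \<in> carrier_mat (d j) n" if "j < m" for j using B[OF that] .
    show "A j \<in> positive_definite (d j)" if "j < m" for j using Apd[OF that] .
    show "R j (\<Gamma> j i) \<in> carrier_mat (d j) (d j)" "L j (\<Gamma> j i) \<in> carrier_mat (d j) (d j)" "R j (\<Gamma> j i) * L j (\<Gamma> j i) = 1\<^sub>m (d j)"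
      "A j = transpose_mat (R j (\<Gamma> j i)) * R j (\<Gamma> j i)" if "j < m" "i \<in> I j" for j i
      using fr(1,2,3,5)[OF that(1) \<Gamma>(1)[OF that]] by auto
    show "vv j (\<Gamma> j i) k \<bullet> x = (R j (\<Gamma> j i) *\<^sub>v (B j *\<^sub>v x)) $ k" if "j < m" "i \<in> I j" "k < d j" "x \<in> carrier_vec n" for j i k x
      using vvx[OF that(1) \<Gamma>(1)[OF that(1,2)] that(3,4)] .
    show "(\<Sum>k<d j. l j (\<Gamma> j i) k * ((R j (\<Gamma> j i) *\<^sub>v y) $ k)\<^sup>2) \<le> qform (G j) y" if "j < m" "i \<in> I j" "y \<in> carrier_vec (d j)" for j i y
    proof -
      have "qform (\<Gamma> j i) y \<le> qform (G j) y" using \<Gamma>(2)[OF that(1,2)] that(3) by (simp add: loewner_le_def)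
      then show ?thesis using qX(1)[OF that(1) \<Gamma>(1)[OF that(1,2)] that(3)] by simp
    qed
    show "qform (A j) y \<le> qform (G j) y" if "j < m" "y \<in> carrier_vec (d j)" for j y
      using Ale[OF that(1)] that(2) by (simp add: loewner_le_def)
    show lc: "col LM k \<in> carrier_vec n" if "k < n" for k using RM(2) that by auto
    show "qform Q (col LM k) + (\<Sum>j<m. c j * qform (A j) (B j *\<^sub>v col LM k)) = 1" if k: "k < n" for k
    proof -
      have "qform (Q_plus n m B c Q A) (col LM k) = 1"
        using gram_frame(2)[OF RM(1-3) k, of "\<lambda>_. 1"] RM by (simp add: one_mat_eq_diag_of[symmetric])
      then show ?thesis
        using Qc B positive_definiteD(1)[OF Apd] lc[OF k] by (subst (asm) qform_Q_plus[where d = d]) auto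
    qed
    show "qform Q x + (\<Sum>j<m. c j * qform (pd_inverse (d j) (A j)) (\<eta> j)) \<le>
        (\<Sum>k<n. (col LM k \<bullet> (Q *\<^sub>v x) + (\<Sum>j<m. c j * ((B j *\<^sub>v col LM k) \<bullet> \<eta> j)))\<^sup>2)"
      if "x \<in> carrier_vec n" "\<And>j. j < m \<Longrightarrow> \<eta> j \<in> carrier_vec (d j)" for x \<eta>
      by (rule signature_inequality[OF Q _ _ mp _ lift RM(1,2,4,5) that(1)]) (use B Apd cn that(2) in \<open>auto simp: less_imp_le\<close>)
    show "(\<Sum>k<n. \<Sum>j<m. c j * qform (H j) (B j *\<^sub>v col LM k)) \<le> (\<Sum>j<m. c j * frobenius (d j) (pd_inverse (d j) (A j)) (H j))"
      if "\<And>j. j < m \<Longrightarrow> H j \<in> self_adjoint (d j)" "\<And>j x. j < m \<Longrightarrow> x \<in> carrier_vec (d j) \<Longrightarrow> qform (A j) x + qform (H j) x \<le> qform (G j) x" for H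
      by (rule log_det_minimizer_variation[OF Q _ A min _ _ RM(1,2,3,5)]) (use B that in auto)
  qed
  have F0: "F j 0 x = (\<Sum>i\<in>I j. w j i * gaussian (\<Gamma> j i) (B j *\<^sub>v x - a j i))" if j: "j < m" and x: "x \<in> carrier_vec n" for j x
    unfolding F_def
  proof (intro sum.cong refl)
    fix i assume i: "i \<in> I j"
    note f = fr[OF j \<Gamma>(1)[OF j i]]
    have Ba: "B j *\<^sub>v x - a j i \<in> carrier_vec (d j)" using Bx[OF j x] a[OF j i] by simp
    have "u j i k 0 x = (R j (\<Gamma> j i) *\<^sub>v (B j *\<^sub>v x - a j i)) $ k" if k: "k < d j" for k
    proof -
      have "R j (\<Gamma> j i) *\<^sub>v (B j *\<^sub>v x - a j i) = R j (\<Gamma> j i) *\<^sub>v (B j *\<^sub>v x) - R j (\<Gamma> j i) *\<^sub>v a j i"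
        by (rule mult_minus_distrib_mat_vec[OF f(1) Bx[OF j x] a[OF j i]])
      moreover have "dim_vec (R j (\<Gamma> j i) *\<^sub>v a j i) = d j" using f(1) by simp
      ultimately show ?thesis using k vvx[OF j \<Gamma>(1)[OF j i] k x] by (simp add: u_def del: index_mult_mat_vec dim_mult_mat_vec)
    qed
    then have \<phi>0: "\<phi> j i 0 x = ww j i * exp (\<Sum>k<d j. ln (l j (\<Gamma> j i) k) / 2 - pi * (l j (\<Gamma> j i) k * ((R j (\<Gamma> j i) *\<^sub>v (B j *\<^sub>v x - a j i)) $ k)\<^sup>2))"
      unfolding \<phi>_def E_def g_def by (intro arg_cong2[of _ _ _ _ "(*)"] arg_cong[of _ _ exp] sum.cong refl) simp
    then show "\<phi> j i 0 x = w j i * gaussian (\<Gamma> j i) (B j *\<^sub>v x - a j i)"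
    proof -
      have "gaussian (transpose_mat (R j (\<Gamma> j i)) * diag_of (d j) (l j (\<Gamma> j i)) * R j (\<Gamma> j i)) (B j *\<^sub>v x - a j i) =
          \<bar>Determinant.det (R j (\<Gamma> j i))\<bar> * exp (\<Sum>k<d j. ln (l j (\<Gamma> j i) k) / 2 - pi * (l j (\<Gamma> j i) k * ((R j (\<Gamma> j i) *\<^sub>v (B j *\<^sub>v x - a j i)) $ k)\<^sup>2))"
        by (rule gaussian_congruence[OF f(1) f(7) Ba])
      then have "gaussian (\<Gamma> j i) (B j *\<^sub>v x - a j i) =
          \<bar>Determinant.det (R j (\<Gamma> j i))\<bar> * exp (\<Sum>k<d j. ln (l j (\<Gamma> j i) k) / 2 - pi * (l j (\<Gamma> j i) k * ((R j (\<Gamma> j i) *\<^sub>v (B j *\<^sub>v x - a j i)) $ k)\<^sup>2))"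
        unfolding f(6)[symmetric] .
      then show ?thesis unfolding \<phi>0 by (simp add: ww_def)
    qed
  qed
  \<comment> \<open>At t = 1 all inverse variances are 1 and all centers are 0, so in every frame
    the component has become a multiple of the same Gaussian g_A.\<close>
  have F1: "F j 1 x = (\<Sum>i\<in>I j. w j i) * gaussian (A j) (B j *\<^sub>v x)" if j: "j < m" and x: "x \<in> carrier_vec n" for j x
    unfolding F_def sum_distrib_right
  proof (intro sum.cong refl)
    fix i assume i: "i \<in> I j"
    note f = fr[OF j \<Gamma>(1)[OF j i]]
    have "\<phi> j i 1 x = ww j i * exp (\<Sum>k<d j. ln 1 / 2 - pi * (1 * ((R j (\<Gamma> j i) *\<^sub>v (B j *\<^sub>v x)) $ k)\<^sup>2))"
      unfolding \<phi>_def E_def g_def u_def using f(7) vvx[OF j \<Gamma>(1)[OF j i] _ x]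
      by (intro arg_cong2[of _ _ _ _ "(*)"] arg_cong[of _ _ exp] sum.cong refl) (simp add: less_imp_neq[symmetric])
    moreover have "gaussian (A j) (B j *\<^sub>v x) = \<bar>Determinant.det (R j (\<Gamma> j i))\<bar> * exp (\<Sum>k<d j. ln 1 / 2 - pi * (1 * ((R j (\<Gamma> j i) *\<^sub>v (B j *\<^sub>v x)) $ k)\<^sup>2))"
      using gaussian_congruence[OF f(1) _ Bx[OF j x], of "\<lambda>_. 1"] f(1,5) by (simp add: one_mat_eq_diag_of[symmetric])
    ultimately show "\<phi> j i 1 x = w j i * gaussian (A j) (B j *\<^sub>v x)" by (simp add: ww_def)
  qed
  have Wt: "W t x = exp (- pi * qform Q x) * (\<Prod>j<m. F j t x powr c j)" for t x
    unfolding W_def by (rule powr_prod_exp) (rule F_pos)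
  have W0: "W 0 x = exp (- pi * qform Q x) * (\<Prod>j<m. (\<Sum>i\<in>I j. w j i * gaussian (\<Gamma> j i) (B j *\<^sub>v x - a j i)) powr c j)"
    and W1: "W 1 x = exp (- pi * qform Q x) * (\<Prod>j<m. ((\<Sum>i\<in>I j. w j i) * gaussian (A j) (B j *\<^sub>v x)) powr c j)"
    if x: "x \<in> carrier_vec n" for x
    unfolding Wt using F0[OF _ x] F1[OF _ x] by simp_all
  have nn: "(\<integral>\<^sup>+x. ennreal (W t x) \<partial>lborel_vec n) = ennreal (LINT x|lborel_vec n. W t x)" if "0 \<le> t" "t \<le> 1" for t
    by (rule nn_integral_eq_integral[OF integrable_W[OF that]]) (simp add: W_pos less_imp_le)
  have "(\<integral>\<^sup>+x. ennreal (W 1 x) \<partial>lborel_vec n) \<le> (\<integral>\<^sup>+x. ennreal (W 0 x) \<partial>lborel_vec n)"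
    using integral_W_le by (simp add: nn ennreal_leI)
  then show ?thesis
    by (simp add: W0 W1 cong: nn_integral_cong_simp)
qed

section \<open>From Gaussian mixtures to functions of type \<open>G\<close>\<close>

locale nondegenerate_datum =
  fixes n m mp :: nat and d :: "nat \<Rightarrow> nat" and B :: "nat \<Rightarrow> real mat" and c :: "nat \<Rightarrow> real"
    and Q :: "real mat" and G :: "nat \<Rightarrow> real mat"
  assumes datum: "BL_datum n m mp d B c Q G" and nondeg: "nondegenerate n mp d B c Q G"
begin

lemma mp_le: "mp \<le> m" and B: "j < m \<Longrightarrow> B j \<in> carrier_mat (d j) n"
  and cp: "j < mp \<Longrightarrow> c j > 0" and cn: "mp \<le> j \<Longrightarrow> j < m \<Longrightarrow> c j < 0"
  and Q: "Q \<in> self_adjoint n" and G: "j < m \<Longrightarrow> G j \<in> positive_definite (d j)"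
  using datum by (auto simp: BL_datum_def)

lemma Bx: "j < m \<Longrightarrow> x \<in> carrier_vec n \<Longrightarrow> B j *\<^sub>v x \<in> carrier_vec (d j)"
  using mult_mat_vec_carrier[OF B] .

lemma lift: "nonpos_lifting n mp d B Q"
  using nondeg B mp_le Q by (intro nonpos_lifting_of_index) (auto simp: nondegenerate_def)

text \<open>The perturbation makes Q(w) <= 0 strict on lifted vectors, by \<epsilon> times the
  squared length of the prescribed values B_j w; this is the source of the uniform lower bound on
  A_j.\<close>

definition Qe where "Qe \<epsilon> = Q_plus n mp B (\<lambda>_. - \<epsilon>) Q (\<lambda>j. 1\<^sub>m (d j))"

lemma Qe: "Qe \<epsilon> \<in> self_adjoint n"
  unfolding Qe_def using Q B mp_le by (intro Q_plus_self_adjoint[where d = d]) (auto simp: self_adjoint_def)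

lemma qform_Qe:
  assumes x: "x \<in> carrier_vec n"
  shows "qform (Qe \<epsilon>) x = qform Q x - \<epsilon> * (\<Sum>j<mp. (B j *\<^sub>v x) \<bullet> (B j *\<^sub>v x))"
proof -
  have "qform (Qe \<epsilon>) x = qform Q x + (\<Sum>j<mp. - \<epsilon> * qform (1\<^sub>m (d j)) (B j *\<^sub>v x))"
    unfolding Qe_def using self_adjointD(1)[OF Q] B mp_le x by (intro qform_Q_plus[where d = d]) auto
  also have "(\<Sum>j<mp. - \<epsilon> * qform (1\<^sub>m (d j)) (B j *\<^sub>v x)) = (\<Sum>j<mp. - \<epsilon> * ((B j *\<^sub>v x) \<bullet> (B j *\<^sub>v x)))"
    using Bx[OF _ x] mp_le by (intro sum.cong refl) (simp add: qform_one_mat)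
  finally show ?thesis by (simp add: sum_distrib_left sum_negf)
qed

lemma sq_nonneg: "x \<in> carrier_vec n \<Longrightarrow> (\<Sum>j<mp. (B j *\<^sub>v x) \<bullet> (B j *\<^sub>v x)) \<ge> 0"
  using Bx mp_le by (intro sum_nonneg) (auto simp: scalar_prod_self_sum[OF Bx] intro!: sum_nonneg)

lemma lift_Qe:
  assumes "\<epsilon> \<ge> 0"
  shows "nonpos_lifting n mp d B (Qe \<epsilon>)"
  unfolding nonpos_lifting_def
proof (intro allI impI)
  fix y :: "nat \<Rightarrow> real vec" assume "\<forall>j<mp. y j \<in> carrier_vec (d j)"
  then obtain w where w: "w \<in> carrier_vec n" "qform Q w \<le> 0" "\<forall>j<mp. B j *\<^sub>v w = y j"
    using lift unfolding nonpos_lifting_def by blast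
  have "qform (Qe \<epsilon>) w \<le> 0" using qform_Qe[OF w(1)] w(2) mult_nonneg_nonneg[OF assms sq_nonneg[OF w(1)]] by simp
  then show "\<exists>w\<in>carrier_vec n. qform (Qe \<epsilon>) w \<le> 0 \<and> (\<forall>j<mp. B j *\<^sub>v w = y j)" using w by blast
qed

text \<open>Reference inverse covariances: G_j itself for c_j > 0, the decay of truncated functions
  of type G, and a small multiple of G_j for c_j < 0, so that condition (ii) survives when the
  negative terms are added.\<close>

definition ref where "ref s j = (if j < mp then G j else s \<cdot>\<^sub>m G j)"

lemma smult_positive_definite:
  assumes "A \<in> positive_definite k" "s > 0"
  shows "s \<cdot>\<^sub>m A \<in> positive_definite k"
proof (rule positive_definiteI)
  note A = positive_definiteD[OF assms(1)]
  have "transpose_mat (s \<cdot>\<^sub>m A) = s \<cdot>\<^sub>m transpose_mat A" by (rule eq_matI) auto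
  then show "s \<cdot>\<^sub>m A \<in> self_adjoint k" using A by (simp add: self_adjoint_def)
  fix x :: "real vec" assume "x \<in> carrier_vec k" "x \<noteq> 0\<^sub>v k"
  then show "qform (s \<cdot>\<^sub>m A) x > 0" using A assms(2) by (simp add: qform_smult_mat)
qed

lemma ref: "s > 0 \<Longrightarrow> j < m \<Longrightarrow> ref s j \<in> positive_definite (d j)"
  using G smult_positive_definite by (simp add: ref_def)

lemma ref_le:
  assumes "0 \<le> s" "s \<le> 1" "j < m"
  shows "loewner_le (d j) (ref s j) (G j)"
  unfolding loewner_le_def
proof
  fix x :: "real vec" assume x: "x \<in> carrier_vec (d j)"
  have "s * qform (G j) x \<le> 1 * qform (G j) x"
    using assms positive_definiteD(5)[OF G x] by (intro mult_right_mono) auto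
  then show "qform (ref s j) x \<le> qform (G j) x"
    using qform_smult_mat[OF positive_definiteD(1)[OF G[OF assms(3)]] x] by (simp add: ref_def)
qed

lemma qform_Q_plus_ref:
  assumes "s > 0" and x: "x \<in> carrier_vec n"
  shows "qform (Q_plus n m B c (Qe \<epsilon>) (ref s)) x = qform (Qe \<epsilon>) x + (\<Sum>j<m. c j * qform (ref s j) (B j *\<^sub>v x))"
  using self_adjointD(1)[OF Qe] B positive_definiteD(1)[OF ref[OF assms(1)]] x by (intro qform_Q_plus[where d = d]) auto

text \<open>Condition (ii) leaves room \<delta> |x|^2. The \<epsilon>-term and the negative
  exponents scaled by s together cost at most s times a fixed form bounded by K |x|^2, so s K <=
  \<delta> / 2 suffices for all \<epsilon> <= s.\<close>

lemma reference_form_coercive: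
  "\<exists>s \<delta>. 0 < s \<and> s \<le> 1 \<and> 0 < \<delta> \<and> (\<forall>\<epsilon> x. 0 \<le> \<epsilon> \<longrightarrow> \<epsilon> \<le> s \<longrightarrow> x \<in> carrier_vec n \<longrightarrow>
     \<delta> * (x \<bullet> x) \<le> qform (Q_plus n m B c (Qe \<epsilon>) (ref s)) x)"
proof -
  have "Q_plus n mp B c Q G \<in> positive_definite n" using nondeg by (simp add: nondegenerate_def)
  then obtain \<delta> where \<delta>: "\<delta> > 0" "\<And>x. x \<in> carrier_vec n \<Longrightarrow> \<delta> * (x \<bullet> x) \<le> qform (Q_plus n mp B c Q G) x"
    using positive_definite_coercive by blast
  \<comment> \<open>With the coefficients \<open>e\<close> this is the fixed form: the sum of |B_j
    x|^2 over j < mp plus the sum of |c_j| G_j(B_j x) over the other j, written as a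
    \<open>Q_plus\<close> with Q = 0 so that the general bound on self-adjoint forms
    applies.\<close>
  define C where "C j = (if j < mp then 1\<^sub>m (d j) else G j)" for j
  define e where "e j = (if j < mp then 1 else - c j)" for j
  have C: "C j \<in> self_adjoint (d j)" if "j < m" for j
    using positive_definiteD(3)[OF G[OF that]] by (simp add: C_def self_adjoint_def)
  have 0: "0\<^sub>m n n \<in> self_adjoint n" by (simp add: self_adjoint_def)
  have "Q_plus n m B e (0\<^sub>m n n) C \<in> self_adjoint n" using 0 B C by (intro Q_plus_self_adjoint[where d = d]) auto
  then obtain K where K: "K \<ge> 0" "\<And>x. x \<in> carrier_vec n \<Longrightarrow> \<bar>qform (Q_plus n m B e (0\<^sub>m n n) C) x\<bar> \<le> K * (x \<bullet> x)"
    using self_adjoint_qform_bounds by blast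
  define s where "s = min 1 (\<delta> / (2 * (K + 1)))"
  have s: "0 < s" "s \<le> 1" using \<delta> K by (auto simp: s_def)
  have sK: "s * K \<le> \<delta> / 2"
  proof -
    have "s * K \<le> \<delta> / (2 * (K + 1)) * (K + 1)" using K \<delta> s by (intro mult_mono) (auto simp: s_def)
    also have "\<delta> / (2 * (K + 1)) * (K + 1) = \<delta> / 2" using K(1) by (simp add: field_simps)
    finally show ?thesis .
  qed
  have "\<delta> / 2 * (x \<bullet> x) \<le> qform (Q_plus n m B c (Qe \<epsilon>) (ref s)) x"
    if \<epsilon>: "0 \<le> \<epsilon>" "\<epsilon> \<le> s" and x: "x \<in> carrier_vec n" for \<epsilon> x
  proof -
    have split: "(\<Sum>j<m. f j) = (\<Sum>j<mp. f j) + (\<Sum>j=mp..<m. f j)" for f :: "nat \<Rightarrow> real"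
      using mp_le by (simp add: lessThan_atLeast0 sum.atLeastLessThan_concat)
    define P where "P = (\<Sum>j<mp. (B j *\<^sub>v x) \<bullet> (B j *\<^sub>v x))"
    define N where "N = (\<Sum>j=mp..<m. c j * qform (G j) (B j *\<^sub>v x))"
    have xx: "x \<bullet> x \<ge> 0" using x by (simp add: scalar_prod_self_sum sum_nonneg)
    have "qform (Q_plus n m B e (0\<^sub>m n n) C) x = qform (0\<^sub>m n n) x + (\<Sum>j<m. e j * qform (C j) (B j *\<^sub>v x))"
      using B self_adjointD(1)[OF C] x by (intro qform_Q_plus[where d = d]) auto
    also have "qform (0\<^sub>m n n) x = 0" using x by (subst qform_sum[of _ n]) auto
    also have "(\<Sum>j<m. e j * qform (C j) (B j *\<^sub>v x)) = P - N"
      unfolding split P_def N_def using Bx[OF _ x] mp_le by (simp add: e_def C_def qform_one_mat sum_negf)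
    finally have PN: "P - N \<le> K * (x \<bullet> x)" using K(2)[OF x] by simp
    have "qform (Q_plus n m B c (Qe \<epsilon>) (ref s)) x = qform Q x - \<epsilon> * P + (\<Sum>j<m. c j * qform (ref s j) (B j *\<^sub>v x))"
      unfolding qform_Q_plus_ref[OF s(1) x] qform_Qe[OF x] P_def ..
    also have "(\<Sum>j<m. c j * qform (ref s j) (B j *\<^sub>v x)) = (\<Sum>j<mp. c j * qform (G j) (B j *\<^sub>v x)) + s * N"
    proof -
      have "(\<Sum>j=mp..<m. c j * qform (ref s j) (B j *\<^sub>v x)) = (\<Sum>j=mp..<m. s * (c j * qform (G j) (B j *\<^sub>v x)))"
      proof (intro sum.cong refl)
        fix j assume j: "j \<in> {mp..<m}"
        then have jm: "j < m" by simp
        show "c j * qform (ref s j) (B j *\<^sub>v x) = s * (c j * qform (G j) (B j *\<^sub>v x))"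
          using j qform_smult_mat[OF positive_definiteD(1)[OF G[OF jm]] Bx[OF jm x], of s] by (simp add: ref_def)
      qed
      then show ?thesis unfolding split N_def by (simp add: ref_def sum_distrib_left)
    qed
    also have "qform Q x - \<epsilon> * P + ((\<Sum>j<mp. c j * qform (G j) (B j *\<^sub>v x)) + s * N) = qform (Q_plus n mp B c Q G) x - \<epsilon> * P + s * N"
      using self_adjointD(1)[OF Q] B positive_definiteD(1)[OF G] x mp_le by (subst qform_Q_plus[where d = d]) auto
    also have "\<dots> \<ge> \<delta> * (x \<bullet> x) - s * P + s * N"
      using \<delta>(2)[OF x] mult_right_mono[OF \<epsilon>(2) sq_nonneg[OF x]] by (simp add: P_def)
    finally have "\<delta> * (x \<bullet> x) - s * (P - N) \<le> qform (Q_plus n m B c (Qe \<epsilon>) (ref s)) x" by (simp add: algebra_simps)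
    moreover have "s * (P - N) \<le> s * (K * (x \<bullet> x))" using PN s by (intro mult_left_mono) auto
    moreover have "s * K * (x \<bullet> x) \<le> \<delta> / 2 * (x \<bullet> x)" using sK xx by (intro mult_right_mono)
    ultimately show ?thesis by (simp add: algebra_simps)
  qed
  then show ?thesis using s \<delta>(1) by (intro exI[of _ s] exI[of _ "\<delta> / 2"]) auto
qed

text \<open>One number serves both as the factor in \<open>ref\<close> and as the upper limit for
  \<epsilon>.\<close>

definition s0 where "s0 = (SOME s. \<exists>\<delta>. 0 < s \<and> s \<le> 1 \<and> 0 < \<delta> \<and> (\<forall>\<epsilon> x. 0 \<le> \<epsilon> \<longrightarrow> \<epsilon> \<le> s \<longrightarrow> x \<in> carrier_vec n \<longrightarrow>
     \<delta> * (x \<bullet> x) \<le> qform (Q_plus n m B c (Qe \<epsilon>) (ref s)) x))"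

lemma s0: "0 < s0" "s0 \<le> 1"
  and s0_coercive: "\<exists>\<delta>>0. \<forall>\<epsilon> x. 0 \<le> \<epsilon> \<longrightarrow> \<epsilon> \<le> s0 \<longrightarrow> x \<in> carrier_vec n \<longrightarrow> \<delta> * (x \<bullet> x) \<le> qform (Q_plus n m B c (Qe \<epsilon>) (ref s0)) x"
  using someI_ex[OF reference_form_coercive, folded s0_def] by auto

lemma Q_plus_ref_pd:
  assumes "0 \<le> \<epsilon>" "\<epsilon> \<le> s0"
  shows "Q_plus n m B c (Qe \<epsilon>) (ref s0) \<in> positive_definite n"
proof (rule positive_definiteI)
  show "Q_plus n m B c (Qe \<epsilon>) (ref s0) \<in> self_adjoint n"
    using Qe B positive_definiteD(3)[OF ref[OF s0(1)]] by (intro Q_plus_self_adjoint[where d = d]) auto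
  fix x :: "real vec" assume x: "x \<in> carrier_vec n" "x \<noteq> 0\<^sub>v n"
  obtain \<delta> where "\<delta> > 0" "\<delta> * (x \<bullet> x) \<le> qform (Q_plus n m B c (Qe \<epsilon>) (ref s0)) x"
    using s0_coercive assms x(1) by blast
  then show "qform (Q_plus n m B c (Qe \<epsilon>) (ref s0)) x > 0"
    using scalar_prod_self_pos[OF x] by (metis mult_pos_pos order_less_le_trans)
qed

lemma minimizer_exists:
  assumes \<epsilon>: "0 < \<epsilon>" "\<epsilon> \<le> s0"
  shows "\<exists>A. feasible n m d B c (Qe \<epsilon>) G A \<and>
    (\<forall>A'. feasible n m d B c (Qe \<epsilon>) G A' \<longrightarrow> log_det_functional n m B c (Qe \<epsilon>) A \<le> log_det_functional n m B c (Qe \<epsilon>) A')"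
proof (rule log_det_minimizer_exists[OF Qe B G mp_le cp cn])
  \<comment> \<open>1 + sum c_j exceeds every positive c_j, so one constant serves all j <
    mp.\<close>
  define \<kappa> where "\<kappa> = \<epsilon> / (1 + (\<Sum>j<mp. c j))"
  have C: "(\<Sum>j<mp. c j) \<ge> 0" using cp by (intro sum_nonneg) (auto simp: less_imp_le)
  show "0 < \<kappa>" using \<epsilon> C by (simp add: \<kappa>_def)
  show "feasible n m d B c (Qe \<epsilon>) G (ref s0)"
    using ref[OF s0(1)] ref_le[of s0] s0 Q_plus_ref_pd[of \<epsilon>] \<epsilon> by (auto simp: feasible_def)
  fix A j and y :: "real vec" assume A: "feasible n m d B c (Qe \<epsilon>) G A" and j: "j < mp" and y: "y \<in> carrier_vec (d j)"
  have jm: "j < m" using j mp_le by simp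
  have Apd: "A i \<in> positive_definite (d i)" if "i < m" for i using A that by (simp add: feasible_def)
  \<comment> \<open>A lift of y in slot j and of 0 in the other positive slots. Then 0 <= M(w) <=
    -\<epsilon> |y|^2 + c_j A_j(y), because negative exponents contribute nonpositive terms.\<close>
  obtain w where w: "w \<in> carrier_vec n" "qform Q w \<le> 0" "\<forall>i<mp. B i *\<^sub>v w = (if i = j then y else 0\<^sub>v (d i))"
    using lift y unfolding nonpos_lifting_def by (elim allE[of _ "\<lambda>i. if i = j then y else 0\<^sub>v (d i)"]) auto
  have "0 \<le> qform (Q_plus n m B c (Qe \<epsilon>) A) w"
    using A w(1) positive_definiteD(5) unfolding feasible_def by blast
  also have "\<dots> = qform (Qe \<epsilon>) w + (\<Sum>i<m. c i * qform (A i) (B i *\<^sub>v w))"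
    using self_adjointD(1)[OF Qe] B positive_definiteD(1)[OF Apd] w(1) by (intro qform_Q_plus[where d = d]) auto
  also have "(\<Sum>i<m. c i * qform (A i) (B i *\<^sub>v w)) \<le> (\<Sum>i<m. if i = j then c j * qform (A j) y else 0)"
  proof (intro sum_mono)
    fix i assume "i \<in> {..<m}"
    then have i: "i < m" by simp
    show "c i * qform (A i) (B i *\<^sub>v w) \<le> (if i = j then c j * qform (A j) y else 0)"
    proof (cases "i < mp")
      case True
      have "qform (A i) (0\<^sub>v (d i)) = 0" using positive_definiteD(1)[OF Apd[OF i]] by (subst qform_sum[of _ "d i"]) auto
      then show ?thesis using w(3) True by simp
    next
      case False
      have "c i * qform (A i) (B i *\<^sub>v w) \<le> 0"
        using cn[of i] False i positive_definiteD(5)[OF Apd[OF i] Bx[OF i w(1)]] by (intro mult_nonpos_nonneg) auto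
      then show ?thesis using False j by auto
    qed
  qed
  also have "\<dots> = c j * qform (A j) y" using jm by simp
  also have "qform (Qe \<epsilon>) w \<le> - (\<epsilon> * (y \<bullet> y))"
  proof -
    have "(\<Sum>i<mp. (B i *\<^sub>v w) \<bullet> (B i *\<^sub>v w)) = (\<Sum>i<mp. if i = j then y \<bullet> y else 0)"
      using w(3) by (intro sum.cong refl) auto
    then show ?thesis using qform_Qe[OF w(1), of \<epsilon>] w(2) j by simp
  qed
  finally have le: "\<epsilon> * (y \<bullet> y) \<le> c j * qform (A j) y" by simp
  also have "\<dots> \<le> (1 + (\<Sum>j<mp. c j)) * qform (A j) y"
  proof (intro mult_right_mono)
    show "c j \<le> 1 + (\<Sum>j<mp. c j)"
      using member_le_sum[of j "{..<mp}" c] j cp by (auto simp: less_imp_le)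
    show "qform (A j) y \<ge> 0" using positive_definiteD(5)[OF Apd[OF jm] y] .
  qed
  finally show "\<kappa> * (y \<bullet> y) \<le> qform (A j) y"
    using C by (simp add: \<kappa>_def pos_divide_le_eq mult.commute)
qed auto

lemma BL_pos:
  assumes "\<And>j y. j < m \<Longrightarrow> y \<in> carrier_vec (d j) \<Longrightarrow> f j y > 0"
  shows "BL n m d B c Q f = (\<integral>\<^sup>+x. ennreal (exp (- pi * qform Q x) * (\<Prod>j<m. f j (B j *\<^sub>v x) powr c j)) \<partial>lborel_vec n)
     / ennreal (\<Prod>j<m. (LINT y|lborel_vec (d j). f j y) powr c j)"
proof -
  have "(\<integral>\<^sup>+x. ennreal (exp (- pi * qform Q x)) * (\<Prod>j<m. pow_ennreal (f j (B j *\<^sub>v x)) (c j)) \<partial>lborel_vec n) =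
    (\<integral>\<^sup>+x. ennreal (exp (- pi * qform Q x) * (\<Prod>j<m. f j (B j *\<^sub>v x) powr c j)) \<partial>lborel_vec n)"
  proof (rule nn_integral_cong)
    fix x assume "x \<in> space (lborel_vec n)"
    then have x: "x \<in> carrier_vec n" by simp
    have "(\<Prod>j<m. pow_ennreal (f j (B j *\<^sub>v x)) (c j)) = (\<Prod>j<m. ennreal (f j (B j *\<^sub>v x) powr c j))"
    proof (intro prod.cong refl)
      fix j assume "j \<in> {..<m}"
      then have "f j (B j *\<^sub>v x) > 0" using assms[OF _ Bx[OF _ x]] by simp
      then show "pow_ennreal (f j (B j *\<^sub>v x)) (c j) = ennreal (f j (B j *\<^sub>v x) powr c j)" by (simp add: pow_ennreal_def)
    qed
    also have "\<dots> = ennreal (\<Prod>j<m. f j (B j *\<^sub>v x) powr c j)" by (rule prod_ennreal) simp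
    finally show "ennreal (exp (- pi * qform Q x)) * (\<Prod>j<m. pow_ennreal (f j (B j *\<^sub>v x)) (c j)) =
        ennreal (exp (- pi * qform Q x) * (\<Prod>j<m. f j (B j *\<^sub>v x) powr c j))"
      by (simp add: ennreal_mult prod_nonneg)
  qed
  then show ?thesis by (simp add: BL_def)
qed

lemma integral_gaussian:
  assumes "A \<in> positive_definite k"
  shows "integrable (lborel_vec k) (gaussian A)" "(LINT y|lborel_vec k. gaussian A y) = 1"
  using integral_gaussian_qform[OF assms] positive_definite_det_pos[OF assms] by (simp_all add: gaussian_def[abs_def])

definition Imin where
  "Imin = (INF A \<in> {A. \<forall>j<m. A j \<in> positive_definite (d j) \<and> loewner_le (d j) (A j) (G j)}. BL n m d B c Q (\<lambda>j. gaussian (A j)))"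

lemma BL_gaussian:
  assumes "\<And>j. j < m \<Longrightarrow> A j \<in> positive_definite (d j)"
  shows "BL n m d B c Q (\<lambda>j. gaussian (A j)) =
    (\<integral>\<^sup>+x. ennreal (exp (- pi * qform Q x) * (\<Prod>j<m. gaussian (A j) (B j *\<^sub>v x) powr c j)) \<partial>lborel_vec n)"
  using gaussian_pos[OF assms] integral_gaussian(2)[OF assms] by (subst BL_pos) (auto simp: divide_ennreal_def)

lemma measurable_gaussian:
  assumes "A \<in> carrier_mat k k" shows "gaussian A \<in> borel_measurable (borel_vec k)"
  unfolding gaussian_def[abs_def] using measurable_qform_self[OF assms] by simp

text \<open>\<open>None\<close> indexes the small centered Gaussian, \<open>Some b\<close> a
  translate of g_G. The minimizer for the perturbed form merely competes in \<open>Imin\<close>,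
  which belongs to Q: \<open>Imin\<close> is at most its Gaussian integral with Q, hence with
  \<open>Qe\<close>, and the flow bounds the latter, multiplied by the masses, by the integral of
  the mixture.\<close>

lemma mixture_lower_bound:
  fixes F :: "nat \<Rightarrow> real vec option set" and w :: "nat \<Rightarrow> real vec option \<Rightarrow> real"
  assumes \<epsilon>: "0 < \<epsilon>" "\<epsilon> \<le> s0"
    and F: "\<And>j. j < m \<Longrightarrow> finite (F j)" "\<And>j b. j < m \<Longrightarrow> Some b \<in> F j \<Longrightarrow> b \<in> carrier_vec (d j)"
    and w: "\<And>j i. j < m \<Longrightarrow> i \<in> F j \<Longrightarrow> w j i \<ge> 0" "\<And>j. j < m \<Longrightarrow> \<exists>i\<in>F j. w j i > 0"
    and neg: "\<And>j. mp \<le> j \<Longrightarrow> j < m \<Longrightarrow> None \<in> F j \<and> w j None > 0"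
    and pos: "\<And>j. j < mp \<Longrightarrow> None \<notin> F j"
  shows "ennreal (\<Prod>j<m. (\<Sum>i\<in>F j. w j i) powr c j) * Imin \<le>
    (\<integral>\<^sup>+x. ennreal (exp (- pi * qform (Qe \<epsilon>) x) * (\<Prod>j<m. (\<Sum>i\<in>F j. w j i *
       (case i of None \<Rightarrow> gaussian (ref s0 j) (B j *\<^sub>v x) | Some b \<Rightarrow> gaussian (G j) (B j *\<^sub>v x - b))) powr c j)) \<partial>lborel_vec n)"
proof -
  obtain A where A: "feasible n m d B c (Qe \<epsilon>) G A"
    and min: "\<And>A'. feasible n m d B c (Qe \<epsilon>) G A' \<Longrightarrow> log_det_functional n m B c (Qe \<epsilon>) A \<le> log_det_functional n m B c (Qe \<epsilon>) A'"
    using minimizer_exists[OF \<epsilon>] by blast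
  have Apd: "A j \<in> positive_definite (d j)" and Ale: "loewner_le (d j) (A j) (G j)" if "j < m" for j
    using A that by (auto simp: feasible_def)
  define S where "S j = (\<Sum>i\<in>F j. w j i)" for j
  have S: "S j > 0" if "j < m" for j
    unfolding S_def using w(2)[OF that] w(1)[OF that] F(1)[OF that] by (auto intro: sum_pos2)
  define a where "a j i = (case i of None \<Rightarrow> 0\<^sub>v (d j) | Some b \<Rightarrow> b)" for j :: nat and i :: "real vec option"
  define \<Gamma> where "\<Gamma> j i = (case i of None \<Rightarrow> ref s0 j | Some b \<Rightarrow> G j)" for j :: nat and i :: "real vec option"
  have Gpd: "\<Gamma> j i \<in> positive_definite (d j)" "loewner_le (d j) (\<Gamma> j i) (G j)" if "j < m" for j i
    using ref[OF s0(1) that] G[OF that] ref_le[of s0 j] s0 that by (auto simp: \<Gamma>_def loewner_le_def split: option.split)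
  have "(\<integral>\<^sup>+x. ennreal (exp (- pi * qform (Qe \<epsilon>) x) * (\<Prod>j<m. (S j * gaussian (A j) (B j *\<^sub>v x)) powr c j)) \<partial>lborel_vec n)
    \<le> (\<integral>\<^sup>+x. ennreal (exp (- pi * qform (Qe \<epsilon>) x) * (\<Prod>j<m. (\<Sum>i\<in>F j. w j i * gaussian (\<Gamma> j i) (B j *\<^sub>v x - a j i)) powr c j)) \<partial>lborel_vec n)"
    unfolding S_def
  proof (rule gaussian_mixture_inequality[OF Qe B mp_le cp cn lift_Qe A min ref[OF s0(1)] Q_plus_ref_pd F(1) w _ Gpd])
    show "a j i \<in> carrier_vec (d j)" if "j < m" "i \<in> F j" for j i
      using F(2)[OF that(1)] that(2) by (auto simp: a_def split: option.split)
    show "\<Gamma> j i = ref s0 j" if "j < mp" "i \<in> F j" for j i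
      using that pos[OF that(1)] by (auto simp: \<Gamma>_def ref_def split: option.split)
    show "\<exists>i\<in>F j. 0 < w j i \<and> a j i = 0\<^sub>v (d j) \<and> \<Gamma> j i = ref s0 j" if "mp \<le> j" "j < m" for j
      using neg[OF that] by (intro bexI[of _ None]) (auto simp: a_def \<Gamma>_def)
  qed (use \<epsilon> in auto)
  also have "\<dots> = (\<integral>\<^sup>+x. ennreal (exp (- pi * qform (Qe \<epsilon>) x) * (\<Prod>j<m. (\<Sum>i\<in>F j. w j i *
       (case i of None \<Rightarrow> gaussian (ref s0 j) (B j *\<^sub>v x) | Some b \<Rightarrow> gaussian (G j) (B j *\<^sub>v x - b))) powr c j)) \<partial>lborel_vec n)"
  proof (rule nn_integral_cong)
    fix x assume "x \<in> space (lborel_vec n)"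
    then have x: "x \<in> carrier_vec n" by simp
    have "gaussian (\<Gamma> j i) (B j *\<^sub>v x - a j i) =
        (case i of None \<Rightarrow> gaussian (ref s0 j) (B j *\<^sub>v x) | Some b \<Rightarrow> gaussian (G j) (B j *\<^sub>v x - b))" if "j < m" for j i
    proof -
      have "y - 0\<^sub>v (d j) = y" if "y \<in> carrier_vec (d j)" for y :: "real vec" using that by (intro eq_vecI) auto
      then show ?thesis using Bx[OF that x] by (auto simp: \<Gamma>_def a_def split: option.split)
    qed
    then show "ennreal (exp (- pi * qform (Qe \<epsilon>) x) * (\<Prod>j<m. (\<Sum>i\<in>F j. w j i * gaussian (\<Gamma> j i) (B j *\<^sub>v x - a j i)) powr c j)) =
      ennreal (exp (- pi * qform (Qe \<epsilon>) x) * (\<Prod>j<m. (\<Sum>i\<in>F j. w j i *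
       (case i of None \<Rightarrow> gaussian (ref s0 j) (B j *\<^sub>v x) | Some b \<Rightarrow> gaussian (G j) (B j *\<^sub>v x - b))) powr c j))"
      by simp
  qed
  finally have up: "(\<integral>\<^sup>+x. ennreal (exp (- pi * qform (Qe \<epsilon>) x) * (\<Prod>j<m. (S j * gaussian (A j) (B j *\<^sub>v x)) powr c j)) \<partial>lborel_vec n) \<le> \<dots>" .
  have BLg: "BL n m d B c Q (\<lambda>j. gaussian (A j)) =
    (\<integral>\<^sup>+x. ennreal (exp (- pi * qform Q x) * (\<Prod>j<m. gaussian (A j) (B j *\<^sub>v x) powr c j)) \<partial>lborel_vec n)"
    by (rule BL_gaussian) (rule Apd)
  have "ennreal (\<Prod>j<m. S j powr c j) * Imin \<le> ennreal (\<Prod>j<m. S j powr c j) * BL n m d B c Q (\<lambda>j. gaussian (A j))"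
    unfolding Imin_def using Apd Ale by (intro mult_left_mono INF_lower) auto
  also have "\<dots> = (\<integral>\<^sup>+x. ennreal (\<Prod>j<m. S j powr c j) * ennreal (exp (- pi * qform Q x) * (\<Prod>j<m. gaussian (A j) (B j *\<^sub>v x) powr c j)) \<partial>lborel_vec n)"
    unfolding BLg
  proof (rule nn_integral_cmult[symmetric])
    have "(\<lambda>x. gaussian (A j) (B j *\<^sub>v x)) \<in> borel_measurable (borel_vec n)" if "j < m" for j
      by (rule measurable_compose[OF measurable_mult_mat_vec[OF B[OF that] measurable_ident_sets[OF refl]]
           measurable_gaussian[OF positive_definiteD(1)[OF Apd[OF that]]]])
    then have "(\<lambda>x. ennreal (exp (- pi * qform Q x) * (\<Prod>j<m. gaussian (A j) (B j *\<^sub>v x) powr c j))) \<in> borel_measurable (borel_vec n)"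
      using measurable_qform_self[OF self_adjointD(1)[OF Q]] by simp
    then show "(\<lambda>x. ennreal (exp (- pi * qform Q x) * (\<Prod>j<m. gaussian (A j) (B j *\<^sub>v x) powr c j))) \<in> borel_measurable (lborel_vec n)"
      by (simp cong: measurable_cong_sets)
  qed
  also have "\<dots> \<le> (\<integral>\<^sup>+x. ennreal (exp (- pi * qform (Qe \<epsilon>) x) * (\<Prod>j<m. (S j * gaussian (A j) (B j *\<^sub>v x)) powr c j)) \<partial>lborel_vec n)"
  proof (rule nn_integral_mono)
    fix x assume "x \<in> space (lborel_vec n)"
    then have x: "x \<in> carrier_vec n" by simp
    have pr: "(\<Prod>j<m. (S j * gaussian (A j) (B j *\<^sub>v x)) powr c j) = (\<Prod>j<m. S j powr c j) * (\<Prod>j<m. gaussian (A j) (B j *\<^sub>v x) powr c j)"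
      unfolding prod.distrib[symmetric] using S gaussian_pos[OF Apd] by (intro prod.cong refl) (simp add: powr_mult less_imp_le)
    have "exp (- pi * qform Q x) \<le> exp (- pi * qform (Qe \<epsilon>) x)"
      using qform_Qe[OF x, of \<epsilon>] mult_nonneg_nonneg[OF less_imp_le[OF \<epsilon>(1)] sq_nonneg[OF x]] by simp
    moreover have "(\<Prod>j<m. S j powr c j) * (\<Prod>j<m. gaussian (A j) (B j *\<^sub>v x) powr c j) \<ge> 0"
      by (intro mult_nonneg_nonneg prod_nonneg) auto
    ultimately have "exp (- pi * qform Q x) * ((\<Prod>j<m. S j powr c j) * (\<Prod>j<m. gaussian (A j) (B j *\<^sub>v x) powr c j))
      \<le> exp (- pi * qform (Qe \<epsilon>) x) * ((\<Prod>j<m. S j powr c j) * (\<Prod>j<m. gaussian (A j) (B j *\<^sub>v x) powr c j))"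
      by (rule mult_right_mono)
    then have "(\<Prod>j<m. S j powr c j) * (exp (- pi * qform Q x) * (\<Prod>j<m. gaussian (A j) (B j *\<^sub>v x) powr c j))
      \<le> exp (- pi * qform (Qe \<epsilon>) x) * ((\<Prod>j<m. S j powr c j) * (\<Prod>j<m. gaussian (A j) (B j *\<^sub>v x) powr c j))"
      by (simp only: mult.left_commute)
    moreover have "ennreal (\<Prod>j<m. S j powr c j) * ennreal (exp (- pi * qform Q x) * (\<Prod>j<m. gaussian (A j) (B j *\<^sub>v x) powr c j))
       = ennreal ((\<Prod>j<m. S j powr c j) * (exp (- pi * qform Q x) * (\<Prod>j<m. gaussian (A j) (B j *\<^sub>v x) powr c j)))"
      by (rule ennreal_mult[symmetric]) (auto intro!: mult_nonneg_nonneg prod_nonneg)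
    ultimately show "ennreal (\<Prod>j<m. S j powr c j) * ennreal (exp (- pi * qform Q x) * (\<Prod>j<m. gaussian (A j) (B j *\<^sub>v x) powr c j))
       \<le> ennreal (exp (- pi * qform (Qe \<epsilon>) x) * (\<Prod>j<m. (S j * gaussian (A j) (B j *\<^sub>v x)) powr c j))"
      unfolding pr by (simp only: ennreal_leI)
  qed
  also note up
  finally show ?thesis unfolding S_def .
qed

end

section \<open>Discretization of the mixing measures\<close>

definition rnd :: "nat \<Rightarrow> real \<Rightarrow> real" where
  "rnd i r = (if \<bar>r\<bar> \<le> real i then of_int \<lfloor>r * real (Suc i)\<rfloor> / real (Suc i) else 0)"

lemma rnd_close:
  assumes "\<bar>r\<bar> \<le> real i"
  shows "\<bar>rnd i r - r\<bar> \<le> 1 / real (Suc i)"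
proof -
  have "rnd i r - r = (of_int \<lfloor>r * real (Suc i)\<rfloor> - r * real (Suc i)) / real (Suc i)"
    using assms by (simp add: rnd_def diff_divide_distrib)
  moreover have "\<bar>of_int \<lfloor>r * real (Suc i)\<rfloor> - r * real (Suc i)\<bar> \<le> 1" by linarith
  ultimately show ?thesis by (simp add: abs_divide divide_right_mono)
qed

text \<open>The bound does not depend on i, so rounding keeps a bounded support inside one
  box.\<close>

lemma rnd_bound: "\<bar>rnd i r\<bar> \<le> \<bar>r\<bar> + 1"
proof (cases "\<bar>r\<bar> \<le> real i")
  case True
  have "1 / real (Suc i) \<le> 1" by simp
  then show ?thesis using rnd_close[OF True] by linarith
qed (simp add: rnd_def)

lemma rnd_tendsto: "(\<lambda>i. rnd i r) \<longlonglongrightarrow> r"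
proof -
  obtain N :: nat where N: "\<bar>r\<bar> \<le> real N" using real_arch_simple by blast
  have "(\<lambda>i. rnd i r - r) \<longlonglongrightarrow> 0"
  proof (rule Lim_null_comparison)
    show "eventually (\<lambda>i. norm (rnd i r - r) \<le> 1 / real (Suc i)) sequentially"
      using eventually_ge_at_top[of N]
    proof eventually_elim
      case (elim i)
      then show ?case using rnd_close[of r i] N by simp
    qed
    show "(\<lambda>i. 1 / real (Suc i)) \<longlonglongrightarrow> 0" using lim_1_over_n LIMSEQ_Suc by blast
  qed
  then show ?thesis by (simp add: LIM_zero_iff)
qed

text \<open>Arguments beyond i are sent to 0, and the others to multiples k / (i+1) with |k| <=
  (i+1)^2.\<close>

lemma finite_range_rnd: "finite (range (rnd i))"
proof -
  define K where "K = int (Suc i) * int (Suc i)"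
  have "range (rnd i) \<subseteq> insert 0 ((\<lambda>k. of_int k / real (Suc i)) ` {- K..K})"
  proof
    fix y assume "y \<in> range (rnd i)"
    then obtain r where y: "y = rnd i r" by blast
    show "y \<in> insert 0 ((\<lambda>k. of_int k / real (Suc i)) ` {- K..K})"
    proof (cases "\<bar>r\<bar> \<le> real i")
      case True
      have "\<bar>r * real (Suc i)\<bar> \<le> real (Suc i) * real (Suc i)" using True by (simp add: abs_mult mult_right_mono)
      also have "\<dots> = of_int K" by (simp add: K_def)
      finally have "- of_int K \<le> r * real (Suc i)" "r * real (Suc i) \<le> of_int K" by (auto simp: abs_le_iff)
      then have "\<lfloor>r * real (Suc i)\<rfloor> \<in> {- K..K}" by (simp add: le_floor_iff floor_le_iff)
      then show ?thesis using True unfolding y rnd_def by auto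
    qed (simp add: y rnd_def)
  qed
  then show ?thesis by (rule finite_subset) simp
qed

lemma measurable_rnd [measurable]: "rnd i \<in> borel_measurable borel"
  unfolding rnd_def[abs_def] by measurable

definition rndv :: "nat \<Rightarrow> nat \<Rightarrow> real vec \<Rightarrow> real vec" where
  "rndv i k z = vec k (\<lambda>s. rnd i (z $ s))"

lemma rndv_carrier [simp]: "rndv i k z \<in> carrier_vec k" by (simp add: rndv_def)

lemma finite_rndv: "finite (rndv i k ` X)"
proof -
  have "rndv i k ` X \<subseteq> vec k ` (PiE {..<k} (\<lambda>_. range (rnd i)))"
  proof
    fix y assume "y \<in> rndv i k ` X"
    then obtain z where "y = rndv i k z" by blast
    then have "y = vec k (\<lambda>s\<in>{..<k}. rnd i (z $ s))" by (auto simp: rndv_def intro!: eq_vecI)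
    moreover have "(\<lambda>s\<in>{..<k}. rnd i (z $ s)) \<in> PiE {..<k} (\<lambda>_. range (rnd i))" by auto
    ultimately show "y \<in> vec k ` (PiE {..<k} (\<lambda>_. range (rnd i)))" by (rule image_eqI)
  qed
  then show ?thesis by (rule finite_subset) (intro finite_imageI finite_PiE finite_range_rnd, simp)
qed

lemma measurable_rndv: "rndv i k \<in> measurable (borel_vec k) (borel_vec k)"
  by (rule measurable_into_borel_vec) (auto simp: rndv_def intro!: measurable_compose[OF measurable_vec_index measurable_rnd])

lemma borel_vec_singleton:
  assumes "b \<in> carrier_vec k"
  shows "{b} \<in> sets (borel_vec k)"
proof -
  have "{z \<in> space (borel_vec k). \<forall>s\<in>{..<k}. z $ s = b $ s} \<in> sets (borel_vec k)"
  proof (intro sets.sets_Collect_finite_All finite_lessThan)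
    fix s assume "s \<in> {..<k}"
    then show "{z \<in> space (borel_vec k). z $ s = b $ s} \<in> sets (borel_vec k)"
      using measurable_sets[OF measurable_vec_index, of s k "{b $ s}"] by (simp add: vimage_def Int_def conj_commute)
  qed
  also have "{z \<in> space (borel_vec k). \<forall>s\<in>{..<k}. z $ s = b $ s} = {b}"
    using assms by (auto intro!: eq_vecI)
  finally show ?thesis .
qed

lemma gaussian_le:
  assumes "A \<in> positive_definite k" "y \<in> carrier_vec k"
  shows "gaussian A y \<le> sqrt (Determinant.det A)"
  using positive_definiteD(5)[OF assms] positive_definite_det_pos[OF assms(1)] by (simp add: gaussian_def mult_left_le)

text \<open>In the expansion of the form at B x - b the term quadratic in b has the favourable sign
  and the cross term is linear in x; bounded centers therefore cost at most a factor exponential in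
  |x|.\<close>

lemma gaussian_shift_le:
  assumes G: "G \<in> positive_definite k" and B: "B \<in> carrier_mat k n" and x: "x \<in> carrier_vec n"
    and b: "b \<in> carrier_vec k" "\<And>s. s < k \<Longrightarrow> \<bar>b $ s\<bar> \<le> R"
  shows "gaussian G (B *\<^sub>v x - b) \<le> gaussian G (B *\<^sub>v x) *
    exp (2 * pi * (\<Sum>r<k. \<Sum>s<k. \<bar>G $$ (r, s)\<bar> * nrm (row B r) * R) * nrm x)" (is "_ \<le> _ * exp (2 * pi * ?D * _)")
proof -
  note Gd = positive_definiteD[OF G]
  define y where "y = B *\<^sub>v x"
  have y: "y \<in> carrier_vec k" unfolding y_def by (rule mult_mat_vec_carrier[OF B x])
  have Gb: "G *\<^sub>v b \<in> carrier_vec k" by (rule mult_mat_vec_carrier[OF Gd(1) b(1)])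
  have "y - b + b = y" using y b(1) by (intro eq_vecI) auto
  then have "qform G y = qform G (y - b) + qform G b + 2 * ((y - b) \<bullet> (G *\<^sub>v b))"
    using qform_add[OF Gd(3), of "y - b" b] y b(1) by simp
  also have "(y - b) \<bullet> (G *\<^sub>v b) = y \<bullet> (G *\<^sub>v b) - qform G b"
    using minus_scalar_prod_distrib[OF y b(1) Gb] by (simp add: qform_def)
  finally have q: "qform G y \<le> qform G (y - b) + 2 * (y \<bullet> (G *\<^sub>v b))" using Gd(5)[OF b(1)] by simp
  have "y \<bullet> (G *\<^sub>v b) = (\<Sum>r<k. \<Sum>s<k. y $ r * (G $$ (r, s) * b $ s))"
    using y Gd(1) b(1) by (auto simp: scalar_prod_def lessThan_atLeast0 sum_distrib_left intro!: sum.cong)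
  also have "\<dots> \<le> (\<Sum>r<k. \<Sum>s<k. \<bar>G $$ (r, s)\<bar> * nrm (row B r) * R * nrm x)"
  proof (intro sum_mono)
    fix r s assume "r \<in> {..<k}" "s \<in> {..<k}"
    then have r: "r < k" and s: "s < k" by auto
    have "y $ r = row B r \<bullet> x" using r B by (simp add: y_def)
    then have yr: "\<bar>y $ r\<bar> \<le> nrm (row B r) * nrm x" using abs_scalar_prod_le[of "row B r" n x] B x r by simp
    have nn: "0 \<le> nrm (row B r)" "0 \<le> nrm x" using nrm_nonneg[of "row B r" n] nrm_nonneg[OF x] B r by auto
    have "y $ r * (G $$ (r, s) * b $ s) \<le> \<bar>y $ r * (G $$ (r, s) * b $ s)\<bar>" by simp
    also have "\<dots> = \<bar>y $ r\<bar> * (\<bar>G $$ (r, s)\<bar> * \<bar>b $ s\<bar>)" by (simp add: abs_mult)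
    also have "\<dots> \<le> (nrm (row B r) * nrm x) * (\<bar>G $$ (r, s)\<bar> * R)"
      using yr b(2)[OF s] nn by (intro mult_mono mult_left_mono mult_nonneg_nonneg) (auto intro: order_trans[OF abs_ge_zero])
    finally show "y $ r * (G $$ (r, s) * b $ s) \<le> \<bar>G $$ (r, s)\<bar> * nrm (row B r) * R * nrm x"
      by (simp add: mult_ac)
  qed
  also have "\<dots> = ?D * nrm x" by (simp add: sum_distrib_right)
  finally have "qform G y - 2 * (?D * nrm x) \<le> qform G (y - b)" using q by simp
  then have "pi * (qform G y - 2 * (?D * nrm x)) \<le> pi * qform G (y - b)" by (intro mult_left_mono) auto
  then have "- pi * qform G (y - b) \<le> - pi * qform G y + 2 * pi * ?D * nrm x" by (simp add: algebra_simps)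
  then have "exp (- pi * qform G (y - b)) \<le> exp (- pi * qform G y) * exp (2 * pi * ?D * nrm x)"
    unfolding exp_add[symmetric] by simp
  then show ?thesis
    using positive_definite_det_pos[OF G] by (simp add: gaussian_def y_def mult.assoc)
qed

lemma gaussian_rndv_tendsto:
  assumes A: "A \<in> carrier_mat k k" and y: "y \<in> carrier_vec k" and z: "z \<in> carrier_vec k"
  shows "(\<lambda>i. gaussian A (y - rndv i k z)) \<longlonglongrightarrow> gaussian A (y - z)"
proof -
  have "qform A (y - rndv i k z) = (\<Sum>r<k. \<Sum>s<k. A $$ (r, s) * (y $ r - rnd i (z $ r)) * (y $ s - rnd i (z $ s)))" for i
    using y by (subst qform_sum[OF A]) (auto simp: rndv_def)
  moreover have "qform A (y - z) = (\<Sum>r<k. \<Sum>s<k. A $$ (r, s) * (y $ r - z $ r) * (y $ s - z $ s))"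
    using y z by (subst qform_sum[OF A]) auto
  moreover have "(\<lambda>i. \<Sum>r<k. \<Sum>s<k. A $$ (r, s) * (y $ r - rnd i (z $ r)) * (y $ s - rnd i (z $ s))) \<longlonglongrightarrow>
      (\<Sum>r<k. \<Sum>s<k. A $$ (r, s) * (y $ r - z $ r) * (y $ s - z $ s))"
    by (intro tendsto_intros rnd_tendsto)
  ultimately have "(\<lambda>i. qform A (y - rndv i k z)) \<longlonglongrightarrow> qform A (y - z)" by simp
  then show ?thesis unfolding gaussian_def by (intro tendsto_intros)
qed

locale finite_vec_measure = finite_measure \<nu> for \<nu> :: "real vec measure" +
  fixes k :: nat and G :: "real mat"
  assumes sets_\<nu>: "sets \<nu> = sets (borel_vec k)" and G: "G \<in> positive_definite k"
begin

lemma space_\<nu>: "space \<nu> = carrier_vec k"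
  using sets_eq_imp_space_eq[OF sets_\<nu>] by simp

lemma measurable_\<nu>: "measurable \<nu> M = measurable (borel_vec k) M"
  by (rule measurable_cong_sets[OF sets_\<nu> refl])

lemma measurable_gaussian_shift:
  assumes "y \<in> carrier_vec k" "s \<in> measurable (borel_vec k) (borel_vec k)"
  shows "(\<lambda>z. gaussian G (y - s z)) \<in> borel_measurable \<nu>"
proof -
  have "gaussian G \<in> borel_measurable (borel_vec k)"
    unfolding gaussian_def[abs_def] using measurable_qform_self[OF positive_definiteD(1)[OF G]] by simp
  moreover have "(\<lambda>z. y - s z) \<in> measurable (borel_vec k) (borel_vec k)"
    using assms by (intro measurable_vec_diff measurable_const) auto
  ultimately show ?thesis unfolding measurable_\<nu> by (rule measurable_compose[rotated])
qed

lemma integrable_gaussian_shift: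
  assumes y: "y \<in> carrier_vec k" and s: "s \<in> measurable (borel_vec k) (borel_vec k)"
  shows "integrable \<nu> (\<lambda>z. gaussian G (y - s z))"
proof (rule integrable_const_bound[where B = "sqrt (Determinant.det G)"])
  show "AE z in \<nu>. norm (gaussian G (y - s z)) \<le> sqrt (Determinant.det G)"
  proof (rule AE_I2)
    fix z assume "z \<in> space \<nu>"
    then have "s z \<in> carrier_vec k" using measurable_space_vec[OF s] space_\<nu> by simp
    then show "norm (gaussian G (y - s z)) \<le> sqrt (Determinant.det G)"
      using gaussian_le[OF G, of "y - s z"] gaussian_pos[OF G, of "y - s z"] y by simp
  qed
qed (rule measurable_gaussian_shift[OF y s])

lemma integral_gaussian_rndv_tendsto:
  assumes y: "y \<in> carrier_vec k"
  shows "(\<lambda>i. LINT z|\<nu>. gaussian G (y - rndv i k z)) \<longlonglongrightarrow> (LINT z|\<nu>. gaussian G (y - z))"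
proof (rule integral_dominated_convergence[where w = "\<lambda>_. sqrt (Determinant.det G)"])
  show "(\<lambda>z. gaussian G (y - z)) \<in> borel_measurable \<nu>"
    using measurable_gaussian_shift[OF y measurable_ident_sets[OF refl]] .
  show "(\<lambda>z. gaussian G (y - rndv i k z)) \<in> borel_measurable \<nu>" for i
    by (rule measurable_gaussian_shift[OF y measurable_rndv])
  show "AE z in \<nu>. (\<lambda>i. gaussian G (y - rndv i k z)) \<longlonglongrightarrow> gaussian G (y - z)"
    using gaussian_rndv_tendsto[OF positive_definiteD(1)[OF G] y] by (intro AE_I2) (simp add: space_\<nu>)
  show "AE z in \<nu>. norm (gaussian G (y - rndv i k z)) \<le> sqrt (Determinant.det G)" for i
    using gaussian_le[OF G] gaussian_pos[OF G] y by (intro AE_I2) (auto simp: less_imp_le)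
qed simp

definition cell where "cell i b = {z \<in> space \<nu>. rndv i k z = b}"

lemma sets_cell: "cell i b \<in> sets \<nu>"
proof (cases "b \<in> carrier_vec k")
  case True
  have "rndv i k -` {b} \<inter> space (borel_vec k) \<in> sets (borel_vec k)"
    by (rule measurable_sets[OF measurable_rndv borel_vec_singleton[OF True]])
  moreover have "rndv i k -` {b} \<inter> space (borel_vec k) = cell i b" by (auto simp: cell_def space_\<nu>)
  ultimately show ?thesis by (simp add: sets_\<nu>)
next
  case False
  then have "cell i b = {}" by (auto simp: cell_def)
  then show ?thesis by simp
qed

text \<open>Rounding pushes the measure forward to finitely many atoms, weighted by the masses of
  the cells; the convolution of the rounded measure is thus a finite Gaussian mixture.\<close>

lemma integral_rndv:
  fixes h :: "real vec \<Rightarrow> real"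
  shows "(LINT z|\<nu>. h (rndv i k z)) = (\<Sum>b\<in>rndv i k ` carrier_vec k. measure \<nu> (cell i b) * h b)"
proof -
  have "(LINT z|\<nu>. h (rndv i k z)) = (LINT z|\<nu>. (\<Sum>b\<in>rndv i k ` carrier_vec k. indicator (cell i b) z * h b))"
  proof (rule Bochner_Integration.integral_cong[OF refl])
    fix z assume z: "z \<in> space \<nu>"
    have "(\<Sum>b\<in>rndv i k ` carrier_vec k. indicator (cell i b) z * h b) = (\<Sum>b\<in>rndv i k ` carrier_vec k. if b = rndv i k z then h b else 0)"
      using z by (intro sum.cong refl) (auto simp: cell_def indicator_def)
    also have "\<dots> = h (rndv i k z)" using z finite_rndv by (simp add: space_\<nu>)
    finally show "h (rndv i k z) = (\<Sum>b\<in>rndv i k ` carrier_vec k. indicator (cell i b) z * h b)" by simp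
  qed
  also have "\<dots> = (\<Sum>b\<in>rndv i k ` carrier_vec k. measure \<nu> (cell i b) * h b)"
    using sets_cell emeasure_finite by (subst Bochner_Integration.integral_sum) (auto intro!: integrable_mult_left integrable_real_indicator simp: less_top[symmetric])
  finally show ?thesis .
qed

lemma sum_cells: "(\<Sum>b\<in>rndv i k ` carrier_vec k. measure \<nu> (cell i b)) = measure \<nu> (space \<nu>)"
  using integral_rndv[of "\<lambda>_. 1" i] by simp

lemma discretize:
  "\<exists>w. (\<forall>b. w b \<ge> 0) \<and> (\<Sum>b\<in>rndv i k ` carrier_vec k. w b) = measure \<nu> (space \<nu>) \<and>
     (\<forall>h. (LINT z|\<nu>. h (rndv i k z)) = (\<Sum>b\<in>rndv i k ` carrier_vec k. w b * (h b :: real)))"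
  using integral_rndv[of _ i] sum_cells[of i] by (intro exI[of _ "\<lambda>b. measure \<nu> (cell i b)"]) simp

lemma integral_rndv_le:
  assumes N: "AE z in \<nu>. \<forall>s<k. \<bar>z $ s\<bar> \<le> N" and B: "B \<in> carrier_mat k n" and x: "x \<in> carrier_vec n"
  shows "(LINT z|\<nu>. gaussian G (B *\<^sub>v x - rndv i k z)) \<le> measure \<nu> (space \<nu>) *
    (gaussian G (B *\<^sub>v x) * exp (2 * pi * (\<Sum>r<k. \<Sum>s<k. \<bar>G $$ (r, s)\<bar> * nrm (row B r) * (N + 1)) * nrm x))"
    (is "_ \<le> _ * ?C")
proof -
  have Bx: "B *\<^sub>v x \<in> carrier_vec k" by (rule mult_mat_vec_carrier[OF B x])
  have "(LINT z|\<nu>. gaussian G (B *\<^sub>v x - rndv i k z)) \<le> (LINT z|\<nu>. ?C)"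
  proof (rule integral_mono_AE)
    show "integrable \<nu> (\<lambda>z. gaussian G (B *\<^sub>v x - rndv i k z))"
      by (rule integrable_gaussian_shift[OF Bx measurable_rndv])
    show "AE z in \<nu>. gaussian G (B *\<^sub>v x - rndv i k z) \<le> ?C"
      using N
    proof eventually_elim
      case (elim z)
      have "\<bar>rndv i k z $ s\<bar> \<le> N + 1" if "s < k" for s
        using rnd_bound[of i "z $ s"] elim that by (fastforce simp: rndv_def)
      then show ?case by (intro gaussian_shift_le[OF G B x]) auto
    qed
  qed simp
  then show ?thesis by simp
qed

lemma convolution_pos:
  assumes y: "y \<in> carrier_vec k" and mass: "measure \<nu> (space \<nu>) > 0"
  shows "(LINT z|\<nu>. gaussian G (y - z)) > 0"
proof -
  have int: "integrable \<nu> (\<lambda>z. gaussian G (y - z))"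
    using integrable_gaussian_shift[OF y measurable_ident_sets[OF refl]] .
  have "(LINT z|\<nu>. gaussian G (y - z)) \<noteq> 0"
  proof
    assume "(LINT z|\<nu>. gaussian G (y - z)) = 0"
    then have "AE z in \<nu>. gaussian G (y - z) = 0"
      using integral_nonneg_eq_0_iff_AE[OF int] gaussian_pos[OF G] by (simp add: less_imp_le)
    then have "AE z in \<nu>. False" by eventually_elim (metis gaussian_pos[OF G] less_irrefl)
    then have "emeasure \<nu> (space \<nu>) = 0" by (simp add: AE_iff_null null_setsD1)
    then show False using mass by (simp add: measure_def)
  qed
  moreover have "(LINT z|\<nu>. gaussian G (y - z)) \<ge> 0"
    using gaussian_pos[OF G] by (intro integral_nonneg_AE AE_I2) (simp add: less_imp_le)
  ultimately show ?thesis by simp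
qed

lemma measurable_convolution: "(\<lambda>y. LINT z|\<nu>. gaussian G (y - z)) \<in> borel_measurable (borel_vec k)"
proof (rule borel_measurable_lebesgue_integral)
  have 1: "(\<lambda>(y, z). y - z) \<in> measurable (borel_vec k \<Otimes>\<^sub>M \<nu>) (borel_vec k)"
    unfolding case_prod_beta'
    by (intro measurable_vec_diff measurable_fst) (rule measurable_compose[OF measurable_snd measurable_ident_sets[OF sets_\<nu>]])
  have "gaussian G \<in> borel_measurable (borel_vec k)"
    unfolding gaussian_def[abs_def] using measurable_qform_self[OF positive_definiteD(1)[OF G]] by simp
  from measurable_compose[OF 1 this]
  show "(\<lambda>(y, z). gaussian G (y - z)) \<in> borel_measurable (borel_vec k \<Otimes>\<^sub>M \<nu>)" by (simp add: case_prod_beta')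
qed

text \<open>After exchanging the integrals, translation invariance leaves the mass 1 of the kernel
  for every z.\<close>

lemma integral_convolution: "(LINT y|lborel_vec k. (LINT z|\<nu>. gaussian G (y - z))) = measure \<nu> (space \<nu>)"
proof -
  interpret L: sigma_finite_measure "lborel_vec k" by (rule sigma_finite_lborel_vec)
  interpret P: pair_sigma_finite "lborel_vec k" \<nu> ..
  have mG: "gaussian G \<in> borel_measurable (borel_vec k)"
    unfolding gaussian_def[abs_def] using measurable_qform_self[OF positive_definiteD(1)[OF G]] by simp
  have 1: "(\<lambda>(y, z). y - z) \<in> measurable (lborel_vec k \<Otimes>\<^sub>M \<nu>) (borel_vec k)"
    unfolding case_prod_beta'
    by (intro measurable_vec_diff) (rule measurable_compose[OF measurable_fst measurable_ident_sets[OF sets_lborel_vec]],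
        rule measurable_compose[OF measurable_snd measurable_ident_sets[OF sets_\<nu>]])
  have m2: "(\<lambda>(y, z). ennreal (gaussian G (y - z))) \<in> borel_measurable (lborel_vec k \<Otimes>\<^sub>M \<nu>)"
    using measurable_compose[OF 1 mG] by (simp add: case_prod_beta')
  have "(\<integral>\<^sup>+y. ennreal (LINT z|\<nu>. gaussian G (y - z)) \<partial>lborel_vec k) = (\<integral>\<^sup>+y. (\<integral>\<^sup>+z. ennreal (gaussian G (y - z)) \<partial>\<nu>) \<partial>lborel_vec k)"
  proof (rule nn_integral_cong)
    fix y assume "y \<in> space (lborel_vec k)"
    then have "integrable \<nu> (\<lambda>z. gaussian G (y - z))"
      using integrable_gaussian_shift[OF _ measurable_ident_sets[OF refl]] by simp
    then show "ennreal (LINT z|\<nu>. gaussian G (y - z)) = (\<integral>\<^sup>+z. ennreal (gaussian G (y - z)) \<partial>\<nu>)"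
      by (rule nn_integral_eq_integral[symmetric]) (simp add: gaussian_pos[OF G] less_imp_le)
  qed
  also have "\<dots> = (\<integral>\<^sup>+z. (\<integral>\<^sup>+y. ennreal (gaussian G (y - z)) \<partial>lborel_vec k) \<partial>\<nu>)"
    using P.Fubini'[OF m2] by simp
  also have "\<dots> = (\<integral>\<^sup>+z. 1 \<partial>\<nu>)"
  proof (rule nn_integral_cong)
    fix z assume "z \<in> space \<nu>"
    then have z: "z \<in> carrier_vec k" by (simp add: space_\<nu>)
    have "(\<integral>\<^sup>+y. ennreal (gaussian G (y - z)) \<partial>lborel_vec k) = (\<integral>\<^sup>+y. ennreal (gaussian G (y + - z)) \<partial>lborel_vec k)"
      using z by (intro nn_integral_cong) (simp add: minus_add_uminus_vec[of _ k])
    also have "\<dots> = (\<integral>\<^sup>+y. ennreal (gaussian G y) \<partial>lborel_vec k)"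
      using mG z by (intro nn_integral_lborel_vec_translate) auto
    also have "\<dots> = ennreal (LINT y|lborel_vec k. gaussian G y)"
      using integral_gaussian_qform(1)[OF G] by (intro nn_integral_eq_integral) (auto simp: gaussian_def[abs_def] positive_definite_det_pos[OF G] less_imp_le)
    also have "(LINT y|lborel_vec k. gaussian G y) = 1"
      using integral_gaussian_qform(2)[OF G] positive_definite_det_pos[OF G] by (simp add: gaussian_def[abs_def])
    finally show "(\<integral>\<^sup>+y. ennreal (gaussian G (y - z)) \<partial>lborel_vec k) = 1" by simp
  qed
  also have "\<dots> = ennreal (measure \<nu> (space \<nu>))" by (simp add: emeasure_eq_measure)
  finally have nn: "(\<integral>\<^sup>+y. ennreal (LINT z|\<nu>. gaussian G (y - z)) \<partial>lborel_vec k) = ennreal (measure \<nu> (space \<nu>))" .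
  have "(LINT y|lborel_vec k. (LINT z|\<nu>. gaussian G (y - z))) = enn2real (\<integral>\<^sup>+y. ennreal (LINT z|\<nu>. gaussian G (y - z)) \<partial>lborel_vec k)"
  proof (rule integral_eq_nn_integral)
    show "(\<lambda>y. LINT z|\<nu>. gaussian G (y - z)) \<in> borel_measurable (lborel_vec k)"
      using measurable_convolution by (simp cong: measurable_cong_sets)
    show "AE y in lborel_vec k. 0 \<le> (LINT z|\<nu>. gaussian G (y - z))"
      using gaussian_pos[OF G] by (intro AE_I2 integral_nonneg_AE) (simp add: less_imp_le)
  qed
  then show ?thesis by (simp add: nn)
qed

end

text \<open>In the frame where \<open>A = R\<^sup>T R\<close> and \<open>G = R\<^sup>T diag(g) R\<close>, the convolving Gaussian has covariance
  \<open>diag(1 - 1/g)\<close>, which may be singular; it is the image of the standard Gaussian.\<close>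

lemma gaussian_as_convolution:
  assumes A: "A \<in> positive_definite k" and G: "G \<in> positive_definite k" and le: "loewner_le k A G"
  shows "\<exists>\<mu>. finite_measure \<mu> \<and> sets \<mu> = sets (borel_vec k) \<and> emeasure \<mu> (space \<mu>) > 0 \<and>
    (\<forall>y\<in>carrier_vec k. (LINT z|\<mu>. gaussian G (y - z)) = gaussian A y)"
proof -
  obtain R L g where R: "R \<in> carrier_mat k k" "L \<in> carrier_mat k k" "R * L = 1\<^sub>m k" "L * R = 1\<^sub>m k"
    and eq: "A = transpose_mat R * R" "G = transpose_mat R * diag_of k g * R"
    using simultaneous_diagonalization[OF A positive_definiteD(3)[OF G]] by blast
  have g: "g i \<ge> 1" if i: "i < k" for i
  proof -
    have "qform A (col L i) = 1"
      using gram_frame(2)[OF R(1-3) i, of "\<lambda>_. 1"] R(1) by (simp add: eq(1) one_mat_eq_diag_of[symmetric])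
    moreover have "qform G (col L i) = g i" using gram_frame(2)[OF R(1-3) i, of g] eq(2) by simp
    moreover have "col L i \<in> carrier_vec k" using gram_frame(1)[OF R(1-3) i] .
    ultimately show ?thesis using le by (force simp: loewner_le_def)
  qed
  have gp: "g i > 0" if "i < k" for i using g[OF that] by simp
  define s where "s i = sqrt (1 - 1 / g i)" for i
  have s2: "(s i)\<^sup>2 = 1 - 1 / g i" if "i < k" for i using g[OF that] by (simp add: s_def)
  define S where "S = L * diag_of k s"
  have S: "S \<in> carrier_mat k k" using R(2) by (simp add: S_def)
  have RS: "R * S = diag_of k s"
  proof -
    have "R * S = (R * L) * diag_of k s" unfolding S_def using R by (intro assoc_mult_mat[symmetric]) auto
    then show ?thesis by (simp add: R(3) left_mult_one_mat[OF diag_of_carrier])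
  qed
  have one: "1\<^sub>m k \<in> positive_definite k"
    using gram_positive_definite[of "1\<^sub>m k" k "1\<^sub>m k" "\<lambda>_. 1"] by (simp add: one_mat_eq_diag_of[symmetric])
  define \<rho> where "\<rho> = density (lborel_vec k) (\<lambda>z. ennreal (gaussian (1\<^sub>m k) z))"
  have m1: "gaussian (1\<^sub>m k) \<in> borel_measurable (lborel_vec k)"
    unfolding gaussian_def[abs_def] using measurable_qform_self[OF positive_definiteD(1)[OF one]] by (simp cong: measurable_cong_sets)
  have int1: "integrable (lborel_vec k) (gaussian (1\<^sub>m k))" "(LINT z|lborel_vec k. gaussian (1\<^sub>m k) z) = 1"
    using integral_gaussian_qform[OF one] by (simp_all add: gaussian_def[abs_def])
  have \<rho>1: "emeasure \<rho> (space \<rho>) = 1"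
  proof -
    have "emeasure \<rho> (space \<rho>) = (\<integral>\<^sup>+z. ennreal (gaussian (1\<^sub>m k) z) \<partial>lborel_vec k)"
      unfolding \<rho>_def using m1 sets.top[of "borel_vec k"]
      by (subst emeasure_density) (auto intro!: nn_integral_cong simp: indicator_def)
    also have "\<dots> = ennreal 1"
      using nn_integral_eq_integral[OF int1(1)] gaussian_pos[OF one] int1(2) by (simp add: less_imp_le)
    finally show ?thesis by simp
  qed
  define \<mu> where "\<mu> = distr \<rho> (borel_vec k) (\<lambda>z. S *\<^sub>v z)"
  have mS: "(\<lambda>z. S *\<^sub>v z) \<in> measurable \<rho> (borel_vec k)"
    using measurable_mult_mat_vec[OF S measurable_ident_sets[OF refl]] unfolding \<rho>_def by (simp cong: measurable_cong_sets)
  have \<mu>1: "emeasure \<mu> (space \<mu>) = 1"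
  proof -
    have "(\<lambda>z. S *\<^sub>v z) -` space (borel_vec k) \<inter> space \<rho> = space \<rho>" using measurable_space[OF mS] by auto
    then show ?thesis unfolding \<mu>_def using mS \<rho>1 sets.top[of "borel_vec k"] by (subst emeasure_distr) auto
  qed
  have "(LINT z|\<mu>. gaussian G (y - z)) = gaussian A y" if y: "y \<in> carrier_vec k" for y
  proof -
    define Y where "Y = R *\<^sub>v y"
    have Y: "Y \<in> carrier_vec k" unfolding Y_def by (rule mult_mat_vec_carrier[OF R(1) y])
    define b where "b = vec k (\<lambda>i. s i * Y $ i)"
    have b: "b \<in> carrier_vec k" by (simp add: b_def)
    have mG: "gaussian G \<in> borel_measurable (borel_vec k)"
      unfolding gaussian_def[abs_def] using measurable_qform_self[OF positive_definiteD(1)[OF G]] by simp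
    have mGy: "(\<lambda>z. gaussian G (y - z)) \<in> borel_measurable (borel_vec k)"
      using y by (intro measurable_compose[OF _ mG] measurable_vec_diff measurable_const measurable_ident_sets) auto
    have mGyS: "(\<lambda>z. gaussian G (y - S *\<^sub>v z)) \<in> borel_measurable (lborel_vec k)"
      using measurable_compose[OF mS mGy] unfolding \<rho>_def by (simp cong: measurable_cong_sets)
    have "(LINT z|\<mu>. gaussian G (y - z)) = (LINT z|\<rho>. gaussian G (y - S *\<^sub>v z))"
      unfolding \<mu>_def by (rule integral_distr[OF mS mGy])
    also have "\<dots> = (LINT z|lborel_vec k. gaussian (1\<^sub>m k) z * gaussian G (y - S *\<^sub>v z))"
      unfolding \<rho>_def using m1 mGyS gaussian_pos[OF one]
      by (subst integral_density) (auto simp: less_imp_le)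
    also have "\<dots> = (LINT z|lborel_vec k. sqrt (Determinant.det G) * exp (- pi * qform A y) * exp (- pi * qform (diag_of k g) (z + - b)))"
    proof (rule Bochner_Integration.integral_cong[OF refl])
      fix z assume "z \<in> space (lborel_vec k)"
      then have z: "z \<in> carrier_vec k" by simp
      have Sz: "S *\<^sub>v z \<in> carrier_vec k" by (rule mult_mat_vec_carrier[OF S z])
      have dz: "(diag_of k s *\<^sub>v z) $ i = s i * z $ i" if "i < k" for i
      proof -
        have "(diag_of k s *\<^sub>v z) $ i = (\<Sum>q<k. (if i = q then s i else 0) * z $ q)"
          using that z by (simp add: scalar_prod_def lessThan_atLeast0)
        also have "\<dots> = (\<Sum>q<k. if q = i then s i * z $ i else 0)"
          by (intro sum.cong) auto
        finally have "(diag_of k s *\<^sub>v z) $ i = (\<Sum>q<k. if q = i then s i * z $ i else 0)" .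
        then show ?thesis using that by simp
      qed
      have Ryz: "(R *\<^sub>v (y - S *\<^sub>v z)) $ i = Y $ i - s i * z $ i" if "i < k" for i
      proof -
        have "R *\<^sub>v (y - S *\<^sub>v z) = R *\<^sub>v y - R *\<^sub>v (S *\<^sub>v z)" by (rule mult_minus_distrib_mat_vec[OF R(1) y Sz])
        also have "R *\<^sub>v (S *\<^sub>v z) = diag_of k s *\<^sub>v z"
          using R(1) S z by (simp add: RS[symmetric] assoc_mult_mat_vec[of _ k k _ k])
        finally show ?thesis using that dz[OF that] by (simp add: Y_def diag_of_dim del: index_mult_mat_vec)
      qed
      have "qform (1\<^sub>m k) z + qform G (y - S *\<^sub>v z) = (\<Sum>i<k. (z $ i)\<^sup>2 + g i * (Y $ i - s i * z $ i)\<^sup>2)"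
        unfolding eq(2) using y Sz z R(1)
        by (simp add: qform_congruence_diag Ryz qform_one_mat scalar_prod_self_sum[OF z] sum.distrib del: index_mult_mat_vec)
      \<comment> \<open>Since g s^2 = g - 1, the expression p^2 + g (q - s p)^2 is symmetric in p
        and q. Exchanging them completes the square in z and isolates the form of A at y.\<close>
      also have "\<dots> = (\<Sum>i<k. (Y $ i)\<^sup>2 + g i * (z $ i - s i * Y $ i)\<^sup>2)"
      proof (intro sum.cong refl)
        fix i assume "i \<in> {..<k}"
        then have i: "i < k" by simp
        have gs: "g i * (s i)\<^sup>2 = g i - 1" using s2[OF i] g[OF i] by (simp add: right_diff_distrib)
        have "p\<^sup>2 + g i * (q - s i * p)\<^sup>2 = p\<^sup>2 + g i * q\<^sup>2 - 2 * g i * s i * p * q + (g i * (s i)\<^sup>2) * p\<^sup>2" for p q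
          by (simp add: power2_eq_square algebra_simps)
        then have "p\<^sup>2 + g i * (q - s i * p)\<^sup>2 = g i * q\<^sup>2 - 2 * g i * s i * p * q + g i * p\<^sup>2" for p q
          unfolding gs by (simp add: algebra_simps)
        from this[of "z $ i" "Y $ i"] this[of "Y $ i" "z $ i"]
        show "(z $ i)\<^sup>2 + g i * (Y $ i - s i * z $ i)\<^sup>2 = (Y $ i)\<^sup>2 + g i * (z $ i - s i * Y $ i)\<^sup>2" by simp
      qed
      also have "\<dots> = qform A y + qform (diag_of k g) (z + - b)"
        unfolding eq(1) using z b Y_def qform_gram[OF R(1) y]
        by (subst qform_diag_of) (auto simp: sum.distrib b_def)
      finally have "qform (1\<^sub>m k) z + qform G (y - S *\<^sub>v z) = qform A y + qform (diag_of k g) (z + - b)" .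
      then have "exp (- pi * (qform (1\<^sub>m k) z + qform G (y - S *\<^sub>v z))) = exp (- pi * (qform A y + qform (diag_of k g) (z + - b)))"
        by simp
      then have "exp (- pi * qform (1\<^sub>m k) z) * exp (- pi * qform G (y - S *\<^sub>v z)) = exp (- pi * qform A y) * exp (- pi * qform (diag_of k g) (z + - b))"
        by (simp only: distrib_left exp_add)
      then show "gaussian (1\<^sub>m k) z * gaussian G (y - S *\<^sub>v z) = sqrt (Determinant.det G) * exp (- pi * qform A y) * exp (- pi * qform (diag_of k g) (z + - b))"
        by (simp add: gaussian_def mult_ac)
    qed
    also have "\<dots> = sqrt (Determinant.det G) * exp (- pi * qform A y) * (LINT z|lborel_vec k. exp (- pi * qform (diag_of k g) (z + - b)))"
      by simp
    also have "(LINT z|lborel_vec k. exp (- pi * qform (diag_of k g) (z + - b))) = (LINT z|lborel_vec k. exp (- pi * qform (diag_of k g) z))"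
    proof (rule integral_lborel_vec_translate(2))
      show "(\<lambda>z. exp (- pi * qform (diag_of k g) z)) \<in> borel_measurable (lborel_vec k)"
        using measurable_qform_self[OF diag_of_carrier[of k g]] by (simp cong: measurable_cong_sets)
    qed (use b in simp)
    also have "\<dots> = 1 / sqrt (\<Prod>i<k. g i)"
    proof -
      have "transpose_mat (1\<^sub>m k) * diag_of k g * 1\<^sub>m k \<in> positive_definite k"
        using gp by (intro gram_positive_definite[of _ _ "1\<^sub>m k"]) auto
      then have "diag_of k g \<in> positive_definite k" by simp
      from integral_gaussian_qform(2)[OF this] show ?thesis by (simp add: det_diag_of)
    qed
    also have "sqrt (Determinant.det G) * exp (- pi * qform A y) * (1 / sqrt (\<Prod>i<k. g i)) = gaussian A y"
    proof -
      have "(\<Prod>i<k. g i) > 0" using gp by (intro prod_pos) auto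
      then have "sqrt (\<Prod>i<k. g i) \<noteq> 0" using real_sqrt_gt_zero less_imp_neq[symmetric] by blast
      then show ?thesis
        unfolding gaussian_def eq det_congruence_diag[OF R(1)] det_gram[OF R(1)]
        by (simp add: real_sqrt_mult del: prod_zero_iff real_sqrt_eq_0_iff)
    qed
    finally show ?thesis .
  qed
  moreover have "finite_measure \<mu>" using \<mu>1 by (intro finite_measureI) simp
  ultimately show ?thesis using \<mu>1 by (intro exI[of _ \<mu>]) (auto simp: \<mu>_def)
qed

text \<open>Members of \<open>type_G\<close> are functions on the whole type
  \<open>real vec\<close>, whereas a convolution is known to equal g_A only on vectors of the right
  dimension; the functional sees nothing else.\<close>

lemma BL_cong:
  assumes "\<And>j. j < m \<Longrightarrow> B j \<in> carrier_mat (d j) n"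
    and "\<And>j y. j < m \<Longrightarrow> y \<in> carrier_vec (d j) \<Longrightarrow> f j y = g j y"
  shows "BL n m d B c Q f = BL n m d B c Q g"
proof -
  have "f j (B j *\<^sub>v x) = g j (B j *\<^sub>v x)" if "j < m" "x \<in> carrier_vec n" for j x
    using assms(2)[OF that(1) mult_mat_vec_carrier[OF assms(1)[OF that(1)] that(2)]] .
  then have "(\<integral>\<^sup>+x. ennreal (exp (- pi * qform Q x)) * (\<Prod>j<m. pow_ennreal (f j (B j *\<^sub>v x)) (c j)) \<partial>lborel_vec n) =
    (\<integral>\<^sup>+x. ennreal (exp (- pi * qform Q x)) * (\<Prod>j<m. pow_ennreal (g j (B j *\<^sub>v x)) (c j)) \<partial>lborel_vec n)"
    by (intro nn_integral_cong) simp
  moreover have "(LINT y|lborel_vec (d j). f j y) = (LINT y|lborel_vec (d j). g j y)" if "j < m" for j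
    using assms(2)[OF that] by (intro Bochner_Integration.integral_cong) auto
  ultimately show ?thesis by (simp add: BL_def)
qed

lemma powr_minus_mono:
  fixes c :: real
  assumes "c < 0" "0 < x" "x \<le> y"
  shows "y powr c \<le> x powr c"
  using assms by (intro powr_mono2') auto

section \<open>Passage from finite mixtures to arbitrary mixing measures\<close>

context nondegenerate_datum
begin

text \<open>Rounding of order i and \<epsilon> = s0 / (i+1) run together. Bounded supports give
  upper bounds on the factors with c_j > 0 and the added Gaussian lower bounds on those with c_j <
  0; both are of reference type, so one Gaussian majorant holds for all i and dominated convergence
  applies.\<close>

lemma truncated_lower_bound:
  fixes \<nu> :: "nat \<Rightarrow> real vec measure"
  assumes \<nu>: "\<And>j. j < m \<Longrightarrow> finite_vec_measure (\<nu> j) (d j) (G j)"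
    and mass: "\<And>j. j < m \<Longrightarrow> measure (\<nu> j) (space (\<nu> j)) > 0"
    and N: "\<And>j. j < mp \<Longrightarrow> AE z in \<nu> j. \<forall>s<d j. \<bar>z $ s\<bar> \<le> N"
    and w0: "w0 > 0"
  shows "ennreal (\<Prod>j<m. (measure (\<nu> j) (space (\<nu> j)) + (if j < mp then 0 else w0)) powr c j) * Imin \<le>
    (\<integral>\<^sup>+x. ennreal (exp (- pi * qform Q x) * (\<Prod>j<m. ((LINT z|\<nu> j. gaussian (G j) (B j *\<^sub>v x - z)) +
       (if j < mp then 0 else w0 * gaussian (ref s0 j) (B j *\<^sub>v x))) powr c j)) \<partial>lborel_vec n)"
proof -
  note refpd = ref[OF s0(1)]
  define T where "T j x = (if j < mp then 0 else w0 * gaussian (ref s0 j) (B j *\<^sub>v x))" for j x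
  define h where "h j x = (LINT z|\<nu> j. gaussian (G j) (B j *\<^sub>v x - z)) + T j x" for j x
  define hi where "hi i j x = (LINT z|\<nu> j. gaussian (G j) (B j *\<^sub>v x - rndv i (d j) z)) + T j x" for i j x
  define g where "g x = exp (- pi * qform Q x) * (\<Prod>j<m. h j x powr c j)" for x
  define gi where "gi i x = exp (- pi * qform (Qe (s0 / real (Suc i))) x) * (\<Prod>j<m. hi i j x powr c j)" for i x
  have \<epsilon>: "0 < s0 / real (Suc i)" "s0 / real (Suc i) \<le> s0" for i
    using s0(1) by (auto simp: divide_le_eq mult_le_cancel_left1)
  have T0: "T j x \<ge> 0" if "j < m" for j x
    using w0 gaussian_pos[OF refpd[OF that]] by (simp add: T_def less_imp_le)
  have hpos: "h j x > 0" if "j < m" "x \<in> carrier_vec n" for j x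
    using finite_vec_measure.convolution_pos[OF \<nu>[OF that(1)] Bx[OF that] mass[OF that(1)]] T0[OF that(1), of x]
    by (simp add: h_def)
  have gpos: "gaussian (G j) y \<ge> 0" if "j < m" for j y using gaussian_pos[OF G[OF that]] by (simp add: less_imp_le)
  have low: "ennreal (\<Prod>j<m. (measure (\<nu> j) (space (\<nu> j)) + (if j < mp then 0 else w0)) powr c j) * Imin \<le>
    (\<integral>\<^sup>+x. ennreal (gi i x) \<partial>lborel_vec n)" and meas: "gi i \<in> borel_measurable (borel_vec n)" for i
  proof -
    have "\<forall>j. \<exists>w. j < m \<longrightarrow> (\<forall>b. w b \<ge> 0) \<and> (\<Sum>b\<in>rndv i (d j) ` carrier_vec (d j). w b) = measure (\<nu> j) (space (\<nu> j)) \<and>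
     (\<forall>h. (LINT z|\<nu> j. h (rndv i (d j) z)) = (\<Sum>b\<in>rndv i (d j) ` carrier_vec (d j). w b * (h b :: real)))"
      using finite_vec_measure.discretize[OF \<nu>] by blast
    then obtain w where "\<forall>j. j < m \<longrightarrow> (\<forall>b. w j b \<ge> 0) \<and> (\<Sum>b\<in>rndv i (d j) ` carrier_vec (d j). w j b) = measure (\<nu> j) (space (\<nu> j)) \<and>
     (\<forall>h. (LINT z|\<nu> j. h (rndv i (d j) z)) = (\<Sum>b\<in>rndv i (d j) ` carrier_vec (d j). w j b * (h b :: real)))"
      by (rule choice[THEN exE])
    then have w: "\<And>j b. j < m \<Longrightarrow> w j b \<ge> 0"
      "\<And>j. j < m \<Longrightarrow> (\<Sum>b\<in>rndv i (d j) ` carrier_vec (d j). w j b) = measure (\<nu> j) (space (\<nu> j))"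
      "\<And>j h. j < m \<Longrightarrow> (LINT z|\<nu> j. h (rndv i (d j) z)) = (\<Sum>b\<in>rndv i (d j) ` carrier_vec (d j). w j b * (h b :: real))"
      by blast+
    define F where "F j = Some ` (rndv i (d j) ` carrier_vec (d j)) \<union> (if j < mp then {} else {None})" for j
    define W where "W j o' = (case o' of None \<Rightarrow> w0 | Some b \<Rightarrow> w j b)" for j o'
    have sumF: "(\<Sum>o'\<in>F j. \<phi> o') = (\<Sum>b\<in>rndv i (d j) ` carrier_vec (d j). \<phi> (Some b)) + (if j < mp then 0 else \<phi> None)"
      for \<phi> :: "real vec option \<Rightarrow> real" and j
      unfolding F_def using finite_rndv[of i "d j"]
      by (subst sum.union_disjoint) (auto simp: sum.reindex)
    have "(\<Sum>o'\<in>F j. W j o') = measure (\<nu> j) (space (\<nu> j)) + (if j < mp then 0 else w0)" if "j < m" for j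
      using w(2)[OF that] by (simp add: sumF W_def)
    moreover have hi_sum: "(\<Sum>o'\<in>F j. W j o' * (case o' of None \<Rightarrow> gaussian (ref s0 j) (B j *\<^sub>v x) | Some b \<Rightarrow> gaussian (G j) (B j *\<^sub>v x - b))) = hi i j x"
      if "j < m" for j x
      using w(3)[OF that, of "\<lambda>b. gaussian (G j) (B j *\<^sub>v x - b)"] by (simp add: sumF W_def hi_def T_def)
    moreover have "ennreal (\<Prod>j<m. (\<Sum>o'\<in>F j. W j o') powr c j) * Imin \<le>
      (\<integral>\<^sup>+x. ennreal (exp (- pi * qform (Qe (s0 / real (Suc i))) x) * (\<Prod>j<m. (\<Sum>o'\<in>F j. W j o' *
       (case o' of None \<Rightarrow> gaussian (ref s0 j) (B j *\<^sub>v x) | Some b \<Rightarrow> gaussian (G j) (B j *\<^sub>v x - b))) powr c j)) \<partial>lborel_vec n)"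
    proof (rule mixture_lower_bound[OF \<epsilon>])
      show "\<exists>o'\<in>F j. 0 < W j o'" if j: "j < m" for j
      proof (rule ccontr)
        assume nex: "\<not> ?thesis"
        have "w j b \<le> 0" if "b \<in> rndv i (d j) ` carrier_vec (d j)" for b
        proof -
          have "Some b \<in> F j" using that by (simp add: F_def)
          then have "\<not> 0 < W j (Some b)" using nex by blast
          then show ?thesis by (simp add: W_def)
        qed
        then have "(\<Sum>b\<in>rndv i (d j) ` carrier_vec (d j). w j b) \<le> 0" by (rule sum_nonpos)
        then show False using w(2)[OF j] mass[OF j] by simp
      qed
    qed (use w(1) w0 finite_rndv in \<open>auto simp: F_def W_def split: option.split if_splits\<close>)
    ultimately show "ennreal (\<Prod>j<m. (measure (\<nu> j) (space (\<nu> j)) + (if j < mp then 0 else w0)) powr c j) * Imin \<le>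
      (\<integral>\<^sup>+x. ennreal (gi i x) \<partial>lborel_vec n)" by (simp add: gi_def)
    have mG: "(\<lambda>x. gaussian A (B j *\<^sub>v x - b)) \<in> borel_measurable (borel_vec n)"
      if "j < m" "b \<in> carrier_vec (d j)" "A \<in> positive_definite (d j)" for A j b
      using that(2) by (intro measurable_compose[OF _ measurable_gaussian[OF positive_definiteD(1)[OF that(3)]]]
        measurable_vec_diff measurable_mult_mat_vec[OF B[OF that(1)] measurable_ident_sets[OF refl]] measurable_const) auto
    have mT: "T j \<in> borel_measurable (borel_vec n)" if "j < m" for j
      unfolding T_def[abs_def] using measurable_compose[OF measurable_mult_mat_vec[OF B[OF that] measurable_ident_sets[OF refl]]
         measurable_gaussian[OF positive_definiteD(1)[OF refpd[OF that]]]] by simp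
    have "hi i j \<in> borel_measurable (borel_vec n)" if "j < m" for j
    proof -
      have "hi i j x = (\<Sum>b\<in>rndv i (d j) ` carrier_vec (d j). w j b * gaussian (G j) (B j *\<^sub>v x - b)) + T j x" for x
        using w(3)[OF that, of "\<lambda>b. gaussian (G j) (B j *\<^sub>v x - b)"] by (simp add: hi_def)
      then have "hi i j = (\<lambda>x. (\<Sum>b\<in>rndv i (d j) ` carrier_vec (d j). w j b * gaussian (G j) (B j *\<^sub>v x - b)) + T j x)"
        by (rule ext)
      moreover have "(\<lambda>x. (\<Sum>b\<in>rndv i (d j) ` carrier_vec (d j). w j b * gaussian (G j) (B j *\<^sub>v x - b)) + T j x) \<in> borel_measurable (borel_vec n)"
        using mG[OF that _ G[OF that]] mT[OF that] by (intro borel_measurable_add borel_measurable_sum borel_measurable_times measurable_const) auto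
      ultimately show ?thesis by simp
    qed
    then show "gi i \<in> borel_measurable (borel_vec n)"
      unfolding gi_def[abs_def] using measurable_qform_self[OF self_adjointD(1)[OF Qe]] by simp
  qed
  have hi_tendsto: "(\<lambda>i. hi i j x) \<longlonglongrightarrow> h j x" if "j < m" "x \<in> carrier_vec n" for j x
    unfolding hi_def h_def
    by (intro tendsto_add tendsto_const finite_vec_measure.integral_gaussian_rndv_tendsto[OF \<nu>[OF that(1)] Bx[OF that]])
  have gi_tendsto: "(\<lambda>i. gi i x) \<longlonglongrightarrow> g x" if x: "x \<in> carrier_vec n" for x
  proof -
    have "(\<lambda>i. s0 / real (Suc i)) \<longlonglongrightarrow> 0"
      using tendsto_mult[OF tendsto_const LIMSEQ_Suc[OF lim_1_over_n], of s0] by simp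
    then have "(\<lambda>i. qform Q x - s0 / real (Suc i) * (\<Sum>j<mp. (B j *\<^sub>v x) \<bullet> (B j *\<^sub>v x))) \<longlonglongrightarrow> qform Q x - 0 * (\<Sum>j<mp. (B j *\<^sub>v x) \<bullet> (B j *\<^sub>v x))"
      by (intro tendsto_intros)
    then have "(\<lambda>i. qform (Qe (s0 / real (Suc i))) x) \<longlonglongrightarrow> qform Q x" by (simp add: qform_Qe[OF x])
    then show ?thesis unfolding gi_def g_def using hi_tendsto[OF _ x] hpos[OF _ x]
      by (intro tendsto_intros tendsto_prod tendsto_powr) (auto dest: less_imp_neq[symmetric])
  qed
  \<comment> \<open>The rate of the linear exponent caused by the rounded centers, which lie in a
    box of size N + 1. For c_j < 0 the lower bound is a centered Gaussian, so the rate is 0.\<close>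
  define D where "D j = (if j < mp then 2 * pi * (\<Sum>r<d j. \<Sum>s<d j. \<bar>G j $$ (r, s)\<bar> * nrm (row (B j) r) * (N + 1)) else 0)" for j
  define M where "M j = (if j < mp then measure (\<nu> j) (space (\<nu> j)) else w0) * sqrt (Determinant.det (ref s0 j))" for j
  have M: "M j > 0" if "j < m" for j
    using mass[OF that] w0 positive_definite_det_pos[OF refpd[OF that]] by (simp add: M_def)
  have hi_le: "hi i j x powr c j \<le> exp (c j * (ln (M j) - pi * qform (ref s0 j) (B j *\<^sub>v x) + D j * nrm x))"
    if j: "j < m" and x: "x \<in> carrier_vec n" for i j x
  proof -
    define E where "E = M j * exp (- pi * qform (ref s0 j) (B j *\<^sub>v x)) * exp (D j * nrm x)"
    have E: "E > 0" using M[OF j] by (simp add: E_def)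
    have L0: "(LINT z|\<nu> j. gaussian (G j) (B j *\<^sub>v x - rndv i (d j) z)) \<ge> 0"
      using gpos[OF j] by (intro integral_nonneg_AE AE_I2) simp
    \<comment> \<open>E bounds \<open>hi\<close> from above for c_j > 0 and from below for c_j < 0,
      and the sign of the exponent makes one inequality of the two.\<close>
    have "hi i j x powr c j \<le> E powr c j"
    proof (cases "j < mp")
      case True
      have "hi i j x \<le> E"
        using finite_vec_measure.integral_rndv_le[OF \<nu>[OF j] N[OF True] B[OF j] x, of i] True
        by (simp add: hi_def T_def E_def M_def D_def ref_def gaussian_def mult_ac)
      moreover have "0 \<le> hi i j x" using L0 T0[OF j, of x] by (simp add: hi_def)
      ultimately show ?thesis using cp[OF True] by (intro powr_mono2) auto
    next
      case False
      have "E = T j x" using False by (simp add: T_def E_def M_def D_def gaussian_def)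
      then have "E \<le> hi i j x" using L0 by (simp add: hi_def)
      then show ?thesis using E cn[of j] False j by (intro powr_minus_mono) auto
    qed
    also have "E powr c j = exp (c j * ln E)" using E by (simp add: powr_def)
    also have "ln E = ln (M j) - pi * qform (ref s0 j) (B j *\<^sub>v x) + D j * nrm x"
      using M[OF j] by (simp add: E_def ln_mult)
    finally show ?thesis .
  qed
  obtain \<delta> where \<delta>: "\<delta> > 0" "\<And>\<epsilon> x. 0 \<le> \<epsilon> \<Longrightarrow> \<epsilon> \<le> s0 \<Longrightarrow> x \<in> carrier_vec n \<Longrightarrow>
      \<delta> * (x \<bullet> x) \<le> qform (Q_plus n m B c (Qe \<epsilon>) (ref s0)) x"
    using s0_coercive by blast
  define L where "L = (\<Sum>j<m. c j * ln (M j))"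
  define C where "C = (\<Sum>j<m. c j * D j)"
  obtain K where K: "K \<ge> 0" "\<And>u. exp (C * u - pi * \<delta> * u\<^sup>2) \<le> K * exp (- \<delta> * u\<^sup>2)"
    using exp_linear_quadratic_bound[OF \<delta>(1), of C] by blast
  have dom: "gi i x \<le> exp L * K * exp (- \<delta> * (x \<bullet> x))" if x: "x \<in> carrier_vec n" for i x
  proof -
    define \<epsilon>' where "\<epsilon>' = s0 / real (Suc i)"
    have "gi i x \<le> exp (- pi * qform (Qe \<epsilon>') x) * (\<Prod>j<m. exp (c j * (ln (M j) - pi * qform (ref s0 j) (B j *\<^sub>v x) + D j * nrm x)))"
      unfolding gi_def \<epsilon>'_def using hi_le[OF _ x] by (intro mult_left_mono prod_mono) auto
    also have "\<dots> = exp (- pi * qform (Qe \<epsilon>') x + (\<Sum>j<m. c j * (ln (M j) - pi * qform (ref s0 j) (B j *\<^sub>v x) + D j * nrm x)))"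
      by (simp only: exp_add exp_sum[OF finite_lessThan])
    also have "- pi * qform (Qe \<epsilon>') x + (\<Sum>j<m. c j * (ln (M j) - pi * qform (ref s0 j) (B j *\<^sub>v x) + D j * nrm x)) =
        L + C * nrm x - pi * qform (Q_plus n m B c (Qe \<epsilon>') (ref s0)) x"
      unfolding qform_Q_plus_ref[OF s0(1) x] L_def C_def
      by (simp add: algebra_simps sum.distrib sum_subtractf sum_distrib_left)
    also have "\<dots> \<le> L + (C * nrm x - pi * \<delta> * (nrm x)\<^sup>2)"
      using mult_left_mono[OF \<delta>(2)[OF less_imp_le[OF \<epsilon>(1)[of i]] \<epsilon>(2)[of i] x], of pi]
      by (simp add: nrm_power2[OF x] \<epsilon>'_def)
    finally have "gi i x \<le> exp L * exp (C * nrm x - pi * \<delta> * (nrm x)\<^sup>2)" by (simp add: exp_add)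
    also have "\<dots> \<le> exp L * (K * exp (- \<delta> * (nrm x)\<^sup>2))" using K(2)[of "nrm x"] by (intro mult_left_mono) auto
    finally show ?thesis by (simp add: nrm_power2[OF x])
  qed
  have gi0: "gi i x \<ge> 0" for i x by (simp add: gi_def prod_nonneg)
  have meas_g: "g \<in> borel_measurable (borel_vec n)"
    using borel_measurable_LIMSEQ_real[of "borel_vec n" gi g] gi_tendsto meas by simp
  have "(\<lambda>i. \<integral>\<^sup>+x. ennreal (gi i x) \<partial>lborel_vec n) \<longlonglongrightarrow> (\<integral>\<^sup>+x. ennreal (g x) \<partial>lborel_vec n)"
  proof (rule nn_integral_dominated_convergence)
    show "(\<lambda>x. ennreal (gi i x)) \<in> borel_measurable (lborel_vec n)" for i
      using meas[of i] by (simp cong: measurable_cong_sets)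
    show "(\<lambda>x. ennreal (g x)) \<in> borel_measurable (lborel_vec n)"
      using meas_g by (simp cong: measurable_cong_sets)
    have int: "integrable (lborel_vec n) (\<lambda>x. exp L * K * exp (- \<delta> * (x \<bullet> x)))"
      using integrable_exp_neg_norm[OF \<delta>(1)] by (rule integrable_mult_right)
    then show "(\<lambda>x. ennreal (exp L * K * exp (- \<delta> * (x \<bullet> x)))) \<in> borel_measurable (lborel_vec n)"
      by (intro measurable_compose[OF borel_measurable_integrable measurable_ennreal])
    show "(\<integral>\<^sup>+x. ennreal (exp L * K * exp (- \<delta> * (x \<bullet> x))) \<partial>lborel_vec n) < \<infinity>"
      using nn_integral_eq_integral[OF int] K(1) by simp
    show "AE x in lborel_vec n. ennreal (gi i x) \<le> ennreal (exp L * K * exp (- \<delta> * (x \<bullet> x)))" for i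
      using dom by (intro AE_I2 ennreal_leI) simp
    show "AE x in lborel_vec n. (\<lambda>i. ennreal (gi i x)) \<longlonglongrightarrow> ennreal (g x)"
      using gi_tendsto by (intro AE_I2 tendsto_ennrealI) simp
  qed
  then have "ennreal (\<Prod>j<m. (measure (\<nu> j) (space (\<nu> j)) + (if j < mp then 0 else w0)) powr c j) * Imin \<le> (\<integral>\<^sup>+x. ennreal (g x) \<partial>lborel_vec n)"
    by (rule LIMSEQ_le_const) (use low in blast)
  then show ?thesis by (simp add: g_def h_def T_def)
qed

text \<open>The modifications are monotone: restricting the measure lowers f_j where c_j > 0, adding
  a Gaussian raises it where c_j < 0, and both lower the integrand. The modified integrals thus stay
  below J, and only the normalizing masses have to pass to the limit.\<close>

lemma Imin_le_BL_type_G: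
  fixes \<mu> :: "nat \<Rightarrow> real vec measure"
  assumes \<mu>: "\<And>j. j < m \<Longrightarrow> finite_vec_measure (\<mu> j) (d j) (G j)"
    and mass: "\<And>j. j < m \<Longrightarrow> measure (\<mu> j) (space (\<mu> j)) > 0"
  shows "Imin \<le> BL n m d B c Q (\<lambda>j y. LINT z|\<mu> j. gaussian (G j) (y - z))"
proof -
  define J where "J = (\<integral>\<^sup>+x. ennreal (exp (- pi * qform Q x) * (\<Prod>j<m. (LINT z|\<mu> j. gaussian (G j) (B j *\<^sub>v x - z)) powr c j)) \<partial>lborel_vec n)"
  define a where "a = (\<Prod>j<m. measure (\<mu> j) (space (\<mu> j)) powr c j)"
  have a: "a > 0" unfolding a_def using mass by (intro prod_pos) (auto dest: less_imp_neq[symmetric])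
  have BL: "BL n m d B c Q (\<lambda>j y. LINT z|\<mu> j. gaussian (G j) (y - z)) = J / ennreal a"
  proof -
    have "(\<Prod>j<m. (LINT y|lborel_vec (d j). (LINT z|\<mu> j. gaussian (G j) (y - z))) powr c j) = a"
      unfolding a_def using finite_vec_measure.integral_convolution[OF \<mu>] by (intro prod.cong) auto
    then show ?thesis
      using finite_vec_measure.convolution_pos[OF \<mu> _ mass] by (subst BL_pos) (auto simp: J_def)
  qed
  define box where "box j N = {z \<in> space (\<mu> j). \<forall>s<d j. \<bar>z $ s\<bar> \<le> real N}" for j N
  \<comment> \<open>Measures with negative exponents are kept whole, since cutting them off would
    enlarge the integrand.\<close>
  define \<nu> where "\<nu> N j = (if j < mp then density (\<mu> j) (\<lambda>z. ennreal (indicator (box j N) z)) else \<mu> j)" for N j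
  have sets_\<mu>: "sets (\<mu> j) = sets (borel_vec (d j))" if "j < m" for j
    using finite_vec_measure.sets_\<nu>[OF \<mu>[OF that]] .
  have box: "box j N \<in> sets (\<mu> j)" if "j < m" for j N
  proof -
    have "{z \<in> space (\<mu> j). \<forall>s\<in>{..<d j}. \<bar>z $ s\<bar> \<le> real N} \<in> sets (\<mu> j)"
    proof (intro sets.sets_Collect_finite_All finite_lessThan)
      fix s assume "s \<in> {..<d j}"
      then have "(\<lambda>z. z $ s) \<in> borel_measurable (\<mu> j)"
        unfolding measurable_cong_sets[OF sets_\<mu>[OF that] refl] by (intro measurable_vec_index) simp
      then have "(\<lambda>z. \<bar>z $ s\<bar>) \<in> borel_measurable (\<mu> j)" by (rule borel_measurable_abs)
      then show "{z \<in> space (\<mu> j). \<bar>z $ s\<bar> \<le> real N} \<in> sets (\<mu> j)"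
        using borel_measurable_le[OF _ borel_measurable_const] by blast
    qed
    moreover have "{z \<in> space (\<mu> j). \<forall>s\<in>{..<d j}. \<bar>z $ s\<bar> \<le> real N} = box j N" by (auto simp: box_def)
    ultimately show ?thesis by metis
  qed
  have fm: "finite_measure (\<mu> j)" if "j < m" for j
    using \<mu>[OF that] by (simp add: finite_vec_measure_def)
  have em\<nu>: "emeasure (\<nu> N j) (space (\<nu> N j)) = emeasure (\<mu> j) (box j N)" if "j < mp" for j N
  proof -
    have jm: "j < m" using that mp_le by simp
    have "emeasure (density (\<mu> j) (\<lambda>z. ennreal (indicator (box j N) z))) (space (\<mu> j)) =
        (\<integral>\<^sup>+z. ennreal (indicator (box j N) z) * indicator (space (\<mu> j)) z \<partial>\<mu> j)"
      using box[OF jm] by (intro emeasure_density) auto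
    also have "\<dots> = (\<integral>\<^sup>+z. indicator (box j N) z \<partial>\<mu> j)"
      by (intro nn_integral_cong) (simp add: indicator_def)
    finally show ?thesis using box[OF jm] that by (simp add: \<nu>_def)
  qed
  have m\<nu>: "measure (\<nu> N j) (space (\<nu> N j)) = (if j < mp then measure (\<mu> j) (box j N) else measure (\<mu> j) (space (\<mu> j)))" for N j
    using em\<nu>[of j N] by (simp add: measure_def) (simp add: \<nu>_def)
  have fv: "finite_vec_measure (\<nu> N j) (d j) (G j)" if j: "j < m" for N j
  proof (cases "j < mp")
    case True
    have "finite_measure (\<nu> N j)"
      using em\<nu>[OF True, of N] finite_measure.emeasure_finite[OF fm[OF j], of "box j N"] by (intro finite_measureI) simp
    moreover have "sets (\<nu> N j) = sets (borel_vec (d j))" using sets_\<mu>[OF j] by (simp add: \<nu>_def)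
    ultimately show ?thesis using G[OF j] by (simp add: finite_vec_measure_def finite_vec_measure_axioms_def)
  qed (use \<mu>[OF j] in \<open>simp add: \<nu>_def\<close>)
  have mass_tendsto: "(\<lambda>N. measure (\<nu> N j) (space (\<nu> N j))) \<longlonglongrightarrow> measure (\<mu> j) (space (\<mu> j))" if j: "j < m" for j
  proof (cases "j < mp")
    case True
    have "(\<lambda>N. measure (\<mu> j) (box j N)) \<longlonglongrightarrow> measure (\<mu> j) (\<Union>N. box j N)"
    proof (rule finite_measure.finite_Lim_measure_incseq[OF fm[OF j]])
      show "range (box j) \<subseteq> sets (\<mu> j)" using box[OF j] by blast
      show "incseq (box j)"
      proof (rule monoI)
        fix N N' :: nat assume "N \<le> N'"
        then have "real N \<le> real N'" by simp
        then show "box j N \<subseteq> box j N'" unfolding box_def by (blast intro: order_trans)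
      qed
    qed
    moreover have "(\<Union>N. box j N) = space (\<mu> j)"
    proof -
      have "\<exists>N. \<forall>s<d j. \<bar>z $ s\<bar> \<le> real N" for z :: "real vec"
      proof -
        obtain N where N: "(\<Sum>s<d j. \<bar>z $ s\<bar>) \<le> real N" using real_arch_simple by blast
        have "\<bar>z $ s\<bar> \<le> (\<Sum>s<d j. \<bar>z $ s\<bar>)" if "s < d j" for s
          using that by (intro member_le_sum) auto
        then show ?thesis using N by (meson order_trans)
      qed
      then show ?thesis by (auto simp: box_def)
    qed
    ultimately show ?thesis using True by (simp add: m\<nu>)
  qed (simp add: m\<nu>)
  define aN where "aN N = (\<Prod>j<m. (measure (\<nu> N j) (space (\<nu> N j)) + (if j < mp then 0 else 1 / real (Suc N))) powr c j)" for N
  have one_over_Suc: "(\<lambda>N. 1 / real (Suc N)) \<longlonglongrightarrow> 0" using LIMSEQ_Suc[OF lim_1_over_n] by blast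
  have "aN \<longlonglongrightarrow> (\<Prod>j<m. (measure (\<mu> j) (space (\<mu> j)) + (if j < mp then 0 else 0)) powr c j)"
    unfolding aN_def
  proof (intro tendsto_prod tendsto_powr tendsto_const tendsto_add)
    fix j assume "j \<in> {..<m}"
    then have j: "j < m" by simp
    show "(\<lambda>N. measure (\<nu> N j) (space (\<nu> N j))) \<longlonglongrightarrow> measure (\<mu> j) (space (\<mu> j))" by (rule mass_tendsto[OF j])
    show "(\<lambda>N. if j < mp then 0 else 1 / real (Suc N)) \<longlonglongrightarrow> (if j < mp then 0 else 0)"
      using one_over_Suc by (cases "j < mp") (simp_all only: if_True if_False tendsto_const)
    show "measure (\<mu> j) (space (\<mu> j)) + (if j < mp then 0 else 0) \<noteq> 0" using mass[OF j] by simp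
  qed
  then have "(\<lambda>N. ennreal (aN N)) \<longlonglongrightarrow> ennreal a" by (intro tendsto_ennrealI) (simp add: a_def)
  then have lim: "(\<lambda>N. ennreal (aN N) * Imin) \<longlonglongrightarrow> ennreal a * Imin"
    using a by (intro tendsto_mult_ennreal tendsto_const) auto
  \<comment> \<open>For small N a box may carry no mass, and the truncated bound requires positive
    mass.\<close>
  have "eventually (\<lambda>N. \<forall>j\<in>{..<m}. measure (\<nu> N j) (space (\<nu> N j)) > 0) sequentially"
    using order_tendstoD(1)[OF mass_tendsto mass] by (intro eventually_ball_finite) auto
  then have "eventually (\<lambda>N. ennreal (aN N) * Imin \<le> J) sequentially"
  proof eventually_elim
    case (elim N)
    have pos: "measure (\<nu> N j) (space (\<nu> N j)) > 0" if "j < m" for j using elim that by simp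
    have ae: "AE z in \<nu> N j. \<forall>s<d j. \<bar>z $ s\<bar> \<le> real N" if "j < mp" for j
    proof -
      have "j < m" using that mp_le by simp
      then have f: "(\<lambda>z. ennreal (indicator (box j N) z)) \<in> borel_measurable (\<mu> j)"
        using box by (intro measurable_compose[OF borel_measurable_indicator measurable_ennreal]) auto
      have eq: "\<nu> N j = density (\<mu> j) (\<lambda>z. ennreal (indicator (box j N) z))"
        unfolding \<nu>_def using that by (rule if_P)
      show ?thesis
        unfolding eq AE_density[OF f]
      proof (intro AE_I2 impI)
        fix z assume "0 < ennreal (indicator (box j N) z)"
        then have "z \<in> box j N" by (cases "z \<in> box j N") simp_all
        then show "\<forall>s<d j. \<bar>z $ s\<bar> \<le> real N" by (simp add: box_def)
      qed
    qed
    define w0 where "w0 = 1 / real (Suc N)"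
    have w0: "w0 > 0" by (simp add: w0_def)
    have "ennreal (aN N) * Imin \<le> (\<integral>\<^sup>+x. ennreal (exp (- pi * qform Q x) * (\<Prod>j<m. ((LINT z|\<nu> N j. gaussian (G j) (B j *\<^sub>v x - z)) +
       (if j < mp then 0 else w0 * gaussian (ref s0 j) (B j *\<^sub>v x))) powr c j)) \<partial>lborel_vec n)"
      unfolding aN_def using truncated_lower_bound[OF fv pos ae w0] unfolding w0_def by simp
    also have "\<dots> \<le> J"
      unfolding J_def
    proof (intro nn_integral_mono ennreal_leI mult_left_mono prod_mono conjI)
      fix x j assume "x \<in> space (lborel_vec n)" "j \<in> {..<m}"
      then have x: "x \<in> carrier_vec n" and j: "j < m" by auto
      note y = Bx[OF j x]
      show "((LINT z|\<nu> N j. gaussian (G j) (B j *\<^sub>v x - z)) + (if j < mp then 0 else w0 * gaussian (ref s0 j) (B j *\<^sub>v x))) powr c j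
         \<le> (LINT z|\<mu> j. gaussian (G j) (B j *\<^sub>v x - z)) powr c j"
      proof (cases "j < mp")
        case True
        interpret \<mu>j: finite_vec_measure "\<mu> j" "d j" "G j" by (rule \<mu>[OF j])
        have int: "integrable (\<mu> j) (\<lambda>z. gaussian (G j) (B j *\<^sub>v x - z))"
          using \<mu>j.integrable_gaussian_shift[OF y measurable_ident_sets[OF refl]] .
        have "(LINT z|\<nu> N j. gaussian (G j) (B j *\<^sub>v x - z)) = (LINT z|\<mu> j. indicator (box j N) z *\<^sub>R gaussian (G j) (B j *\<^sub>v x - z))"
          using True box[OF j] int by (simp add: \<nu>_def) (subst integral_density, auto)
        also have "\<dots> \<le> (LINT z|\<mu> j. gaussian (G j) (B j *\<^sub>v x - z))"
          using int box[OF j] gaussian_pos[OF G[OF j]]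
          by (intro integral_mono integrable_mult_indicator) (auto simp: indicator_def less_imp_le)
        finally show ?thesis
          using True cp[OF True] finite_vec_measure.convolution_pos[OF fv[OF j] y pos[OF j]]
          by (intro powr_mono2) auto
      next
        case False
        then show ?thesis
          using cn[of j] j finite_vec_measure.convolution_pos[OF \<mu>[OF j] y mass[OF j]] w0 gaussian_pos[OF ref[OF s0(1) j]]
          by (intro powr_minus_mono) (auto simp: \<nu>_def less_imp_le)
      qed
    qed auto
    finally show ?case .
  qed
  then have "ennreal a * Imin \<le> J" using tendsto_upperbound[OF lim] by simp
  then have "ennreal a * Imin / ennreal a \<le> J / ennreal a" by (rule divide_right_mono_ennreal)
  moreover have "ennreal a * Imin / ennreal a = Imin"
    using a by (simp add: mult.commute[of "ennreal a"] ennreal_mult_divide_eq)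
  ultimately show ?thesis using BL by simp
qed

lemma type_G_infimum:
  "(INF f \<in> {f. \<forall>j<m. f j \<in> type_G (d j) (G j)}. BL n m d B c Q f) = Imin"
proof (rule antisym)
  show "(INF f \<in> {f. \<forall>j<m. f j \<in> type_G (d j) (G j)}. BL n m d B c Q f) \<le> Imin"
    unfolding Imin_def
  proof (rule INF_greatest)
    fix A assume A: "A \<in> {A. \<forall>j<m. A j \<in> positive_definite (d j) \<and> loewner_le (d j) (A j) (G j)}"
    have "\<forall>j. \<exists>\<mu>. j < m \<longrightarrow> finite_measure \<mu> \<and> sets \<mu> = sets (borel_vec (d j)) \<and> emeasure \<mu> (space \<mu>) > 0 \<and>
        (\<forall>y\<in>carrier_vec (d j). (LINT z|\<mu>. gaussian (G j) (y - z)) = gaussian (A j) y)"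
    proof
      fix j
      show "\<exists>\<mu>. j < m \<longrightarrow> finite_measure \<mu> \<and> sets \<mu> = sets (borel_vec (d j)) \<and> emeasure \<mu> (space \<mu>) > 0 \<and>
        (\<forall>y\<in>carrier_vec (d j). (LINT z|\<mu>. gaussian (G j) (y - z)) = gaussian (A j) y)"
      proof (cases "j < m")
        case True
        then have "A j \<in> positive_definite (d j)" "loewner_le (d j) (A j) (G j)" using A by auto
        from gaussian_as_convolution[OF this(1) G[OF True] this(2)] show ?thesis by auto
      qed simp
    qed
    then obtain \<mu> where \<mu>: "\<forall>j. j < m \<longrightarrow> finite_measure (\<mu> j) \<and> sets (\<mu> j) = sets (borel_vec (d j)) \<and> emeasure (\<mu> j) (space (\<mu> j)) > 0 \<and>
        (\<forall>y\<in>carrier_vec (d j). (LINT z|\<mu> j. gaussian (G j) (y - z)) = gaussian (A j) y)"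
      by (rule choice[THEN exE])
    define f where "f j = (\<lambda>y. LINT z|\<mu> j. gaussian (G j) (y - z))" for j
    have "f j \<in> type_G (d j) (G j)" if "j < m" for j
      unfolding type_G_def f_def using \<mu> that by blast
    then have f: "f \<in> {f. \<forall>j<m. f j \<in> type_G (d j) (G j)}" by simp
    have eq: "BL n m d B c Q f = BL n m d B c Q (\<lambda>j. gaussian (A j))"
      by (rule BL_cong[where d = d, OF B]) (simp_all add: f_def \<mu>)
    show "(INF f \<in> {f. \<forall>j<m. f j \<in> type_G (d j) (G j)}. BL n m d B c Q f) \<le> BL n m d B c Q (\<lambda>j. gaussian (A j))"
      by (rule order_trans[OF INF_lower[OF f, where f = "BL n m d B c Q"] eq_refl[OF eq]])
  qed
  show "Imin \<le> (INF f \<in> {f. \<forall>j<m. f j \<in> type_G (d j) (G j)}. BL n m d B c Q f)"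
  proof (rule INF_greatest)
    fix f assume "f \<in> {f. \<forall>j<m. f j \<in> type_G (d j) (G j)}"
    then have "\<forall>j. \<exists>\<mu>. j < m \<longrightarrow> f j = (\<lambda>x. LINT y|\<mu>. gaussian (G j) (x - y)) \<and>
        finite_measure \<mu> \<and> sets \<mu> = sets (borel_vec (d j)) \<and> emeasure \<mu> (space \<mu>) > 0"
      unfolding type_G_def by blast
    then obtain \<mu> where "\<forall>j. j < m \<longrightarrow> f j = (\<lambda>x. LINT y|\<mu> j. gaussian (G j) (x - y)) \<and>
        finite_measure (\<mu> j) \<and> sets (\<mu> j) = sets (borel_vec (d j)) \<and> emeasure (\<mu> j) (space (\<mu> j)) > 0"
      by (rule choice[THEN exE])
    then have \<mu>: "f j = (\<lambda>x. LINT y|\<mu> j. gaussian (G j) (x - y))" "finite_measure (\<mu> j)"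
      "sets (\<mu> j) = sets (borel_vec (d j))" "emeasure (\<mu> j) (space (\<mu> j)) > 0" if "j < m" for j
      using that by blast+
    have "BL n m d B c Q f = BL n m d B c Q (\<lambda>j y. LINT z|\<mu> j. gaussian (G j) (y - z))"
      by (rule BL_cong[where d = d, OF B]) (simp_all add: \<mu>(1))
    moreover have "measure (\<mu> j) (space (\<mu> j)) > 0" if "j < m" for j
      using \<mu>(4)[OF that] finite_measure.emeasure_finite[OF \<mu>(2)[OF that]]
      by (simp add: measure_def enn2real_positive_iff less_top[symmetric])
    then have "Imin \<le> BL n m d B c Q (\<lambda>j y. LINT z|\<mu> j. gaussian (G j) (y - z))"
      using \<mu>(2,3) G by (intro Imin_le_BL_type_G) (auto simp: finite_vec_measure_def finite_vec_measure_axioms_def)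
    ultimately show "Imin \<le> BL n m d B c Q f" by simp
  qed
qed

end

theorem theorem2p1:
  fixes n m mp :: nat and d :: "nat \<Rightarrow> nat"
    and B :: "nat \<Rightarrow> real mat" and c :: "nat \<Rightarrow> real"
    and Q :: "real mat" and G :: "nat \<Rightarrow> real mat"
  assumes "BL_datum n m mp d B c Q G"
    and "nondegenerate n mp d B c Q G"
  shows "(INF f \<in> {f. \<forall>j<m. f j \<in> type_G (d j) (G j)}. BL n m d B c Q f) =
         (INF A \<in> {A. \<forall>j<m. A j \<in> positive_definite (d j) \<and> loewner_le (d j) (A j) (G j)}.
            BL n m d B c Q (\<lambda>j. gaussian (A j)))"
proof -
  interpret nondegenerate_datum n m mp d B c Q G
    by unfold_locales (use assms in auto)
  show ?thesis using type_G_infimum unfolding Imin_def .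
qed

end
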